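(* Any nonsingular pair of compatible flat metrics is described by the system (1)-(3) below, in the following sense. A nonsingular pair of contravariant metrics $g_1^{ij}$, $g_2^{ij}$ is a pair of compatible flat metrics if and only if there exist local coordinates $u=(u^1,\dots,u^N)$, functions $H_i(u)$ and nonzero (possibly, complex) functions $f^i(u^i)$ of single variables, $i=1,\dots,N$ (the functions $f^i$ being the eigenvalues of the pair of metrics), such that $$g_2^{ij}(u)=\frac{1}{(H_i(u))^2}\,\delta^{ij},\qquad g_1^{ij}(u)=\frac{f^i(u^i)}{(H_i(u))^2}\,\delta^{ij}\quad\text{(no summation)},$$ and the rotation coefficients $\beta_{ik}(u)=\frac{1}{H_i(u)}\frac{\partial H_k}{\partial u^i}$, $i\ne k$, satisfy the nonlinear system $$\frac{\partial\beta_{ij}}{\partial u^k}=\beta_{ik}\beta_{kj},\qquad i\ne j,\ i\ne k,\ j\ne k,\tag{1}$$ $$\frac{\partial\beta_{ij}}{\partial u^i}+\frac{\partial\beta_{ji}}{\partial u^j}+\sum_{s\ne i,\,s\ne j}\beta_{si}\beta_{sj}=0,\qquad i\ne j,\tag{2}$$ $$\sqrt{f^i(u^i)}\,\frac{\partial\big(\sqrt{f^i(u^i)}\,\beta_{ij}\big)}{\partial u^i}+\sqrt{f^j(u^j)}\,\frac{\partial\big(\sqrt{f^j(u^j)}\,\beta_{ji}\big)}{\partial u^j}+\sum_{s\ne i,\,s\ne j}f^s(u^s)\beta_{si}\beta_{sj}=0,\qquad i\ne j.\tag{3}$$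
   Context: A contravariant metric $g^{ij}(u)$ is a smooth symmetric nondegenerate (Riemannian or pseudo-Riemannian) contravariant 2-tensor; complex coordinates and complex $H_i$, $f^i$ are allowed (e.g. when signs or eigenvalues require it). It is flat if its Riemann curvature tensor vanishes. With $\Gamma^i_{jk}$ the Christoffel symbols of the Levi-Civita connection of $g$, put $\Gamma^{ij}_k=g^{is}\Gamma^j_{sk}$. Two flat contravariant metrics $g_1,g_2$ are called compatible (form a flat pencil) if every linear combination $g^{ij}=\lambda_1g_1^{ij}+\lambda_2g_2^{ij}$ ($\lambda_1,\lambda_2$ constants with $\det(g^{ij})\not\equiv0$) is also a flat metric and $\Gamma^{ij}_k=\lambda_1\Gamma^{ij}_{1,k}+\lambda_2\Gamma^{ij}_{2,k}$. A pair of metrics is nonsingular if the roots $\lambda$ of $\det(g_1^{ij}(u)-\lambda g_2^{ij}(u))=0$ (the eigenvalues of the pair) are distinct. Equations (1) and (2) are the Lamé equations. *)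

theory Defs
  imports "HOL-Analysis.Analysis"
begin

text \<open>
  Everything is local, so the manifold is an open subset of \<open>real ^ 'n\<close> (a chart), with
  \<open>N = CARD('n)\<close>, and tensors are given by their components in the standard coordinates
  \<open>x\<close> of that chart.
\<close>

definition pd :: "'n::finite \<Rightarrow> (real ^ 'n \<Rightarrow> 'b::real_normed_vector) \<Rightarrow> real ^ 'n \<Rightarrow> 'b"
  where "pd a f x = frechet_derivative f (at x) (axis a 1)"

primrec Ck_on :: "nat \<Rightarrow> (real ^ 'n::finite) set \<Rightarrow> (real ^ 'n \<Rightarrow> 'b::real_normed_vector) \<Rightarrow> bool"
  where
    "Ck_on 0 S f \<longleftrightarrow> continuous_on S f"
  | "Ck_on (Suc k) S f \<longleftrightarrow> (\<forall>x\<in>S. f differentiable (at x)) \<and> (\<forall>a. Ck_on k S (pd a f))"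

text \<open>Only used for open sets \<open>S\<close>.\<close>

definition smooth_on :: "(real ^ 'n::finite) set \<Rightarrow> (real ^ 'n \<Rightarrow> 'b::real_normed_vector) \<Rightarrow> bool"
  where "smooth_on S f \<longleftrightarrow> (\<forall>k. Ck_on k S f)"


section \<open>Contravariant metrics and their curvature\<close>

type_synonym 'n tensor2 = "real ^ 'n \<Rightarrow> real ^ 'n ^ 'n"

definition contravariant_metric :: "(real ^ 'n::finite) set \<Rightarrow> 'n tensor2 \<Rightarrow> bool"
  where "contravariant_metric S g \<longleftrightarrow>
    (\<forall>i j. smooth_on S (\<lambda>x. g x $ i $ j)) \<and>
    (\<forall>x\<in>S. transpose (g x) = g x \<and> det (g x) \<noteq> 0)"

definition covariant :: "'n::finite tensor2 \<Rightarrow> 'n tensor2"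
  where "covariant g x = matrix_inv (g x)"

text \<open>\<open>christoffel g i j k\<close> is \<open>\<Gamma>\<^sup>i\<^sub>j\<^sub>k\<close>;
  \<open>christoffel_up g i j k\<close> is \<open>\<Gamma>\<^sup>i\<^sup>j\<^sub>k = g\<^sup>i\<^sup>s \<Gamma>\<^sup>j\<^sub>s\<^sub>k\<close>.\<close>

definition christoffel :: "'n::finite tensor2 \<Rightarrow> 'n \<Rightarrow> 'n \<Rightarrow> 'n \<Rightarrow> real ^ 'n \<Rightarrow> real"
  where "christoffel g i j k x = (1 / 2) * (\<Sum>s\<in>UNIV. g x $ i $ s *
     (pd j (\<lambda>y. covariant g y $ s $ k) x + pd k (\<lambda>y. covariant g y $ j $ s) x
      - pd s (\<lambda>y. covariant g y $ j $ k) x))"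

definition christoffel_up :: "'n::finite tensor2 \<Rightarrow> 'n \<Rightarrow> 'n \<Rightarrow> 'n \<Rightarrow> real ^ 'n \<Rightarrow> real"
  where "christoffel_up g i j k x = (\<Sum>s\<in>UNIV. g x $ i $ s * christoffel g j s k x)"

text \<open>\<open>riemann g i j k l\<close> is \<open>R\<^sup>i\<^sub>j\<^sub>k\<^sub>l\<close>.\<close>

definition riemann :: "'n::finite tensor2 \<Rightarrow> 'n \<Rightarrow> 'n \<Rightarrow> 'n \<Rightarrow> 'n \<Rightarrow> real ^ 'n \<Rightarrow> real"
  where "riemann g i j k l x =
     pd k (christoffel g i l j) x - pd l (christoffel g i k j) x +
     (\<Sum>s\<in>UNIV. christoffel g i k s x * christoffel g s l j x
              - christoffel g i l s x * christoffel g s k j x)"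

definition flat_metric :: "(real ^ 'n::finite) set \<Rightarrow> 'n tensor2 \<Rightarrow> bool"
  where "flat_metric S g \<longleftrightarrow>
    contravariant_metric S g \<and> (\<forall>x\<in>S. \<forall>i j k l. riemann g i j k l x = 0)"


section \<open>Pairs of metrics\<close>

definition pencil :: "real \<Rightarrow> real \<Rightarrow> 'n::finite tensor2 \<Rightarrow> 'n tensor2 \<Rightarrow> 'n tensor2"
  where "pencil l1 l2 g1 g2 x = l1 *\<^sub>R g1 x + l2 *\<^sub>R g2 x"

text \<open>
  A linear combination of \<open>g1\<close> and \<open>g2\<close> whose determinant is not identically zero may still
  degenerate at some points of \<open>S\<close>; it is a metric on the open set where its determinant does not
  vanish, and the conditions on the pencil are imposed there. For a combination with identically
  vanishing determinant that set is empty and nothing is required.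
\<close>

definition compatible_flat_metrics ::
    "(real ^ 'n::finite) set \<Rightarrow> 'n tensor2 \<Rightarrow> 'n tensor2 \<Rightarrow> bool"
  where "compatible_flat_metrics S g1 g2 \<longleftrightarrow>
    flat_metric S g1 \<and> flat_metric S g2 \<and>
    (\<forall>l1 l2. flat_metric {x \<in> S. det (pencil l1 l2 g1 g2 x) \<noteq> 0} (pencil l1 l2 g1 g2) \<and>
       (\<forall>x\<in>S. det (pencil l1 l2 g1 g2 x) \<noteq> 0 \<longrightarrow>
          (\<forall>i j k. christoffel_up (pencil l1 l2 g1 g2) i j k x =
             l1 * christoffel_up g1 i j k x + l2 * christoffel_up g2 i j k x)))"

text \<open>The eigenvalues of a pair are taken in the complex numbers.\<close>

definition eigenvalues_pair :: "'n::finite tensor2 \<Rightarrow> 'n tensor2 \<Rightarrow> real ^ 'n \<Rightarrow> complex set"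
  where "eigenvalues_pair g1 g2 x =
    {l. det (\<chi> i j. complex_of_real (g1 x $ i $ j) - l * complex_of_real (g2 x $ i $ j)) = 0}"

text \<open>The characteristic equation has degree \<open>N\<close>, so its roots are distinct
  iff there are \<open>N\<close> of them.\<close>

definition nonsingular_pair :: "(real ^ 'n::finite) set \<Rightarrow> 'n tensor2 \<Rightarrow> 'n tensor2 \<Rightarrow> bool"
  where "nonsingular_pair S g1 g2 \<longleftrightarrow> (\<forall>x\<in>S. card (eigenvalues_pair g1 g2 x) = CARD('n))"


section \<open>Possibly complex local coordinates\<close>

text \<open>
  Coordinates \<open>u\<^sup>1, \<dots>, u\<^sup>N\<close> on \<open>V\<close> are smooth functions with values in the complex numbers (real
  coordinates being the case of real values) that separate points and whose differentials are
  linearly independent over the complex numbers. Functions of the coordinates are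
  represented as functions of the point \<open>x\<close>, and \<open>\<partial>/\<partial>u\<^sup>i\<close> is the frame of the
  complexified tangent bundle dual to the \<open>du\<^sup>i\<close>.
\<close>

definition jacobian :: "(real ^ 'n::finite \<Rightarrow> complex ^ 'n) \<Rightarrow> real ^ 'n \<Rightarrow> complex ^ 'n ^ 'n"
  where "jacobian u x = (\<chi> i a. pd a (\<lambda>y. u y $ i) x)"

definition local_coordinates :: "(real ^ 'n::finite) set \<Rightarrow> (real ^ 'n \<Rightarrow> complex ^ 'n) \<Rightarrow> bool"
  where "local_coordinates V u \<longleftrightarrow>
    (\<forall>i. smooth_on V (\<lambda>x. u x $ i)) \<and> inj_on u V \<and> (\<forall>x\<in>V. det (jacobian u x) \<noteq> 0)"

definition cd :: "(real ^ 'n::finite \<Rightarrow> complex ^ 'n) \<Rightarrow> 'n \<Rightarrow> (real ^ 'n \<Rightarrow> complex)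
    \<Rightarrow> real ^ 'n \<Rightarrow> complex"
  where "cd u i h x = (\<Sum>a\<in>UNIV. matrix_inv (jacobian u x) $ a $ i * pd a h x)"

text \<open>The components \<open>g\<^sup>i\<^sup>j(u)\<close> of a contravariant tensor in the coordinates \<open>u\<close>.\<close>

definition coord_components :: "(real ^ 'n::finite \<Rightarrow> complex ^ 'n) \<Rightarrow> 'n tensor2
    \<Rightarrow> real ^ 'n \<Rightarrow> complex ^ 'n ^ 'n"
  where "coord_components u g x =
    jacobian u x ** map_matrix complex_of_real (g x) ** transpose (jacobian u x)"

text \<open>
  \<open>F(u\<^sup>i)\<close> is a smooth function of the single variable \<open>u\<^sup>i\<close>. The derivative of \<open>F\<close> is taken within
  the set of values of \<open>u\<^sup>i\<close>: for a real coordinate \<open>u\<^sup>i\<close> that set is real and this is the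
  ordinary derivative with respect to a real variable, while for a genuinely complex one \<open>F\<close> is
  holomorphic. In either case \<open>dF(u\<^sup>i) = F' du\<^sup>i\<close>.
\<close>

definition single_variable_fun :: "(real ^ 'n::finite) set \<Rightarrow> (real ^ 'n \<Rightarrow> complex ^ 'n) \<Rightarrow> 'n
    \<Rightarrow> (complex \<Rightarrow> complex) \<Rightarrow> bool"
  where "single_variable_fun V u i F \<longleftrightarrow>
    F holomorphic_on ((\<lambda>x. u x $ i) ` V) \<and> smooth_on V (\<lambda>x. F (u x $ i))"


section \<open>Rotation coefficients and the nonlinear system\<close>

definition rot :: "(real ^ 'n::finite \<Rightarrow> complex ^ 'n) \<Rightarrow> ('n \<Rightarrow> real ^ 'n \<Rightarrow> complex)
    \<Rightarrow> 'n \<Rightarrow> 'n \<Rightarrow> real ^ 'n \<Rightarrow> complex"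
  where "rot u H i k x = 1 / H i x * cd u i (H k) x"

definition lame_equations :: "(real ^ 'n::finite) set \<Rightarrow> (real ^ 'n \<Rightarrow> complex ^ 'n)
    \<Rightarrow> ('n \<Rightarrow> real ^ 'n \<Rightarrow> complex) \<Rightarrow> bool"
  where "lame_equations V u H \<longleftrightarrow> (\<forall>x\<in>V.
    (\<forall>i j k. i \<noteq> j \<and> i \<noteq> k \<and> j \<noteq> k \<longrightarrow>
       cd u k (rot u H i j) x = rot u H i k x * rot u H k j x) \<and>
    (\<forall>i j. i \<noteq> j \<longrightarrow>
       cd u i (rot u H i j) x + cd u j (rot u H j i) x +
       (\<Sum>s\<in>UNIV - {i, j}. rot u H s i x * rot u H s j x) = 0))"

text \<open>Here \<open>r i\<close> stands for \<open>\<surd>f\<^sup>i\<close>, a branch of the square root of \<open>f i\<close>; the equation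
  does not depend on its choice.\<close>

definition pencil_equation :: "(real ^ 'n::finite) set \<Rightarrow> (real ^ 'n \<Rightarrow> complex ^ 'n)
    \<Rightarrow> ('n \<Rightarrow> real ^ 'n \<Rightarrow> complex) \<Rightarrow> ('n \<Rightarrow> complex \<Rightarrow> complex) \<Rightarrow> ('n \<Rightarrow> complex \<Rightarrow> complex) \<Rightarrow> bool"
  where "pencil_equation V u H f r \<longleftrightarrow> (\<forall>x\<in>V. \<forall>i j. i \<noteq> j \<longrightarrow>
     r i (u x $ i) * cd u i (\<lambda>y. r i (u y $ i) * rot u H i j y) x +
     r j (u x $ j) * cd u j (\<lambda>y. r j (u y $ j) * rot u H j i y) x +
     (\<Sum>s\<in>UNIV - {i, j}. f s (u x $ s) * rot u H s i x * rot u H s j x) = 0)"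

end

theory Submission
 imports Defs "HOL-Complex_Analysis.Cauchy_Integral_Formula"
begin

text \<open>
 In eigencoordinates of the pair the pencil is \<open>(l1 f\<^sup>i + l2) / H\<^sub>i\<^sup>2\<close>; in the frame \<open>H\<^sub>i du\<^sup>i\<close> its curvature
 is (1) together with \<open>l1\<close> times (3) plus \<open>l2\<close> times (2), which gives both directions once the
 coordinates exist. Linearity of the Christoffel symbols in the pencil makes every smooth eigencovector
 field \<open>\<theta>\<close> satisfy \<open>\<theta> \<and> d\<theta> = 0\<close> and \<open>df \<parallel> \<theta>\<close>. A real \<open>\<theta>\<close> is integrated by
 Frobenius' theorem; a complex one reduces by Frobenius to a planar Beltrami equation, solved by a
 Neumann series of Fourier multipliers.
\<close>

section \<open>Smooth functions\<close>

text \<open>The metrics are only smooth and cannot be continued to complex points, so a holomorphic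
  Frobenius theorem is out of reach; this is why a nonreal eigenvalue calls for an elliptic
  equation. After straightening, a nonreal theta is a multiple of dx_a + m dx_b, where m depends on
  x_a and x_b alone and Im m never vanishes; the coordinate Z must satisfy d_b Z = m d_a Z. A cutoff
  and a dilation make m a constant m0 plus a small periodic function. The multiplier k / (l - m0 k)
  of the iteration is bounded by 1 / |Im m0|, and the sum of the absolute values of the Fourier
  coefficients is a submultiplicative norm, so no estimate for singular integrals enters.

  Frobenius' theorem rests on one integral equation along rays, solvable without any integrability;
  integrability enters only to show that the defect of its solution obeys a homogeneous equation of
  the same kind.

  An eigenvalue must be a holomorphic function of its coordinate on the whole image of V, not just
  near each point. Charts are therefore shrunk until their images are balls, where functions with
  vanishing derivatives in some directions can be compared along segments.\<close>

lemma pd_eqI: "(f has_derivative f') (at x) ==> pd a f x = f' (axis a 1)"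
 by (simp add: pd_def frechet_derivative_at[symmetric])

lemma has_derivative_pd:
 fixes f :: "real ^ 'n => 'b::real_normed_vector"
 assumes "f differentiable at x"
 shows "(f has_derivative (\<lambda>h. \<Sum>a\<in>UNIV. h $ a *\<^sub>R pd a f x)) (at x)"
proof -
 obtain f' where f': "(f has_derivative f') (at x)" using assms by (auto simp: differentiable_def)
 then have lin: "linear f'" by (simp add: has_derivative_linear)
 have "f' h = (\<Sum>a\<in>UNIV. h $ a *\<^sub>R pd a f x)" for h
 proof -
  have "f' h = f' (\<Sum>a\<in>UNIV. h $ a *\<^sub>R axis a 1)"
   by (simp add: basis_expansion scalar_mult_eq_scaleR[symmetric])
  also have "... = (\<Sum>a\<in>UNIV. h $ a *\<^sub>R f' (axis a 1))"
   by (simp add: linear_sum[OF lin] linear_cmul[OF lin])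
  finally show ?thesis using pd_eqI[OF f'] by simp
 qed
 then have "f' = (\<lambda>h. \<Sum>a\<in>UNIV. h $ a *\<^sub>R pd a f x)" by auto
 with f' show ?thesis by simp
qed

text \<open>Derivatives depend on germs only. If neither function is differentiable,
  \<open>frechet_derivative\<close> chooses from the same empty predicate on both sides, so the
  rewriting under \<open>pd\<close> is unconditional.\<close>

lemma pd_cong_open:
 assumes "open S" "x \<in> S" "!!y. y \<in> S ==> f y = g y"
 shows "pd a f x = pd a g x"
proof (cases "f differentiable at x")
 case True
 then obtain f' where f': "(f has_derivative f') (at x)" by (auto simp: differentiable_def)
 have "(g has_derivative f') (at x)"
  by (rule has_derivative_transform_within_open[OF f' assms]) auto
 with f' show ?thesis by (simp add: pd_eqI)
next
 case False
 have "\<not> g differentiable at x"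
 proof
  assume "g differentiable at x"
  then obtain f' where f': "(g has_derivative f') (at x)" by (auto simp: differentiable_def)
  have "(f has_derivative f') (at x)"
   by (rule has_derivative_transform_within_open[OF f' assms(1,2)]) (use assms in auto)
  with False show False by (auto simp: differentiable_def)
 qed
 then have "!!f'. \<not> (g has_derivative f') (at x)" "!!f'. \<not> (f has_derivative f') (at x)"
  using False by (auto simp: differentiable_def)
 then show ?thesis by (simp add: pd_def frechet_derivative_def)
qed

lemma differentiable_cong_open:
 assumes "open S" "x \<in> S" "!!y. y \<in> S ==> f y = g y" "f differentiable at x"
 shows "g differentiable at x"
 using assms has_derivative_transform_within_open unfolding differentiable_def by blast

lemma pd_const [simp]: "pd a (\<lambda>x. c) x = 0"
 by (simp add: pd_def)

lemma pd_linear: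
 assumes "bounded_linear T" "f differentiable at x"
 shows "pd a (\<lambda>x. T (f x)) x = T (pd a f x)"
proof -
 obtain f' where f': "(f has_derivative f') (at x)" using assms by (auto simp: differentiable_def)
 show ?thesis
  using pd_eqI[OF bounded_linear.has_derivative[OF assms(1) f']] pd_eqI[OF f'] by simp
qed

lemma differentiable_linear:
 assumes "bounded_linear T" "f differentiable at x"
 shows "(\<lambda>x. T (f x)) differentiable at x"
 using assms bounded_linear.has_derivative[OF assms(1)] unfolding differentiable_def by blast

lemma pd_add:
 assumes "f differentiable at x" "g differentiable at x"
 shows "pd a (\<lambda>x. f x + g x) x = pd a f x + pd a g x"
proof -
 obtain f' g' where d: "(f has_derivative f') (at x)" "(g has_derivative g') (at x)"
  using assms by (auto simp: differentiable_def)
 show ?thesis using pd_eqI[OF has_derivative_add[OF d]] pd_eqI[OF d(1)] pd_eqI[OF d(2)] by simp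
qed

lemma pd_minus:
 assumes "f differentiable at x"
 shows "pd a (\<lambda>x. - f x) x = - pd a f x"
 using pd_linear[OF bounded_linear_minus[OF bounded_linear_ident] assms] by simp

lemma pd_diff:
 assumes "f differentiable at x" "g differentiable at x"
 shows "pd a (\<lambda>x. f x - g x) x = pd a f x - pd a g x"
 using pd_add[of f x "\<lambda>x. - g x"] assms by (simp add: pd_minus)

lemma pd_sum:
 assumes "!!i. i \<in> I ==> f i differentiable at x"
 shows "pd a (\<lambda>x. \<Sum>i\<in>I. f i x) x = (\<Sum>i\<in>I. pd a (f i) x)"
 using assms
 by (induction I rule: infinite_finite_induct) (simp_all add: pd_add differentiable_sum)

lemma pd_bilinear:
 assumes "bounded_bilinear B" "f differentiable at x" "g differentiable at x"
 shows "pd a (\<lambda>x. B (f x) (g x)) x = B (f x) (pd a g x) + B (pd a f x) (g x)"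
  and "(\<lambda>x. B (f x) (g x)) differentiable at x"
proof -
 obtain f' g' where d: "(f has_derivative f') (at x)" "(g has_derivative g') (at x)"
  using assms by (auto simp: differentiable_def)
 note D = bounded_bilinear.FDERIV[OF assms(1) d]
 show "pd a (\<lambda>x. B (f x) (g x)) x = B (f x) (pd a g x) + B (pd a f x) (g x)"
  using pd_eqI[OF D] pd_eqI[OF d(1)] pd_eqI[OF d(2)] by simp
 show "(\<lambda>x. B (f x) (g x)) differentiable at x" using D by (auto simp: differentiable_def)
qed

lemma pd_mult:
 fixes f :: "real ^ 'n => 'b::real_normed_algebra"
 assumes "f differentiable at x" "g differentiable at x"
 shows "pd a (\<lambda>x. f x * g x) x = f x * pd a g x + pd a f x * g x"
 by (rule pd_bilinear[OF bounded_bilinear_mult assms])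

lemma pd_inverse:
 fixes f :: "real ^ 'n => 'b::real_normed_field"
 assumes "f differentiable at x" "f x \<noteq> 0"
 shows "pd a (\<lambda>x. inverse (f x)) x = - (pd a f x * (inverse (f x))\<^sup>2)"
proof -
 obtain f' where d: "(f has_derivative f') (at x)" using assms by (auto simp: differentiable_def)
 show ?thesis
  using pd_eqI[OF Deriv.has_derivative_inverse[OF assms(2) d]] pd_eqI[OF d]
  by (simp add: power2_eq_square algebra_simps)
qed

lemma pd_nth [simp]: "pd a (\<lambda>x. x $ i) x = (if i = a then 1 else 0)"
 by (subst pd_eqI[OF bounded_linear.has_derivative[OF bounded_linear_vec_nth has_derivative_ident]])
  (auto simp: axis_def)

lemma differentiable_nth [simp]: "(\<lambda>x::real^'n::finite. x $ i) differentiable at x"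
 by (simp add: differentiable_linear[OF bounded_linear_vec_nth, of "\<lambda>x. x"])

lemma norm_axis_gen: "norm (axis i y :: 'b::real_normed_vector ^ 'm) = norm y"
 by (simp add: norm_vec_def axis_def if_distrib cong: if_cong) (simp add: L2_set_def if_distrib[of "\<lambda>x. x\<^sup>2"] cong: if_cong)

lemma sum_axis: "(\<Sum>i\<in>UNIV. axis i (y i)) = (\<chi> i. y i)" for y :: "'m::finite => 'b::real_normed_vector"
 by (simp add: vec_eq_iff axis_def)

lemma pd_vec_lambda:
 fixes f :: "'m::finite => real ^ 'n => 'b::real_normed_vector"
 assumes "!!i. f i differentiable at x"
 shows "(\<lambda>x. \<chi> i. f i x) differentiable at x" "pd a (\<lambda>x. \<chi> i. f i x) x = (\<chi> i. pd a (f i) x)"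
proof -
 have ax: "bounded_linear (\<lambda>y::'b. (axis i y :: 'b^'m))" for i
  by (rule bounded_linear_intro[where K=1]) (auto simp: norm_axis_gen, auto simp: axis_def vec_eq_iff)
 have eq: "(\<lambda>x. \<chi> i. f i x) = (\<lambda>x. \<Sum>i\<in>UNIV. axis i (f i x))"
  by (simp only: sum_axis)
 have d: "!!i. (\<lambda>x. (axis i (f i x) :: 'b^'m)) differentiable at x"
  by (rule differentiable_linear[OF ax assms])
 show "(\<lambda>x. \<chi> i. f i x) differentiable at x"
  unfolding eq by (intro differentiable_sum) (auto simp: d)
 show "pd a (\<lambda>x. \<chi> i. f i x) x = (\<chi> i. pd a (f i) x)"
  unfolding eq by (subst pd_sum[OF d]) (simp only: pd_linear[OF ax assms] sum_axis)

qed

lemma pd_component: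
 fixes f :: "real ^ 'n => 'b::real_normed_vector ^ 'm"
 assumes "f differentiable at x"
 shows "pd a (\<lambda>x. f x $ i) x = pd a f x $ i"
 by (rule pd_linear[OF bounded_linear_vec_nth assms])

lemma pd_compose:
 fixes f :: "real ^ 'm => 'b::real_normed_vector" and g :: "real ^ 'n => real ^ 'm"
 assumes "f differentiable at (g x)" "g differentiable at x"
 shows "pd a (\<lambda>x. f (g x)) x = (\<Sum>j\<in>UNIV. pd a g x $ j *\<^sub>R pd j f (g x))"
  and "(\<lambda>x. f (g x)) differentiable at x"
proof -
 obtain g' where g': "(g has_derivative g') (at x)" using assms by (auto simp: differentiable_def)
 note D = has_derivative_compose[OF g' has_derivative_pd[OF assms(1)]]
 show "pd a (\<lambda>x. f (g x)) x = (\<Sum>j\<in>UNIV. pd a g x $ j *\<^sub>R pd j f (g x))"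
  using pd_eqI[OF D] pd_eqI[OF g'] by simp
 show "(\<lambda>x. f (g x)) differentiable at x" using D by (auto simp: differentiable_def)
qed

section \<open>Closure properties of functions of class C^k and of smooth functions\<close>

lemma Ck_subset: "Ck_on k S f ==> T \<subseteq> S ==> Ck_on k T f"
 by (induction k arbitrary: f) (auto intro: continuous_on_subset)

lemma Ck_cong:
 assumes "open S" "!!x. x \<in> S ==> f x = g x" "Ck_on k S f"
 shows "Ck_on k S g"
 using assms(2,3)
proof (induction k arbitrary: f g)
 case 0 then show ?case using continuous_on_eq by auto
next
 case (Suc k)
 have "g differentiable at x" if "x \<in> S" for x
  by (rule differentiable_cong_open[OF assms(1) that Suc.prems(1)]) (use Suc.prems that in auto)
 moreover have "Ck_on k S (pd a g)" for a
  using Suc.IH[of "pd a f" "pd a g"] Suc.prems pd_cong_open[OF assms(1) _ Suc.prems(1)] by auto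
 ultimately show ?case by auto
qed

lemma Ck_SucD: "Ck_on (Suc k) S f ==> Ck_on k S f"
proof (induction k arbitrary: f)
 case 0
 then show ?case
  by (auto intro!: continuous_at_imp_continuous_on differentiable_imp_continuous_within)
qed auto

lemma Ck_imp_continuous: "Ck_on k S f ==> continuous_on S f"
 by (induction k) (auto dest: Ck_SucD simp del: Ck_on.simps(2))

lemma Ck_const [simp]: "Ck_on k S (\<lambda>x. c)"
proof (induction k arbitrary: c)
 case (Suc k)
 have "pd a (\<lambda>x. c) = (\<lambda>x. 0)" for a :: 'a by auto
 then show ?case using Suc by simp
qed simp

lemma Ck_linear:
 assumes "open S" "bounded_linear T" "Ck_on k S f"
 shows "Ck_on k S (\<lambda>x. T (f x))"
 using assms(3)
proof (induction k arbitrary: f)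
 case 0 then show ?case
  by (auto intro: bounded_linear.continuous_on[OF assms(2)])
next
 case (Suc k)
 then show ?case
  using Ck_cong[OF assms(1), of "\<lambda>x. T (pd _ f x)" "pd _ (\<lambda>x. T (f x))"]
  by (auto simp: differentiable_linear[OF assms(2)] pd_linear[OF assms(2)])
qed

lemma Ck_add:
 assumes "open S" "Ck_on k S f" "Ck_on k S g"
 shows "Ck_on k S (\<lambda>x. f x + g x)"
 using assms(2,3)
proof (induction k arbitrary: f g)
 case 0 then show ?case by (auto intro: continuous_intros)
next
 case (Suc k)
 then show ?case
  using Ck_cong[OF assms(1), of "\<lambda>x. pd _ f x + pd _ g x" "pd _ (\<lambda>x. f x + g x)"]
  by (auto simp: pd_add)
qed

lemma Ck_sum:
 assumes "open S" "!!i. i \<in> I ==> Ck_on k S (f i)"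
 shows "Ck_on k S (\<lambda>x. \<Sum>i\<in>I. f i x)"
 using assms(2) by (induction I rule: infinite_finite_induct) (auto intro: Ck_add[OF assms(1)])

lemma Ck_minus: "open S ==> Ck_on k S f ==> Ck_on k S (\<lambda>x. - f x)"
 by (rule Ck_linear[OF _ bounded_linear_minus[OF bounded_linear_ident]])

lemma Ck_diff: "open S ==> Ck_on k S f ==> Ck_on k S g ==> Ck_on k S (\<lambda>x. f x - g x)"
 using Ck_add[of S k f "\<lambda>x. - g x"] Ck_minus by auto

lemma Ck_bilinear:
 assumes "open S" "bounded_bilinear B" "Ck_on k S f" "Ck_on k S g"
 shows "Ck_on k S (\<lambda>x. B (f x) (g x))"
 using assms(3,4)
proof (induction k arbitrary: f g)
 case 0 then show ?case by (auto intro: bounded_bilinear.continuous_on[OF assms(2)])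
next
 case (Suc k)
 have "Ck_on k S (\<lambda>x. B (f x) (pd a g x) + B (pd a f x) (g x))" for a
  using Suc.prems Ck_SucD[OF Suc.prems(1)] Ck_SucD[OF Suc.prems(2)]
  by (intro Ck_add[OF assms(1)] Suc.IH) auto
 then have "Ck_on k S (pd a (\<lambda>x. B (f x) (g x)))" for a
  by (rule Ck_cong[OF assms(1), rotated]) (use Suc.prems in \<open>auto simp: pd_bilinear[OF assms(2)]\<close>)
 then show ?case using Suc.prems by (auto simp: pd_bilinear[OF assms(2)])
qed

lemma Ck_mult:
 fixes f :: "real ^ 'n => 'b::real_normed_algebra"
 shows "open S ==> Ck_on k S f ==> Ck_on k S g ==> Ck_on k S (\<lambda>x. f x * g x)"
 by (rule Ck_bilinear[OF _ bounded_bilinear_mult])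

lemma Ck_prod:
 fixes f :: "'i => real ^ 'n => 'b::real_normed_field"
 assumes "open S" "!!i. i \<in> I ==> Ck_on k S (f i)"
 shows "Ck_on k S (\<lambda>x. \<Prod>i\<in>I. f i x)"
 using assms(2) by (induction I rule: infinite_finite_induct) (auto intro: Ck_mult[OF assms(1)])

lemma Ck_inverse:
 fixes f :: "real ^ 'n => 'b::real_normed_field"
 assumes "open S" "Ck_on k S f" "!!x. x \<in> S ==> f x \<noteq> 0"
 shows "Ck_on k S (\<lambda>x. inverse (f x))"
 using assms(2)
proof (induction k)
 case 0 then show ?case using assms(3) by (auto intro: continuous_on_inverse)
next
 case (Suc k)
 have d: "(\<lambda>x. inverse (f x)) differentiable at x" if "x \<in> S" for x
  using Suc.prems that assms(3)[OF that] by (auto intro: differentiable_inverse)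
 have "Ck_on k S (\<lambda>x. - (pd a f x * (inverse (f x) * inverse (f x))))" for a
  using Suc.prems Suc.IH[OF Ck_SucD[OF Suc.prems]]
  by (intro Ck_minus[OF assms(1)] Ck_mult[OF assms(1)]) auto
 then have "Ck_on k S (pd a (\<lambda>x. inverse (f x)))" for a
  by (rule Ck_cong[OF assms(1), rotated])
   (use Suc.prems assms(3) in \<open>auto simp: pd_inverse power2_eq_square\<close>)
 with d show ?case by auto
qed

lemma Ck_divide:
 fixes f :: "real ^ 'n => 'b::real_normed_field"
 assumes "open S" "Ck_on k S f" "Ck_on k S g" "!!x. x \<in> S ==> g x \<noteq> 0"
 shows "Ck_on k S (\<lambda>x. f x / g x)"
 unfolding divide_inverse by (intro Ck_mult Ck_inverse assms)

lemma Ck_nth [simp]: "Ck_on k (S :: (real ^ 'n) set) (\<lambda>x. x $ i)"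
proof (cases k)
 case (Suc m)
 have "pd a (\<lambda>x::real^'n. x $ i) = (\<lambda>x. if i = a then 1 else 0)" for a by auto
 then show ?thesis using Suc by auto
qed (auto intro: continuous_intros)

lemma Ck_vec_lambda:
 fixes f :: "'m::finite => real ^ 'n => 'b::real_normed_vector"
 assumes "open S" "!!i. Ck_on k S (f i)"
 shows "Ck_on k S (\<lambda>x. \<chi> i. f i x)"
 using assms(2)
proof (induction k arbitrary: f)
 case 0 then show ?case by (auto intro: continuous_intros)
next
 case (Suc k)
 then show ?case
  using Ck_cong[OF assms(1), of "\<lambda>x. \<chi> i. pd _ (f i) x" "pd _ (\<lambda>x. \<chi> i. f i x)"]
  by (auto simp: pd_vec_lambda)
qed

lemma Ck_component: "open S ==> Ck_on k S f ==> Ck_on k S (\<lambda>x. f x $ i)"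
 by (rule Ck_linear[OF _ bounded_linear_vec_nth])

lemma Ck_compose:
 fixes f :: "real ^ 'm => 'b::real_normed_vector" and g :: "real ^ 'n => real ^ 'm"
 assumes "open S" "Ck_on k T f" "Ck_on k S g" "g ` S \<subseteq> T"
 shows "Ck_on k S (\<lambda>x. f (g x))"
 using assms(2,3)
proof (induction k arbitrary: f)
 case 0 then show ?case using continuous_on_compose2[OF _ _ assms(4)] by simp
next
 case (Suc k)
 have sm: "Ck_on k S g" by (rule Ck_SucD[OF Suc.prems(2)])
 have "Ck_on k S (\<lambda>x. \<Sum>j\<in>UNIV. pd a g x $ j *\<^sub>R pd j f (g x))" for a
  using Suc.prems sm
  by (intro Ck_sum[OF assms(1)] Ck_bilinear[OF assms(1) bounded_bilinear_scaleR]
   Ck_component[OF assms(1)] Suc.IH) auto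
 then have "Ck_on k S (pd a (\<lambda>x. f (g x)))" for a
  by (rule Ck_cong[OF assms(1), rotated]) (use Suc.prems assms(4) in \<open>auto simp: pd_compose image_subset_iff\<close>)
 then show ?case using Suc.prems assms(4) by (auto simp: pd_compose image_subset_iff)
qed

lemma pd_holomorphic:
 fixes f :: "real ^ 'n => complex"
 assumes "F field_differentiable at (f x)" "f differentiable at x"
 shows "pd a (\<lambda>x. F (f x)) x = deriv F (f x) * pd a f x" "(\<lambda>x. F (f x)) differentiable at x"
proof -
 obtain f' where f': "(f has_derivative f') (at x)" using assms by (auto simp: differentiable_def)
 have "(F has_derivative (*) (deriv F (f x))) (at (f x))"
  using assms(1) by (simp add: field_differentiable_derivI has_field_derivative_imp_has_derivative)
 note D = has_derivative_compose[OF f' this]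
 show "pd a (\<lambda>x. F (f x)) x = deriv F (f x) * pd a f x"
  using pd_eqI[OF D] pd_eqI[OF f'] by simp
 show "(\<lambda>x. F (f x)) differentiable at x" using D by (auto simp: differentiable_def)
qed

lemma Ck_holomorphic:
 fixes f :: "real ^ 'n => complex"
 assumes "open S" "open T" "F holomorphic_on T" "Ck_on k S f" "f ` S \<subseteq> T"
 shows "Ck_on k S (\<lambda>x. F (f x))"
 using assms(3,4)
proof (induction k arbitrary: F)
 case 0 then show ?case
  using continuous_on_compose2[OF holomorphic_on_imp_continuous_on _ assms(5)] by simp
next
 case (Suc k)
 have fd: "F field_differentiable at (f x)" if "x \<in> S" for x
  by (rule holomorphic_on_imp_differentiable_at[OF Suc.prems(1) assms(2)])
   (use assms(5) that in auto)
 have "Ck_on k S (\<lambda>x. deriv F (f x) * pd a f x)" for a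
  using Ck_mult[OF assms(1) Suc.IH[OF holomorphic_deriv[OF Suc.prems(1) assms(2)] Ck_SucD[OF Suc.prems(2)]]]
   Suc.prems(2) by simp
 then have "Ck_on k S (pd a (\<lambda>x. F (f x)))" for a
  by (rule Ck_cong[OF assms(1), rotated]) (use Suc.prems fd in \<open>auto simp: pd_holomorphic\<close>)
 then show ?case using Suc.prems fd by (auto simp: pd_holomorphic)
qed

lemma smooth_Ck: "smooth_on S f ==> Ck_on k S f"
 by (simp add: smooth_on_def)

lemma smooth_pd: "smooth_on S f ==> smooth_on S (pd a f)"
 using Ck_on.simps(2) unfolding smooth_on_def by blast

lemma smoothD: "smooth_on S f ==> x \<in> S ==> f differentiable at x"
 using Ck_on.simps(2) unfolding smooth_on_def by blast

lemma smoothC: "smooth_on S f ==> continuous_on S f"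
 by (meson smooth_on_def Ck_imp_continuous)

lemma smooth_subset: "smooth_on S f ==> T \<subseteq> S ==> smooth_on T f"
 unfolding smooth_on_def by (meson Ck_subset)

lemma smooth_cong: "open S ==> (!!x. x \<in> S ==> f x = g x) ==> smooth_on S f ==> smooth_on S g"
 unfolding smooth_on_def by (meson Ck_cong)

lemma smooth_const [simp]: "smooth_on S (\<lambda>x. c)"
 by (simp add: smooth_on_def)

lemma smooth_nth [simp]: "smooth_on S (\<lambda>x. x $ i)"
 by (simp add: smooth_on_def)

lemma smooth_linear: "open S ==> bounded_linear T ==> smooth_on S f ==> smooth_on S (\<lambda>x. T (f x))"
 by (simp add: smooth_on_def Ck_linear)

lemma smooth_of_real:
 "open S ==> smooth_on S f ==> smooth_on S (\<lambda>x. of_real (f x) :: 'b::real_normed_algebra_1)"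
 by (rule smooth_linear[OF _ bounded_linear_of_real])

lemma smooth_Re: "open S ==> smooth_on S f ==> smooth_on S (\<lambda>x. Re (f x))"
 by (rule smooth_linear[OF _ bounded_linear_Re])

lemma smooth_Im: "open S ==> smooth_on S f ==> smooth_on S (\<lambda>x. Im (f x))"
 by (rule smooth_linear[OF _ bounded_linear_Im])

lemma smooth_add: "open S ==> smooth_on S f ==> smooth_on S g ==> smooth_on S (\<lambda>x. f x + g x)"
 by (simp add: smooth_on_def Ck_add)

lemma smooth_diff: "open S ==> smooth_on S f ==> smooth_on S g ==> smooth_on S (\<lambda>x. f x - g x)"
 by (simp add: smooth_on_def Ck_diff)

lemma smooth_minus: "open S ==> smooth_on S f ==> smooth_on S (\<lambda>x. - f x)"
 by (simp add: smooth_on_def Ck_minus)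

lemma smooth_sum: "open S ==> (!!i. i \<in> I ==> smooth_on S (f i)) ==> smooth_on S (\<lambda>x. \<Sum>i\<in>I. f i x)"
 by (simp add: smooth_on_def Ck_sum)

lemma smooth_mult:
 fixes f :: "real ^ 'n => 'b::real_normed_algebra"
 shows "open S ==> smooth_on S f ==> smooth_on S g ==> smooth_on S (\<lambda>x. f x * g x)"
 by (simp add: smooth_on_def Ck_mult)

lemma smooth_scaleR:
 "open S ==> smooth_on S f ==> smooth_on S g ==> smooth_on S (\<lambda>x. f x *\<^sub>R g x)"
 by (simp add: smooth_on_def Ck_bilinear[OF _ bounded_bilinear_scaleR])

lemma smooth_power:
 fixes f :: "real ^ 'n => 'b::real_normed_algebra_1"
 shows "open S ==> smooth_on S f ==> smooth_on S (\<lambda>x. f x ^ k)"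
 by (induction k) (auto intro: smooth_mult)

lemma smooth_prod:
 fixes f :: "'i => real ^ 'n => 'b::real_normed_field"
 shows "open S ==> (!!i. i \<in> I ==> smooth_on S (f i)) ==> smooth_on S (\<lambda>x. \<Prod>i\<in>I. f i x)"
 by (simp add: smooth_on_def Ck_prod)

lemma smooth_on_inverse:
 fixes f :: "real ^ 'n => 'b::real_normed_field"
 shows "open S ==> smooth_on S f ==> (!!x. x \<in> S ==> f x \<noteq> 0) ==> smooth_on S (\<lambda>x. inverse (f x))"
 by (simp add: smooth_on_def Ck_inverse)

lemma smooth_divide:
 fixes f :: "real ^ 'n => 'b::real_normed_field"
 shows "open S ==> smooth_on S f ==> smooth_on S g ==> (!!x. x \<in> S ==> g x \<noteq> 0) ==> smooth_on S (\<lambda>x. f x / g x)"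
 by (simp add: smooth_on_def Ck_divide)

lemma smooth_vec_lambda:
 fixes f :: "'m::finite => real ^ 'n => 'b::real_normed_vector"
 shows "open S ==> (!!i. smooth_on S (f i)) ==> smooth_on S (\<lambda>x. \<chi> i. f i x)"
 by (simp add: smooth_on_def Ck_vec_lambda)

lemma smooth_component: "open S ==> smooth_on S f ==> smooth_on S (\<lambda>x. f x $ i)"
 by (simp add: smooth_on_def Ck_component)

lemma smooth_compose:
 fixes f :: "real ^ 'm => 'b::real_normed_vector" and g :: "real ^ 'n => real ^ 'm"
 assumes "open S" "smooth_on T f" "smooth_on S g" "g ` S \<subseteq> T"
 shows "smooth_on S (\<lambda>x. f (g x))"
 using Ck_compose[OF assms(1) _ _ assms(4), of _ f] assms(2,3) by (simp add: smooth_on_def)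

lemma smooth_holomorphic:
 fixes f :: "real ^ 'n => complex"
 assumes "open S" "open T" "F holomorphic_on T" "smooth_on S f" "f ` S \<subseteq> T"
 shows "smooth_on S (\<lambda>x. F (f x))"
 using Ck_holomorphic[OF assms(1-3) _ assms(5)] assms(4) by (simp add: smooth_on_def)

lemma smooth_ident [simp]: "open S ==> smooth_on S (\<lambda>x. x)"
 using smooth_vec_lambda[of S "\<lambda>i x. x $ i"] by simp

section \<open>Symmetry of mixed second derivatives\<close>

lemma pd_along_axis:
 fixes f :: "real ^ 'n => 'b::real_normed_vector"
 assumes "f differentiable at (x + s *\<^sub>R axis a 1)"
 shows "((\<lambda>s. f (x + s *\<^sub>R axis a 1)) has_vector_derivative pd a f (x + s *\<^sub>R axis a 1)) (at s within A)"
proof -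
 have "((\<lambda>s. x + s *\<^sub>R axis a 1) has_derivative (\<lambda>h. h *\<^sub>R axis a 1)) (at s within A)"
  by (auto intro!: derivative_eq_intros)
 moreover obtain f' where f': "(f has_derivative f') (at (x + s *\<^sub>R axis a 1))"
  using assms by (auto simp: differentiable_def)
 ultimately have "((\<lambda>s. f (x + s *\<^sub>R axis a 1)) has_derivative (\<lambda>h. f' (h *\<^sub>R axis a 1))) (at s within A)"
  by (rule has_derivative_compose)
 moreover have "f' (h *\<^sub>R axis a 1) = h *\<^sub>R pd a f (x + s *\<^sub>R axis a 1)" for h
  using pd_eqI[OF f'] linear_cmul[OF has_derivative_linear[OF f']] by simp
 ultimately show ?thesis by (simp add: has_vector_derivative_def)
qed

text \<open>The double difference \<open>f(x+ta+tb) - f(x+ta) - f(x+tb) + f(x)\<close> is symmetric in \<open>a\<close> and \<open>b\<close>.\<close>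

lemma double_difference_bound:
 fixes f :: "real ^ 'n => 'b::real_normed_vector"
 assumes "Ck_on 2 S f" "open S" "0 < r" "ball x r \<subseteq> S" "0 \<le> t" "2 * t < r"
  and e: "!!y. y \<in> ball x r ==> norm (pd b (pd a f) y - c) \<le> e"
 shows "norm (f (x + t *\<^sub>R axis a 1 + t *\<^sub>R axis b 1) - f (x + t *\<^sub>R axis a 1)
   - (f (x + t *\<^sub>R axis b 1) - f x) - (t * t) *\<^sub>R c) \<le> e * t * t"
proof -
 have C2: "!!y. y \<in> S ==> f differentiable at y" "!!a y. y \<in> S ==> pd a f differentiable at y"
  using assms(1) by (auto simp: numeral_2_eq_2)
 have mem: "x + s *\<^sub>R axis a 1 + u *\<^sub>R axis b 1 \<in> ball x r" if "0 \<le> s" "s \<le> t" "0 \<le> u" "u \<le> t" for s u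
 proof -
  have "norm (s *\<^sub>R axis a 1 + u *\<^sub>R axis b 1 :: real ^ 'n) \<le> s + u"
   using norm_triangle_ineq[of "s *\<^sub>R axis a 1 :: real ^ 'n" "u *\<^sub>R axis b 1"] that by (simp add: norm_axis_gen)
  moreover have "dist x (x + v) = norm v" for v by (simp add: dist_norm)
  ultimately have "dist x (x + (s *\<^sub>R axis a 1 + u *\<^sub>R axis b 1)) < r" using that assms(6) by simp
  then show ?thesis by (simp add: add.assoc)
 qed
 have mem0: "x + s *\<^sub>R axis a 1 \<in> ball x r" if "0 \<le> s" "s \<le> t" for s
  using mem[OF that, of 0] assms(5) by simp
 have inner: "norm (pd a f (x + s *\<^sub>R axis a 1 + t *\<^sub>R axis b 1) - pd a f (x + s *\<^sub>R axis a 1) - t *\<^sub>R c) \<le> e * t"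
  if s: "0 \<le> s" "s \<le> t" for s
 proof -
  let ?g = "\<lambda>u. pd a f (x + s *\<^sub>R axis a 1 + u *\<^sub>R axis b 1) - u *\<^sub>R c"
  have "norm (?g t - ?g 0) \<le> e * norm (t - 0)"
  proof (rule differentiable_bound[of "{0..t}"])
   show "(?g has_derivative (\<lambda>h. h *\<^sub>R (pd b (pd a f) (x + s *\<^sub>R axis a 1 + u *\<^sub>R axis b 1) - c))) (at u within {0..t})"
    if "u \<in> {0..t}" for u
   proof -
    have "x + s *\<^sub>R axis a 1 + u *\<^sub>R axis b 1 \<in> S"
     using mem[OF s, of u] that assms(4) by auto
    from pd_along_axis[OF C2(2)[OF this]]
    have "(?g has_vector_derivative (pd b (pd a f) (x + s *\<^sub>R axis a 1 + u *\<^sub>R axis b 1) - c)) (at u within {0..t})"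
     by (auto intro!: derivative_eq_intros)
    then show ?thesis by (simp add: has_vector_derivative_def)
   qed
   show "onorm (\<lambda>h. h *\<^sub>R (pd b (pd a f) (x + s *\<^sub>R axis a 1 + u *\<^sub>R axis b 1) - c)) \<le> e"
    if "u \<in> {0..t}" for u
    using e[OF mem[OF s, of u]] that by (intro onorm_le) (auto simp: mult.commute[of e] intro!: mult_left_mono)
  qed (use assms(5) in auto)
  then show ?thesis using assms(5) by (simp add: algebra_simps)
 qed
 \<comment> \<open>The derivative of \<open>?g\<close> in \<open>s\<close> is the quantity bounded
   by \<open>inner\<close>; a second mean value estimate therefore supplies the second factor
   \<open>t\<close>.\<close>
 let ?g = "\<lambda>s. f (x + t *\<^sub>R axis b 1 + s *\<^sub>R axis a 1) - f (x + s *\<^sub>R axis a 1) - (s * t) *\<^sub>R c"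
 let ?d = "\<lambda>s. pd a f (x + t *\<^sub>R axis b 1 + s *\<^sub>R axis a 1) - pd a f (x + s *\<^sub>R axis a 1) - t *\<^sub>R c"
 have "norm (?g t - ?g 0) \<le> (e * t) * norm (t - 0)"
 proof (rule differentiable_bound[of "{0..t}"])
  show "(?g has_derivative (\<lambda>h. h *\<^sub>R ?d s)) (at s within {0..t})" if "s \<in> {0..t}" for s
  proof -
   have "x + s *\<^sub>R axis a 1 + t *\<^sub>R axis b 1 \<in> S" "x + s *\<^sub>R axis a 1 \<in> S"
    using mem[of s t] mem0[of s] that assms(4) by auto
   then have "x + t *\<^sub>R axis b 1 + s *\<^sub>R axis a 1 \<in> S" "x + s *\<^sub>R axis a 1 \<in> S" by (auto simp: algebra_simps)
   note pd_along_axis[OF C2(1)[OF this(1)]] pd_along_axis[OF C2(1)[OF this(2)]]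
   then have "(?g has_vector_derivative ?d s) (at s within {0..t})"
    by (auto intro!: derivative_eq_intros)
   then show ?thesis by (simp add: has_vector_derivative_def)
  qed
  show "onorm (\<lambda>h. h *\<^sub>R ?d s) \<le> e * t" if "s \<in> {0..t}" for s
   using inner[of s] that
   by (intro onorm_le) (auto simp: mult.commute[of "e * t"] add_ac intro!: mult_left_mono)
 qed (use assms(5) in auto)
 then show ?thesis using assms(5) by (simp add: algebra_simps)
qed

text \<open>Both mixed derivatives, times t * t, lie within e * t * t of one and the same double
  difference. With \<open>e\<close> a third of their distance this gives 3 e \<le> 2 e.\<close>

lemma pd_commute:
 fixes f :: "real ^ 'n => 'b::real_normed_vector"
 assumes "Ck_on 2 S f" "open S" "x \<in> S"
 shows "pd a (pd b f) x = pd b (pd a f) x"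
proof (rule ccontr)
 define e where "e = norm (pd a (pd b f) x - pd b (pd a f) x) / 3"
 assume "pd a (pd b f) x \<noteq> pd b (pd a f) x"
 then have e: "e > 0" by (simp add: e_def)
 have cont: "continuous_on S (pd a (pd b f))" "continuous_on S (pd b (pd a f))"
  using assms(1) by (auto simp: numeral_2_eq_2)
 obtain r0 where r0: "r0 > 0" "ball x r0 \<subseteq> S" using assms openE by blast
 obtain r1 where r1: "r1 > 0" "!!y. y \<in> S ==> dist y x < r1 ==> dist (pd a (pd b f) y) (pd a (pd b f) x) < e"
  using cont(1) assms(3) e unfolding continuous_on_iff by metis
 obtain r2 where r2: "r2 > 0" "!!y. y \<in> S ==> dist y x < r2 ==> dist (pd b (pd a f) y) (pd b (pd a f) x) < e"
  using cont(2) assms(3) e unfolding continuous_on_iff by metis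
 define r where "r = min r0 (min r1 r2)"
 define t where "t = r / 3"
 have r: "r > 0" "ball x r \<subseteq> S" using r0 r1 r2 by (auto simp: r_def)
 have t: "0 \<le> t" "2 * t < r" "t > 0" using r by (auto simp: t_def)
 have b1: "!!y. y \<in> ball x r ==> norm (pd a (pd b f) y - pd a (pd b f) x) \<le> e"
  using r1(2) r by (fastforce simp: r_def dist_norm dist_commute norm_minus_commute)
 have b2: "!!y. y \<in> ball x r ==> norm (pd b (pd a f) y - pd b (pd a f) x) \<le> e"
  using r2(2) r by (fastforce simp: r_def dist_norm dist_commute norm_minus_commute)
 note B1 = double_difference_bound[OF assms(1,2) r t(1,2) b1]
 note B2 = double_difference_bound[OF assms(1,2) r t(1,2) b2]
 have "norm ((t * t) *\<^sub>R pd a (pd b f) x - (t * t) *\<^sub>R pd b (pd a f) x) \<le> e * t * t + e * t * t"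
  using norm_triangle_ineq4[THEN order_trans, OF add_mono, OF B2 B1]
  by (simp add: algebra_simps)
 then have "(t * t) * norm (pd a (pd b f) x - pd b (pd a f) x) \<le> (t * t) * (2 * e)"
  by (simp add: scaleR_diff_right[symmetric] del: scaleR_diff_right) (simp add: algebra_simps)
 then have "norm (pd a (pd b f) x - pd b (pd a f) x) \<le> 2 * e"
  using t by (simp add: mult_le_cancel_left)
 with e show False by (simp add: e_def)
qed

text \<open>\<open>Ck_on\<close> speaks about functions on \<open>real ^ 'n\<close> only, so a
  smooth function of one real variable is given by the sequence \<open>D\<close> of its successive
  derivatives; the induction shifts the index \<open>n\<close>.\<close>

lemma Ck_real_compose:
 fixes D :: "nat => real => real" and f :: "real ^ 'n => real"
 assumes "open S" "!!n t. (D n has_real_derivative D (Suc n) t) (at t)" "Ck_on k S f"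
 shows "Ck_on k S (\<lambda>x. D n (f x))"
 using assms(3)
proof (induction k arbitrary: n)
 case 0
 have "continuous_on UNIV (D n)"
  using assms(2) by (meson DERIV_continuous continuous_at_imp_continuous_on)
 then show ?case using 0 continuous_on_compose2[of UNIV "D n" S f] by simp
next
 case (Suc k)
 have d: "((\<lambda>x. D n (f x)) has_derivative (\<lambda>h. (\<Sum>a\<in>UNIV. h $ a *\<^sub>R pd a f x) * D (Suc n) (f x))) (at x)"
  if "x \<in> S" for x
  by (rule DERIV_compose_FDERIV[OF assms(2) has_derivative_pd]) (use Suc.prems that in auto)
 have *: "pd a (\<lambda>x. D n (f x)) x = pd a f x * D (Suc n) (f x)" if "x \<in> S" for a x
  using pd_eqI[OF d[OF that], of a] by (simp add: axis_def if_distrib[of "\<lambda>y. y * _"] cong: if_cong)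
 have "Ck_on k S (pd a (\<lambda>x. D n (f x)))" for a
 proof (rule Ck_cong[OF assms(1)])
  show "Ck_on k S (\<lambda>x. pd a f x * D (Suc n) (f x))"
   using Ck_mult[OF assms(1) _ Suc.IH[OF Ck_SucD[OF Suc.prems]]] Suc.prems by simp
 qed (simp add: *)
 then show ?case using d by (auto simp: differentiable_def)
qed

lemma smooth_real_compose:
 fixes D :: "nat => real => real" and f :: "real ^ 'n => real"
 assumes "open S" "!!n t. (D n has_real_derivative D (Suc n) t) (at t)" "smooth_on S f"
 shows "smooth_on S (\<lambda>x. D n (f x))"
 using assms(3) Ck_real_compose[of S D, OF assms(1,2)] by (simp add: smooth_on_def)

section \<open>A smooth cutoff function\<close>

definition exp_inv :: "real => real"
 where "exp_inv t = (if t > 0 then exp (- 1 / t) else 0)"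

text \<open>With s = 1 / t the n-th derivative of exp (- 1 / t) is p(s) exp (- s). As ds/dt = - s^2,
  the next polynomial is s^2 (p - p').\<close>

fun exp_inv_poly :: "nat => real poly"
 where "exp_inv_poly 0 = 1"
 | "exp_inv_poly (Suc n) = [:0, 0, 1:] * (exp_inv_poly n - pderiv (exp_inv_poly n))"

definition exp_inv_deriv :: "nat => real => real"
 where "exp_inv_deriv n t = (if t > 0 then poly (exp_inv_poly n) (1 / t) * exp (- 1 / t) else 0)"

lemma poly_over_exp_tendsto_0: "((\<lambda>x::real. poly p x * exp (- x)) \<longlongrightarrow> 0) at_top"
proof -
 have "((\<lambda>x::real. \<Sum>i\<le>degree p. coeff p i * (x ^ i / exp x)) \<longlongrightarrow> (\<Sum>i\<le>degree p. coeff p i * 0)) at_top"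
  by (intro tendsto_intros tendsto_power_div_exp_0)
 then show ?thesis
  by (simp add: poly_altdef exp_minus divide_inverse sum_distrib_right mult.assoc)
qed

lemma exp_inv_deriv_has_derivative:
 "(exp_inv_deriv n has_real_derivative exp_inv_deriv (Suc n) t) (at t)"
proof -
 consider "t > 0" | "t < 0" | "t = 0" by linarith
 then show ?thesis
 proof cases
  case 1
  have "((\<lambda>t. poly (exp_inv_poly n) (1 / t) * exp (- 1 / t)) has_real_derivative exp_inv_deriv (Suc n) t) (at t)"
   using 1 by (auto intro!: derivative_eq_intros simp: exp_inv_deriv_def field_simps power2_eq_square)
  then show ?thesis
   by (rule DERIV_cong_ev[THEN iffD1, rotated -1]) (use 1 in \<open>auto simp: exp_inv_deriv_def eventually_nhds intro!: exI[of _ "{0<..}"]\<close>)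
 next
  case 2
  have "((\<lambda>t::real. 0) has_real_derivative 0) (at t)" by simp
  then have "(exp_inv_deriv n has_real_derivative 0) (at t)"
   by (rule DERIV_cong_ev[THEN iffD1, rotated -1]) (use 2 in \<open>auto simp: exp_inv_deriv_def eventually_nhds intro!: exI[of _ "{..<0}"]\<close>)
  then show ?thesis using 2 by (simp add: exp_inv_deriv_def)
 next
  case 3
  \<comment> \<open>The difference quotient at 0 divides by h, which is one more factor 1 / h; it is
    \<open>?p\<close> at 1 / h times exp (- 1 / h), and the exponential wins.\<close>
  let ?p = "[:0, 1:] * exp_inv_poly n"
  have R: "((\<lambda>h. poly ?p (inverse h) * exp (- inverse h)) \<longlongrightarrow> 0) (at_right 0)"
   by (rule filterlim_compose[OF poly_over_exp_tendsto_0 filterlim_inverse_at_top_right])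
  have "((\<lambda>h. exp_inv_deriv n h / h) \<longlongrightarrow> 0) (at_right 0)"
   by (rule tendsto_cong[THEN iffD1, OF _ R])
    (auto simp: exp_inv_deriv_def eventually_at_right_field field_simps intro!: exI[of _ 1])
  moreover have "((\<lambda>h. exp_inv_deriv n h / h) \<longlongrightarrow> 0) (at_left 0)"
   by (rule tendsto_eventually) (auto simp: exp_inv_deriv_def eventually_at_left_field intro!: exI[of _ "-1"])
  ultimately have "((\<lambda>h. exp_inv_deriv n h / h) \<longlongrightarrow> 0) (at 0)"
   by (simp add: filterlim_split_at)
  then show ?thesis using 3 by (simp add: DERIV_def exp_inv_deriv_def)
 qed
qed

lemma smooth_exp_inv:
 assumes "open S" "smooth_on S f"
 shows "smooth_on S (\<lambda>x. exp_inv (f x))"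
proof -
 have "exp_inv_deriv 0 = exp_inv" by (auto simp: exp_inv_deriv_def exp_inv_def)
 then show ?thesis
  using smooth_real_compose[of S exp_inv_deriv f 0, OF assms(1) exp_inv_deriv_has_derivative assms(2)]
  by simp
qed

lemma exp_inv_nonneg [simp]: "exp_inv t \<ge> 0"
 by (simp add: exp_inv_def)

text \<open>The denominator never vanishes because s^2 < 2 or s^2 > 1. The function is 0 once s^2
  \<ge> 2, in particular for |s| \<ge> 3 / 2, safely inside the box |s| \<le> 2 used for
  supports.\<close>

definition cutoff :: "real => real"
 where "cutoff s = exp_inv (2 - s\<^sup>2) / (exp_inv (2 - s\<^sup>2) + exp_inv (s\<^sup>2 - 1))"

lemma cutoff_eq_1: "\<bar>s\<bar> \<le> 1 ==> cutoff s = 1"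
proof -
 assume "\<bar>s\<bar> \<le> 1"
 then have "s\<^sup>2 \<le> 1" by (simp add: abs_le_square_iff[of s 1, simplified])
 then show ?thesis by (simp add: cutoff_def exp_inv_def)
qed

lemma cutoff_eq_0: "\<bar>s\<bar> \<ge> 3 / 2 ==> cutoff s = 0"
proof -
 assume "\<bar>s\<bar> \<ge> 3 / 2"
 then have "(3 / 2)\<^sup>2 \<le> s\<^sup>2" using abs_le_square_iff[of "3 / 2" s] by simp
 then show ?thesis by (simp add: cutoff_def exp_inv_def power2_eq_square)
qed

lemma smooth_cutoff:
 assumes "open S" "smooth_on S f"
 shows "smooth_on S (\<lambda>x. cutoff (f x))"
proof -
 have "exp_inv (2 - s\<^sup>2) + exp_inv (s\<^sup>2 - 1) \<noteq> 0" for s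
 proof -
  have "exp_inv (2 - s\<^sup>2) > 0 \<or> exp_inv (s\<^sup>2 - 1) > 0" by (auto simp: exp_inv_def)
  then show ?thesis using exp_inv_nonneg[of "2 - s\<^sup>2"] exp_inv_nonneg[of "s\<^sup>2 - 1"] by linarith
 qed
 then show ?thesis
  unfolding cutoff_def using assms
  by (intro smooth_divide smooth_add smooth_exp_inv smooth_diff smooth_power) auto
qed

section \<open>Fourier series\<close>

definition fourier :: "(real => complex) => int => complex"
 where "fourier f k = integral {-pi..pi} (\<lambda>s. f s * cis (- (of_int k * s))) / (2 * pi)"

lemma continuous_on_cis_mult [continuous_intros]:
 "continuous_on A f ==> continuous_on A (\<lambda>s. cis (f s))"
 by (rule continuous_on_compose2[of UNIV cis]) (auto intro!: continuous_intros simp: cis_conv_exp)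

lemma has_vector_derivative_cis [derivative_intros]:
 "(f has_real_derivative f') (at s within A) ==>
  ((\<lambda>s. cis (f s)) has_vector_derivative (\<i> * of_real f' * cis (f s))) (at s within A)"
proof -
 assume f: "(f has_real_derivative f') (at s within A)"
 have "((\<lambda>z. exp (\<i> * z)) has_field_derivative \<i> * exp (\<i> * of_real (f s))) (at (of_real (f s)))"
  by (auto intro!: derivative_eq_intros)
 then have "((\<lambda>s. exp (\<i> * of_real s)) has_vector_derivative \<i> * exp (\<i> * of_real (f s))) (at (f s))"
  by (rule has_vector_derivative_real_field)
 then have "((\<lambda>s. exp (\<i> * of_real s)) \<circ> f has_vector_derivative f' *\<^sub>R (\<i> * exp (\<i> * of_real (f s)))) (at s within A)"
  by (intro vector_diff_chain_within f[unfolded has_real_derivative_iff_has_vector_derivative])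
   (rule has_vector_derivative_at_within)
 then show ?thesis by (simp add: o_def cis_conv_exp scaleR_conv_of_real algebra_simps)
qed

lemma cis_int_pi: "cis (of_int k * pi) = cis (- (of_int k * pi))"
proof -
 have "cis (of_int k * pi) = cis (- (of_int k * pi)) * cis (2 * pi * of_int k)"
  by (simp add: cis_mult algebra_simps)
 also have "cis (2 * pi * of_int k) = 1" by (rule cis_multiple_2pi) auto
 finally show ?thesis by simp
qed

lemma integral_cis: "integral {-pi..pi} (\<lambda>s. cis (of_int k * s)) = (if k = 0 then 2 * pi else 0)"
proof (cases "k = 0")
 case False
 have "((\<lambda>s. cis (of_int k * s)) has_integral
   (cis (of_int k * pi) / (\<i> * of_int k) - cis (of_int k * (- pi)) / (\<i> * of_int k))) {-pi..pi}"
  by (rule fundamental_theorem_of_calculus)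
   (use False in \<open>auto intro!: derivative_eq_intros has_vector_derivative_divide[THEN has_vector_derivative_eq_rhs]\<close>)
 then show ?thesis using False cis_int_pi[of k] by (simp add: integral_unique)
qed (simp add: scaleR_conv_of_real)

lemma norm_fourier_coeff_le:
 assumes "continuous_on {-pi..pi} f" "!!s. s \<in> {-pi..pi} ==> norm (f s) \<le> B"
 shows "norm (fourier f k) \<le> B"
proof -
 have "norm (integral {-pi..pi} (\<lambda>s. f s * cis (- (of_int k * s)))) \<le> B * (pi - - pi)"
  by (rule integral_bound) (use assms in \<open>auto intro!: continuous_intros simp: norm_mult\<close>)
 then show ?thesis by (simp add: fourier_def norm_divide field_simps)
qed

text \<open>With S the partial sum over \<open>K\<close>, the integrals of g cnj S and of S cnj S
  both equal \<open>sigma\<close>; expanding the integral of |g - S|^2 \<ge> 0 leaves the integral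
  of |g|^2 minus \<open>sigma\<close>.\<close>

lemma Bessel_inequality:
 assumes g: "continuous_on {-pi..pi} g" and "finite K"
 shows "2 * pi * (\<Sum>k\<in>K. (norm (fourier g k))\<^sup>2) \<le> integral {-pi..pi} (\<lambda>s. (norm (g s))\<^sup>2)"
proof -
 define S where "S s = (\<Sum>k\<in>K. fourier g k * cis (of_int k * s))" for s
 have S: "continuous_on {-pi..pi} S" unfolding S_def by (intro continuous_intros)
 have coeff: "integral {-pi..pi} (\<lambda>s. h s * cnj (cis (of_int k * s))) = 2 * pi * fourier h k" for h k
  by (simp add: fourier_def cis_cnj)
 have Sk: "integral {-pi..pi} (\<lambda>s. S s * cnj (cis (of_int k * s))) = 2 * pi * fourier g k" if "k \<in> K" for k
 proof -
  have "integral {-pi..pi} (\<lambda>s. S s * cnj (cis (of_int k * s)))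
   = integral {-pi..pi} (\<lambda>s. \<Sum>j\<in>K. fourier g j * cis (of_int (j - k) * s))"
   by (simp add: S_def sum_distrib_right mult.assoc cis_cnj cis_mult left_diff_distrib)
  also have "... = (\<Sum>j\<in>K. fourier g j * integral {-pi..pi} (\<lambda>s. cis (of_int (j - k) * s)))"
   by (subst integral_sum[OF assms(2)])
    (auto intro!: integrable_continuous_real continuous_intros sum.cong)
  also have "... = (\<Sum>j\<in>K. if j = k then 2 * pi * fourier g k else 0)"
   by (rule sum.cong) (simp_all only: integral_cis, auto)
  finally show ?thesis using that assms(2) by simp
 qed
 have hS: "integral {-pi..pi} (\<lambda>s. h s * cnj (S s)) = (\<Sum>k\<in>K. cnj (fourier g k) * integral {-pi..pi} (\<lambda>s. h s * cnj (cis (of_int k * s))))"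
  if "continuous_on {-pi..pi} h" for h
 proof -
  have "integral {-pi..pi} (\<lambda>s. h s * cnj (S s)) = integral {-pi..pi} (\<lambda>s. \<Sum>k\<in>K. cnj (fourier g k) * (h s * cnj (cis (of_int k * s))))"
   by (simp add: S_def sum_distrib_left algebra_simps)
  also have "... = (\<Sum>k\<in>K. integral {-pi..pi} (\<lambda>s. cnj (fourier g k) * (h s * cnj (cis (of_int k * s)))))"
   by (rule integral_sum[OF assms(2)]) (intro integrable_continuous_real continuous_intros that)
  finally show ?thesis by simp
 qed
 define sigma where "sigma = 2 * pi * (\<Sum>k\<in>K. (norm (fourier g k))\<^sup>2)"
 have gS: "integral {-pi..pi} (\<lambda>s. g s * cnj (S s)) = of_real sigma"
  unfolding hS[OF g] coeff sigma_def
  by (simp add: sum_distrib_left mult_ac flip: complex_norm_square)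
 have SS: "integral {-pi..pi} (\<lambda>s. S s * cnj (S s)) = of_real sigma"
  unfolding hS[OF S] gS[symmetric] hS[OF g] by (rule sum.cong) (simp_all only: Sk coeff[of g])
 have "0 \<le> integral {-pi..pi} (\<lambda>s. (norm (g s - S s))\<^sup>2)"
  by (rule integral_nonneg) (auto intro!: integrable_continuous_real continuous_intros g S)
 also have "(\<lambda>s. (norm (g s - S s))\<^sup>2) = (\<lambda>s. (norm (g s))\<^sup>2 - 2 * Re (g s * cnj (S s)) + Re (S s * cnj (S s)))"
  by (simp only: fun_eq_iff cmod_power2) (simp add: power2_eq_square algebra_simps)
 also have "integral {-pi..pi} ... = integral {-pi..pi} (\<lambda>s. (norm (g s))\<^sup>2)
   - 2 * integral {-pi..pi} (\<lambda>s. Re (g s * cnj (S s))) + integral {-pi..pi} (\<lambda>s. Re (S s * cnj (S s)))"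
  by (subst integral_add integral_diff, (intro integrable_continuous_real continuous_intros g S)+)+
   (simp only: integral_mult_right)
 also have "integral {-pi..pi} (\<lambda>s. Re (g s * cnj (S s))) = sigma"
  using gS integral_linear[OF _ bounded_linear_Re, of "\<lambda>s. g s * cnj (S s)" "{-pi..pi}"]
  by (simp add: o_def integrable_continuous_real continuous_intros g S)
 also have "integral {-pi..pi} (\<lambda>s. Re (S s * cnj (S s))) = sigma"
  using SS integral_linear[OF _ bounded_linear_Re, of "\<lambda>s. S s * cnj (S s)" "{-pi..pi}"]
  by (simp add: o_def integrable_continuous_real continuous_intros g S)
 finally show ?thesis by (simp add: sigma_def)
qed

text \<open>Bessel's inequality bounds the partial sums of the squared coefficients along any
  injective enumeration of frequencies, so their terms tend to 0.\<close>

lemma fourier_tendsto_0: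
 assumes g: "continuous_on {-pi..pi} g" and inj: "inj kappa"
 shows "(\<lambda>n::nat. fourier g (kappa n)) \<longlonglongrightarrow> 0"
proof -
 have "summable (\<lambda>n. (norm (fourier g (kappa n)))\<^sup>2)"
 proof (rule summableI_nonneg_bounded)
  fix n
  have "(\<Sum>i<n. (norm (fourier g (kappa i)))\<^sup>2) = (\<Sum>k\<in>kappa ` {..<n}. (norm (fourier g k))\<^sup>2)"
   using inj by (subst sum.reindex) (auto intro: inj_on_subset)
  also have "... \<le> integral {-pi..pi} (\<lambda>s. (norm (g s))\<^sup>2) / (2 * pi)"
   using Bessel_inequality[OF g, of "kappa ` {..<n}"] by (simp add: field_simps)
  finally show "(\<Sum>i<n. (norm (fourier g (kappa i)))\<^sup>2) \<le> integral {-pi..pi} (\<lambda>s. (norm (g s))\<^sup>2) / (2 * pi)" .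
 qed auto
 then have "(\<lambda>n. (norm (fourier g (kappa n)))\<^sup>2) \<longlonglongrightarrow> 0" by (rule summable_LIMSEQ_zero)
 then have "(\<lambda>n. sqrt ((norm (fourier g (kappa n)))\<^sup>2)) \<longlonglongrightarrow> sqrt 0" by (rule tendsto_real_sqrt)
 then show ?thesis by (simp add: tendsto_norm_zero_iff)
qed

lemma has_vector_derivative_quotient:
 fixes f :: "real => complex"
 assumes "(f has_vector_derivative D) (at x within A)"
 shows "((\<lambda>y. (f y - f x) / of_real (y - x)) \<longlongrightarrow> D) (at x within A)"
proof -
 have "((\<lambda>y. (1 / norm (y - x)) *\<^sub>R (f y - (f x + (y - x) *\<^sub>R D))) \<longlongrightarrow> 0) (at x within A)"
  using assms by (simp add: has_vector_derivative_def has_derivative_within)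
 then have "((\<lambda>y. norm ((1 / norm (y - x)) *\<^sub>R (f y - (f x + (y - x) *\<^sub>R D)))) \<longlongrightarrow> 0) (at x within A)"
  by (rule tendsto_norm_zero)
 then have "((\<lambda>y. norm ((f y - f x) / of_real (y - x) - D)) \<longlongrightarrow> 0) (at x within A)"
 proof (rule Lim_transform_eventually)
  have "norm ((1 / norm (y - x)) *\<^sub>R (f y - (f x + (y - x) *\<^sub>R D))) =
    norm ((f y - f x) / of_real (y - x) - D)" if "y \<noteq> x" for y
  proof -
   have "of_real (y - x) \<noteq> (0 :: complex)" using that by (simp del: of_real_diff)
   then have "(f y - f x) / of_real (y - x) - D = (f y - (f x + (y - x) *\<^sub>R D)) / of_real (y - x)"
    by (simp add: diff_divide_distrib add_divide_distrib scaleR_conv_of_real del: of_real_diff)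
   then show ?thesis
    by (simp only: norm_divide norm_scaleR norm_of_real) (simp add: divide_inverse mult.commute)
  qed
  then show "\<forall>\<^sub>F y in at x within A. norm ((1 / norm (y - x)) *\<^sub>R (f y - (f x + (y - x) *\<^sub>R D))) =
    norm ((f y - f x) / of_real (y - x) - D)"
   by (simp add: eventually_at_filter)
 qed
 then show ?thesis by (simp add: tendsto_norm_zero_iff LIM_zero_iff)
qed

lemma sum_telescope_int: "(\<Sum>k\<in>{- int M..int M}. a k - a (k + 1)) = a (- int M) - a (int M + 1)"
 for a :: "int => complex"
proof (induction M)
 case (Suc M)
 have "{- int (Suc M)..int (Suc M)} = insert (int M + 1) (insert (- int M - 1) {- int M..int M})" by auto
 moreover have "- int (Suc M) = - int M - 1" "int (Suc M) = int M + 1" by auto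
 ultimately show ?case using Suc by (simp only:) simp
qed simp

text \<open>Chernoff's argument: \<open>f - f(s0)\<close> is divisible by \<open>e\<^sup>i\<^sup>s - e\<^sup>i\<^sup>s\<^sup>0\<close>, which makes the Fourier sum telescope.\<close>

theorem fourier_series_tendsto:
 assumes f: "continuous_on {-pi..pi} f" and s0: "-pi < s0" "s0 < pi"
  and D: "(f has_vector_derivative D) (at s0)"
 shows "(\<lambda>M. \<Sum>k\<in>{- int M..int M}. fourier f k * cis (of_int k * s0)) \<longlonglongrightarrow> f s0"
proof -
 \<comment> \<open>The value at \<open>s0\<close> is the limit of the quotient, which exists because
   \<open>f\<close> is differentiable there; this makes \<open>g\<close> continuous and the
   Riemann-Lebesgue lemma applicable.\<close>
 define g where "g s = (if s = s0 then D / (\<i> * cis s0) else (f s - f s0) / (cis s - cis s0))" for s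
 have ne: "cis s \<noteq> cis s0" if "s \<in> {-pi..pi}" "s \<noteq> s0" for s
 proof
  assume "cis s = cis s0"
  then have "sin s = sin s0 \<and> cos s = cos s0" by (simp add: complex_eq_iff)
  then obtain n :: int where n: "s = s0 + 2 * pi * n" using sin_cos_eq_iff[of s s0] by auto
  have "\<bar>2 * pi * n\<bar> < 2 * pi" using n that s0 by auto
  then have "\<bar>real_of_int n\<bar> < 1" by (simp add: abs_mult)
  then show False using n that by simp
 qed
 have g: "continuous_on {-pi..pi} g"
  unfolding continuous_on_eq_continuous_within
 proof
  fix s assume s: "s \<in> {-pi..pi}"
  show "continuous (at s within {-pi..pi}) g"
  proof (cases "s = s0")
   case True
   have "((\<lambda>y. (cis y - cis s0) / of_real (y - s0)) \<longlongrightarrow> \<i> * cis s0) (at s0)"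
    by (rule has_vector_derivative_quotient) (auto intro!: derivative_eq_intros)
   then have "((\<lambda>y. ((f y - f s0) / of_real (y - s0)) / ((cis y - cis s0) / of_real (y - s0))) \<longlongrightarrow> D / (\<i> * cis s0)) (at s0)"
    using has_vector_derivative_quotient[OF D] by (intro tendsto_divide) (simp_all del: of_real_diff)
   then have "(g \<longlongrightarrow> g s0) (at s0)"
    unfolding g_def[of s0] if_P[OF refl]
    by (rule Lim_transform_eventually) (auto simp: g_def eventually_at_filter simp del: of_real_diff)
   then show ?thesis using True by (auto simp: continuous_within intro: tendsto_within_subset)
  next
   case False
   have "((\<lambda>s. (f s - f s0) / (cis s - cis s0)) \<longlongrightarrow> (f s - f s0) / (cis s - cis s0)) (at s within {-pi..pi})"
    using f s ne[OF s False] continuous_on_cis_mult[OF continuous_on_id, of "{-pi..pi}"]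
    by (intro tendsto_intros) (auto simp: continuous_on_def)
   moreover have "\<forall>\<^sub>F y in at s within {-pi..pi}. y \<noteq> s0"
    using False by (auto simp: eventually_at_topological intro!: exI[of _ "- {s0}"])
   ultimately have "(g \<longlongrightarrow> (f s - f s0) / (cis s - cis s0)) (at s within {-pi..pi})"
    by (rule Lim_transform_eventually[OF _ eventually_mono]) (auto simp: g_def)
   then show ?thesis using False by (simp add: continuous_within g_def)
  qed
 qed
 have fg: "f s = f s0 + g s * cis s - cis s0 * g s" if "s \<in> {-pi..pi}" for s
 proof (cases "s = s0")
  case False
  then have "g s * (cis s - cis s0) = f s - f s0" using ne[OF that] by (simp add: g_def)
  then show ?thesis by (simp add: algebra_simps)
 qed simp
 have coeff: "fourier f k = (if k = 0 then f s0 else 0) + (fourier g (k - 1) - cis s0 * fourier g k)" for k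
 proof -
  have "integral {-pi..pi} (\<lambda>s. f s * cis (- (of_int k * s)))
   = integral {-pi..pi} (\<lambda>s. f s0 * cis (of_int (- k) * s) + g s * cis (- (of_int (k - 1) * s)) - cis s0 * (g s * cis (- (of_int k * s))))"
   by (rule integral_cong) (subst fg, auto simp: algebra_simps cis_mult)
  also have "... = f s0 * integral {-pi..pi} (\<lambda>s. cis (of_int (- k) * s))
    + integral {-pi..pi} (\<lambda>s. g s * cis (- (of_int (k - 1) * s))) - cis s0 * integral {-pi..pi} (\<lambda>s. g s * cis (- (of_int k * s)))"
   by (subst integral_diff integral_add, (intro integrable_continuous_real continuous_intros g)+)+ simp
  finally show ?thesis unfolding integral_cis
   by (auto simp: fourier_def diff_divide_distrib add_divide_distrib)
 qed
 \<comment> \<open>Multiplying \<open>g\<close> by cis s shifts its coefficients by one, so the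
   summand is a k - a (k + 1), plus the value f s0 at k = 0. Only the two end terms survive, and
   they tend to 0.\<close>
 define a where "a k = fourier g (k - 1) * cis (of_int k * s0)" for k
 have sum_eq: "(\<Sum>k\<in>{- int M..int M}. fourier f k * cis (of_int k * s0)) = f s0 + (a (- int M) - a (int M + 1))" for M
 proof -
  have "(\<Sum>k\<in>{- int M..int M}. fourier f k * cis (of_int k * s0))
   = (\<Sum>k\<in>{- int M..int M}. (if k = 0 then f s0 else 0) + (a k - a (k + 1)))"
  proof (rule sum.cong[OF refl])
   fix k
   have "cis s0 * cis (of_int k * s0) = cis (of_int (k + 1) * s0)" by (simp add: cis_mult algebra_simps)
   then show "fourier f k * cis (of_int k * s0) = (if k = 0 then f s0 else 0) + (a k - a (k + 1))"
    by (simp add: coeff a_def algebra_simps)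
  qed
  then show ?thesis by (simp add: sum.distrib sum_telescope_int del: sum_subtractf)
 qed
 have "inj (\<lambda>M. - int M - 1)" "inj int" by (auto simp: inj_def)
 from this[THEN fourier_tendsto_0[OF g], THEN tendsto_norm_zero]
 have "(\<lambda>M. norm (a (- int M))) \<longlonglongrightarrow> 0" "(\<lambda>M. norm (a (int M + 1))) \<longlonglongrightarrow> 0"
  by (simp_all add: a_def norm_mult)
 then have "(\<lambda>M. a (- int M)) \<longlonglongrightarrow> 0" "(\<lambda>M. a (int M + 1)) \<longlonglongrightarrow> 0"
  by (auto intro: tendsto_norm_zero_cancel)
 then have "(\<lambda>M. f s0 + (a (- int M) - a (int M + 1))) \<longlonglongrightarrow> f s0 + (0 - 0)"
  by (intro tendsto_intros)
 then show ?thesis by (simp add: sum_eq)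
qed

text \<open>Absolute summability gives an unconditional sum. The symmetric intervals exhaust the
  integers, so its value is the limit of the symmetric partial sums, which is known.\<close>

lemma fourier_series_has_sum:
 assumes f: "continuous_on {-pi..pi} f" and s0: "-pi < s0" "s0 < pi"
  and D: "(f has_vector_derivative D) (at s0)"
  and summ: "(\<lambda>k. norm (fourier f k)) summable_on UNIV"
 shows "((\<lambda>k. fourier f k * cis (of_int k * s0)) has_sum f s0) UNIV"
proof -
 have "(\<lambda>k. norm (fourier f k * cis (of_int k * s0))) summable_on UNIV"
  using summ by (simp add: norm_mult)
 then have "(\<lambda>k. fourier f k * cis (of_int k * s0)) summable_on UNIV"
  by (rule Infinite_Sum.abs_summable_summable)
 then obtain l where l: "((\<lambda>k. fourier f k * cis (of_int k * s0)) has_sum l) UNIV"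
  by (auto simp: summable_on_def)
 have "filterlim (\<lambda>M. {- int M..int M}) (finite_subsets_at_top UNIV) sequentially"
  unfolding filterlim_iff eventually_finite_subsets_at_top
 proof (intro allI impI)
  fix P :: "int set => bool"
  assume "\<exists>X. finite X \<and> X \<subseteq> UNIV \<and> (\<forall>Y. finite Y \<and> X \<subseteq> Y \<and> Y \<subseteq> UNIV --> P Y)"
  then obtain X where X: "finite X" "!!Y. finite Y ==> X \<subseteq> Y ==> P Y" by auto
  obtain N :: nat where N: "!!x. x \<in> (\<lambda>x. nat \<bar>x\<bar>) ` X ==> x \<le> N"
   using X(1) by (meson Max_ge finite_imageI)
  have "P {- int M..int M}" if "M \<ge> N" for M
   using N that by (intro X(2)) force+
  then show "\<forall>\<^sub>F M in sequentially. P {- int M..int M}" by (auto simp: eventually_sequentially)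
 qed
 then have "(\<lambda>M. \<Sum>k\<in>{- int M..int M}. fourier f k * cis (of_int k * s0)) \<longlonglongrightarrow> l"
  using l unfolding has_sum_def by (rule filterlim_compose[rotated])
 from LIMSEQ_unique[OF this fourier_series_tendsto[OF f s0 D]] l show ?thesis by simp
qed

lemma fourier_diff:
 "continuous_on {-pi..pi} f ==> continuous_on {-pi..pi} g ==>
  fourier (\<lambda>s. f s - g s) k = fourier f k - fourier g k"
 unfolding fourier_def left_diff_distrib
 by (subst integral_diff) (auto intro!: integrable_continuous_real continuous_intros simp: diff_divide_distrib)

lemma fourier_cmult: "fourier (\<lambda>s. c * f s) k = c * fourier f k"
 unfolding fourier_def mult.assoc by (subst integral_mult_right) simp

lemma fourier_cong:
 "(!!s. s \<in> {-pi..pi} ==> f s = g s) ==> fourier f k = fourier g k"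
 unfolding fourier_def by (auto intro!: integral_cong)

text \<open>Integration by parts; the boundary terms disappear because \<open>f\<close> vanishes at
  both end points.\<close>

lemma fourier_derivative:
 assumes "!!s. s \<in> {-pi..pi} ==> (f has_vector_derivative f' s) (at s within {-pi..pi})"
  and f': "continuous_on {-pi..pi} f'" and "f pi = 0" "f (- pi) = 0"
 shows "fourier f' k = \<i> * of_int k * fourier f k"
proof -
 have f: "continuous_on {-pi..pi} f"
  by (rule continuous_on_vector_derivative[OF assms(1)])
 have "((\<lambda>s. f' s * cis (- (of_int k * s)) - \<i> * of_int k * (f s * cis (- (of_int k * s)))) has_integral
   (f pi * cis (- (of_int k * pi)) - f (- pi) * cis (- (of_int k * - pi)))) {-pi..pi}"
  by (rule fundamental_theorem_of_calculus)
   (auto intro!: has_vector_derivative_eq_rhs[OF has_vector_derivative_mult] has_vector_derivative_cis derivative_eq_intros assms(1) simp: algebra_simps)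
 then have "integral {-pi..pi} (\<lambda>s. f' s * cis (- (of_int k * s)) - \<i> * of_int k * (f s * cis (- (of_int k * s)))) = 0"
  using assms by (simp add: integral_unique)
 then show ?thesis
  by (subst (asm) integral_diff)
   (auto intro!: integrable_continuous_real continuous_intros f f' simp: fourier_def)
qed

section \<open>Fourier series in two variables\<close>

lemma summable_on_int_inverse_square: "(\<lambda>k::int. 1 / (1 + (real_of_int k)\<^sup>2)) summable_on UNIV"
proof -
 let ?f = "\<lambda>k::int. 1 / (1 + (real_of_int k)\<^sup>2)"
 have S: "summable (\<lambda>n. 1 / (1 + (real n)\<^sup>2))"
  by (rule summable_comparison_test_ev[OF _ inverse_power_summable[of 2]])
   (auto simp: divide_inverse intro!: eventually_sequentiallyI[of 1] le_imp_inverse_le)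
 have N: "(\<lambda>n::nat. 1 / (1 + (real n)\<^sup>2)) summable_on UNIV"
  using S by (intro norm_summable_imp_summable_on) simp
 have "?f summable_on range int" "?f summable_on range (\<lambda>n. - int n)"
  using N by (subst summable_on_reindex; simp add: inj_def o_def)+
 then have "?f summable_on (range int \<union> range (\<lambda>n. - int n))"
  by (rule summable_on_union)
 moreover have "range int \<union> range (\<lambda>n. - int n) = UNIV"
  by (auto simp: image_iff) (metis int_cases2)
 ultimately show ?thesis by simp
qed

text \<open>The Fourier multiplier of (1 - d_a^2)(1 - d_b^2).\<close>

definition int2_weight :: "int \<times> int => real"
 where "int2_weight kl = (1 + (real_of_int (fst kl))\<^sup>2) * (1 + (real_of_int (snd kl))\<^sup>2)"

lemma int2_weight_ge_1: "int2_weight kl \<ge> 1"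
 unfolding int2_weight_def by (rule order_trans[OF _ mult_mono[of 1 _ 1]]) auto

lemma summable_on_int2_weight: "(\<lambda>kl. 1 / int2_weight kl) summable_on UNIV"
proof (rule nonneg_bdd_above_summable_on)
 let ?f = "\<lambda>k::int. 1 / (1 + (real_of_int k)\<^sup>2)"
 have "sum (\<lambda>kl. 1 / int2_weight kl) F \<le> (infsum ?f UNIV)\<^sup>2" if "finite F" for F
 proof -
  have "sum (\<lambda>kl. 1 / int2_weight kl) F \<le> sum (\<lambda>kl. 1 / int2_weight kl) (fst ` F \<times> snd ` F)"
   using that by (intro sum_mono2) (auto simp: image_iff Bex_def int2_weight_def intro: prod.collapse[symmetric])
  also have "... = sum ?f (fst ` F) * sum ?f (snd ` F)"
   by (simp add: int2_weight_def sum_product sum.cartesian_product case_prod_unfold)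
  also have "... \<le> infsum ?f UNIV * infsum ?f UNIV"
   using that by (intro mult_mono finite_sum_le_infsum summable_on_int_inverse_square infsum_nonneg sum_nonneg) auto
  finally show ?thesis by (simp add: power2_eq_square)
 qed
 then show "bdd_above (sum (\<lambda>kl. 1 / int2_weight kl) ` {F. F \<subseteq> UNIV \<and> finite F})"
  by (auto intro!: bdd_aboveI2)
qed (use int2_weight_ge_1 order_trans[OF zero_le_one] in auto)

text \<open>Planar functions stay functions on \<open>real ^ 'n\<close>, restricted to the plane
  through 0 spanned by the axes \<open>a\<close> and \<open>b\<close>; the same \<open>pd\<close>
  and \<open>smooth_on\<close> then serve both the plane and the whole space.\<close>

definition plane_pt :: "'n::finite => 'n => real => real => real ^ 'n"
 where "plane_pt a b s t = s *\<^sub>R axis a 1 + t *\<^sub>R axis b 1"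

text \<open>The box \<open>[-\<pi>,\<pi>]\<^sup>2\<close> of the \<open>(a,b)\<close>-plane lies in \<open>ball 0 7\<close>.\<close>

definition supp_box :: "'n::finite => 'n => (real ^ 'n => complex) => bool"
 where "supp_box a b F \<longleftrightarrow> smooth_on (ball 0 7) F \<and>
  (\<forall>x\<in>ball 0 7. \<bar>x $ a\<bar> > 2 \<or> \<bar>x $ b\<bar> > 2 --> F x = 0)"

definition fourier2 :: "'n::finite => 'n => (real ^ 'n => complex) => int \<times> int => complex"
 where "fourier2 a b F kl =
  fourier (\<lambda>t. fourier (\<lambda>s. F (plane_pt a b s t)) (fst kl)) (snd kl)"

text \<open>The vanishing condition is posed on an open set, hence passes to derivatives. Thus
  repeated integration by parts never meets a boundary term.\<close>

lemma supp_box_pd: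
 fixes a b :: "'n::finite"
 assumes "supp_box a b F"
 shows "supp_box a b (pd c F)"
 unfolding supp_box_def
proof (intro conjI ballI impI)
 show "smooth_on (ball 0 7) (pd c F)" using assms by (simp add: supp_box_def smooth_pd)
 fix x :: "real ^ 'n" assume x: "x \<in> ball 0 7" "\<bar>x $ a\<bar> > 2 \<or> \<bar>x $ b\<bar> > 2"
 let ?S = "ball (0 :: real ^ 'n) 7 \<inter> ({x. \<bar>x $ a\<bar> > 2} \<union> {x. \<bar>x $ b\<bar> > 2})"
 have o: "open {x :: real ^ 'n. \<bar>x $ c\<bar> > 2}" for c
  by (rule open_Collect_less) (intro continuous_intros)+
 have "open ?S" by (intro open_Int open_Un o open_ball)
 then have "pd c F x = pd c (\<lambda>x. 0) x"
  by (rule pd_cong_open) (use assms x in \<open>auto simp: supp_box_def\<close>)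
 then show "pd c F x = 0" by simp
qed

lemma supp_box_diff:
 "supp_box a b F ==> supp_box a b G ==> supp_box a b (\<lambda>x. F x - G x)"
 by (simp add: supp_box_def smooth_diff)

context
 fixes a b :: "'n::finite" and F :: "real ^ 'n => complex"
 assumes ab: "a \<noteq> b" and F: "supp_box a b F"
begin

lemma plane_point_in_ball: "s \<in> {-pi..pi} ==> t \<in> {-pi..pi} ==> plane_pt a b s t \<in> ball (0 :: real ^ 'n) 7"
proof -
 assume "s \<in> {-pi..pi}" "t \<in> {-pi..pi}"
 then have "norm (plane_pt a b s t) \<le> pi + pi"
  unfolding plane_pt_def by (intro norm_triangle_le add_mono) (auto simp: norm_axis_gen)
 also have "... < 7" using pi_less_4 pi_approx by simp
 finally show ?thesis by simp
qed

lemma continuous_on_plane [continuous_intros]: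
 assumes "continuous_on A f" "continuous_on A g" "f ` A \<subseteq> {-pi..pi}" "g ` A \<subseteq> {-pi..pi}"
 shows "continuous_on A (\<lambda>x. F (plane_pt a b (f x) (g x)))"
proof (rule continuous_on_compose2[of "ball 0 7" F])
 show "continuous_on (ball 0 7) F" using F by (simp add: supp_box_def smoothC)
 show "continuous_on A (\<lambda>x. plane_pt a b (f x) (g x))"
  unfolding plane_pt_def by (intro continuous_intros assms)
qed (use assms(3,4) plane_point_in_ball in blast)

lemma F_differentiable: "s \<in> {-pi..pi} ==> t \<in> {-pi..pi} ==> F differentiable at (plane_pt a b s t)"
 using F plane_point_in_ball by (auto simp: supp_box_def intro: smoothD)

lemma plane_derivative_1:
 assumes "s \<in> {-pi..pi}" "t \<in> {-pi..pi}"
 shows "((\<lambda>s. F (plane_pt a b s t)) has_vector_derivative pd a F (plane_pt a b s t)) (at s within A)"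
 using pd_along_axis[of F "t *\<^sub>R axis b 1" s a A] F_differentiable[OF assms]
 by (simp add: plane_pt_def add.commute)

lemma plane_derivative_2:
 assumes "s \<in> {-pi..pi}" "t \<in> {-pi..pi}"
 shows "((\<lambda>t. F (plane_pt a b s t)) has_vector_derivative pd b F (plane_pt a b s t)) (at t within A)"
 using pd_along_axis[of F "s *\<^sub>R axis a 1" t b A] F_differentiable[OF assms]
 by (simp add: plane_pt_def)

lemma plane_boundary:
 assumes "s \<in> {-pi..pi}" "t \<in> {-pi..pi}" "\<bar>s\<bar> = pi \<or> \<bar>t\<bar> = pi"
 shows "F (plane_pt a b s t) = 0"
 using F plane_point_in_ball[OF assms(1,2)] assms(3) ab pi_gt3
 by (auto simp: supp_box_def plane_pt_def axis_def)

end

lemma fourier_pd1: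
 assumes ab: "a \<noteq> b" and F: "supp_box a b F" and t: "t \<in> {-pi..pi}"
 shows "fourier (\<lambda>s. pd a F (plane_pt a b s t)) k = \<i> * of_int k * fourier (\<lambda>s. F (plane_pt a b s t)) k"
proof (rule fourier_derivative)
 show "continuous_on {-pi..pi} (\<lambda>s. pd a F (plane_pt a b s t))"
  by (rule continuous_on_plane[OF ab supp_box_pd[OF F]]) (use t in \<open>auto intro: continuous_intros\<close>)
qed (use t in \<open>auto intro!: plane_derivative_1[OF ab F] plane_boundary[OF ab F]\<close>)

lemma continuous_on_fourier_coeff:
 assumes ab: "a \<noteq> b" and F: "supp_box a b F"
 shows "continuous_on {-pi..pi} (\<lambda>t. fourier (\<lambda>s. F (plane_pt a b s t)) k)"
proof -
 have "continuous_on {-pi..pi} (\<lambda>t. integral (cbox (-pi) pi) (\<lambda>s. F (plane_pt a b s t) * cis (- (of_int k * s))))"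
  by (rule integral_continuous_on_param)
   (auto simp: case_prod_unfold intro!: continuous_intros continuous_on_plane[OF ab F])
 then show ?thesis by (auto simp: fourier_def intro!: continuous_intros)
qed

lemma fourier_has_derivative:
 assumes ab: "a \<noteq> b" and F: "supp_box a b F" and t: "t \<in> {-pi..pi}"
 shows "((\<lambda>t. fourier (\<lambda>s. F (plane_pt a b s t)) k) has_vector_derivative
  fourier (\<lambda>s. pd b F (plane_pt a b s t)) k) (at t within {-pi..pi})"
proof -
 have "((\<lambda>t. integral (cbox (-pi) pi) (\<lambda>s. F (plane_pt a b s t) * cis (- (of_int k * s))))
  has_vector_derivative integral (cbox (-pi) pi) (\<lambda>s. pd b F (plane_pt a b s t) * cis (- (of_int k * s)))) (at t within {-pi..pi})"
 proof (rule leibniz_rule_vector_derivative)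
  fix t s assume "t \<in> {-pi..pi}" "s \<in> cbox (- pi) pi"
  then show "((\<lambda>t. F (plane_pt a b s t) * cis (- (real_of_int k * s))) has_vector_derivative
    pd b F (plane_pt a b s t) * cis (- (real_of_int k * s))) (at t within {-pi..pi})"
   by (intro has_vector_derivative_mult_left plane_derivative_2[OF ab F]) auto
 next
  fix t assume "t \<in> {-pi..pi}"
  then show "(\<lambda>s. F (plane_pt a b s t) * cis (- (real_of_int k * s))) integrable_on cbox (- pi) pi"
   by (intro integrable_continuous continuous_intros continuous_on_plane[OF ab F]) auto
 next
  show "continuous_on ({-pi..pi} \<times> cbox (- pi) pi) (\<lambda>(t, s). pd b F (plane_pt a b s t) * cis (- (real_of_int k * s)))"
   by (auto simp: case_prod_unfold intro!: continuous_intros continuous_on_plane[OF ab supp_box_pd[OF F]])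
 qed (use t in auto)
 then show ?thesis
  unfolding fourier_def by (auto intro!: has_vector_derivative_divide)
qed

lemma fourier2_pd1:
 assumes ab: "a \<noteq> b" and F: "supp_box a b F"
 shows "fourier2 a b (pd a F) kl = \<i> * of_int (fst kl) * fourier2 a b F kl"
 unfolding fourier2_def fourier_cmult[symmetric]
 by (rule fourier_cong) (simp only: fourier_cmult fourier_pd1[OF ab F])

lemma fourier2_pd2:
 assumes ab: "a \<noteq> b" and F: "supp_box a b F"
 shows "fourier2 a b (pd b F) kl = \<i> * of_int (snd kl) * fourier2 a b F kl"
 unfolding fourier2_def
proof (rule fourier_derivative)
 have "fourier (\<lambda>s. F (plane_pt a b s t)) (fst kl) = 0" if "\<bar>t\<bar> = pi" for t
 proof -
  have "fourier (\<lambda>s. F (plane_pt a b s t)) (fst kl) = fourier (\<lambda>s. 0) (fst kl)"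
   by (rule fourier_cong, rule plane_boundary[OF ab F]) (use that in auto)
  then show ?thesis by (simp add: fourier_def)
 qed
 then show "fourier (\<lambda>s. F (plane_pt a b s pi)) (fst kl) = 0"
  "fourier (\<lambda>s. F (plane_pt a b s (-pi))) (fst kl) = 0" by auto
qed (use fourier_has_derivative[OF ab F] continuous_on_fourier_coeff[OF ab supp_box_pd[OF F]] in auto)

lemma fourier2_diff:
 assumes ab: "a \<noteq> b" and F: "supp_box a b F" and G: "supp_box a b G"
 shows "fourier2 a b (\<lambda>x. F x - G x) kl = fourier2 a b F kl - fourier2 a b G kl"
 unfolding fourier2_def
 using continuous_on_fourier_coeff[OF ab F] continuous_on_fourier_coeff[OF ab G]
 by (subst fourier_diff[symmetric])
  (auto intro!: fourier_cong fourier_diff continuous_on_plane[OF ab] F G continuous_intros)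

lemma norm_fourier_coeff2_le:
 assumes ab: "a \<noteq> b" and F: "supp_box a b F" and B: "!!x. x \<in> cball 0 (2 * pi) ==> norm (F x) \<le> B"
 shows "norm (fourier2 a b F kl) \<le> B"
 unfolding fourier2_def
proof (intro norm_fourier_coeff_le continuous_on_fourier_coeff[OF ab F] B)
 fix s t :: real assume st: "t \<in> {- pi..pi}" "s \<in> {- pi..pi}"
 show "continuous_on {- pi..pi} (\<lambda>s. F (plane_pt a b s t))"
  using st by (intro continuous_on_plane[OF ab F] continuous_intros) auto
 have "norm (plane_pt a b s t) \<le> pi + pi"
  unfolding plane_pt_def using st by (intro norm_triangle_le add_mono) (auto simp: norm_axis_gen)
 then show "plane_pt a b s t \<in> cball 0 (2 * pi)" by simp
qed

text \<open>The operator 1 - d_c^2. Its multiplier 1 + k^2 is at least 1, so one may divide by it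
  for every frequency, zero included.\<close>

definition one_minus_pd2 :: "'n::finite => (real ^ 'n => complex) => real ^ 'n => complex"
 where "one_minus_pd2 c F x = F x - pd c (pd c F) x"

lemma supported_one_minus_pd2:
 "supp_box a b F ==> supp_box a b (one_minus_pd2 c F)"
 unfolding one_minus_pd2_def by (intro supp_box_diff supp_box_pd)

lemma fourier_coeff2_one_minus_pd2:
 assumes ab: "a \<noteq> b" and F: "supp_box a b F"
 shows "fourier2 a b (one_minus_pd2 a (one_minus_pd2 b F)) kl = of_real (int2_weight kl) * fourier2 a b F kl"
proof -
 note sup = supp_box_pd supp_box_diff
 have 1: "fourier2 a b (one_minus_pd2 a G) kl = (1 + (of_int (fst kl))\<^sup>2) * fourier2 a b G kl"
  if "supp_box a b G" for G
  unfolding one_minus_pd2_def using that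
  by (simp add: fourier2_diff[OF ab] fourier2_pd1[OF ab] sup power2_eq_square algebra_simps)
 have 2: "fourier2 a b (one_minus_pd2 b G) kl = (1 + (of_int (snd kl))\<^sup>2) * fourier2 a b G kl"
  if "supp_box a b G" for G
  unfolding one_minus_pd2_def using that
  by (simp add: fourier2_diff[OF ab] fourier2_pd2[OF ab] sup power2_eq_square algebra_simps)
 show ?thesis by (simp add: 1 2 F supported_one_minus_pd2 int2_weight_def)
qed

lemma supported_bounded:
 assumes F: "supp_box a b F"
 obtains B where "!!x. x \<in> cball 0 (2 * pi) ==> norm (F x) \<le> B"
proof -
 have "cball (0 :: real ^ 'a) (2 * pi) \<subseteq> ball 0 7" using pi_approx by auto
 then have "continuous_on (cball 0 (2 * pi)) F"
  using F by (auto simp: supp_box_def intro: continuous_on_subset smoothC)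
 then have "bounded (F ` cball 0 (2 * pi))" by (intro compact_imp_bounded compact_continuous_image) auto
 then obtain B where "\<forall>y\<in>F ` cball 0 (2 * pi). norm y \<le> B" unfolding bounded_iff ..
 then show ?thesis by (intro that[of B]) auto
qed

text \<open>Applying (1 - d_a^2)(1 - d_b^2) multiplies the coefficient by the weight and keeps the
  support condition, so each power of the weight costs one application and the case of power 0 is
  boundedness.\<close>

lemma fourier2_decay:
 assumes ab: "a \<noteq> b" and F: "supp_box a b F"
 shows "\<exists>B. \<forall>kl. norm (fourier2 a b F kl) * int2_weight kl ^ r \<le> B"
 using F
proof (induction r arbitrary: F)
 case 0
 then obtain B where "!!x. x \<in> cball 0 (2 * pi) ==> norm (F x) \<le> B" using supported_bounded by blast
 then have "norm (fourier2 a b F kl) \<le> B" for kl by (rule norm_fourier_coeff2_le[OF ab 0])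
 then show ?case by auto
next
 case (Suc r)
 have eq: "norm (fourier2 a b F kl) * int2_weight kl ^ Suc r
  = norm (fourier2 a b (one_minus_pd2 a (one_minus_pd2 b F)) kl) * int2_weight kl ^ r" for kl
  using int2_weight_ge_1[of kl]
  by (simp add: fourier_coeff2_one_minus_pd2[OF ab Suc.prems] norm_mult)
 show ?case unfolding eq by (intro Suc.IH supported_one_minus_pd2 Suc.prems)
qed

lemma fourier2_summable:
 assumes ab: "a \<noteq> b" and F: "supp_box a b F"
 shows "(\<lambda>kl. norm (fourier2 a b F kl) * (1 + \<bar>of_int (fst kl)\<bar> + \<bar>of_int (snd kl)\<bar>) ^ r) summable_on UNIV"
proof -
 \<comment> \<open>One power more than \<open>r\<close> is used: the spare factor 1 /
   \<open>int2_weight\<close> is what is summed.\<close>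
 obtain B where B: "!!kl. norm (fourier2 a b F kl) * int2_weight kl ^ Suc r \<le> B"
  using fourier2_decay[OF ab F] by blast
 have le: "norm (fourier2 a b F kl) * (1 + \<bar>of_int (fst kl)\<bar> + \<bar>of_int (snd kl)\<bar>) ^ r \<le> 4 ^ r * B * (1 / int2_weight kl)" for kl
 proof -
  have abs: "1 + \<bar>x\<bar> \<le> 2 * (1 + x\<^sup>2)" for x :: real
  proof -
   have "0 \<le> x\<^sup>2 + 1 - 2 * \<bar>x\<bar>" using zero_le_power2[of "\<bar>x\<bar> - 1"] by (simp add: power2_diff)
   then show ?thesis using zero_le_power2[of x] by (smt (verit))
  qed
  have "1 + \<bar>real_of_int (fst kl)\<bar> + \<bar>real_of_int (snd kl)\<bar> \<le> (1 + \<bar>real_of_int (fst kl)\<bar>) * (1 + \<bar>real_of_int (snd kl)\<bar>)"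
   by (simp add: algebra_simps)
  also have "... \<le> (2 * (1 + (real_of_int (fst kl))\<^sup>2)) * (2 * (1 + (real_of_int (snd kl))\<^sup>2))"
   by (intro mult_mono abs) auto
  also have "... = 4 * int2_weight kl" by (simp add: int2_weight_def algebra_simps)
  finally have "norm (fourier2 a b F kl) * (1 + \<bar>of_int (fst kl)\<bar> + \<bar>of_int (snd kl)\<bar>) ^ r
   \<le> norm (fourier2 a b F kl) * (4 * int2_weight kl) ^ r"
   by (intro mult_left_mono power_mono) auto
  also have "... = 4 ^ r * (norm (fourier2 a b F kl) * int2_weight kl ^ Suc r) * (1 / int2_weight kl)"
   using int2_weight_ge_1[of kl] by (simp add: power_mult_distrib)
  also have "... \<le> 4 ^ r * B * (1 / int2_weight kl)"
   using B[of kl] int2_weight_ge_1[of kl] by (intro mult_right_mono mult_left_mono) auto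
  finally show ?thesis .
 qed
 show ?thesis
  by (rule summable_on_comparison_test[OF summable_on_cmult_right[OF summable_on_int2_weight]])
   (use le in \<open>auto intro!: mult_nonneg_nonneg\<close>)
qed

text \<open>Turns a sup bound on derivatives up to order four into a bound on the sum of the
  absolute values of the coefficients, the norm in which the Neumann series converges.\<close>

lemma fourier2_infsum_le:
 assumes ab: "a \<noteq> b" and F: "supp_box a b F"
  and B: "!!x. x \<in> cball 0 (2 * pi) ==> norm (one_minus_pd2 a (one_minus_pd2 b F) x) \<le> B"
 shows "infsum (\<lambda>kl. norm (fourier2 a b F kl)) UNIV \<le> B * infsum (\<lambda>kl. 1 / int2_weight kl) UNIV"
proof -
 have "norm (fourier2 a b F kl) \<le> B * (1 / int2_weight kl)" for kl
 proof -
  have "norm (of_real (int2_weight kl) * fourier2 a b F kl) \<le> B"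
   unfolding fourier_coeff2_one_minus_pd2[OF ab F, symmetric]
   by (rule norm_fourier_coeff2_le[OF ab _ B]) (intro supported_one_minus_pd2 F)
  then show ?thesis using int2_weight_ge_1[of kl] by (simp add: norm_mult field_simps)
 qed
 moreover have "(\<lambda>kl. norm (fourier2 a b F kl)) summable_on UNIV"
  using fourier2_summable[OF ab F, of 0] by simp
 ultimately show ?thesis
  unfolding infsum_cmult_right[OF summable_on_int2_weight, symmetric]
  by (intro infsum_mono summable_on_cmult_right summable_on_int2_weight)
qed

text \<open>One-variable inversion in t for each fixed k, and in s for the resulting coefficients.
  Absolute summability over pairs identifies the iterated sum with the double one.\<close>

lemma fourier_expansion2:
 assumes ab: "a \<noteq> b" and F: "supp_box a b F" and s: "\<bar>s\<bar> < pi" and t: "\<bar>t\<bar> < pi"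
 shows "((\<lambda>kl. fourier2 a b F kl * cis (of_int (fst kl) * s + of_int (snd kl) * t)) has_sum F (plane_pt a b s t)) UNIV"
proof -
 have t': "t \<in> {-pi..pi}" "t \<in> interior {-pi..pi}" using t by (auto simp: abs_less_iff)
 let ?c = "\<lambda>t k. fourier (\<lambda>s. F (plane_pt a b s t)) k"
 let ?g = "\<lambda>kl. fourier2 a b F kl * cis (of_int (fst kl) * s + of_int (snd kl) * t)"
 have "(\<lambda>kl. norm (?g kl)) summable_on UNIV"
  using fourier2_summable[OF ab F, of 0] by (simp add: norm_mult)
 then have g: "?g summable_on UNIV \<times> UNIV"
  unfolding UNIV_Times_UNIV by (rule Infinite_Sum.abs_summable_summable)
 have inner: "((\<lambda>l. fourier2 a b F (k, l) * cis (of_int l * t)) has_sum ?c t k) UNIV" for k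
  unfolding fourier2_def fst_conv snd_conv
 proof (rule fourier_series_has_sum)
  show "((\<lambda>t. ?c t k) has_vector_derivative fourier (\<lambda>s. pd b F (plane_pt a b s t)) k) (at t)"
   using fourier_has_derivative[OF ab F t'(1)] at_within_interior[OF t'(2)] by simp
  have "(\<lambda>(k, l). norm (fourier2 a b F (k, l))) summable_on UNIV \<times> UNIV"
   using fourier2_summable[OF ab F, of 0] by (simp add: case_prod_unfold)
  from summable_on_SigmaD1[OF this, of k]
  show "(\<lambda>l. norm (fourier (\<lambda>t. ?c t k) l)) summable_on UNIV" by (simp add: fourier2_def)
 qed (use t continuous_on_fourier_coeff[OF ab F] in auto)
 have outer: "((\<lambda>k. ?c t k * cis (of_int k * s)) has_sum F (plane_pt a b s t)) UNIV"
 proof (rule fourier_series_has_sum)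
  \<comment> \<open>At fixed \<open>t\<close> only the first variable is transformed, so 1 - d_a^2
    alone provides the summable factor 1 / (1 + k^2).\<close>
  have "norm (?c t k) \<le> B * (1 / (1 + (of_int k)\<^sup>2))" if B: "!!x. x \<in> cball 0 (2 * pi) ==> norm (one_minus_pd2 a F x) \<le> B" for B k
  proof -
   have c: "continuous_on {-pi..pi} (\<lambda>s. G (plane_pt a b s t))" if "supp_box a b G" for G
    by (rule continuous_on_plane[OF ab that]) (use t' in \<open>auto intro: continuous_intros\<close>)
   have "fourier (\<lambda>s. one_minus_pd2 a F (plane_pt a b s t)) k = (1 + (of_int k)\<^sup>2) * ?c t k"
    unfolding one_minus_pd2_def using F
    by (simp add: fourier_diff c fourier_pd1[OF ab _ t'(1)] supp_box_pd power2_eq_square algebra_simps)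
   moreover have "norm (fourier (\<lambda>s. one_minus_pd2 a F (plane_pt a b s t)) k) \<le> B"
   proof (rule norm_fourier_coeff_le[OF c[OF supported_one_minus_pd2[OF F]] B])
    fix s assume "s \<in> {-pi..pi}"
    then have "norm (plane_pt a b s t) \<le> pi + pi"
     unfolding plane_pt_def using t' by (intro norm_triangle_le add_mono) (auto simp: norm_axis_gen)
    then show "plane_pt a b s t \<in> cball 0 (2 * pi)" by simp
   qed
   moreover have "norm (1 + (of_int k)\<^sup>2 :: complex) = 1 + (of_int k)\<^sup>2"
   proof -
    have "(1 + (of_int k)\<^sup>2 :: complex) = of_real (1 + (of_int k)\<^sup>2)" by simp
    then show ?thesis by (simp only: norm_of_real) simp
   qed
   moreover have "1 + (real_of_int k)\<^sup>2 > 0" by (simp add: add_pos_nonneg)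
   ultimately have "(1 + (of_int k)\<^sup>2) * norm (?c t k) \<le> B" by (simp only: norm_mult)
   then show ?thesis using \<open>1 + (real_of_int k)\<^sup>2 > 0\<close>
    by (simp only: mult_1_right times_divide_eq_right pos_le_divide_eq mult.commute[of "norm _"])
  qed
  then show "(\<lambda>k. norm (?c t k)) summable_on UNIV"
   using supported_bounded[OF supported_one_minus_pd2[OF F]]
   by (metis (no_types, lifting) summable_on_comparison_test[OF summable_on_cmult_right[OF summable_on_int_inverse_square]] norm_ge_zero)
  show "((\<lambda>s. F (plane_pt a b s t)) has_vector_derivative pd a F (plane_pt a b s t)) (at s)"
   using s t' by (intro plane_derivative_1[OF ab F]) auto
  show "continuous_on {-pi..pi} (\<lambda>s. F (plane_pt a b s t))"
   by (rule continuous_on_plane[OF ab F]) (use t' in \<open>auto intro: continuous_intros\<close>)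
 qed (use s in auto)
 have "infsum (\<lambda>k. infsum (\<lambda>l. ?g (k, l)) UNIV) UNIV = infsum ?g (UNIV \<times> UNIV)"
  by (rule infsum_Sigma_banach[OF g])
 moreover have "infsum (\<lambda>l. ?g (k, l)) UNIV = ?c t k * cis (of_int k * s)" for k
  using has_sum_cmult_right[OF inner, of "cis (of_int k * s)" k]
  by (intro infsumI) (simp add: cis_mult[symmetric] mult_ac)
 ultimately have "infsum ?g UNIV = F (plane_pt a b s t)"
  using infsumI[OF outer] by simp
 then show ?thesis using has_sum_infsum[OF g] by simp
qed

section \<open>Trigonometric series with rapidly decreasing coefficients\<close>

lemma norm_cis_diff_le: "norm (cis x - 1) \<le> \<bar>x\<bar>"
proof -
 have "norm (cis x - cis 0) \<le> 1 * norm (x - 0)"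
 proof (rule differentiable_bound[of UNIV])
  show "(cis has_derivative (\<lambda>h. h *\<^sub>R (\<i> * of_real 1 * cis y))) (at y within UNIV)" for y
   using has_vector_derivative_cis[of "\<lambda>y. y" 1 y UNIV] by (simp add: has_vector_derivative_def)
 qed (auto intro!: onorm_le simp: norm_mult)
 then show ?thesis by simp
qed

lemma norm_cis_taylor_le: "norm (cis x - 1 - \<i> * x) \<le> x\<^sup>2"
proof -
 have "norm ((cis x - \<i> * x) - (cis 0 - \<i> * of_real 0)) \<le> \<bar>x\<bar> * norm (x - 0)"
 proof (rule differentiable_bound[of "{- \<bar>x\<bar>..\<bar>x\<bar>}"])
  show "((\<lambda>y. cis y - \<i> * y) has_derivative (\<lambda>h. h *\<^sub>R (\<i> * (cis y - 1)))) (at y within A)" for y A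
  proof -
   have "((\<lambda>y. cis y - \<i> * y) has_vector_derivative (\<i> * of_real 1 * cis y - \<i> * of_real 1)) (at y within A)"
    by (intro has_vector_derivative_diff has_vector_derivative_cis[of "\<lambda>y. y"] has_vector_derivative_mult_right
     has_vector_derivative_of_real) (auto intro: derivative_eq_intros)
   then show ?thesis by (simp add: has_vector_derivative_def algebra_simps)
  qed
  show "onorm (\<lambda>h. h *\<^sub>R (\<i> * (cis y - 1))) \<le> \<bar>x\<bar>" if "y \<in> {- \<bar>x\<bar>..\<bar>x\<bar>}" for y
  proof (rule onorm_le)
   fix h :: real
   have "norm (h *\<^sub>R (\<i> * (cis y - 1))) \<le> \<bar>h\<bar> * \<bar>y\<bar>"
    using norm_cis_diff_le[of y] by (simp add: norm_mult mult_left_mono)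
   also have "\<bar>h\<bar> * \<bar>y\<bar> \<le> \<bar>h\<bar> * \<bar>x\<bar>" using that by (intro mult_left_mono) auto
   also have "... = \<bar>x\<bar> * norm h" by simp
   finally show "norm (h *\<^sub>R (\<i> * (cis y - 1))) \<le> \<bar>x\<bar> * norm h" .
  qed
 qed auto
 then show ?thesis by (simp add: power2_eq_square algebra_simps flip: abs_mult)
qed

text \<open>The index type is arbitrary and the frequencies are separate functions of the index,
  because the modes of the Neumann series are lists and infinitely many lists share one
  frequency.\<close>

definition rapid_summable :: "('i => real) => ('i => real) => ('i => complex) => bool"
 where "rapid_summable kappa nu A \<longleftrightarrow> (\<forall>r. (\<lambda>i. norm (A i) * (1 + \<bar>kappa i\<bar> + \<bar>nu i\<bar>) ^ r) summable_on UNIV)"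

lemma rapidly_summable_bound:
 assumes "rapid_summable kappa nu A" "!!i. norm (B i) \<le> C * norm (A i) * (1 + \<bar>kappa i\<bar> + \<bar>nu i\<bar>) ^ q"
 shows "rapid_summable kappa nu B"
 unfolding rapid_summable_def
proof
 fix r
 have "(\<lambda>i. C * (norm (A i) * (1 + \<bar>kappa i\<bar> + \<bar>nu i\<bar>) ^ (q + r))) summable_on UNIV"
  using assms(1) by (intro summable_on_cmult_right) (simp add: rapid_summable_def)
 then show "(\<lambda>i. norm (B i) * (1 + \<bar>kappa i\<bar> + \<bar>nu i\<bar>) ^ r) summable_on UNIV"
 proof (rule summable_on_comparison_test)
  fix i
  have "norm (B i) * (1 + \<bar>kappa i\<bar> + \<bar>nu i\<bar>) ^ r \<le> (C * norm (A i) * (1 + \<bar>kappa i\<bar> + \<bar>nu i\<bar>) ^ q) * (1 + \<bar>kappa i\<bar> + \<bar>nu i\<bar>) ^ r"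
   by (intro mult_right_mono assms(2)) auto
  then show "norm (B i) * (1 + \<bar>kappa i\<bar> + \<bar>nu i\<bar>) ^ r \<le> C * (norm (A i) * (1 + \<bar>kappa i\<bar> + \<bar>nu i\<bar>) ^ (q + r))"
   by (simp add: power_add mult_ac)
 qed auto
qed

lemma rapidly_summable_norm: "rapid_summable kappa nu A ==> (\<lambda>i. norm (A i)) summable_on UNIV"
 unfolding rapid_summable_def by (drule spec[of _ 0]) simp

definition trig_series :: "'n::finite => 'n => ('i => real) => ('i => real) => ('i => complex) => real ^ 'n => complex"
 where "trig_series a b kappa nu A x = infsum (\<lambda>i. A i * cis (kappa i * x $ a + nu i * x $ b)) UNIV"

lemma has_sum_diff:
 fixes f g :: "'i => complex"
 assumes "(f has_sum x) A" "(g has_sum y) A"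
 shows "((\<lambda>i. f i - g i) has_sum (x - y)) A"
 using has_sum_add[OF assms(1) has_sum_uminusI[OF assms(2)]] by simp

lemma trig_series_summable:
 assumes "rapid_summable kappa nu A"
 shows "(\<lambda>i. A i * cis (theta i)) summable_on UNIV"
 using rapidly_summable_norm[OF assms]
 by (simp add: summable_on_iff_abs_summable_on_complex norm_mult)

lemma rapidly_summable_mult_freq:
 assumes "rapid_summable kappa nu A"
 shows "rapid_summable kappa nu (\<lambda>i. \<i> * kappa i * A i)" "rapid_summable kappa nu (\<lambda>i. \<i> * nu i * A i)"
proof -
 have "\<bar>kappa i\<bar> * norm (A i) \<le> (1 + \<bar>kappa i\<bar> + \<bar>nu i\<bar>) * norm (A i)" "\<bar>nu i\<bar> * norm (A i) \<le> (1 + \<bar>kappa i\<bar> + \<bar>nu i\<bar>) * norm (A i)" for i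
  by (intro mult_right_mono; simp)+
 then show "rapid_summable kappa nu (\<lambda>i. \<i> * kappa i * A i)" "rapid_summable kappa nu (\<lambda>i. \<i> * nu i * A i)"
  by (auto intro!: rapidly_summable_bound[OF assms, of _ 1 1] simp: norm_mult mult.commute)
qed

text \<open>The second-order Taylor bound for \<open>cis\<close> is applied to each term: the
  remainders are dominated by |A i| (1 + |kappa i| + |nu i|)^2 |h|^2, whose sum is \<open>M\<close>
  times |h|^2.\<close>

lemma trig_series_has_derivative:
 fixes a b :: "'n::finite"
 assumes A: "rapid_summable kappa nu A"
 shows "(trig_series a b kappa nu A has_derivative (\<lambda>h. h $ a *\<^sub>R trig_series a b kappa nu (\<lambda>i. \<i> * kappa i * A i) x
  + h $ b *\<^sub>R trig_series a b kappa nu (\<lambda>i. \<i> * nu i * A i) x)) (at x)"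
  (is "(?F has_derivative ?F') _")
proof -
 define M where "M = infsum (\<lambda>i. norm (A i) * (1 + \<bar>kappa i\<bar> + \<bar>nu i\<bar>) ^ 2) UNIV"
 have S2: "(\<lambda>i. norm (A i) * (1 + \<bar>kappa i\<bar> + \<bar>nu i\<bar>) ^ 2) summable_on UNIV"
  using A by (auto simp: rapid_summable_def)
 note A1 = rapidly_summable_mult_freq[OF A]
 have bound: "norm (?F (x + h) - ?F x - ?F' h) \<le> M * (norm h)\<^sup>2" for h
 proof -
  let ?theta = "\<lambda>i y. kappa i * (y :: real ^ 'n) $ a + nu i * y $ b"
  have eq: "?F (x + h) - ?F x - ?F' h
   = infsum (\<lambda>i. A i * cis (?theta i x) * (cis (?theta i h) - 1 - \<i> * ?theta i h)) UNIV"
  proof (rule infsumI[symmetric])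
   have "((\<lambda>i. A i * cis (?theta i (x + h)) - A i * cis (?theta i x)
     - ((h $ a *\<^sub>R (\<i> * kappa i * A i * cis (?theta i x))) + (h $ b *\<^sub>R (\<i> * nu i * A i * cis (?theta i x)))))
     has_sum (?F (x + h) - ?F x - ?F' h)) UNIV"
    unfolding trig_series_def
    by (intro has_sum_diff has_sum_add has_sum_scaleR has_sum_infsum trig_series_summable[OF A]
      trig_series_summable[OF A1(1)] trig_series_summable[OF A1(2)])
   then show "((\<lambda>i. A i * cis (?theta i x) * (cis (?theta i h) - 1 - \<i> * ?theta i h)) has_sum (?F (x + h) - ?F x - ?F' h)) UNIV"
   proof (rule has_sum_cong[THEN iffD1, rotated])
    fix i
    have "cis (?theta i (x + h)) = cis (?theta i x) * cis (?theta i h)" by (simp add: cis_mult algebra_simps)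
    then show "A i * cis (?theta i (x + h)) - A i * cis (?theta i x)
     - ((h $ a *\<^sub>R (\<i> * kappa i * A i * cis (?theta i x))) + (h $ b *\<^sub>R (\<i> * nu i * A i * cis (?theta i x))))
     = A i * cis (?theta i x) * (cis (?theta i h) - 1 - \<i> * ?theta i h)"
     by (simp add: scaleR_conv_of_real algebra_simps)
   qed
  qed
  have "norm (infsum (\<lambda>i. A i * cis (?theta i x) * (cis (?theta i h) - 1 - \<i> * ?theta i h)) UNIV) \<le> infsum (\<lambda>i. norm (A i) * (1 + \<bar>kappa i\<bar> + \<bar>nu i\<bar>) ^ 2 * (norm h)\<^sup>2) UNIV"
  proof (rule norm_infsum_le[OF has_sum_infsum has_sum_infsum])
   show "norm (A i * cis (?theta i x) * (cis (?theta i h) - 1 - \<i> * ?theta i h)) \<le> norm (A i) * (1 + \<bar>kappa i\<bar> + \<bar>nu i\<bar>) ^ 2 * (norm h)\<^sup>2" for i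
   proof -
    have "\<bar>?theta i h\<bar> \<le> \<bar>kappa i\<bar> * norm h + \<bar>nu i\<bar> * norm h"
     by (intro order_trans[OF abs_triangle_ineq] add_mono) (auto simp: abs_mult intro!: mult_left_mono component_le_norm_cart)
    also have "... \<le> (1 + \<bar>kappa i\<bar> + \<bar>nu i\<bar>) * norm h" by (simp add: algebra_simps)
    finally have "(?theta i h)\<^sup>2 \<le> ((1 + \<bar>kappa i\<bar> + \<bar>nu i\<bar>) * norm h)\<^sup>2"
     by (intro abs_le_square_iff[THEN iffD1]) simp
    then have "norm (cis (?theta i h) - 1 - \<i> * ?theta i h) \<le> ((1 + \<bar>kappa i\<bar> + \<bar>nu i\<bar>) * norm h)\<^sup>2"
     using norm_cis_taylor_le[of "?theta i h"] by simp
    then have "norm (A i) * norm (cis (?theta i h) - 1 - \<i> * ?theta i h) \<le> norm (A i) * ((1 + \<bar>kappa i\<bar> + \<bar>nu i\<bar>) * norm h)\<^sup>2"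
     by (rule mult_left_mono) simp
    then show ?thesis by (simp only: norm_mult norm_cis mult_1_right power_mult_distrib mult.assoc)
   qed
   show "(\<lambda>i. norm (A i) * (1 + \<bar>kappa i\<bar> + \<bar>nu i\<bar>) ^ 2 * (norm h)\<^sup>2) summable_on UNIV"
    by (rule summable_on_cmult_left[OF S2])
   then show "(\<lambda>i. A i * cis (?theta i x) * (cis (?theta i h) - 1 - \<i> * ?theta i h)) summable_on UNIV"
    using \<open>!!i. norm (A i * cis (?theta i x) * (cis (?theta i h) - 1 - \<i> * ?theta i h)) \<le> norm (A i) * (1 + \<bar>kappa i\<bar> + \<bar>nu i\<bar>) ^ 2 * (norm h)\<^sup>2\<close>
    unfolding summable_on_iff_abs_summable_on_complex
    by (rule summable_on_comparison_test) auto
  qed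
  then show ?thesis unfolding eq M_def infsum_cmult_left[OF S2] .
 qed
 show ?thesis
 proof (rule has_derivativeI_sandwich[of 1])
  show "bounded_linear ?F'"
   by (intro bounded_linear_add bounded_linear_scaleR_left[THEN bounded_linear_compose] bounded_linear_vec_nth)
  show "norm (?F y - ?F x - ?F' (y - x)) / norm (y - x) \<le> M * norm (y - x)" if "y \<noteq> x" for y
   using bound[of "y - x"] that by (simp add: field_simps power2_eq_square)
  show "((\<lambda>y. M * norm (y - x)) \<longlongrightarrow> 0) (at x)"
   by (auto intro!: tendsto_eq_intros)
 qed auto
qed

lemma pd_trig_series:
 assumes "rapid_summable kappa nu A" "a \<noteq> b"
 shows "pd a (trig_series a b kappa nu A) = trig_series a b kappa nu (\<lambda>i. \<i> * kappa i * A i)"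
  "pd b (trig_series a b kappa nu A) = trig_series a b kappa nu (\<lambda>i. \<i> * nu i * A i)"
  "c \<noteq> a ==> c \<noteq> b ==> pd c (trig_series a b kappa nu A) = (\<lambda>x. 0)"
 using assms(2) by (auto simp: fun_eq_iff pd_eqI[OF trig_series_has_derivative[OF assms(1)]] axis_def)

lemma smooth_trig_series:
 assumes "rapid_summable kappa nu A" "a \<noteq> b"
 shows "smooth_on S (trig_series a b kappa nu A)"
proof -
 have "Ck_on k UNIV (trig_series a b kappa nu A)" for k
  using assms(1)
 proof (induction k arbitrary: A)
  case 0
  then show ?case
   using trig_series_has_derivative[OF 0] has_derivative_continuous
   by (simp add: continuous_on_eq_continuous_within) blast
 next
  case (Suc k)
  have "Ck_on k UNIV (pd c (trig_series a b kappa nu A))" for c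
   using Suc.IH[OF rapidly_summable_mult_freq(1)[OF Suc.prems]] Suc.IH[OF rapidly_summable_mult_freq(2)[OF Suc.prems]]
    pd_trig_series[OF Suc.prems assms(2)] by (cases "c = a \<or> c = b") auto
  moreover have "trig_series a b kappa nu A differentiable at x" for x
   unfolding differentiable_def using trig_series_has_derivative[OF Suc.prems] by blast
  ultimately show ?case by simp
 qed
 then have "smooth_on UNIV (trig_series a b kappa nu A)" by (simp add: smooth_on_def)
 then show ?thesis by (rule smooth_subset) simp
qed

text \<open>The factor 2 does not grow with \<open>s\<close>; all dependence on \<open>s\<close>
  sits in \<open>C\<close>. This lets one smallness condition on the weights serve every exponent in
  the summation over lists. If y \<le> d x with (1 + d)^s \<le> 2 the first term suffices, otherwise
  x is bounded by y / d.\<close>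

lemma power_add_le_weighted:
 obtains C :: real where "C \<ge> 0" "!!x y :: real. x \<ge> 0 ==> y \<ge> 0 ==> (x + y) ^ s \<le> 2 * x ^ s + C * y ^ s"
proof -
 have "((\<lambda>d. (1 + d) ^ s) \<longlongrightarrow> (1 + 0 :: real) ^ s) (at_right 0)" by (intro tendsto_intros)
 then have "\<forall>\<^sub>F d in at_right 0. (1 + d) ^ s < (2 :: real)" by (rule order_tendstoD) simp
 then obtain d :: real where d: "d > 0" "(1 + d) ^ s \<le> 2"
  by (auto simp: eventually_at_right_field) (metis dense less_eq_real_def)
 have "(x + y) ^ s \<le> 2 * x ^ s + (1 + 1 / d) ^ s * y ^ s" if "x \<ge> 0" "y \<ge> 0" for x y
 proof (cases "y \<le> d * x")
  case True
  then have "(x + y) ^ s \<le> ((1 + d) * x) ^ s" using that by (intro power_mono) (auto simp: algebra_simps)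
  also have "... \<le> 2 * x ^ s" using that d by (simp add: power_mult_distrib mult_right_mono)
  finally show ?thesis using that d by (simp add: add_increasing2)
 next
  case False
  then have "x \<le> y / d" using d by (simp add: field_simps)
  then have "(x + y) ^ s \<le> ((1 + 1 / d) * y) ^ s" using that by (intro power_mono) (auto simp: algebra_simps)
  then show ?thesis using that by (simp add: power_mult_distrib add_increasing)
 qed
 then show ?thesis using that[of "(1 + 1 / d) ^ s"] d by auto
qed

text \<open>Lists of length m have total weight at most (1/8)^m. With the polynomial factor
  included, splitting off the head gives b(m+1) \<le> 2 (1/8) b(m) + C Q (1/8)^m, so the sums decay
  like 2^(-m).\<close>

lemma summable_on_lists:
 fixes w n :: "'k => real"
 assumes w: "!!k. w k \<ge> 0" and n: "!!k. n k \<ge> 0"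
  and summ: "!!r. (\<lambda>k. w k * (1 + n k) ^ r) summable_on UNIV"
  and small: "infsum w UNIV \<le> 1 / 8"
 shows "(\<lambda>ks. prod_list (map w ks) * (1 + sum_list (map n ks)) ^ s) summable_on UNIV"
proof (rule nonneg_bdd_above_summable_on)
 have nn: "prod_list (map w ks) \<ge> 0" "sum_list (map n ks) \<ge> 0" for ks
  by (auto intro!: prod_list_nonneg sum_list_nonneg simp: w n)
 then show "prod_list (map w ks) * (1 + sum_list (map n ks)) ^ s \<ge> 0" for ks by (simp add: add_nonneg_nonneg)
 obtain C where C: "C \<ge> 0" "!!x y :: real. x \<ge> 0 ==> y \<ge> 0 ==> (x + y) ^ s \<le> 2 * x ^ s + C * y ^ s"
  using power_add_le_weighted[of s] by metis
 define Q where "Q = infsum (\<lambda>k. w k * (1 + n k) ^ s) UNIV"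
 have Q0: "Q \<ge> 0" unfolding Q_def by (rule infsum_nonneg) (simp add: w n add_nonneg_nonneg)
 \<comment> \<open>The empty list contributes 1, whence the maximum with 1; D \<ge> 4 C Q makes both
   terms of the recursion at most D / 4 times 2^(-m).\<close>
 define D where "D = max 1 (4 * (C * Q))"
 have main: "sum (\<lambda>ks. prod_list (map w ks) * (1 + sum_list (map n ks)) ^ s) F \<le> 2 * D" if "finite F" for F
 proof -
  \<comment> \<open>A finite set of lists uses finitely many letters, so it lies in a finite union
    of the finite sets \<open>L m\<close> of lists over \<open>K\<close>.\<close>
  define K where "K = (\<Union>ks\<in>F. set ks)"
  have K: "finite K" using that by (simp add: K_def)
  define L where "L m = {ks. set ks \<subseteq> K \<and> length ks = m}" for m
  have fL: "finite (L m)" for m unfolding L_def by (rule finite_lists_length_eq[OF K])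
  have L_Suc: "sum h (L (Suc m)) = (\<Sum>k\<in>K. \<Sum>ks\<in>L m. h (k # ks))" for h :: "_ => real" and m
  proof -
   have "L (Suc m) = (\<lambda>(k, ks). k # ks) ` (K \<times> L m)"
    unfolding L_def by (auto simp: length_Suc_conv image_iff)
   then show ?thesis
    by (simp add: sum.reindex inj_on_def case_prod_unfold sum.cartesian_product)
  qed
  have L_0: "L 0 = {[]}" by (auto simp: L_def)
  have wK: "sum w K \<le> 1 / 8"
   using finite_sum_le_infsum[of w UNIV K] summ[of 0] w K small by simp
  have P: "(\<Sum>ks\<in>L m. prod_list (map w ks)) \<le> (1 / 8) ^ m" for m
  proof (induction m)
   case (Suc m)
   have "(\<Sum>ks\<in>L (Suc m). prod_list (map w ks)) = sum w K * (\<Sum>ks\<in>L m. prod_list (map w ks))"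
    by (simp add: L_Suc sum_product)
   also have "... \<le> (1 / 8) * (1 / 8) ^ m"
    using w wK Suc by (intro mult_mono) (auto intro!: sum_nonneg nn)
   finally show ?case by simp
  qed (simp add: L_0)
  have B: "(\<Sum>ks\<in>L m. prod_list (map w ks) * (1 + sum_list (map n ks)) ^ s) \<le> D * (1 / 2) ^ m" for m
  proof (induction m)
   case (Suc m)
   let ?b = "\<Sum>ks\<in>L m. prod_list (map w ks) * (1 + sum_list (map n ks)) ^ s"
   have "(\<Sum>ks\<in>L (Suc m). prod_list (map w ks) * (1 + sum_list (map n ks)) ^ s)
    = (\<Sum>k\<in>K. \<Sum>ks\<in>L m. w k * prod_list (map w ks) * ((1 + sum_list (map n ks)) + n k) ^ s)"
    by (simp add: L_Suc add_ac)
   also have "... \<le> (\<Sum>k\<in>K. \<Sum>ks\<in>L m. w k * prod_list (map w ks) * (2 * (1 + sum_list (map n ks)) ^ s + C * (1 + n k) ^ s))"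
   proof (intro sum_mono mult_left_mono)
    fix k ks
    have "((1 + sum_list (map n ks)) + n k) ^ s \<le> 2 * (1 + sum_list (map n ks)) ^ s + C * n k ^ s"
     by (intro C) (auto simp: nn n add_nonneg_nonneg)
    also have "C * n k ^ s \<le> C * (1 + n k) ^ s" using C n by (intro mult_left_mono power_mono) auto
    finally show "((1 + sum_list (map n ks)) + n k) ^ s \<le> 2 * (1 + sum_list (map n ks)) ^ s + C * (1 + n k) ^ s" by simp
   qed (auto simp: w nn)
   also have "... = 2 * (sum w K * ?b) + C * ((\<Sum>k\<in>K. w k * (1 + n k) ^ s) * (\<Sum>ks\<in>L m. prod_list (map w ks)))"
    unfolding sum_product unfolding sum_distrib_left sum.distrib[symmetric]
    by (intro sum.cong refl) (simp add: algebra_simps)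
   also have "... \<le> 2 * (1 / 8 * (D * (1 / 2) ^ m)) + C * (Q * (1 / 8) ^ m)"
   proof (intro add_mono mult_left_mono mult_mono wK Suc P)
    show "(\<Sum>k\<in>K. w k * (1 + n k) ^ s) \<le> Q"
     unfolding Q_def by (rule finite_sum_le_infsum[OF summ K]) (auto simp: w n add_nonneg_nonneg)
   qed (auto intro!: sum_nonneg mult_nonneg_nonneg zero_le_power simp: w n nn Q0 C add_nonneg_nonneg)
   also have "C * (Q * (1 / 8) ^ m) \<le> (D / 4) * (1 / 2) ^ m"
    unfolding mult.assoc[symmetric] using C Q0 by (intro mult_mono power_mono) (auto simp: D_def)
   finally show ?case by (simp add: algebra_simps)
  qed (simp add: L_0 D_def)
  obtain M where M: "!!ks. ks \<in> F ==> length ks < M"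
   using finite_imageI[OF \<open>finite F\<close>, of length] unfolding finite_nat_set_iff_bounded by blast
  have "sum (\<lambda>ks. prod_list (map w ks) * (1 + sum_list (map n ks)) ^ s) F
   \<le> sum (\<lambda>ks. prod_list (map w ks) * (1 + sum_list (map n ks)) ^ s) (\<Union>m<M. L m)"
  proof (intro sum_mono2)
   show "F \<subseteq> (\<Union>m<M. L m)" using M by (auto simp: L_def K_def)
  qed (auto simp: fL intro!: mult_nonneg_nonneg zero_le_power add_nonneg_nonneg nn)
  also have "... = (\<Sum>m<M. \<Sum>ks\<in>L m. prod_list (map w ks) * (1 + sum_list (map n ks)) ^ s)"
   by (rule sum.UNION_disjoint) (auto simp: fL, auto simp: L_def)
  also have "... \<le> (\<Sum>m<M. D * (1 / 2) ^ m)" by (intro sum_mono B)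
  also have "... = D * (\<Sum>m<M. (1 / 2) ^ m)" by (simp add: sum_distrib_left)
  also have "... \<le> D * 2"
   by (intro mult_left_mono) (auto simp: D_def sum_gp_strict)
  finally show ?thesis by simp
 qed
 then show "bdd_above (sum (\<lambda>ks. prod_list (map w ks) * (1 + sum_list (map n ks)) ^ s) ` {F. F \<subseteq> UNIV \<and> finite F})"
  by (auto intro!: bdd_aboveI2)
qed

text \<open>A list is empty or a pair of head and tail; this turns a sum over lists into a
  self-referential identity, as for a geometric series.\<close>

lemma infsum_lists_Cons:
 fixes f :: "'k list => 'b::banach"
 assumes "f summable_on UNIV"
 shows "infsum f UNIV = f [] + infsum (\<lambda>(k, ks). f (k # ks)) UNIV"
  and "(\<lambda>(k, ks). f (k # ks)) summable_on UNIV"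
proof -
 have inj: "inj (\<lambda>(k :: 'k, ks). k # ks)" by (auto simp: inj_def)
 have U: "UNIV = insert [] (range (\<lambda>(k :: 'k, ks). k # ks))"
  by (auto simp: image_iff) (metis list.exhaust)
 have sub: "f summable_on range (\<lambda>(k :: 'k, ks). k # ks)"
  by (rule summable_on_subset_banach[OF assms]) auto
 have eq: "f \<circ> (\<lambda>(k, ks). k # ks) = (\<lambda>(k, ks). f (k # ks))" by (auto simp: fun_eq_iff)
 show "(\<lambda>(k, ks). f (k # ks)) summable_on UNIV"
  using sub summable_on_reindex[OF inj, of f] by (simp add: eq)
 have "infsum f UNIV = f [] + infsum f (range (\<lambda>(k :: 'k, ks). k # ks))"
  by (subst U, subst infsum_insert[OF sub]) auto
 then show "infsum f UNIV = f [] + infsum (\<lambda>(k, ks). f (k # ks)) UNIV"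
  by (simp add: infsum_reindex[OF inj] eq)
qed

section \<open>The Beltrami equation\<close>

text \<open>A list stands for the product of the exponentials of its members, so frequencies add up
  along it.\<close>

definition freq1 :: "(int \<times> int) list => real"
 where "freq1 ks = of_int (sum_list (map fst ks))"

definition freq2 :: "(int \<times> int) list => real"
 where "freq2 ks = of_int (sum_list (map snd ks))"

text \<open>\<open>\<i> * symbol m0 ks\<close> is the Fourier multiplier of the constant coefficient operator
 \<open>\<partial>\<^sub>b - m0 \<partial>\<^sub>a\<close>.\<close>

definition symbol :: "complex => (int \<times> int) list => complex"
 where "symbol m0 ks = of_real (freq2 ks) - m0 * of_real (freq1 ks)"

text \<open>The iterated application of \<open>mu \<mapsto> \<partial>\<^sub>a (\<partial>\<^sub>b - m0 \<partial>\<^sub>a)\<^sup>-\<^sup>1 mu\<close>, expanded into Fourier modes: a mode of the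
 Neumann series is a list of modes of \<open>mu\<close>. For zero frequency the quotient is \<open>0\<close> by convention.\<close>

fun neumann_coeff :: "complex => (int \<times> int => complex) => (int \<times> int) list => complex"
 where "neumann_coeff m0 c [] = 1"
 | "neumann_coeff m0 c (k # ks) = (of_real (freq1 (k # ks)) / symbol m0 (k # ks)) * (c k * neumann_coeff m0 c ks)"

text \<open>While \<open>neumann_coeff\<close> gives the modes of d_a Z, these are the modes of mu
  d_a Z, the right-hand side to be inverted: the head is the mode contributed by mu.\<close>

fun neumann_source :: "complex => (int \<times> int => complex) => (int \<times> int) list => complex"
 where "neumann_source m0 c [] = 0"
 | "neumann_source m0 c (k # ks) = c k * neumann_coeff m0 c ks"

text \<open>Ellipticity: the imaginary part of the symbol is - Im m0 times the first frequency.
  Hence frequency over symbol is at most 1 / |Im m0| in absolute value.\<close>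

lemma norm_symbol_ge: "\<bar>Im m0\<bar> * \<bar>freq1 ks\<bar> \<le> norm (symbol m0 ks)"
 using abs_Im_le_cmod[of "symbol m0 ks"] by (simp add: symbol_def abs_mult)

text \<open>Frequencies are integers: either the first one has absolute value at least 1, or the
  symbol is the second one, itself a nonzero integer.\<close>

lemma norm_symbol_ge_min:
 assumes "symbol m0 ks \<noteq> 0"
 shows "min \<bar>Im m0\<bar> 1 \<le> norm (symbol m0 ks)"
proof (cases "freq1 ks = 0")
 case True
 then have "\<bar>freq2 ks\<bar> \<ge> 1" using assms by (simp add: symbol_def freq2_def)
 then show ?thesis using True by (simp add: symbol_def)
next
 case False
 then have "\<bar>freq1 ks\<bar> \<ge> 1" by (simp add: freq1_def)
 then have "\<bar>Im m0\<bar> \<le> \<bar>Im m0\<bar> * \<bar>freq1 ks\<bar>" using mult_left_mono[of 1 "\<bar>freq1 ks\<bar>" "\<bar>Im m0\<bar>"] by simp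
 then show ?thesis using norm_symbol_ge[of m0 ks] by linarith
qed

lemma has_sum_single: "((\<lambda>i. if i = j then v else 0) has_sum (v :: 'b::{comm_monoid_add,topological_space})) UNIV"
 by (rule has_sum_finite_neutralI[where B="{j}"]) auto

text \<open>The ansatz is Z = x_a + (m0 + phi0) x_b + W with W periodic. The modes of W are the
  source modes divided by the symbol; those of zero symbol cannot be divided and are absorbed by the
  constant phi0. All nonempty lists together contribute at most 1/7 to d_a Z, whose leading term is
  1.\<close>

lemma constant_beltrami_perturbation:
 fixes a b :: "'n::finite" and c :: "int \<times> int => complex"
 assumes ab: "a \<noteq> b" and m0: "Im m0 \<noteq> 0"
  and rapid: "rapid_summable (\<lambda>k. of_int (fst k)) (\<lambda>k. of_int (snd k)) c"
  and small: "infsum (\<lambda>k. norm (c k)) UNIV \<le> \<bar>Im m0\<bar> / 8"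
 obtains Z :: "real ^ 'n => complex" where "smooth_on UNIV Z"
  "!!x d. d \<noteq> a ==> d \<noteq> b ==> pd d Z x = 0"
  "!!x. pd b Z x = (m0 + trig_series a b (\<lambda>k. of_int (fst k)) (\<lambda>k. of_int (snd k)) c x) * pd a Z x"
  "!!x. pd a Z x \<noteq> 0"
proof -
 define beta where "beta = \<bar>Im m0\<bar>"
 have beta: "beta > 0" using m0 by (simp add: beta_def)
 \<comment> \<open>Each step of the iteration costs the multiplier bound 1 / \<open>beta\<close>;
   with this built in, products of \<open>w\<close> along a list dominate
   \<open>neumann_coeff\<close>.\<close>
 define w where "w k = norm (c k) / beta" for k
 define n where "n k = \<bar>real_of_int (fst k)\<bar> + \<bar>real_of_int (snd k)\<bar>" for k :: "int \<times> int"
 define P where "P ks = prod_list (map w ks)" for ks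
 define N where "N ks = sum_list (map n ks)" for ks
 let ?V = "neumann_coeff m0 c" and ?U = "neumann_source m0 c" and ?D = "symbol m0"
 have w0: "w k \<ge> 0" for k using beta by (simp add: w_def)
 have P0: "P ks \<ge> 0" for ks unfolding P_def by (rule prod_list_nonneg) (auto simp: w0)
 have wsum: "(\<lambda>k. w k * (1 + n k) ^ r) summable_on UNIV" for r
 proof -
  have "(\<lambda>k. norm (c k) * (1 + n k) ^ r * (1 / beta)) summable_on UNIV"
   using rapid by (intro summable_on_cmult_left) (simp add: rapid_summable_def n_def add.assoc)
  then show ?thesis by (simp add: w_def)
 qed
 have csum: "(\<lambda>k. norm (c k)) summable_on UNIV" by (rule rapidly_summable_norm[OF rapid])
 have w8: "infsum w UNIV \<le> 1 / 8"
 proof -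
  have "infsum w UNIV = infsum (\<lambda>k. norm (c k)) UNIV * (1 / beta)"
   unfolding infsum_cmult_left[OF csum, symmetric] by (simp add: w_def[abs_def])
  also have "... \<le> (beta / 8) * (1 / beta)" using small beta by (intro mult_right_mono) (auto simp: beta_def)
  finally show ?thesis using beta by simp
 qed
 have lsum: "(\<lambda>ks. P ks * (1 + N ks) ^ r) summable_on UNIV" for r
  unfolding P_def N_def by (rule summable_on_lists[OF w0 _ wsum w8]) (simp add: n_def)
 have Nge: "\<bar>freq1 ks\<bar> + \<bar>freq2 ks\<bar> \<le> N ks" for ks
  by (induction ks) (auto simp: freq1_def freq2_def N_def n_def)
 have rapidP: "rapid_summable freq1 freq2 (\<lambda>ks. of_real (P ks))"
  unfolding rapid_summable_def
 proof
  fix r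
  show "(\<lambda>ks. norm (complex_of_real (P ks)) * (1 + \<bar>freq1 ks\<bar> + \<bar>freq2 ks\<bar>) ^ r) summable_on UNIV"
  proof (rule summable_on_comparison_test[OF lsum[of r]])
   show "norm (complex_of_real (P ks)) * (1 + \<bar>freq1 ks\<bar> + \<bar>freq2 ks\<bar>) ^ r \<le> P ks * (1 + N ks) ^ r" for ks
    using P0[of ks] Nge[of ks] by (auto intro!: mult_left_mono power_mono)
  qed auto
 qed
 have VP: "norm (?V ks) \<le> P ks" for ks
 proof (induction ks)
  case (Cons k ks)
  have "norm (of_real (freq1 (k # ks)) / ?D (k # ks)) \<le> 1 / beta"
  proof (cases "freq1 (k # ks) = 0")
   case False
   then have "norm (?D (k # ks)) > 0" using norm_symbol_ge[of m0 "k # ks"] m0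
    by (smt (verit) mult_pos_pos zero_less_abs_iff)
   then show ?thesis using norm_symbol_ge[of m0 "k # ks"] beta by (simp add: norm_divide field_simps beta_def)
  qed (use beta in simp)
  then have "norm (of_real (freq1 (k # ks)) / ?D (k # ks)) * (norm (c k) * norm (?V ks)) \<le> (1 / beta) * (norm (c k) * P ks)"
   using beta Cons by (intro mult_mono) auto
  moreover have "P (k # ks) = (1 / beta) * (norm (c k) * P ks)" by (simp add: P_def w_def)
  ultimately show ?case by (simp only: neumann_coeff.simps norm_mult)
 qed (simp add: P_def)
 have UP: "norm (?U ks) \<le> beta * P ks" for ks
  using VP beta by (cases ks) (auto simp: P_def norm_mult w_def mult_left_mono)
 define W where "W ks = ?U ks / (\<i> * ?D ks)" for ks
 have WP: "norm (W ks) \<le> (beta / min beta 1) * P ks" for ks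
 proof (cases "?D ks = 0")
  case False
  have "norm (W ks) = norm (?U ks) / norm (?D ks)" by (simp add: W_def norm_divide norm_mult)
  also have "... \<le> (beta * P ks) / min beta 1"
   using UP norm_symbol_ge_min[OF False] beta P0[of ks] by (intro frac_le) (auto simp: beta_def)
  finally show ?thesis by simp
 qed (use beta P0[of ks] in \<open>simp add: W_def\<close>)
 have rV: "rapid_summable freq1 freq2 ?V"
  by (rule rapidly_summable_bound[OF rapidP, of _ 1 0]) (use VP P0 in simp)
 have rU: "rapid_summable freq1 freq2 ?U"
  by (rule rapidly_summable_bound[OF rapidP, of _ beta 0]) (use UP P0 in simp)
 have rW: "rapid_summable freq1 freq2 W"
  by (rule rapidly_summable_bound[OF rapidP, of _ "beta / min beta 1" 0]) (use WP P0 in simp)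
 define e where "e x ks = cis (freq1 ks * x $ a + freq2 ks * x $ b)" for x :: "real ^ 'n" and ks
 have sm: "(\<lambda>ks. A ks * e x ks) summable_on UNIV" if "rapid_summable freq1 freq2 A" for A x
  unfolding e_def by (rule trig_series_summable[OF that])
 \<comment> \<open>The constant mode of the source: the obstruction to solving with a periodic W,
   taken over by the slope in x_b.\<close>
 define phi0 where "phi0 = infsum (\<lambda>ks. if ?D ks = 0 then ?U ks else 0) UNIV"
 define Z where "Z x = x $ a + (m0 + phi0) * x $ b + trig_series a b freq1 freq2 W x" for x
 have smW: "smooth_on UNIV (trig_series a b freq1 freq2 W)" by (rule smooth_trig_series[OF rW ab])
 have smc: "smooth_on UNIV (\<lambda>x :: real ^ 'n. of_real (x $ d) :: complex)" for d by (intro smooth_of_real) auto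
 have smZ: "smooth_on UNIV Z" unfolding Z_def by (intro smooth_add smooth_mult smc smW) auto
 have pdc: "pd d (\<lambda>x :: real ^ 'n. of_real (x $ i) :: complex) x = (if i = d then 1 else 0)" for d i x
  by (simp add: pd_linear[OF bounded_linear_of_real])
 have pdZ: "pd d Z x = (if d = a then 1 else 0) + (m0 + phi0) * (if d = b then 1 else 0) + pd d (trig_series a b freq1 freq2 W) x" for d x
 proof -
  have "(\<lambda>x :: real ^ 'n. of_real (x $ i) :: complex) differentiable at x" for i
   by (rule smoothD[OF smc]) simp
  moreover have "trig_series a b freq1 freq2 W differentiable at x" by (rule smoothD[OF smW]) simp
  ultimately show ?thesis unfolding Z_def by (subst pd_add pd_mult; simp add: pdc)+
 qed
 have Vs: "infsum (\<lambda>ks. ?V ks * e x ks) UNIV = 1 + infsum (\<lambda>ks. \<i> * freq1 ks * W ks * e x ks) UNIV" for x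
 proof -
  \<comment> \<open>The empty list accounts for d_a x_a = 1. For a nonempty list differentiation
    restores the coefficient, also at zero symbol, where both quotients are 0 by convention.\<close>
  have 1: "?V ks * e x ks = (if ks = [] then 1 else 0) + \<i> * freq1 ks * W ks * e x ks" for ks
   by (cases ks) (auto simp: W_def e_def freq1_def freq2_def)
  from has_sum_add[OF has_sum_single has_sum_infsum[OF sm[OF rapidly_summable_mult_freq(1)[OF rW]]]]
  show ?thesis unfolding 1 by (intro infsumI) simp
 qed
 have pda: "pd a Z x = infsum (\<lambda>ks. ?V ks * e x ks) UNIV" for x
  using ab by (simp add: pdZ Vs[unfolded e_def] pd_trig_series[OF rW ab] trig_series_def e_def)
 have pdb: "pd b Z x = m0 + phi0 + infsum (\<lambda>ks. \<i> * freq2 ks * W ks * e x ks) UNIV" for x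
  using ab by (simp add: pdZ pd_trig_series[OF rW ab] trig_series_def e_def)
 have "pd b Z x - m0 * pd a Z x = infsum (\<lambda>ks. ?U ks * e x ks) UNIV" for x
 proof -
  have s0: "(\<lambda>ks. if ?D ks = 0 then ?U ks else 0) summable_on UNIV"
   using rapidly_summable_norm[OF rapidly_summable_bound[OF rU, of "\<lambda>ks. if ?D ks = 0 then ?U ks else 0" 1 0]]
   by (simp add: summable_on_iff_abs_summable_on_complex)
  \<comment> \<open>By ellipticity the symbol vanishes only if both frequencies do, and the
    exponential is then constant; so the discarded modes add up to \<open>phi0\<close> at every
    point.\<close>
  have e1: "e x ks = 1" if "?D ks = 0" for ks
  proof -
   have "freq1 ks = 0" using norm_symbol_ge[of m0 ks] that m0 by (simp add: mult_le_0_iff)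
   then have "freq2 ks = 0" using that by (simp add: symbol_def)
   then show ?thesis using \<open>freq1 ks = 0\<close> by (simp add: e_def)
  qed
  have 1: "(\<lambda>ks. ?U ks * e x ks) = (\<lambda>ks. (if ?D ks = 0 then ?U ks else 0) + (\<i> * freq2 ks * W ks * e x ks - m0 * (\<i> * freq1 ks * W ks * e x ks)))"
  proof
   fix ks
   have "\<i> * freq2 ks * W ks - m0 * (\<i> * freq1 ks * W ks) = \<i> * ?D ks * W ks" by (simp add: symbol_def algebra_simps)
   also have "... = (if ?D ks = 0 then 0 else ?U ks)" by (simp add: W_def)
   finally have "(\<i> * freq2 ks * W ks - m0 * (\<i> * freq1 ks * W ks)) * e x ks = (if ?D ks = 0 then 0 else ?U ks * e x ks)" by simp
   then show "?U ks * e x ks = (if ?D ks = 0 then ?U ks else 0) + (\<i> * freq2 ks * W ks * e x ks - m0 * (\<i> * freq1 ks * W ks * e x ks))"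
    using e1[of ks] by (simp add: algebra_simps split: if_splits)
  qed
  have "((\<lambda>ks. ?U ks * e x ks) has_sum (phi0 + (infsum (\<lambda>ks. \<i> * freq2 ks * W ks * e x ks) UNIV
    - m0 * infsum (\<lambda>ks. \<i> * freq1 ks * W ks * e x ks) UNIV))) UNIV"
   unfolding 1 phi0_def
   by (intro has_sum_add has_sum_diff has_sum_cmult_right has_sum_infsum s0 sm[OF rapidly_summable_mult_freq(1)[OF rW]]
     sm[OF rapidly_summable_mult_freq(2)[OF rW]])
  from infsumI[OF this] show ?thesis
   by (simp only: pda pdb Vs) (simp add: algebra_simps)
 qed
 moreover have "infsum (\<lambda>ks. ?U ks * e x ks) UNIV = trig_series a b (\<lambda>k. of_int (fst k)) (\<lambda>k. of_int (snd k)) c x * pd a Z x" for x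
 proof -
  let ?ec = "\<lambda>k :: int \<times> int. cis (of_int (fst k) * x $ a + of_int (snd k) * x $ b)"
  have eC: "e x (k # ks) = ?ec k * e x ks" for k ks
   by (simp add: e_def cis_mult freq1_def freq2_def algebra_simps)
  \<comment> \<open>Splitting off the head factors the source into the series of \<open>c\<close>
    times the series of d_a Z; this is the perturbation term of the equation.\<close>
  have "infsum (\<lambda>ks. ?U ks * e x ks) UNIV = infsum (\<lambda>(k, ks). (c k * ?ec k) * (?V ks * e x ks)) (UNIV \<times> UNIV)"
   using infsum_lists_Cons(1)[OF sm[OF rU, of x]] by (simp add: eC case_prod_unfold mult_ac)
  also have "... = infsum (\<lambda>k. infsum (\<lambda>ks. (c k * ?ec k) * (?V ks * e x ks)) UNIV) UNIV"
   using infsum_lists_Cons(2)[OF sm[OF rU, of x]]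
   by (subst infsum_Sigma_banach[symmetric]) (simp_all add: eC case_prod_unfold mult_ac)
  also have "... = infsum (\<lambda>k. (c k * ?ec k) * infsum (\<lambda>ks. ?V ks * e x ks) UNIV) UNIV"
   by (subst infsum_cmult_right[OF sm[OF rV]]) simp
  also have "... = trig_series a b (\<lambda>k. of_int (fst k)) (\<lambda>k. of_int (snd k)) c x * pd a Z x"
   unfolding trig_series_def pda
   by (rule infsum_cmult_left) (rule trig_series_summable[OF rapid])
  finally show ?thesis .
 qed
 ultimately have bel: "pd b Z x = (m0 + trig_series a b (\<lambda>k. of_int (fst k)) (\<lambda>k. of_int (snd k)) c x) * pd a Z x" for x
  by (metis (no_types, lifting) add.commute diff_add_cancel distrib_right)
 have nz: "pd a Z x \<noteq> 0" for x
 proof -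
  let ?M = "trig_series a b (\<lambda>k. of_int (fst k)) (\<lambda>k. of_int (snd k)) c x"
  have Psum: "P summable_on UNIV" using lsum[of 0] by simp
  \<comment> \<open>Splitting off the head gives the geometric identity P = 1 + w P for the total
    weights, so P \<le> 8/7.\<close>
  have "infsum P UNIV = 1 + infsum (\<lambda>(k, ks). w k * P ks) (UNIV \<times> UNIV)"
   by (subst infsum_lists_Cons(1)[OF Psum]) (simp add: P_def)
  also have "infsum (\<lambda>(k, ks). w k * P ks) (UNIV \<times> UNIV) = infsum (\<lambda>k. infsum (\<lambda>ks. w k * P ks) UNIV) UNIV"
   using infsum_lists_Cons(2)[OF Psum]
   by (subst infsum_Sigma_banach[symmetric]) (simp_all add: P_def case_prod_unfold)
  also have "... = infsum w UNIV * infsum P UNIV"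
   by (subst infsum_cmult_right', subst infsum_cmult_left') (rule refl)
  finally have Pw: "infsum P UNIV = 1 + infsum w UNIV * infsum P UNIV" .
  have Pge: "infsum P UNIV \<ge> 0" by (rule infsum_nonneg) (rule P0)
  have "infsum w UNIV * infsum P UNIV \<le> 1 / 8 * infsum P UNIV" using w8 Pge by (rule mult_right_mono)
  then have P87: "infsum P UNIV \<le> 8 / 7" using Pw by simp
  have "((\<lambda>ks :: (int \<times> int) list. - (if ks = [] then 1 else 0 :: real)) has_sum -1) UNIV"
   by (rule has_sum_uminusI[OF has_sum_single])
  from has_sum_add[OF has_sum_infsum[OF Psum] this]
  have tail: "((\<lambda>ks. P ks - (if ks = [] then 1 else 0)) has_sum infsum P UNIV - 1) UNIV" by simp
  have "pd a Z x - 1 = infsum (\<lambda>ks. \<i> * freq1 ks * W ks * e x ks) UNIV" by (simp add: pda Vs)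
  also have "norm ... \<le> infsum P UNIV - 1"
  proof (rule norm_infsum_le[OF has_sum_infsum tail])
   have "norm (\<i> * freq1 ks * W ks * e x ks) \<le> P ks - (if ks = [] then 1 else 0)" for ks
   proof (cases ks)
    case (Cons k ks')
    then have "\<i> * freq1 ks * W ks = ?V ks" by (simp add: W_def)
    then have "norm (\<i> * freq1 ks * W ks * e x ks) = norm (?V ks) * norm (e x ks)" by (simp only: norm_mult)
    also have "... = norm (?V ks)" by (simp add: e_def)
    finally show ?thesis using VP[of ks] Cons by (simp only:) simp
   qed (simp add: W_def P_def)
   then show "norm (\<i> * freq1 ks * W ks * e x ks) \<le> P ks - (if ks = [] then 1 else 0)" for ks .
   show "(\<lambda>ks. \<i> * freq1 ks * W ks * e x ks) summable_on UNIV"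
    by (rule sm[OF rapidly_summable_mult_freq(1)[OF rW]])
  qed
  finally have "norm (pd a Z x - 1) < 1" using P87 by simp
  then show ?thesis by (cases "pd a Z x = 0") simp_all
 qed
 have "pd d Z x = 0" if "d \<noteq> a" "d \<noteq> b" for d x
  using that by (simp add: pdZ pd_trig_series[OF rW ab])
 then show ?thesis using that[OF smZ _ bel nz] by blast
qed

section \<open>Derivative bounds, dilation and cutoff\<close>

primrec derivs_le :: "nat => real => (real ^ 'n) set => (real ^ 'n => 'b::real_normed_vector) => bool"
 where
  "derivs_le 0 C S f \<longleftrightarrow> (\<forall>x\<in>S. norm (f x) \<le> C)"
 | "derivs_le (Suc k) C S f \<longleftrightarrow> (\<forall>x\<in>S. norm (f x) \<le> C) \<and> (\<forall>a. derivs_le k C S (pd a f))"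

lemma derivs_le_SucD: "derivs_le (Suc k) C S f ==> derivs_le k C S f"
 by (induction k arbitrary: f) auto

lemma derivs_le_norm: "derivs_le k C S f ==> x \<in> S ==> norm (f x) \<le> C"
 by (cases k) auto

lemma derivs_le_mono: "derivs_le k C S f ==> C \<le> D ==> T \<subseteq> S ==> derivs_le k D T f"
 by (induction k arbitrary: f) fastforce+

lemma derivs_le_cong:
 assumes "open S" "!!x. x \<in> S ==> f x = g x" "derivs_le k C S f"
 shows "derivs_le k C S g"
 using assms(2,3)
proof (induction k arbitrary: f g)
 case (Suc k)
 have "derivs_le k C S (pd a g)" for a
  using Suc.IH[of "pd a f" "pd a g"] Suc.prems pd_cong_open[OF assms(1) _ Suc.prems(1)] by auto
 then show ?case using Suc.prems by auto
qed auto

lemma derivs_le_diff: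
 assumes "open S" "Ck_on k S f" "Ck_on k S g" "derivs_le k C S f" "derivs_le k D S g"
 shows "derivs_le k (C + D) S (\<lambda>x. f x - g x)"
 using assms(2-5)
proof (induction k arbitrary: f g)
 case 0
 then show ?case by (auto intro!: norm_triangle_le_diff add_mono)
next
 case (Suc k)
 have "derivs_le k (C + D) S (pd a (\<lambda>x. f x - g x))" for a
 proof (rule derivs_le_cong[OF assms(1)])
  show "derivs_le k (C + D) S (\<lambda>x. pd a f x - pd a g x)" using Suc by auto
 qed (use Suc.prems in \<open>auto simp: pd_diff\<close>)
 then show ?case using Suc.prems by (auto intro!: norm_triangle_le_diff add_mono)
qed

lemma derivs_le_add:
 assumes "open S" "Ck_on k S f" "Ck_on k S g" "derivs_le k C S f" "derivs_le k D S g"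
 shows "derivs_le k (C + D) S (\<lambda>x. f x + g x)"
 using assms(2-5)
proof (induction k arbitrary: f g)
 case 0
 then show ?case by (auto intro!: norm_triangle_le add_mono)
next
 case (Suc k)
 have "derivs_le k (C + D) S (pd a (\<lambda>x. f x + g x))" for a
 proof (rule derivs_le_cong[OF assms(1)])
  show "derivs_le k (C + D) S (\<lambda>x. pd a f x + pd a g x)" using Suc by auto
 qed (use Suc.prems in \<open>auto simp: pd_add\<close>)
 then show ?case using Suc.prems by (auto intro!: norm_triangle_le add_mono)
qed

text \<open>The Leibniz rule doubles the number of terms with each derivative, whence 2 ^ k.\<close>

lemma derivs_le_mult:
 fixes f g :: "real ^ 'n => 'b::real_normed_algebra"
 assumes "open S" "Ck_on k S f" "Ck_on k S g" "derivs_le k C S f" "derivs_le k D S g" "0 \<le> C" "0 \<le> D"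
 shows "derivs_le k (2 ^ k * C * D) S (\<lambda>x. f x * g x)"
 using assms(2-5)
proof (induction k arbitrary: f g)
 case 0
 then show ?case using assms(6) by (auto intro!: order_trans[OF norm_mult_ineq] mult_mono)
next
 case (Suc k)
 have fg: "Ck_on k S f" "Ck_on k S g" "derivs_le k C S f" "derivs_le k D S g"
  using Suc.prems by (blast intro: Ck_SucD derivs_le_SucD)+
 have "derivs_le k (2 ^ Suc k * C * D) S (pd a (\<lambda>x. f x * g x))" for a
 proof (rule derivs_le_cong[OF assms(1)])
  have "derivs_le k (2 ^ k * C * D + 2 ^ k * C * D) S (\<lambda>x. f x * pd a g x + pd a f x * g x)"
   using Suc.prems fg by (intro derivs_le_add assms(1) Suc.IH Ck_mult) auto
  then show "derivs_le k (2 ^ Suc k * C * D) S (\<lambda>x. f x * pd a g x + pd a f x * g x)"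
   by (simp add: algebra_simps)
 qed (use Suc.prems in \<open>auto simp: pd_mult\<close>)
 moreover have "norm (f x * g x) \<le> 2 ^ Suc k * C * D" if "x \<in> S" for x
 proof -
  have "norm (f x * g x) \<le> C * D"
   using Suc.prems that assms(6) by (intro order_trans[OF norm_mult_ineq] mult_mono) auto
  also have "... \<le> 2 ^ Suc k * (C * D)"
   using mult_right_mono[of 1 "2 ^ Suc k" "C * D"] assms(6,7) one_le_power[of "2::real" "Suc k"] by simp
  finally show ?thesis by (simp add: mult.assoc)
 qed
 ultimately show ?case by (simp only: derivs_le.simps) blast
qed

lemma pd_scale:
 assumes "f differentiable at (c *\<^sub>R x)"
 shows "pd a (\<lambda>x. f (c *\<^sub>R x)) x = c *\<^sub>R pd a f (c *\<^sub>R x)" "(\<lambda>x. f (c *\<^sub>R x)) differentiable at x"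
proof -
 obtain f' where f': "(f has_derivative f') (at (c *\<^sub>R x))" using assms by (auto simp: differentiable_def)
 have "((\<lambda>x. c *\<^sub>R x) has_derivative (\<lambda>h. c *\<^sub>R h)) (at x)" by (auto intro!: derivative_eq_intros)
 from has_derivative_compose[OF this f'] have D: "((\<lambda>x. f (c *\<^sub>R x)) has_derivative (\<lambda>h. f' (c *\<^sub>R h))) (at x)" .
 then show "(\<lambda>x. f (c *\<^sub>R x)) differentiable at x" by (auto simp: differentiable_def)
 show "pd a (\<lambda>x. f (c *\<^sub>R x)) x = c *\<^sub>R pd a f (c *\<^sub>R x)"
  using pd_eqI[OF D] pd_eqI[OF f'] linear_cmul[OF has_derivative_linear[OF f']] by simp
qed

lemma smooth_scale:
 assumes "open S" "smooth_on T f" "!!x. x \<in> S ==> c *\<^sub>R x \<in> T"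
 shows "smooth_on S (\<lambda>x. f (c *\<^sub>R x))"
 by (rule smooth_compose[OF assms(1,2)]) (use assms in \<open>auto intro!: smooth_scaleR\<close>)

lemma derivs_le_scaleR:
 assumes "open S" "Ck_on k S f" "derivs_le k C S f"
 shows "derivs_le k (\<bar>c\<bar> * C) S (\<lambda>x. c *\<^sub>R f x)"
 using assms(2,3)
proof (induction k arbitrary: f)
 case (Suc k)
 have "derivs_le k (\<bar>c\<bar> * C) S (pd a (\<lambda>x. c *\<^sub>R f x))" for a
 proof (rule derivs_le_cong[OF assms(1)])
  show "derivs_le k (\<bar>c\<bar> * C) S (\<lambda>x. c *\<^sub>R pd a f x)" using Suc by auto
 qed (use Suc.prems in \<open>auto simp: pd_linear[OF bounded_linear_scaleR_right]\<close>)
 then show ?case using Suc.prems by (auto intro!: mult_left_mono)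
qed (auto intro!: mult_left_mono)

lemma derivs_le_scale:
 assumes "open S" "smooth_on T f" "!!x. x \<in> S ==> c *\<^sub>R x \<in> T" "derivs_le k C T f" "\<bar>c\<bar> \<le> 1" "0 \<le> C"
 shows "derivs_le k C S (\<lambda>x. f (c *\<^sub>R x))"
 using assms(2,4)
proof (induction k arbitrary: f)
 case (Suc k)
 have "derivs_le k C S (pd a (\<lambda>x. f (c *\<^sub>R x)))" for a
 proof (rule derivs_le_cong[OF assms(1)])
  have "derivs_le k (\<bar>c\<bar> * C) S (\<lambda>x. c *\<^sub>R pd a f (c *\<^sub>R x))"
   using Suc by (intro derivs_le_scaleR[OF assms(1)] smooth_Ck smooth_scale[OF assms(1) _ assms(3)] smooth_pd Suc.IH) auto
  then show "derivs_le k C S (\<lambda>x. c *\<^sub>R pd a f (c *\<^sub>R x))"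
   by (rule derivs_le_mono) (use assms(5,6) in \<open>auto intro: mult_left_le_one_le\<close>)
 qed (use Suc.prems assms(3) in \<open>auto simp: pd_scale smoothD\<close>)
 then show ?case using Suc.prems assms(3) by auto
qed (use assms(3) in auto)

lemma derivs_le_compact:
 fixes f :: "real ^ 'n => 'b::real_normed_vector"
 assumes "smooth_on T f" "compact K" "K \<subseteq> T"
 obtains C where "0 \<le> C" "derivs_le k C K f"
proof -
 have "\<exists>C\<ge>0. derivs_le k C K f"
  using assms(1)
 proof (induction k arbitrary: f)
  case (0 f)
  then have "compact (f ` K)"
   using assms by (intro compact_continuous_image continuous_on_subset[OF smoothC]) auto
  then obtain C where "C > 0" "\<forall>y\<in>f ` K. norm y \<le> C" using compact_imp_bounded bounded_pos by blast
  then show ?case by (intro exI[of _ C]) auto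
 next
  case (Suc k)
  obtain C0 where C0: "C0 \<ge> 0" "derivs_le k C0 K f" using Suc by blast
  have "\<forall>a. \<exists>C\<ge>0. derivs_le k C K (pd a f)" using Suc by (auto intro: smooth_pd)
  then obtain C where C: "!!a. C a \<ge> 0" "!!a. derivs_le k (C a) K (pd a f)" by metis
  define D where "D = C0 + sum C UNIV"
  have D: "D \<ge> C0" "!!a. D \<ge> C a" "D \<ge> 0"
   using C(1) C0(1) by (auto simp: D_def sum_nonneg intro!: add_increasing member_le_sum)
  have "derivs_le (Suc k) D K f"
   using D C(2) C0(2) derivs_le_norm[OF C0(2)] derivs_le_mono[OF C(2)] by fastforce
  then show ?case using D(3) by blast
 qed
 then show ?thesis using that by blast
qed

text \<open>Each derivative of positive order gains at least one factor \<open>eps\<close> under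
  dilation, and the value itself is small by continuity because G 0 = 0. The radius 7 is that of the
  ball containing the period box.\<close>

lemma small_after_scaling:
 fixes G :: "real ^ 'n => 'b::real_normed_vector"
 assumes G: "smooth_on (ball 0 R) G" "R > 0" "G 0 = 0" and delta: "delta > 0"
 obtains eps where "0 < eps" "7 * eps < R" "derivs_le k delta (ball 0 7) (\<lambda>x. G (eps *\<^sub>R x))"
proof -
 have K: "compact (cball (0 :: real ^ 'n) (R / 2))" "cball (0 :: real ^ 'n) (R / 2) \<subseteq> ball 0 R" using assms(2) by auto
 obtain C where C: "0 \<le> C" "derivs_le (Suc k) C (cball 0 (R / 2)) G"
  using derivs_le_compact[OF G(1) K] by blast
 have "isCont G 0"
  using smoothC[OF G(1)] G(2) by (simp add: continuous_on_eq_continuous_at)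
 then obtain eta where eta: "eta > 0" "!!x. norm x < eta ==> norm (G x) < delta"
  using delta G(3) unfolding continuous_at_eps_delta by (auto simp: dist_norm)
 \<comment> \<open>The terms ensure, besides eps \<le> 1, that 7 eps < R / 2, that 7 eps < eta, and
   that eps * C \<le> delta.\<close>
 define eps where "eps = min (min 1 (R / 15)) (min (eta / 8) (delta / (C + 1)))"
 have eps: "0 < eps" "eps \<le> 1" "7 * eps < R / 2" "7 * eps < eta" "eps * C \<le> delta"
 proof -
  show "0 < eps" using assms eta C by (simp add: eps_def)
  have 1: "eps \<le> 1" "eps \<le> R / 15" "eps \<le> eta / 8" "eps \<le> delta / (C + 1)"
   unfolding eps_def by (meson min.cobounded1 min.cobounded2 order_trans)+
  then show "eps \<le> 1" "7 * eps < R / 2" "7 * eps < eta" using eta assms by auto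
  have "eps * C \<le> delta / (C + 1) * C" using 1 C by (intro mult_right_mono) auto
  also have "... \<le> delta" using C delta by (simp add: field_simps)
  finally show "eps * C \<le> delta" .
 qed
 have le: "norm (eps *\<^sub>R x) < 7 * eps" if "x \<in> ball 0 7" for x :: "real ^ 'n"
  using that eps(1) by (simp add: mult.commute)
 then have mem: "eps *\<^sub>R x \<in> ball 0 (R / 2)" if "x \<in> ball 0 7" for x :: "real ^ 'n"
  using eps(3) that by fastforce
 have sub: "ball (0 :: real ^ 'n) (R / 2) \<subseteq> ball 0 R" "ball (0 :: real ^ 'n) (R / 2) \<subseteq> cball 0 (R / 2)" using G(2) by auto
 have norm: "norm (G (eps *\<^sub>R x)) \<le> delta" if "x \<in> ball 0 7" for x
  using eta(2)[of "eps *\<^sub>R x"] le[OF that] eps(4) by linarith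
 have "derivs_le k delta (ball 0 7) (\<lambda>x. G (eps *\<^sub>R x))"
 proof (cases k)
  case (Suc l)
  have "derivs_le l delta (ball 0 7) (pd a (\<lambda>x. G (eps *\<^sub>R x)))" for a
  proof (rule derivs_le_cong)
   have sm: "smooth_on (ball 0 (R / 2)) (pd a G)" by (rule smooth_subset[OF smooth_pd[OF G(1)] sub(1)])
   have "derivs_le (Suc l) C (cball 0 (R / 2)) (pd a G)" using C(2) by (simp add: Suc)
   then have "derivs_le l C (ball 0 (R / 2)) (pd a G)"
    using derivs_le_mono[OF derivs_le_SucD order_refl sub(2)] by blast
   then have "derivs_le l C (ball 0 7) (\<lambda>x. pd a G (eps *\<^sub>R x))"
    using eps C by (intro derivs_le_scale[OF open_ball sm mem]) auto
   then have "derivs_le l (\<bar>eps\<bar> * C) (ball 0 7) (\<lambda>x. eps *\<^sub>R pd a G (eps *\<^sub>R x))"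
    by (intro derivs_le_scaleR open_ball smooth_Ck smooth_scale[OF open_ball sm mem])
   then show "derivs_le l delta (ball 0 7) (\<lambda>x. eps *\<^sub>R pd a G (eps *\<^sub>R x))"
    by (rule derivs_le_mono) (use eps in auto)
  next
   fix x :: "real ^ 'n" assume "x \<in> ball 0 7"
   then have "G differentiable at (eps *\<^sub>R x)" using mem sub(1) smoothD[OF G(1)] by blast
   then show "eps *\<^sub>R pd a G (eps *\<^sub>R x) = pd a (\<lambda>x. G (eps *\<^sub>R x)) x" by (simp add: pd_scale)
  qed auto
  then show ?thesis using norm Suc by auto
 qed (use norm in auto)
 then show ?thesis using that[of eps] eps G(2) by auto
qed

lemma derivs_bounded_one_minus_pd2:
 assumes "open S" "smooth_on S F" "derivs_le (Suc (Suc k)) C S F"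
 shows "derivs_le k (2 * C) S (one_minus_pd2 c F)"
proof -
 have "derivs_le k C S F" by (rule derivs_le_SucD[OF derivs_le_SucD[OF assms(3)]])
 moreover have "derivs_le k C S (pd c (pd c F))" using assms(3) by simp
 ultimately have "derivs_le k (C + C) S (\<lambda>x. F x - pd c (pd c F) x)"
  by (intro derivs_le_diff assms smooth_Ck smooth_pd)
 then show ?thesis by (simp add: one_minus_pd2_def[abs_def])
qed

text \<open>The segment from x to y moves only in directions outside \<open>K\<close>, where the
  derivative vanishes; convexity keeps it inside \<open>S\<close>.\<close>

lemma eq_if_pd_zero:
 fixes f :: "real ^ 'n => 'b::real_normed_vector"
 assumes "convex S" "!!x. x \<in> S ==> f differentiable at x"
  and "!!x d. x \<in> S ==> d \<notin> K ==> pd d f x = 0"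
  and xy: "x \<in> S" "y \<in> S" "!!i. i \<in> K ==> x $ i = y $ i"
 shows "f x = f y"
proof -
 let ?gamma = "\<lambda>t. x + t *\<^sub>R (y - x)"
 have mem: "?gamma t \<in> S" if "t \<in> {0..1}" for t
  using convexD_alt[OF assms(1) xy(1,2), of t] that by (simp add: algebra_simps)
 have "((\<lambda>t. f (?gamma t)) has_derivative (\<lambda>h. 0)) (at t within {0..1})" if "t \<in> {0..1}" for t
 proof -
  have "(?gamma has_derivative (\<lambda>h. h *\<^sub>R (y - x))) (at t within {0..1})" by (auto intro!: derivative_eq_intros)
  from has_derivative_compose[OF this has_derivative_pd[OF assms(2)[OF mem[OF that]]]]
  have "((\<lambda>t. f (?gamma t)) has_derivative (\<lambda>h. \<Sum>a\<in>UNIV. (h *\<^sub>R (y - x)) $ a *\<^sub>R pd a f (?gamma t))) (at t within {0..1})" .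
  moreover have "(h *\<^sub>R (y - x)) $ a *\<^sub>R pd a f (?gamma t) = 0" for h a
   using assms(3)[OF mem[OF that], of a] xy(3)[of a] by (cases "a \<in> K") auto
  ultimately show ?thesis by (simp only:) simp
 qed
 then have "f (?gamma 0) = f (?gamma 1)"
  using has_derivative_zero_unique[of "{0..1::real}" "\<lambda>t. f (?gamma t)" 0 1] by simp
 then show ?thesis by simp
qed

text \<open>After a dilation m - m 0 is small with its derivatives up to order four, and multiplied
  by a cutoff it has a Fourier series with small coefficient sum. On the unit ball the cutoff is 1,
  so there the periodic equation is the given one; undoing the dilation gives the solution.\<close>

theorem local_beltrami:
 fixes m :: "real ^ 'n => complex"
 assumes ab: "a \<noteq> b" and m: "smooth_on (ball 0 R) m" "R > 0" "Im (m 0) \<noteq> 0"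
  and m0: "!!x d. x \<in> ball 0 R ==> d \<noteq> a ==> d \<noteq> b ==> pd d m x = 0"
 obtains r Z where "0 < r" "r \<le> R" "smooth_on (ball 0 r) Z"
  "!!x d. x \<in> ball 0 r ==> d \<noteq> a ==> d \<noteq> b ==> pd d Z x = 0"
  "!!x. x \<in> ball 0 r ==> pd b Z x = m x * pd a Z x"
  "!!x. x \<in> ball 0 r ==> pd a Z x \<noteq> 0"
proof -
 define X where "X x = complex_of_real (cutoff (x $ a)) * complex_of_real (cutoff (x $ b))" for x :: "real ^ 'n"
 have X: "smooth_on UNIV X" unfolding X_def by (intro smooth_mult smooth_of_real smooth_cutoff) auto
 obtain CX where CX: "0 \<le> CX" "derivs_le 4 CX (cball 0 7) X"
  by (rule derivs_le_compact[OF X, of "cball 0 7" 4]) auto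
 then have CX': "derivs_le 4 CX (ball 0 7) X" by (auto intro: derivs_le_mono)
 define S0 where "S0 = infsum (\<lambda>kl. 1 / int2_weight kl) UNIV"
 have S0: "S0 \<ge> 0" unfolding S0_def using int2_weight_ge_1 by (intro infsum_nonneg) (auto intro: order_trans[OF zero_le_one])
 define G where "G x = m x - m 0" for x
 have G: "smooth_on (ball 0 R) G" "G 0 = 0" unfolding G_def using m(1) by (auto intro!: smooth_diff)
 \<comment> \<open>512 = 64 * 8: the Leibniz rule at order four gives 16, the two operators 1 - d^2
   give 2 each, and 8 is the smallness demanded by the Neumann series.\<close>
 define delta where "delta = \<bar>Im (m 0)\<bar> / (512 * (CX * S0 + 1))"
 have pos: "CX * S0 + 1 > 0" using CX(1) S0 by (simp add: add_nonneg_pos)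
 have delta: "delta > 0" using m(3) pos by (simp add: delta_def)
 obtain eps where eps: "0 < eps" "7 * eps < R" "derivs_le 4 delta (ball 0 7) (\<lambda>x. G (eps *\<^sub>R x))"
  using small_after_scaling[OF G(1) m(2) G(2) delta] by blast
 have mem: "eps *\<^sub>R x \<in> ball 0 R" if "x \<in> ball 0 7" for x :: "real ^ 'n"
 proof -
  have "norm (eps *\<^sub>R x) \<le> eps * 7" using that eps(1) by (simp add: mult_left_mono)
  then show ?thesis using eps(2) by simp
 qed
 define F where "F x = X x * G (eps *\<^sub>R x)" for x
 have smG: "smooth_on (ball 0 7) (\<lambda>x. G (eps *\<^sub>R x))" by (rule smooth_scale[OF open_ball G(1) mem])
 have smX: "smooth_on (ball 0 7) X" by (rule smooth_subset[OF X]) simp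
 have smF: "smooth_on (ball 0 7) F" unfolding F_def by (intro smooth_mult smG smX open_ball)
 have F: "supp_box a b F"
  using smF by (auto simp: supp_box_def F_def X_def cutoff_eq_0)
 have bF: "derivs_le (Suc (Suc (Suc (Suc 0)))) (2 ^ 4 * CX * delta) (ball 0 7) F"
  using derivs_le_mult[OF open_ball smooth_Ck[OF smX] smooth_Ck[OF smG] CX' eps(3) CX(1)] delta
  by (simp add: F_def[abs_def] eval_nat_numeral)
 have smF2: "smooth_on (ball 0 7) (one_minus_pd2 b F)"
  unfolding one_minus_pd2_def by (intro smooth_diff smooth_pd smF open_ball)
 have "derivs_le 0 (2 * (2 * (2 ^ 4 * CX * delta))) (ball 0 7) (one_minus_pd2 a (one_minus_pd2 b F))"
  by (intro derivs_bounded_one_minus_pd2 open_ball smF smF2 bF)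
 moreover have "cball (0 :: real ^ 'n) (2 * pi) \<subseteq> ball 0 7" using pi_approx by auto
 ultimately have "!!x. x \<in> cball 0 (2 * pi) ==> norm (one_minus_pd2 a (one_minus_pd2 b F) x) \<le> 2 * (2 * (2 ^ 4 * CX * delta))"
  by auto
 from fourier2_infsum_le[OF ab F this]
 have "infsum (\<lambda>kl. norm (fourier2 a b F kl)) UNIV \<le> 64 * (CX * S0) * delta" by (simp add: S0_def mult_ac)
 also have "... \<le> 64 * (CX * S0 + 1) * delta" using delta by (intro mult_right_mono) auto
 also have "... = \<bar>Im (m 0)\<bar> / 8" using pos by (simp add: delta_def field_simps)
 finally have small: "infsum (\<lambda>kl. norm (fourier2 a b F kl)) UNIV \<le> \<bar>Im (m 0)\<bar> / 8" .
 have rapid: "rapid_summable (\<lambda>k. of_int (fst k)) (\<lambda>k. of_int (snd k)) (fourier2 a b F)"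
  unfolding rapid_summable_def using fourier2_summable[OF ab F] by blast
 obtain Z where Z: "smooth_on UNIV Z" "!!x d. d \<noteq> a ==> d \<noteq> b ==> pd d Z x = 0"
  "!!x. pd b Z x = (m 0 + trig_series a b (\<lambda>k. of_int (fst k)) (\<lambda>k. of_int (snd k)) (fourier2 a b F) x) * pd a Z x"
  "!!x. pd a Z x \<noteq> 0"
  using constant_beltrami_perturbation[OF ab m(3) rapid small] by blast
 have M: "m 0 + trig_series a b (\<lambda>k. of_int (fst k)) (\<lambda>k. of_int (snd k)) (fourier2 a b F) x = m (eps *\<^sub>R x)"
  if x: "x \<in> ball 0 1" for x
 proof -
  let ?p = "plane_pt a b (x $ a) (x $ b)"
  have le1: "\<bar>x $ a\<bar> \<le> 1" "\<bar>x $ b\<bar> \<le> 1"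
   using x component_le_norm_cart[of x a] component_le_norm_cart[of x b] by auto
  then have "\<bar>x $ a\<bar> < pi" "\<bar>x $ b\<bar> < pi" using pi_gt3 by auto
  from infsumI[OF fourier_expansion2[OF ab F this]]
  have "trig_series a b (\<lambda>k. of_int (fst k)) (\<lambda>k. of_int (snd k)) (fourier2 a b F) x = F ?p"
   by (simp add: trig_series_def)
  also have "... = m (eps *\<^sub>R ?p) - m 0"
   using le1 ab by (simp add: F_def X_def G_def plane_pt_def axis_def cutoff_eq_1)
  \<comment> \<open>The expansion holds on the plane only; \<open>m\<close> does not depend on the
    other coordinates, so the point may be replaced by its projection.\<close>
  also have "m (eps *\<^sub>R ?p) = m (eps *\<^sub>R x)"
  proof (rule eq_if_pd_zero[of "ball 0 R" m "{a, b}"])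
   have "norm ?p \<le> 1 + 1"
    unfolding plane_pt_def using le1 by (intro norm_triangle_le add_mono) (auto simp: norm_axis_gen)
   then show "eps *\<^sub>R ?p \<in> ball 0 R" by (intro mem) auto
   show "eps *\<^sub>R x \<in> ball 0 R" using x by (intro mem) auto
  qed (use m0 smoothD[OF m(1)] ab in \<open>auto simp: plane_pt_def axis_def\<close>)
  finally show ?thesis by simp
 qed
 define Y where "Y x = Z ((1 / eps) *\<^sub>R x)" for x
 have "pd d Y x = (1 / eps) *\<^sub>R pd d Z ((1 / eps) *\<^sub>R x)" for d x
  unfolding Y_def by (rule pd_scale) (rule smoothD[OF Z(1)], simp)
 moreover have "smooth_on (ball 0 eps) Y" unfolding Y_def by (rule smooth_scale[OF open_ball Z(1)]) simp
 moreover have "(1 / eps) *\<^sub>R x \<in> ball 0 1" if "x \<in> ball 0 eps" for x :: "real ^ 'n"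
  using that eps(1) by (simp add: field_simps)
 moreover have "eps *\<^sub>R (1 / eps) *\<^sub>R x = x" for x :: "real ^ 'n" using eps(1) by simp
 ultimately show ?thesis
  using eps by (intro that[of eps Y]) (auto simp: Z M scaleR_conv_of_real)
qed

section \<open>Integral equations along rays\<close>

text \<open>Coordinates in \<open>K\<close> label the leaves and stay fixed; the others run along a
  leaf and are contracted to 0. One integral thus treats all leaves, with smooth dependence on the
  label.\<close>

definition ray :: "'n::finite set => real => real ^ 'n => real ^ 'n"
 where "ray K t x = (\<chi> i. if i \<in> K then x $ i else t * x $ i)"

text \<open>The power of t that differentiation in direction c brings out of a function evaluated on
  the ray.\<close>

definition ray_wt :: "'n::finite set => 'n => nat"
 where "ray_wt K c = (if c \<in> K then 0 else 1)"

definition ray_int :: "'n::finite set => nat => (real ^ 'n => real) => real ^ 'n => real"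
 where "ray_int K j f x = integral {0..1} (\<lambda>t. t ^ j * f (ray K t x))"

lemma ray_nth: "ray K t x $ i = t ^ ray_wt K i * x $ i"
 by (simp add: ray_def ray_wt_def)

lemma norm_ray_le: "t \<in> {0..1} ==> norm (ray K t x) \<le> norm x"
 by (rule norm_le_componentwise_cart) (auto simp: ray_def abs_mult mult_left_le_one_le)

lemma ray_in_ball: "t \<in> {0..1} ==> x \<in> ball 0 rho ==> ray K t x \<in> ball 0 rho"
 using norm_ray_le[of t K x] by simp

lemma ray_in_cball: "t \<in> {0..1} ==> x \<in> cball 0 rho ==> ray K t x \<in> cball 0 rho"
 using norm_ray_le[of t K x] by simp

lemma continuous_on_ray [continuous_intros]:
 "continuous_on A f ==> continuous_on A g ==> continuous_on A (\<lambda>z. ray K (f z) (g z))"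
 unfolding ray_def
proof (rule continuous_on_vec_lambda)
 fix i assume "continuous_on A f" "continuous_on A g"
 then show "continuous_on A (\<lambda>z. if i \<in> K then g z $ i else f z * g z $ i)"
  by (cases "i \<in> K") (auto intro!: continuous_intros)
qed

lemma ray_1 [simp]: "ray K 1 x = x"
 by (simp add: vec_eq_iff ray_def)

lemma has_derivative_ray: "((\<lambda>x. ray K t x) has_derivative (\<lambda>h. ray K t h)) (at x within A)"
proof -
 have "linear (ray K t)" by (rule linearI) (auto simp: vec_eq_iff ray_def algebra_simps)
 then show ?thesis by (simp add: linear_linear bounded_linear_imp_has_derivative)
qed

context
 fixes K :: "'n::finite set" and rho :: real
begin

lemma continuous_on_ray_integrand:
 assumes "continuous_on (ball 0 rho) f" "x \<in> ball 0 rho"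
 shows "continuous_on {0..1} (\<lambda>t. t ^ j * f (ray K t x))"
 by (intro continuous_intros continuous_on_compose2[OF assms(1)]) (use ray_in_ball assms(2) in blast)

lemma ray_integrable:
 assumes "continuous_on (ball 0 rho) f" "x \<in> ball 0 rho"
 shows "(\<lambda>t. t ^ j * f (ray K t x)) integrable_on {0..1}"
 by (intro integrable_continuous_real continuous_on_ray_integrand assms)

lemma continuous_on_ray_int:
 assumes "continuous_on (ball 0 rho) f"
 shows "continuous_on (ball 0 rho) (ray_int K j f)"
proof -
 have "continuous_on (ball 0 rho \<times> cbox 0 1) (\<lambda>z. f (ray K (snd z) (fst z)))"
  by (rule continuous_on_compose2[OF assms]) (use ray_in_ball in \<open>force intro!: continuous_intros\<close>)+
 then have "continuous_on (ball 0 rho) (\<lambda>x. integral (cbox 0 1) (\<lambda>t. t ^ j * f (ray K t x)))"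
  by (intro integral_continuous_on_param) (auto simp: case_prod_unfold intro!: continuous_intros)
 then show ?thesis by (simp add: ray_int_def[abs_def])
qed

lemma ray_int_bound:
 assumes "continuous_on (ball 0 rho) f" "x \<in> ball 0 rho" "!!t. t \<in> {0..1} ==> \<bar>f (ray K t x)\<bar> \<le> M"
 shows "\<bar>ray_int K j f x\<bar> \<le> M"
proof -
 have "norm (integral {0..1} (\<lambda>t. t ^ j * f (ray K t x))) \<le> M * (1 - 0)"
 proof (rule integral_bound)
  show "norm (t ^ j * f (ray K t x)) \<le> M" if "t \<in> {0..1}" for t
  proof -
   have "\<bar>t ^ j\<bar> * \<bar>f (ray K t x)\<bar> \<le> 1 * M"
    using that assms(3)[OF that] by (intro mult_mono) (auto simp: power_le_one)
   then show ?thesis by (simp add: abs_mult)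
  qed
 qed (use continuous_on_ray_integrand[OF assms(1,2)] in auto)
 then show ?thesis by (simp add: ray_int_def)
qed

lemma ray_int_diff:
 assumes "continuous_on (ball 0 rho) f" "continuous_on (ball 0 rho) g" "x \<in> ball 0 rho"
 shows "ray_int K j (\<lambda>x. f x - g x) x = ray_int K j f x - ray_int K j g x"
 unfolding ray_int_def right_diff_distrib
 by (intro integral_diff ray_integrable assms)

lemma ray_int_add:
 assumes "continuous_on (ball 0 rho) f" "continuous_on (ball 0 rho) g" "x \<in> ball 0 rho"
 shows "ray_int K j (\<lambda>x. f x + g x) x = ray_int K j f x + ray_int K j g x"
 unfolding ray_int_def distrib_left
 by (intro integral_add ray_integrable assms)

lemma ray_int_cong:
 assumes "!!y. y \<in> ball 0 rho ==> f y = g y" "x \<in> ball 0 rho"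
 shows "ray_int K j f x = ray_int K j g x"
 unfolding ray_int_def
 by (rule integral_cong) (simp only: assms(1)[OF ray_in_ball[OF _ assms(2)]])

text \<open>Differentiation under the integral only raises the power of t, so the integrals with
  weights t^j form a family closed under \<open>pd\<close>.\<close>

lemma pd_ray_int:
 assumes f: "!!x. x \<in> ball 0 rho ==> f differentiable at x" "!!c. continuous_on (ball 0 rho) (pd c f)"
  and x: "x \<in> ball 0 rho"
 shows "ray_int K j f differentiable at x"
  "pd c (ray_int K j f) x = ray_int K (j + ray_wt K c) (pd c f) x"
proof -
 have cf: "continuous_on (ball 0 rho) f"
  using f(1) by (auto intro!: continuous_at_imp_continuous_on differentiable_imp_continuous_within)
 define e where "e c = Blinfun (\<lambda>h :: real ^ 'n. h $ c)" for c
 have e [simp]: "blinfun_apply (e c) h = h $ c" for c h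
  unfolding e_def by (subst bounded_linear_Blinfun_apply) (auto intro: bounded_linear_vec_nth)
 define D where "D y t = (\<Sum>c\<in>UNIV. (t ^ (j + ray_wt K c) * pd c f (ray K t y)) *\<^sub>R e c)" for y t
 have "((\<lambda>y. integral (cbox 0 1) (\<lambda>t. t ^ j * f (ray K t y))) has_derivative integral (cbox 0 1) (D x)) (at x within ball 0 rho)"
 proof (rule leibniz_rule)
  fix y :: "real ^ 'n" and t assume yt: "y \<in> ball 0 rho" "t \<in> cbox (0::real) 1"
  have ry: "ray K t y \<in> ball 0 rho" using yt by (intro ray_in_ball) auto
  have "((\<lambda>y. t ^ j * f (ray K t y)) has_derivative (\<lambda>h. t ^ j * (\<Sum>c\<in>UNIV. ray K t h $ c *\<^sub>R pd c f (ray K t y)))) (at y within ball 0 rho)"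
   by (intro has_derivative_mult_right has_derivative_compose[OF has_derivative_ray has_derivative_pd] f ry)
  moreover have "(\<lambda>h. t ^ j * (\<Sum>c\<in>UNIV. ray K t h $ c *\<^sub>R pd c f (ray K t y))) = blinfun_apply (D y t)"
   by (auto simp: fun_eq_iff D_def blinfun.sum_left blinfun.scaleR_left ray_nth sum_distrib_left power_add mult_ac intro!: sum.cong)
  ultimately show "((\<lambda>y. t ^ j * f (ray K t y)) has_derivative blinfun_apply (D y t)) (at y within ball 0 rho)" by simp
 next
  show "(\<lambda>t. t ^ j * f (ray K t y)) integrable_on cbox 0 1" if "y \<in> ball 0 rho" for y
   using ray_integrable[OF cf that] by simp
 next
  have "continuous_on (ball 0 rho \<times> cbox 0 1) (\<lambda>z. pd c f (ray K (snd z) (fst z)))" for c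
   by (rule continuous_on_compose2[OF f(2)]) (use ray_in_ball in \<open>force intro!: continuous_intros\<close>)+
  then show "continuous_on (ball 0 rho \<times> cbox 0 1) (\<lambda>(y, t). D y t)"
   unfolding D_def case_prod_unfold by (intro continuous_intros)
 qed (use x in auto)
 then have der: "(ray_int K j f has_derivative blinfun_apply (integral {0..1} (D x))) (at x)"
  using at_within_open[OF x open_ball] by (simp add: ray_int_def[abs_def])
 then show "ray_int K j f differentiable at x" by (auto simp: differentiable_def)
 have "continuous_on {0..1} (D x)"
  unfolding D_def by (intro continuous_intros continuous_on_compose2[OF f(2)]) (use ray_in_ball x in blast)
 then have "D x integrable_on {0..1}" by (rule integrable_continuous_real)
 from integral_linear[OF this blinfun.bounded_linear_left, of "axis c 1"]
 have "blinfun_apply (integral {0..1} (D x)) (axis c 1) = integral {0..1} (\<lambda>t. t ^ (j + ray_wt K c) * pd c f (ray K t x))"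
  by (simp add: o_def D_def blinfun.sum_left blinfun.scaleR_left axis_def if_distrib cong: if_cong)
 then show "pd c (ray_int K j f) x = ray_int K (j + ray_wt K c) (pd c f) x"
  using pd_eqI[OF der] by (simp add: ray_int_def)
qed

lemma Ck_ray_int:
 assumes "Ck_on k (ball 0 rho) f"
 shows "Ck_on k (ball 0 rho) (ray_int K j f)"
 using assms
proof (induction k arbitrary: f j)
 case 0
 then show ?case by (simp add: continuous_on_ray_int)
next
 case (Suc k)
 have f: "f differentiable at x" if "x \<in> ball 0 rho" for x using Suc.prems that by simp
 have pf: "continuous_on (ball 0 rho) (pd c f)" for c
  using Suc.prems Ck_imp_continuous[of k "ball 0 rho" "pd c f"] by simp
 have "Ck_on k (ball 0 rho) (pd c (ray_int K j f))" for c
 proof (rule Ck_cong[OF open_ball])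
  show "Ck_on k (ball 0 rho) (ray_int K (j + ray_wt K c) (pd c f))"
   using Suc by simp
 qed (rule pd_ray_int(2)[OF f pf, symmetric])
 then show ?case using pd_ray_int(1)[OF f pf] by simp
qed

text \<open>The linearized integral operator: the derivatives of a solution of the nonlinear ray
  equation are a fixed term plus \<open>ray_op\<close> applied to them.\<close>

definition ray_op :: "nat => ('n => 'n => 'n => real ^ 'n => real) => ('n => real ^ 'n => real) => 'n => real ^ 'n => real"
 where "ray_op j B y i x = (\<Sum>a\<in>UNIV. x $ a * ray_int K j (\<lambda>x. \<Sum>l\<in>UNIV. B i a l x * y l x) x)"

text \<open>There are n directions, each with |x_a| \<le> rho, and n summands bounded by b M. Small
  rho makes the operator a contraction.\<close>

lemma ray_op_bound:
 assumes B: "!!i a l. continuous_on (ball 0 rho) (B i a l)" and y: "!!l. continuous_on (ball 0 rho) (y l)"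
  and "!!i a l z. z \<in> cball 0 rho' ==> \<bar>B i a l z\<bar> \<le> b" "!!l z. z \<in> cball 0 rho' ==> \<bar>y l z\<bar> \<le> M"
  and "0 \<le> b" "0 \<le> M" "0 \<le> rho'" "rho' < rho" and x: "x \<in> cball 0 rho'"
 shows "\<bar>ray_op j B y i x\<bar> \<le> (real CARD('n))\<^sup>2 * rho * b * M"
proof -
 have x': "x \<in> ball 0 rho" using assms by auto
 have c: "continuous_on (ball 0 rho) (\<lambda>x. \<Sum>l\<in>UNIV. B i a l x * y l x)" for a
  by (intro continuous_intros B y)
 have bd: "\<bar>\<Sum>l\<in>UNIV. B i a l z * y l z\<bar> \<le> real CARD('n) * (b * M)" if "z \<in> cball 0 rho'" for z a
 proof -
  have "\<bar>\<Sum>l\<in>UNIV. B i a l z * y l z\<bar> \<le> (\<Sum>l\<in>(UNIV :: 'n set). b * M)"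
   using assms that by (intro order_trans[OF sum_abs] sum_mono) (auto simp: abs_mult intro!: mult_mono)
  then show ?thesis by simp
 qed
 have "\<bar>ray_op j B y i x\<bar> \<le> (\<Sum>a\<in>(UNIV :: 'n set). rho * (real CARD('n) * (b * M)))"
  unfolding ray_op_def
 proof (intro order_trans[OF sum_abs] sum_mono)
  fix a
  have "\<bar>x $ a\<bar> \<le> rho" using component_le_norm_cart[of x a] x' by auto
  moreover have "\<bar>ray_int K j (\<lambda>x. \<Sum>l\<in>UNIV. B i a l x * y l x) x\<bar> \<le> real CARD('n) * (b * M)"
   using ray_in_cball[OF _ x] by (intro ray_int_bound[OF c x'] bd) auto
  ultimately show "\<bar>x $ a * ray_int K j (\<lambda>x. \<Sum>l\<in>UNIV. B i a l x * y l x) x\<bar> \<le> rho * (real CARD('n) * (b * M))"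
   unfolding abs_mult using assms by (intro mult_mono) auto
 qed
 then show ?thesis by (simp add: power2_eq_square mult_ac)
qed

lemma Ck_ray_op:
 assumes "!!i a l. Ck_on k (ball 0 rho) (B i a l)" "!!l. Ck_on k (ball 0 rho) (y l)"
 shows "Ck_on k (ball 0 rho) (ray_op j B y i)"
 unfolding ray_op_def
 by (intro Ck_sum Ck_mult Ck_ray_int open_ball assms Ck_nth)

text \<open>The derivative of \<open>y\<close> enters through an operator with the same coefficients
  \<open>B\<close>; only the power of t has changed. Hence one contraction constant works at all
  orders of differentiation.\<close>

lemma pd_ray_op:
 assumes B: "!!i a l. Ck_on 1 (ball 0 rho) (B i a l)" and y: "!!l. Ck_on 1 (ball 0 rho) (y l)" and x: "x \<in> ball 0 rho"
 shows "pd c (ray_op j B y i) x = ray_int K j (\<lambda>x. \<Sum>l\<in>UNIV. B i c l x * y l x) x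
  + ray_op (j + ray_wt K c) (\<lambda>i a l. pd c (B i a l)) y i x + ray_op (j + ray_wt K c) B (\<lambda>l. pd c (y l)) i x"
proof -
 have d: "B i a l differentiable at z" "y l differentiable at z" if "z \<in> ball 0 rho" for i a l z
  using B[of i a l] y[of l] that by auto
 have cont: "continuous_on (ball 0 rho) (B i a l)" "continuous_on (ball 0 rho) (y l)"
  "continuous_on (ball 0 rho) (pd c (B i a l))" "continuous_on (ball 0 rho) (pd c (y l))" for i a l c
  using B[of i a l] y[of l] Ck_imp_continuous by (auto simp: Ck_imp_continuous[OF B] Ck_imp_continuous[OF y])
 let ?f = "\<lambda>a x. \<Sum>l\<in>UNIV. B i a l x * y l x"
 have pdf: "pd c (?f a) z = (\<Sum>l\<in>UNIV. pd c (B i a l) z * y l z) + (\<Sum>l\<in>UNIV. B i a l z * pd c (y l) z)"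
  if "z \<in> ball 0 rho" for a z c
  using d[OF that] by (subst pd_sum) (auto simp: pd_mult sum.distrib)
 have fC: "Ck_on 1 (ball 0 rho) (?f a)" for a by (intro Ck_sum Ck_mult open_ball B y)
 then have fd: "?f a differentiable at z" "continuous_on (ball 0 rho) (pd c (?f a))" if "z \<in> ball 0 rho" for a z c
  using that by auto
 have J: "ray_int K j (?f a) differentiable at x"
  "pd c (ray_int K j (?f a)) x = ray_int K (j + ray_wt K c) (\<lambda>x. \<Sum>l\<in>UNIV. pd c (B i a l) x * y l x) x
    + ray_int K (j + ray_wt K c) (\<lambda>x. \<Sum>l\<in>UNIV. B i a l x * pd c (y l) x) x" for a
 proof -
  show "ray_int K j (?f a) differentiable at x" using fd x by (intro pd_ray_int(1)) auto
  have "pd c (ray_int K j (?f a)) x = ray_int K (j + ray_wt K c) (pd c (?f a)) x"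
   using fd x by (intro pd_ray_int(2)) auto
  also have "... = ray_int K (j + ray_wt K c) (\<lambda>z. (\<Sum>l\<in>UNIV. pd c (B i a l) z * y l z) + (\<Sum>l\<in>UNIV. B i a l z * pd c (y l) z)) x"
   by (rule ray_int_cong) (use pdf x in auto)
  finally show "pd c (ray_int K j (?f a)) x = ray_int K (j + ray_wt K c) (\<lambda>x. \<Sum>l\<in>UNIV. pd c (B i a l) x * y l x) x
    + ray_int K (j + ray_wt K c) (\<lambda>x. \<Sum>l\<in>UNIV. B i a l x * pd c (y l) x) x"
   by (subst (asm) ray_int_add) (intro continuous_intros cont x)+
 qed
 have "pd c (ray_op j B y i) x = (\<Sum>a\<in>UNIV. x $ a * pd c (ray_int K j (?f a)) x + (if a = c then 1 else 0) * ray_int K j (?f a) x)"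
  unfolding ray_op_def[abs_def] using J(1) by (subst pd_sum) (auto simp: pd_mult)
 also have "... = ray_int K j (?f c) x + (\<Sum>a\<in>UNIV. x $ a * pd c (ray_int K j (?f a)) x)"
  by (simp add: sum.distrib if_distrib[of "\<lambda>z. z * _"] cong: if_cong)
 finally show ?thesis by (simp add: J(2) ray_op_def sum.distrib distrib_left)
qed

end

section \<open>Limits of sequences with bounded derivatives\<close>

lemma C1_limit:
 fixes f :: "nat => real ^ 'n => real"
 assumes f: "!!n. Ck_on 1 (ball 0 rho) (f n)" and lim: "!!x. x \<in> ball 0 rho ==> (\<lambda>n. f n x) \<longlonglongrightarrow> g x"
  and ca: "!!c rho'. 0 \<le> rho' ==> rho' < rho ==> uniformly_Cauchy_on (cball 0 rho') (\<lambda>n. pd c (f n))"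
 shows "Ck_on 1 (ball 0 rho) g" "!!c x. x \<in> ball 0 rho ==> (\<lambda>n. pd c (f n) x) \<longlonglongrightarrow> pd c g x"
proof -
 define h where "h c x = lim (\<lambda>n. pd c (f n) x)" for c x
 have ul: "uniform_limit (cball 0 rho') (\<lambda>n. pd c (f n)) (h c) sequentially" if "0 \<le> rho'" "rho' < rho" for c rho'
  using ca[OF that, of c] uniformly_convergent_eq_Cauchy[of "cball 0 rho'" "\<lambda>n. pd c (f n)"]
   uniformly_convergent_uniform_limit_iff[of "cball 0 rho'" "\<lambda>n. pd c (f n)"]
  by (simp add: h_def[abs_def])
 have key: "(g has_derivative (\<lambda>v. \<Sum>c\<in>UNIV. v $ c *\<^sub>R h c x)) (at x)" if x: "x \<in> ball 0 rho" for x
 proof -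
  have "norm x < rho" using x by simp
  then obtain rho' where rho'23: "norm x < rho'" "rho' < rho" using dense by blast
  have "0 \<le> rho'" by (rule less_imp_le[OF le_less_trans[OF norm_ge_zero rho'23(1)]])
  note rho' = this rho'23(2) rho'23(1)
  have sub: "ball 0 rho' \<subseteq> ball (0 :: real ^ 'n) rho" using rho' by auto
  have "\<exists>G. \<forall>y\<in>ball 0 rho'. (\<lambda>n. f n y) \<longlonglongrightarrow> G y \<and> (G has_derivative (\<lambda>v. \<Sum>c\<in>UNIV. v $ c *\<^sub>R h c y)) (at y within ball 0 rho')"
  proof (rule has_derivative_sequence[of "ball 0 rho'" f "\<lambda>n y v. \<Sum>c\<in>UNIV. v $ c *\<^sub>R pd c (f n) y" "\<lambda>y v. \<Sum>c\<in>UNIV. v $ c *\<^sub>R h c y" x "g x"])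
   show "(f n has_derivative (\<lambda>v. \<Sum>c\<in>UNIV. v $ c *\<^sub>R pd c (f n) y)) (at y within ball 0 rho')" if "y \<in> ball 0 rho'" for n y
   proof (rule has_derivative_at_withinI[OF has_derivative_pd])
    have "y \<in> ball 0 rho" using sub that by blast
    then show "f n differentiable at y" using f[of n] by simp
   qed
   fix e :: real assume e: "e > 0"
   define e' where "e' = e / real CARD('n)"
   have e': "e' > 0" using e by (simp add: e'_def)
   have "\<forall>\<^sub>F n in sequentially. \<forall>y\<in>cball 0 rho'. dist (pd c (f n) y) (h c y) < e'" for c
    using uniform_limitD[OF ul[OF rho'(1,2)] e'] .
   then have "\<forall>\<^sub>F n in sequentially. \<forall>c. \<forall>y\<in>cball 0 rho'. dist (pd c (f n) y) (h c y) < e'"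
    by (simp add: eventually_all_finite)
   then show "\<forall>\<^sub>F n in sequentially. \<forall>y\<in>ball 0 rho'. \<forall>v. norm ((\<Sum>c\<in>UNIV. v $ c *\<^sub>R pd c (f n) y) - (\<Sum>c\<in>UNIV. v $ c *\<^sub>R h c y)) \<le> e * norm v"
   proof eventually_elim
    case (elim n)
    show ?case
    proof (intro ballI allI)
     fix y v :: "real ^ 'n" assume y: "y \<in> ball 0 rho'"
     have "norm ((\<Sum>c\<in>UNIV. v $ c *\<^sub>R pd c (f n) y) - (\<Sum>c\<in>UNIV. v $ c *\<^sub>R h c y)) = \<bar>\<Sum>c\<in>UNIV. v $ c * (pd c (f n) y - h c y)\<bar>"
      by (simp add: sum_subtractf[symmetric] right_diff_distrib)
     also have "... \<le> (\<Sum>c\<in>(UNIV :: 'n set). norm v * e')"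
     proof (intro order_trans[OF sum_abs] sum_mono)
      fix c
      have "\<bar>pd c (f n) y - h c y\<bar> \<le> e'" using elim y by (simp add: dist_real_def less_imp_le)
      then show "\<bar>v $ c * (pd c (f n) y - h c y)\<bar> \<le> norm v * e'"
       unfolding abs_mult by (intro mult_mono component_le_norm_cart) auto
     qed
     also have "... = e * norm v" by (simp add: e'_def)
     finally show "norm ((\<Sum>c\<in>UNIV. v $ c *\<^sub>R pd c (f n) y) - (\<Sum>c\<in>UNIV. v $ c *\<^sub>R h c y)) \<le> e * norm v" .
    qed
   qed
  qed (use rho' lim[OF x] in auto)
  then obtain G where G: "!!y. y \<in> ball 0 rho' ==> (\<lambda>n. f n y) \<longlonglongrightarrow> G y"
   "!!y. y \<in> ball 0 rho' ==> (G has_derivative (\<lambda>v. \<Sum>c\<in>UNIV. v $ c *\<^sub>R h c y)) (at y within ball 0 rho')" by blast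
  have Gg: "G y = g y" if "y \<in> ball 0 rho'" for y
   using LIMSEQ_unique[OF G(1)[OF that] lim] sub that by blast
  have xin: "x \<in> ball 0 rho'" using rho' by simp
  have "(G has_derivative (\<lambda>v. \<Sum>c\<in>UNIV. v $ c *\<^sub>R h c x)) (at x)"
   using G(2)[OF xin] at_within_open[OF xin open_ball] by simp
  then show ?thesis by (rule has_derivative_transform_within_open[OF _ open_ball xin Gg])
 qed
 have pdg: "pd c g x = h c x" if "x \<in> ball 0 rho" for c x
  using pd_eqI[OF key[OF that]] by (simp add: axis_def if_distrib[of "\<lambda>y. y * _"] cong: if_cong)
 have inrho': "\<exists>rho'. 0 \<le> rho' \<and> rho' < rho \<and> x \<in> ball 0 rho'" if "x \<in> ball 0 rho" for x :: "real ^ 'n"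
 proof -
  have "norm x < rho" using that by simp
  then obtain rho' where "norm x < rho'" "rho' < rho" using dense by blast
  moreover from this(1) have "0 \<le> rho'" by (rule less_imp_le[OF le_less_trans[OF norm_ge_zero]])
  ultimately show ?thesis by (intro exI[of _ rho']) simp
 qed
 show "(\<lambda>n. pd c (f n) x) \<longlonglongrightarrow> pd c g x" if x: "x \<in> ball 0 rho" for c x
  using inrho'[OF x] tendsto_uniform_limitI[OF ul, of _ x c] by (auto simp: pdg[OF x])
 have "continuous_on (ball 0 rho) (h c)" for c
 proof (rule continuous_at_imp_continuous_on, rule ballI)
  fix x :: "real ^ 'n" assume "x \<in> ball 0 rho"
  then obtain rho' where rho': "0 \<le> rho'" "rho' < rho" "x \<in> ball 0 rho'" using inrho' by blast
  have "continuous_on (cball 0 rho') (pd c (f n))" for n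
   using f[of n] rho'(2) by (auto intro: continuous_on_subset)
  then have "continuous_on (cball 0 rho') (h c)"
   by (intro uniform_limit_theorem[OF _ ul[OF rho'(1,2)]]) auto
  then have "continuous_on (ball 0 rho') (h c)" by (rule continuous_on_subset) auto
  then show "isCont (h c) x" using rho'(3) by (simp add: continuous_on_eq_continuous_at)
 qed
 then have "continuous_on (ball 0 rho) (pd c g)" for c
  using pdg by (subst continuous_on_cong[OF refl, of _ _ "h c"]) auto
 moreover have "g differentiable at x" if "x \<in> ball 0 rho" for x
  using key[OF that] unfolding differentiable_def by blast
 ultimately show "Ck_on 1 (ball 0 rho) g" by simp
qed

text \<open>Landau's interpolation inequality: a difference quotient over length s is a derivative
  at an intermediate point and costs 2 e / s; carrying this derivative back to x costs M s.\<close>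

lemma derivative_interpolation:
 fixes f :: "real ^ 'n => real"
 assumes f: "smooth_on (ball 0 rho) f" and s: "0 < s" "norm x + s < rho"
  and e: "!!y. y \<in> ball 0 rho ==> \<bar>f y\<bar> \<le> e" and M: "!!y. y \<in> ball 0 rho ==> \<bar>pd c (pd c f) y\<bar> \<le> M"
 shows "\<bar>pd c f x\<bar> \<le> 2 * e / s + M * s"
proof -
 let ?g = "\<lambda>t. x + t *\<^sub>R axis c 1"
 have mem: "?g t \<in> ball 0 rho" if "0 \<le> t" "t \<le> s" for t
  using norm_triangle_ineq[of x "t *\<^sub>R axis c 1"] that s(2) by (simp add: norm_axis_gen)
 have der: "((\<lambda>t. h (?g t)) has_real_derivative pd c h (?g t)) (at t)" if "0 \<le> t" "t \<le> s" "smooth_on (ball 0 rho) h" for h t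
  using pd_along_axis[OF smoothD[OF that(3) mem[OF that(1,2)]], of UNIV]
  by (simp add: has_real_derivative_iff_has_vector_derivative)
 obtain t where t: "0 < t" "t < s" "f (?g s) - f (?g 0) = (s - 0) * pd c f (?g t)"
  using MVT2[OF s(1), of "\<lambda>t. f (?g t)" "\<lambda>t. pd c f (?g t)"] der f by blast
 obtain r where r: "0 < r" "r < t" "pd c f (?g t) - pd c f (?g 0) = (t - 0) * pd c (pd c f) (?g r)"
  using MVT2[OF t(1), of "\<lambda>t. pd c f (?g t)" "\<lambda>t. pd c (pd c f) (?g t)"] der[OF _ _ smooth_pd[OF f]] t(2) by force
 have M0: "M \<ge> 0" using M[OF mem[of 0]] s(1) by simp
 have "\<bar>(t - 0) * pd c (pd c f) (?g r)\<bar> \<le> s * M"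
  unfolding abs_mult using t r M0 by (intro mult_mono M mem) auto
 moreover have "s * \<bar>pd c f (?g t)\<bar> \<le> 2 * e"
  using t(3) e[OF mem[of s]] e[OF mem[of 0]] s(1) by (auto simp: abs_mult[symmetric] abs_le_iff)
 then have "\<bar>pd c f (?g t)\<bar> \<le> 2 * e / s" using s(1) by (simp add: field_simps)
 ultimately show ?thesis using r(3) by (simp add: mult.commute)
qed

context
 fixes f :: "nat => real ^ 'n => real" and g :: "real ^ 'n => real" and rho :: real
 assumes sm: "!!n. smooth_on (ball 0 rho) (f n)" and bd: "!!k. \<exists>C. \<forall>n. derivs_le k C (ball 0 rho) (f n)"
  and cauchy: "!!rho'. 0 \<le> rho' ==> rho' < rho ==> uniformly_Cauchy_on (cball 0 rho') f" and lim: "!!x. x \<in> ball 0 rho ==> (\<lambda>n. f n x) \<longlonglongrightarrow> g x"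
begin

text \<open>Interpolation for f m - f n: uniformly small values and bounded second derivatives force
  small first derivatives, at the price of a slightly smaller ball.\<close>

lemma pd_uniformly_Cauchy:
 assumes rho': "0 \<le> rho'" "rho' < rho"
 shows "uniformly_Cauchy_on (cball 0 rho') (\<lambda>n. pd c (f n))"
proof -
 obtain C0 where C0: "!!n. derivs_le 2 C0 (ball 0 rho) (f n)" using bd by blast
 define C where "C = \<bar>C0\<bar>"
 have C: "\<bar>pd c (pd c (f n)) x\<bar> \<le> C" if "x \<in> ball 0 rho" for n x
 proof -
  have "\<bar>pd c (pd c (f n)) x\<bar> \<le> C0" using C0[of n] that by (simp add: numeral_2_eq_2)
  then show ?thesis by (simp add: C_def)
 qed
 define r where "r = (rho' + rho) / 2"
 have r: "rho' < r" "r < rho" "0 \<le> r" using rho' by (auto simp: r_def)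
 have sub: "ball 0 r \<subseteq> (ball 0 rho :: (real ^ 'n) set)" using r(2) by auto
 show ?thesis
  unfolding uniformly_Cauchy_on_def
 proof (intro allI impI)
  fix e :: real assume e: "e > 0"
  \<comment> \<open>The second-derivative term 2 C s is at most e / 4; asking the values to differ
    by less than s e / 8 makes the other term e / 4 as well.\<close>
  define s where "s = min ((r - rho') / 2) (e / (8 * (C + 1)))"
  have s: "s > 0" using e r by (simp add: s_def C_def)
  have s2: "s \<le> (r - rho') / 2" "s \<le> e / (8 * (C + 1))" unfolding s_def by (rule min.cobounded1 min.cobounded2)+
  then have "s * (8 * (C + 1)) \<le> e" by (simp add: C_def field_simps)
  then have Cs: "2 * C * s \<le> e / 4" using s by (simp add: algebra_simps)
  have "s * e / 8 > 0" using s e by simp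
  then obtain M where M: "!!x m n. x \<in> cball 0 r ==> m \<ge> M ==> n \<ge> M ==> dist (f m x) (f n x) < s * e / 8"
   using cauchy[OF r(3,2)] unfolding uniformly_Cauchy_on_def by blast
  have "dist (pd c (f m) x) (pd c (f n) x) < e" if x: "x \<in> cball 0 rho'" and mn: "m \<ge> M" "n \<ge> M" for x m n
  proof -
   have d: "f n differentiable at y" "pd c (f n) differentiable at y" if "y \<in> ball 0 rho" for n y
    by (rule smoothD[OF sm that] smoothD[OF smooth_pd[OF sm] that])+
   have pdd: "pd c (\<lambda>x. f m x - f n x) y = pd c (f m) y - pd c (f n) y" if "y \<in> ball 0 rho" for y
    by (rule pd_diff[OF d(1)[OF that] d(1)[OF that]])
   have "\<bar>pd c (pd c (\<lambda>x. f m x - f n x)) y\<bar> \<le> 2 * C" if y: "y \<in> ball 0 r" for y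
   proof -
    have yr: "y \<in> ball 0 rho" using sub y by blast
    have "pd c (pd c (\<lambda>x. f m x - f n x)) y = pd c (\<lambda>y. pd c (f m) y - pd c (f n) y) y"
     by (rule pd_cong_open[OF open_ball yr pdd])
    then show ?thesis using C[OF yr, of m] C[OF yr, of n] d(2)[OF yr] by (simp add: pd_diff)
   qed
   moreover have "\<bar>f m y - f n y\<bar> \<le> s * e / 8" if "y \<in> ball 0 r" for y
    using M[of y m n] mn that by (simp add: dist_real_def)
   moreover have "norm x + s < r" using x s2(1) r(1) by simp
   ultimately have "\<bar>pd c (\<lambda>x. f m x - f n x) x\<bar> \<le> 2 * (s * e / 8) / s + 2 * C * s"
    by (intro derivative_interpolation[OF smooth_diff[OF open_ball smooth_subset[OF sm sub] smooth_subset[OF sm sub]] s]) auto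
   also have "... < e" using Cs s e by simp
   finally show ?thesis using pdd[of x] x rho' by (simp add: dist_real_def)
  qed
  then show "\<exists>M. \<forall>x\<in>cball 0 rho'. \<forall>m\<ge>M. \<forall>n\<ge>M. dist (pd c (f m) x) (pd c (f n) x) < e" by blast
 qed
qed

lemmas C1_limit' = C1_limit[of rho f g, OF smooth_Ck[OF sm] lim pd_uniformly_Cauchy]

end

text \<open>Convergence has to be known for the values only; interpolation passes it on to
  derivatives one order at a time, while bounds of all orders are assumed.\<close>

lemma smooth_limit:
 fixes f :: "nat => real ^ 'n => real"
 assumes "!!n. smooth_on (ball 0 rho) (f n)" "!!k. \<exists>C. \<forall>n. derivs_le k C (ball 0 rho) (f n)"
  and "!!rho'. 0 \<le> rho' ==> rho' < rho ==> uniformly_Cauchy_on (cball 0 rho') f" and "!!x. x \<in> ball 0 rho ==> (\<lambda>n. f n x) \<longlonglongrightarrow> g x"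
 shows "smooth_on (ball 0 rho) g"
proof -
 have "Ck_on k (ball 0 rho) g" for k
  using assms
 proof (induction k arbitrary: f g)
  case 0
  then show ?case using Ck_imp_continuous[OF C1_limit'(1)[OF 0]] by simp
 next
  case (Suc k)
  have "Ck_on k (ball 0 rho) (pd c g)" for c
  proof (rule Suc.IH[of "\<lambda>n. pd c (f n)"])
   show "\<exists>C. \<forall>n. derivs_le k C (ball 0 rho) (pd c (f n))" for k using Suc.prems(2)[of "Suc k"] by auto
  qed (use smooth_pd[OF Suc.prems(1)] pd_uniformly_Cauchy[OF Suc.prems] C1_limit'(2)[OF Suc.prems] in auto)
  then show ?case using C1_limit'(1)[OF Suc.prems] by simp
 qed
 then show ?thesis by (simp add: smooth_on_def)
qed

lemma coordinate_lipschitz: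
 fixes f :: "real ^ 'n => real"
 assumes "convex S" "!!x. x \<in> S ==> f differentiable at x"
  and b: "!!l x. x \<in> S ==> \<bar>pd l f x\<bar> \<le> b" and uv: "u \<in> S" "v \<in> S" and e: "!!l. \<bar>u $ l - v $ l\<bar> \<le> e"
 shows "\<bar>f u - f v\<bar> \<le> real CARD('n) * b * e"
proof -
 let ?gamma = "\<lambda>t. v + t *\<^sub>R (u - v)"
 have mem: "?gamma t \<in> S" if "t \<in> {0..1}" for t
  using convexD_alt[OF assms(1) uv(2,1), of t] that by (simp add: algebra_simps)
 let ?D = "\<lambda>t. \<Sum>l\<in>UNIV. (u - v) $ l * pd l f (?gamma t)"
 have "norm (f (?gamma 1) - f (?gamma 0)) \<le> (real CARD('n) * b * e) * norm (1 - 0 :: real)"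
 proof (rule differentiable_bound[of "{0..1}"])
  show "((\<lambda>t. f (?gamma t)) has_derivative (\<lambda>h. h * ?D t)) (at t within {0..1})" if "t \<in> {0..1}" for t
  proof -
   have "(?gamma has_derivative (\<lambda>h. h *\<^sub>R (u - v))) (at t within {0..1})" by (auto intro!: derivative_eq_intros)
   from has_derivative_compose[OF this has_derivative_pd[OF assms(2)[OF mem[OF that]]]]
   have "((\<lambda>t. f (?gamma t)) has_derivative (\<lambda>h. \<Sum>a\<in>UNIV. (h *\<^sub>R (u - v)) $ a *\<^sub>R pd a f (?gamma t))) (at t within {0..1})" .
   then show ?thesis by (simp add: sum_distrib_left mult.assoc)
  qed
  show "onorm (\<lambda>h. h * ?D t) \<le> real CARD('n) * b * e" if "t \<in> {0..1}" for t
  proof (rule onorm_le)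
   fix h :: real
   have b0: "b \<ge> 0" using b[OF uv(1)] abs_ge_zero by (meson order_trans)
   have "\<bar>?D t\<bar> \<le> (\<Sum>l\<in>(UNIV :: 'n set). e * b)"
    by (intro order_trans[OF sum_abs] sum_mono) (use b[OF mem[OF that]] e b0 in \<open>auto simp: abs_mult intro!: mult_mono order_trans[OF abs_ge_zero e]\<close>)
   then have "\<bar>?D t\<bar> \<le> real CARD('n) * b * e" by (simp add: mult_ac)
   then show "norm (h * ?D t) \<le> real CARD('n) * b * e * norm h"
    unfolding real_norm_def abs_mult mult.commute[of "\<bar>h\<bar>"] by (rule mult_right_mono) simp
  qed
 qed auto
 then show ?thesis by simp
qed

lemma smooth_ray_int: "smooth_on (ball 0 rho) f ==> smooth_on (ball 0 rho) (ray_int K j f)"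
 by (simp add: smooth_on_def Ck_ray_int)

text \<open>The interval has length 1 and the weights t^j lie between 0 and 1, so averaging over the
  ray loses no constant.\<close>

lemma derivs_le_ray_int:
 assumes "smooth_on (ball 0 rho) f" "derivs_le k C (ball 0 rho) f"
 shows "derivs_le k C (ball 0 rho) (ray_int K j f)"
 using assms
proof (induction k arbitrary: f j)
 case 0
 have "norm (ray_int K j f x) \<le> C" if x: "x \<in> ball 0 rho" for x
  using ray_int_bound[OF smoothC[OF 0(1)] x] 0(2) ray_in_ball[OF _ x] by auto
 then show ?case by simp
next
 case (Suc k)
 have n: "norm (ray_int K j f x) \<le> C" if x: "x \<in> ball 0 rho" for x
  using ray_int_bound[OF smoothC[OF Suc.prems(1)] x] Suc.prems(2) ray_in_ball[OF _ x] by auto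
 have "derivs_le k C (ball 0 rho) (pd c (ray_int K j f))" for c
 proof (rule derivs_le_cong[OF open_ball])
  show "derivs_le k C (ball 0 rho) (ray_int K (j + ray_wt K c) (pd c f))"
   using Suc.prems(2) by (intro Suc.IH smooth_pd[OF Suc.prems(1)]) simp
 qed (rule pd_ray_int(2)[symmetric, OF smoothD[OF Suc.prems(1)] smoothC[OF smooth_pd[OF Suc.prems(1)]]])
 then show ?case using n by simp
qed

section \<open>Sequences bounded in C^k\<close>

context
 fixes rho :: real
begin

text \<open>The bound is uniform in the sequence index. The closure rules that follow reduce
  boundedness of Picard iterates to their defining formula.\<close>

definition bdd_family :: "nat => (nat => real ^ 'n => real) => bool"
 where "bdd_family k F \<longleftrightarrow> (\<forall>n. smooth_on (ball 0 rho) (F n)) \<and> (\<exists>C\<ge>0. \<forall>n. derivs_le k C (ball 0 rho) (F n))"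

lemma bdd_family_smooth: "bdd_family k F ==> smooth_on (ball 0 rho) (F n)"
 by (simp add: bdd_family_def)

lemma bdd_family_const:
 fixes f :: "real ^ 'n => real"
 assumes "smooth_on UNIV f"
 shows "bdd_family k (\<lambda>n. f)"
proof -
 obtain C where C: "0 \<le> C" "derivs_le k C (cball 0 rho) f" by (rule derivs_le_compact[OF assms compact_cball]) auto
 then have "derivs_le k C (ball 0 rho) f" using derivs_le_mono[OF C(2) order_refl] ball_subset_cball by blast
 then show ?thesis unfolding bdd_family_def using C(1) smooth_subset[OF assms] by auto
qed

lemma bdd_family_add: "bdd_family k F ==> bdd_family k G ==> bdd_family k (\<lambda>n x. F n x + G n x)"
proof -
 assume "bdd_family k F" "bdd_family k G"
 then obtain C D where C: "!!n. smooth_on (ball 0 rho) (F n)" "!!n. derivs_le k C (ball 0 rho) (F n)" "0 \<le> C"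
  and D: "!!n. smooth_on (ball 0 rho) (G n)" "!!n. derivs_le k D (ball 0 rho) (G n)" "0 \<le> D"
  unfolding bdd_family_def by blast
 show ?thesis
  unfolding bdd_family_def
  using smooth_add[OF open_ball C(1) D(1)] derivs_le_add[OF open_ball smooth_Ck[OF C(1)] smooth_Ck[OF D(1)] C(2) D(2)] C(3) D(3)
  by (intro conjI allI exI[of _ "C + D"]) auto
qed

lemma bdd_family_mult: "bdd_family k F ==> bdd_family k G ==> bdd_family k (\<lambda>n x. F n x * G n x)"
proof -
 assume "bdd_family k F" "bdd_family k G"
 then obtain C D where C: "!!n. smooth_on (ball 0 rho) (F n)" "!!n. derivs_le k C (ball 0 rho) (F n)" "0 \<le> C"
  and D: "!!n. smooth_on (ball 0 rho) (G n)" "!!n. derivs_le k D (ball 0 rho) (G n)" "0 \<le> D"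
  unfolding bdd_family_def by blast
 show ?thesis
  unfolding bdd_family_def
  using smooth_mult[OF open_ball C(1) D(1)] derivs_le_mult[OF open_ball smooth_Ck[OF C(1)] smooth_Ck[OF D(1)] C(2) D(2) C(3) D(3)] C(3) D(3)
  by (intro conjI allI exI[of _ "2 ^ k * C * D"]) auto
qed

lemma bdd_family_sum: "(!!i. i \<in> I ==> bdd_family k (F i)) ==> bdd_family k (\<lambda>n x. \<Sum>i\<in>I. F i n x)"
 by (induction I rule: infinite_finite_induct) (auto intro: bdd_family_const bdd_family_add)

lemma bdd_family_ray_int: "bdd_family k F ==> bdd_family k (\<lambda>n. ray_int K j (F n))"
 unfolding bdd_family_def using smooth_ray_int derivs_le_ray_int by blast

lemma bdd_family_ray_op:
 assumes "!!i a l. bdd_family k (\<lambda>n. B n i a l)" "!!l. bdd_family k (\<lambda>n. y n l)"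
 shows "bdd_family k (\<lambda>n. ray_op K j (B n) (y n) i)"
 unfolding ray_op_def
 by (intro bdd_family_sum bdd_family_mult bdd_family_ray_int bdd_family_const assms) simp

lemma bdd_family_cong:
 assumes "!!n x. x \<in> ball 0 rho ==> F n x = G n x" "bdd_family k F"
 shows "bdd_family k G"
proof -
 obtain C where "0 \<le> C" "!!n. derivs_le k C (ball 0 rho) (F n)" using assms(2) unfolding bdd_family_def by blast
 then show ?thesis
  unfolding bdd_family_def
  by (intro conjI allI exI[of _ C] smooth_cong[OF open_ball assms(1) bdd_family_smooth[OF assms(2)]])
   (assumption | rule derivs_le_cong[OF open_ball assms(1)])+
qed

lemma bdd_family_SucI:
 fixes F :: "nat => real ^ 'n => real"
 assumes "bdd_family 0 F" "!!c. bdd_family k (\<lambda>n. pd c (F n))"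
 shows "bdd_family (Suc k) F"
proof -
 obtain C0 where C0: "C0 \<ge> 0" "!!n x. x \<in> ball 0 rho ==> \<bar>F n x\<bar> \<le> C0" using assms(1) by (auto simp: bdd_family_def)
 obtain C where C: "!!c. C c \<ge> 0" "!!c n. derivs_le k (C c) (ball 0 rho) (pd c (F n))"
  using assms(2) unfolding bdd_family_def by metis
 have "C c \<le> C0 + sum C UNIV" for c using member_le_sum[of c UNIV C] C(1) C0(1) by simp
 then have "derivs_le k (C0 + sum C UNIV) (ball 0 rho) (pd c (F n))" for c n
  using derivs_le_mono[OF C(2)] by blast
 moreover have "\<bar>F n x\<bar> \<le> C0 + sum C UNIV" if "x \<in> ball 0 rho" for n x
  using C0(2)[OF that, of n] sum_nonneg[of UNIV C] C(1) by simp
 ultimately show ?thesis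
  using assms(1) C0(1) C(1) unfolding bdd_family_def by (auto intro!: exI[of _ "C0 + sum C UNIV"] add_nonneg_nonneg sum_nonneg)
qed

lemma bdd_family_pd: "bdd_family (Suc k) F ==> bdd_family k (\<lambda>n. pd c (F n))"
 unfolding bdd_family_def using smooth_pd by auto

lemma bdd_family_Suc_imp: "bdd_family (Suc k) F ==> bdd_family k F"
 unfolding bdd_family_def using derivs_le_SucD by blast

text \<open>All values of the inner sequence lie in one compact set \<open>L\<close>, on which each
  derivative of the outer function is bounded; the chain rule does the rest.\<close>

lemma bdd_family_compose:
 fixes N :: "real ^ 'n => real" and v :: "nat => real ^ 'n => real ^ 'n"
 assumes "smooth_on T N" "compact L" "L \<subseteq> T" "open T" "!!n. smooth_on (ball 0 rho) (v n)" "!!n x. x \<in> ball 0 rho ==> v n x \<in> L"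
  and "!!l. bdd_family k (\<lambda>n x. v n x $ l)"
 shows "bdd_family k (\<lambda>n x. N (v n x))"
 using assms(1,7)
proof (induction k arbitrary: N)
 case (0 N)
 obtain C where "0 \<le> C" "derivs_le 0 C L N" by (rule derivs_le_compact[OF 0(1) assms(2,3)])
 moreover have "smooth_on (ball 0 rho) (\<lambda>x. N (v n x))" for n
  by (rule smooth_compose[OF open_ball 0(1) assms(5)]) (use assms(3,6) in blast)
 ultimately show ?case unfolding bdd_family_def using assms(6) by auto
next
 case (Suc k N)
 have v: "v n x \<in> T" "v n differentiable at x" if "x \<in> ball 0 rho" for n x
  using assms(3,6) smoothD[OF assms(5)] that by blast+
 show ?case
 proof (rule bdd_family_SucI)
  show "bdd_family 0 (\<lambda>n x. N (v n x))"
   using Suc.IH[OF Suc.prems(1) bdd_family_Suc_imp[OF Suc.prems(2)]] unfolding bdd_family_def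
   by (metis derivs_le_norm derivs_le.simps(1))
  fix c
  show "bdd_family k (\<lambda>n. pd c (\<lambda>x. N (v n x)))"
  proof (rule bdd_family_cong)
   show "bdd_family k (\<lambda>n x. \<Sum>l\<in>UNIV. pd c (\<lambda>x. v n x $ l) x * pd l N (v n x))"
    by (rule bdd_family_sum, rule bdd_family_mult[OF bdd_family_pd[OF Suc.prems(2)]
     Suc.IH[OF smooth_pd[OF Suc.prems(1)] bdd_family_Suc_imp[OF Suc.prems(2)]]])
   fix n and x :: "real ^ 'n" assume x: "x \<in> ball 0 rho"
   show "(\<Sum>l\<in>UNIV. pd c (\<lambda>x. v n x $ l) x * pd l N (v n x)) = pd c (\<lambda>x. N (v n x)) x"
    using v[OF x] by (simp add: pd_compose(1)[OF smoothD[OF Suc.prems(1)]] pd_component)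
  qed
 qed
qed

text \<open>At order 0 the contraction keeps the sequence bounded. The differentiated recursion has
  the same form with another inhomogeneity, containing \<open>z\<close> only undifferentiated, and
  another power of t; therefore \<open>A\<close> and \<open>j\<close> vary in the induction.\<close>

lemma bdd_family_ray_recursion:
 fixes A z :: "nat => 'n::finite => real ^ 'n => real" and B :: "nat => 'n => 'n => 'n => real ^ 'n => real"
 assumes b: "0 \<le> b" and small: "(real CARD('n))\<^sup>2 * rho * b \<le> 1 / 4"
  and bB: "!!n i a l x. x \<in> ball 0 rho ==> \<bar>B n i a l x\<bar> \<le> b"
  and B: "!!i a l. bdd_family k (\<lambda>n. B n i a l)" and A: "!!i. bdd_family k (\<lambda>n. A n i)"
  and z: "!!n i. smooth_on (ball 0 rho) (z n i)" "!!i. bdd_family k (\<lambda>n. z 0 i)"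
  and rec: "!!n i x. x \<in> ball 0 rho ==> z (Suc n) i x = A n i x + ray_op K j (B n) (z n) i x"
 shows "bdd_family k (\<lambda>n. z n i)"
 using B A z rec
proof (induction k arbitrary: A z i j)
 case 0
 note B = 0(1) and A = 0(2) and z = 0(3,4) and rec = 0(5)
 have "\<exists>C\<ge>0. \<forall>n. \<forall>x\<in>ball 0 rho. \<bar>A n i x\<bar> \<le> C" "\<exists>D\<ge>0. \<forall>x\<in>ball 0 rho. \<bar>z 0 i x\<bar> \<le> D" for i
  using A[of i] z(2)[of i] unfolding bdd_family_def by auto
 then obtain C D where C: "!!i. C i \<ge> 0" "!!i n x. x \<in> ball 0 rho ==> \<bar>A n i x\<bar> \<le> C i"
  and D: "!!i. D i \<ge> 0" "!!i x. x \<in> ball 0 rho ==> \<bar>z 0 i x\<bar> \<le> D i"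
  by metis
 \<comment> \<open>Since M \<ge> 2 C i, the recursion reproduces the bound: C i + M / 4 \<le> M; the
   summand D i covers the initial term.\<close>
 define M where "M = (\<Sum>i\<in>UNIV. 2 * C i + D i)"
 have M: "2 * C i + D i \<le> M" for i unfolding M_def using C(1) D(1) by (intro member_le_sum) auto
 have M0: "0 \<le> M" using M[of i] C(1)[of i] D(1)[of i] by linarith
 have "\<bar>z n i x\<bar> \<le> M" if "x \<in> ball 0 rho" for n i x
  using that
 proof (induction n arbitrary: i x)
  case 0
  show ?case using D(2)[OF 0, of i] C(1)[of i] M[of i] by linarith
 next
  case (Suc n)
  have sub: "cball 0 (norm x) \<subseteq> ball (0 :: real ^ 'n) rho" using Suc.prems by auto
  have "\<bar>ray_op K j (B n) (z n) i x\<bar> \<le> (real CARD('n))\<^sup>2 * rho * b * M"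
   by (rule ray_op_bound[where rho' = "norm x"])
    (use sub bB Suc M0 b smoothC[OF bdd_family_smooth[OF B]] smoothC[OF z(1)] in auto)
  also have "... \<le> 1 / 4 * M" by (rule mult_right_mono[OF small M0])
  finally show ?case using rec[OF Suc.prems, of n i] C(2)[OF Suc.prems, of n i] C(1)[of i] D(1)[of i] M[of i] by linarith
 qed
 then show ?case unfolding bdd_family_def using z(1) M0 by auto
next
 case (Suc k)
 note B = Suc.prems(1) and A = Suc.prems(2) and z = Suc.prems(3,4) and rec = Suc.prems(5)
 note Bs = bdd_family_smooth[OF B] and As = bdd_family_smooth[OF A]
 have zk: "bdd_family k (\<lambda>n. z n i)" for i
  by (rule Suc.IH[OF bdd_family_Suc_imp[OF B] bdd_family_Suc_imp[OF A] z(1) bdd_family_Suc_imp[OF z(2)] rec])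
 have "bdd_family k (\<lambda>n. pd c (z n i))" for c i
 \<comment> \<open>All terms in which \<open>z\<close> is not differentiated are collected in the
   new inhomogeneity; they are bounded by the induction hypothesis at order k for \<open>z\<close>
   itself.\<close>
 proof (rule Suc.IH[of "\<lambda>n i x. pd c (A n i) x + (ray_int K j (\<lambda>x. \<Sum>l\<in>UNIV. B n i c l x * z n l x) x
     + ray_op K (j + ray_wt K c) (\<lambda>i a l. pd c (B n i a l)) (z n) i x)" "\<lambda>n i. pd c (z n i)" "j + ray_wt K c", OF bdd_family_Suc_imp[OF B]])
  show "bdd_family k (\<lambda>n x. pd c (A n i) x + (ray_int K j (\<lambda>x. \<Sum>l\<in>UNIV. B n i c l x * z n l x) x
     + ray_op K (j + ray_wt K c) (\<lambda>i a l. pd c (B n i a l)) (z n) i x))" for i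
   by (intro bdd_family_add bdd_family_pd[OF A] bdd_family_ray_int bdd_family_sum bdd_family_mult
     bdd_family_Suc_imp[OF B] zk bdd_family_ray_op bdd_family_pd[OF B])
  show "smooth_on (ball 0 rho) (pd c (z n i))" for n i by (rule smooth_pd[OF z(1)])
  show "bdd_family k (\<lambda>n. pd c (z 0 i))" for i by (rule bdd_family_pd[OF z(2)])
  fix n i and x :: "real ^ 'n" assume x: "x \<in> ball 0 rho"
  have d: "A n i differentiable at x" "ray_op K j (B n) (z n) i differentiable at x"
   using smoothD[OF As x] Ck_ray_op[OF smooth_Ck[OF Bs] smooth_Ck[OF z(1)], of 1] x by auto
  have "pd c (z (Suc n) i) x = pd c (\<lambda>x. A n i x + ray_op K j (B n) (z n) i x) x" by (rule pd_cong_open[OF open_ball x rec])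
  then show "pd c (z (Suc n) i) x = pd c (A n i) x + (ray_int K j (\<lambda>x. \<Sum>l\<in>UNIV. B n i c l x * z n l x) x
     + ray_op K (j + ray_wt K c) (\<lambda>i a l. pd c (B n i a l)) (z n) i x) + ray_op K (j + ray_wt K c) (B n) (\<lambda>i. pd c (z n i)) i x"
   using pd_ray_op[OF smooth_Ck[OF Bs] smooth_Ck[OF z(1)] x] d by (simp add: pd_add)
 qed
 moreover have "bdd_family 0 (\<lambda>n. z n i)"
  using zk[of i] unfolding bdd_family_def by (metis derivs_le_norm derivs_le.simps(1))
 ultimately show ?case by (intro bdd_family_SucI)
qed

end

text \<open>Picard iteration for the integrated form of d_a phi = e_a + N_a(phi) along rays. It
  converges whether or not that overdetermined system is integrable; the exported formula for
  \<open>pd c phi\<close> is what the integrability argument starts from. \<open>small\<close> gives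
  the contraction factor 1/4, \<open>range\<close> keeps the iterates where \<open>N\<close> is
  controlled.\<close>

lemma nonlinear_ray_equation:
 fixes N :: "'n::finite => 'n => real ^ 'n => real" and K :: "'n set"
 assumes N: "!!i a. smooth_on (ball 0 R) (N i a)" and R': "0 < R'" "R' < R" and b: "0 \<le> b"
  and Nb: "!!i a u. u \<in> cball 0 R' ==> \<bar>N i a u\<bar> \<le> b" and dNb: "!!i a l u. u \<in> cball 0 R' ==> \<bar>pd l (N i a) u\<bar> \<le> b"
  and small: "(real CARD('n))\<^sup>2 * rho * b \<le> 1 / 4" and rho: "rho > 0" and range: "real CARD('n) * (rho * (1 + real CARD('n) * b)) \<le> R'"
 obtains phi where "smooth_on (ball 0 rho) phi" "!!x. x \<in> ball 0 rho ==> phi x \<in> cball 0 R'"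
  "!!i x. x \<in> ball 0 rho ==> phi x $ i = x $ i + (\<Sum>a\<in>UNIV. x $ a * ray_int K 0 (\<lambda>x. N i a (phi x)) x)"
  "!!c i x. x \<in> ball 0 rho ==> pd c phi x $ i = ((if i = c then 1 else 0) + ray_int K 0 (\<lambda>x. N i c (phi x)) x) +
   ray_op K (ray_wt K c) (\<lambda>i a l x. pd l (N i a) (phi x)) (\<lambda>l. pd c (\<lambda>x. phi x $ l)) i x"
proof -
 let ?n = "real CARD('n)" and ?B = "ball (0 :: real ^ 'n) rho" and ?R = "cball (0 :: real ^ 'n) R'"
 define step where "step Phi i x = x $ i + (\<Sum>a\<in>UNIV. x $ a * ray_int K 0 (\<lambda>x. N i a (\<chi> l. Phi l x)) x)"
  for Phi :: "'n => real ^ 'n => real" and i and x :: "real ^ 'n"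
 define Phi where "Phi n = (step ^^ n) (\<lambda>i x. x $ i)" for n
 define V where "V n x = (\<chi> l. Phi n l x)" for n x
 have Phi0: "Phi 0 = (\<lambda>i x. x $ i)" and PhiS: "Phi (Suc n) i x = x $ i + (\<Sum>a\<in>UNIV. x $ a * ray_int K 0 (\<lambda>x. N i a (V n x)) x)" for n i x
  by (simp_all add: Phi_def step_def V_def)
 have PhiS': "Phi (Suc n) i = (\<lambda>x. x $ i + (\<Sum>a\<in>UNIV. x $ a * ray_int K 0 (\<lambda>x. N i a (V n x)) x))" for n i
  by (rule ext) (rule PhiS)
 have sub: "?R \<subseteq> ball (0 :: real ^ 'n) R" using R' by auto
 have N': "N i a differentiable at u" "pd l (N i a) differentiable at u" if "u \<in> ?R" for i a l u
  using smoothD[OF N] smoothD[OF smooth_pd[OF N]] sub that by blast+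
 have inv: "(\<forall>l. smooth_on ?B (Phi n l)) \<and> (\<forall>x\<in>?B. V n x \<in> ?R)" for n
 proof (induction n)
  case 0
  have "rho \<le> 1 * (rho * (1 + ?n * b))" using rho b by (simp add: algebra_simps)
  also have "... \<le> ?n * (rho * (1 + ?n * b))"
   using rho b by (intro mult_right_mono) auto
  finally show ?case using range by (auto simp: Phi0 V_def)
 next
  case (Suc n)
  have smV: "smooth_on ?B (V n)" unfolding V_def using Suc by (intro smooth_vec_lambda) auto
  have smN: "smooth_on ?B (\<lambda>x. N i a (V n x))" for i a
   by (rule smooth_compose[OF open_ball N smV]) (use Suc sub in blast)
  have sm: "smooth_on ?B (Phi (Suc n) l)" for l
   unfolding PhiS' by (intro smooth_add smooth_sum smooth_mult smooth_ray_int smN open_ball smooth_nth)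
  have "V (Suc n) x \<in> ?R" if x: "x \<in> ?B" for x
  proof -
   have x1: "\<bar>x $ a\<bar> \<le> rho" for a using component_le_norm_cart[of x a] x by auto
   have "\<bar>Phi (Suc n) i x\<bar> \<le> rho + (\<Sum>a\<in>(UNIV :: 'n set). rho * b)" for i
    unfolding PhiS
   proof (intro order_trans[OF abs_triangle_ineq] add_mono x1 order_trans[OF sum_abs] sum_mono)
    fix a
    have "\<bar>ray_int K 0 (\<lambda>x. N i a (V n x)) x\<bar> \<le> b"
     by (rule ray_int_bound[OF smoothC[OF smN] x], rule Nb) (use Suc ray_in_ball[OF _ x] in blast)
    then show "\<bar>x $ a * ray_int K 0 (\<lambda>x. N i a (V n x)) x\<bar> \<le> rho * b"
     unfolding abs_mult using x1 rho by (intro mult_mono) auto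
   qed
   then have "(\<Sum>i\<in>UNIV. \<bar>V (Suc n) x $ i\<bar>) \<le> (\<Sum>i\<in>(UNIV :: 'n set). rho + (\<Sum>a\<in>(UNIV :: 'n set). rho * b))"
    by (intro sum_mono) (simp add: V_def)
   also have "... = ?n * (rho * (1 + ?n * b))" by (simp add: algebra_simps)
   finally show ?thesis using norm_le_l1_cart[of "V (Suc n) x"] range by simp
  qed
  with sm show ?case by blast
 qed
 then have sm: "!!n l. smooth_on ?B (Phi n l)" and ran: "!!n x. x \<in> ?B ==> V n x \<in> ?R" by blast+
 have smV: "smooth_on ?B (V n)" for n unfolding V_def by (intro smooth_vec_lambda sm open_ball)
 have smN: "smooth_on ?B (\<lambda>x. N i a (V n x))" for n i a
  by (rule smooth_compose[OF open_ball N smV]) (use ran sub in blast)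
 have smdN: "smooth_on ?B (\<lambda>x. pd l (N i a) (V n x))" for n i a l
  by (rule smooth_compose[OF open_ball smooth_pd[OF N] smV]) (use ran sub in blast)
 have lipN: "\<bar>N i a u - N i a v\<bar> \<le> ?n * b * e"
  if "u \<in> ?R" "v \<in> ?R" "!!l. \<bar>u $ l - v $ l\<bar> \<le> e" for i a u v e
  by (rule coordinate_lipschitz[OF convex_cball N'(1) dNb that])
 \<comment> \<open>Comparing two arbitrary iterates of index at least r, not just consecutive ones,
   gives the Cauchy property without summing a series.\<close>
 have diff: "\<bar>Phi (m + r) i x - Phi (n + r) i x\<bar> \<le> 2 * R' * (1 / 4) ^ r" if "x \<in> ?B" for m n r i x
  using that
 proof (induction r arbitrary: i x)
  case 0
  have "\<bar>Phi m i x\<bar> \<le> R'" for m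
   using component_le_norm_cart[of "V m x" i] ran[OF 0, of m] by (simp add: V_def)
  from this[of m] this[of n] show ?case by simp
 next
  case (Suc r)
  have "Phi (m + Suc r) i x - Phi (n + Suc r) i x
   = (\<Sum>a\<in>UNIV. x $ a * (ray_int K 0 (\<lambda>x. N i a (V (m + r) x)) x - ray_int K 0 (\<lambda>x. N i a (V (n + r) x)) x))"
   by (simp add: PhiS sum_subtractf[symmetric] right_diff_distrib)
  also have "... = (\<Sum>a\<in>UNIV. x $ a * ray_int K 0 (\<lambda>x. N i a (V (m + r) x) - N i a (V (n + r) x)) x)"
   by (simp only: ray_int_diff[OF smoothC[OF smN] smoothC[OF smN] Suc.prems])
  finally have eq: "Phi (m + Suc r) i x - Phi (n + Suc r) i x
   = (\<Sum>a\<in>UNIV. x $ a * ray_int K 0 (\<lambda>x. N i a (V (m + r) x) - N i a (V (n + r) x)) x)" .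
  have "\<bar>\<Sum>a\<in>UNIV. x $ a * ray_int K 0 (\<lambda>x. N i a (V (m + r) x) - N i a (V (n + r) x)) x\<bar>
   \<le> (\<Sum>a\<in>(UNIV :: 'n set). rho * (?n * b * (2 * R' * (1 / 4) ^ r)))"
  proof (intro order_trans[OF sum_abs] sum_mono)
   fix a
   have "\<bar>x $ a\<bar> \<le> rho" using component_le_norm_cart[of x a] Suc.prems by auto
   moreover have "\<bar>ray_int K 0 (\<lambda>x. N i a (V (m + r) x) - N i a (V (n + r) x)) x\<bar> \<le> ?n * b * (2 * R' * (1 / 4) ^ r)"
   proof (rule ray_int_bound[OF _ Suc.prems])
    show "continuous_on ?B (\<lambda>x. N i a (V (m + r) x) - N i a (V (n + r) x))"
     by (intro continuous_intros smoothC[OF smN])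
    fix t :: real assume "t \<in> {0..1}"
    then have "ray K t x \<in> ?B" using Suc.prems by (rule ray_in_ball)
    then show "\<bar>N i a (V (m + r) (ray K t x)) - N i a (V (n + r) (ray K t x))\<bar> \<le> ?n * b * (2 * R' * (1 / 4) ^ r)"
     using Suc.IH by (intro lipN ran) (simp_all add: V_def)
   qed
   ultimately show "\<bar>x $ a * ray_int K 0 (\<lambda>x. N i a (V (m + r) x) - N i a (V (n + r) x)) x\<bar> \<le> rho * (?n * b * (2 * R' * (1 / 4) ^ r))"
    unfolding abs_mult using rho by (intro mult_mono) auto
  qed
  also have "... = ((?n)\<^sup>2 * rho * b) * (2 * R' * (1 / 4) ^ r)" by (simp add: power2_eq_square)
  also have "... \<le> 1 / 4 * (2 * R' * (1 / 4) ^ r)" using R' by (intro mult_right_mono small) auto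
  finally show ?case unfolding eq by simp
 qed
 have tail: "(\<lambda>r. 2 * R' * (1 / 4 :: real) ^ r) \<longlonglongrightarrow> 0"
 proof -
  have "(\<lambda>r. 2 * R' * (1 / 4 :: real) ^ r) \<longlonglongrightarrow> 2 * R' * 0" by (intro tendsto_intros LIMSEQ_realpow_zero) auto
  then show ?thesis by simp
 qed
 have uC: "uniformly_Cauchy_on ?B (\<lambda>n. Phi n k)" for k
  unfolding uniformly_Cauchy_on_def
 proof (intro allI impI)
  fix e :: real assume "e > 0"
  then have "\<forall>\<^sub>F r in sequentially. 2 * R' * (1 / 4 :: real) ^ r < e" by (rule order_tendstoD[OF tail])
  then obtain r where r: "2 * R' * (1 / 4 :: real) ^ r < e" by (auto simp: eventually_sequentially)
  have "dist (Phi m k x) (Phi n k x) < e" if "x \<in> ?B" "m \<ge> r" "n \<ge> r" for m n x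
   using diff[OF that(1), of "m - r" r k "n - r"] r that by (simp add: dist_real_def)
  then show "\<exists>M. \<forall>x\<in>?B. \<forall>m\<ge>M. \<forall>n\<ge>M. dist (Phi m k x) (Phi n k x) < e" by blast
 qed
 define phi where "phi x = (\<chi> i. lim (\<lambda>n. Phi n i x))" for x
 have ul: "uniform_limit ?B (\<lambda>n. Phi n i) (\<lambda>x. phi x $ i) sequentially" for i
  using uC[of i] uniformly_convergent_eq_Cauchy[of "?B" "\<lambda>n. Phi n i"]
   uniformly_convergent_uniform_limit_iff[of "?B" "\<lambda>n. Phi n i"] by (simp add: phi_def)
 have lim: "(\<lambda>n. Phi n i x) \<longlonglongrightarrow> phi x $ i" if "x \<in> ?B" for i x
  by (rule tendsto_uniform_limitI[OF ul that])
 have ranphi: "phi x \<in> ?R" if x: "x \<in> ?B" for x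
 proof (rule closed_sequentially[OF closed_cball])
  show "V n x \<in> ?R" for n by (rule ran[OF x])
  show "(\<lambda>n. V n x) \<longlonglongrightarrow> phi x" by (rule vec_tendstoI) (simp add: V_def lim[OF x])
 qed
 have conphi: "continuous_on ?B (\<lambda>x. phi x $ i)" for i
  by (rule uniform_limit_theorem[OF _ ul]) (auto intro!: always_eventually smoothC[OF sm])
 have conphi': "continuous_on ?B phi"
  using continuous_on_vec_lambda[of "?B" "\<lambda>i x. phi x $ i"] conphi by simp
 have conN: "continuous_on ?B (\<lambda>x. N i a (phi x))" for i a
  by (rule continuous_on_compose2[OF smoothC[OF N] conphi']) (use ranphi sub in blast)
 have fix_eq: "phi x $ i = x $ i + (\<Sum>a\<in>UNIV. x $ a * ray_int K 0 (\<lambda>x. N i a (phi x)) x)" if x: "x \<in> ?B" for i x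
 proof -
  have "(\<lambda>n. ray_int K 0 (\<lambda>x. N i a (V n x)) x) \<longlonglongrightarrow> ray_int K 0 (\<lambda>x. N i a (phi x)) x" for a
  proof (rule LIM_zero_cancel, rule Lim_null_comparison)
   have lt: "\<bar>Phi r l z - phi z $ l\<bar> \<le> 2 * R' * (1 / 4) ^ r" if z: "z \<in> ?B" for r l z
   proof (rule tendsto_upperbound)
    show "(\<lambda>n. \<bar>Phi r l z - Phi (n + r) l z\<bar>) \<longlonglongrightarrow> \<bar>Phi r l z - phi z $ l\<bar>"
     by (intro tendsto_intros LIMSEQ_ignore_initial_segment[OF lim[OF z]])
    show "\<forall>\<^sub>F n in sequentially. \<bar>Phi r l z - Phi (n + r) l z\<bar> \<le> 2 * R' * (1 / 4) ^ r"
     using diff[OF z, of 0 r l] by simp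
   qed simp
   have "\<bar>ray_int K 0 (\<lambda>x. N i a (V r x)) x - ray_int K 0 (\<lambda>x. N i a (phi x)) x\<bar> \<le> ?n * b * (2 * R' * (1 / 4) ^ r)" for r
    unfolding ray_int_diff[OF smoothC[OF smN] conN x, symmetric]
   proof (rule ray_int_bound[OF _ x])
    show "continuous_on ?B (\<lambda>x. N i a (V r x) - N i a (phi x))"
     by (intro continuous_intros smoothC[OF smN] conN)
    fix t :: real assume "t \<in> {0..1}"
    then have "ray K t x \<in> ?B" using x by (rule ray_in_ball)
    then show "\<bar>N i a (V r (ray K t x)) - N i a (phi (ray K t x))\<bar> \<le> ?n * b * (2 * R' * (1 / 4) ^ r)"
     using lt by (intro lipN ran ranphi) (simp_all add: V_def)
   qed
   then show "\<forall>\<^sub>F r in sequentially. norm (ray_int K 0 (\<lambda>x. N i a (V r x)) x - ray_int K 0 (\<lambda>x. N i a (phi x)) x) \<le> ?n * b * (2 * R' * (1 / 4) ^ r)"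
    by simp
   show "(\<lambda>r. ?n * b * (2 * R' * (1 / 4) ^ r)) \<longlonglongrightarrow> 0"
    using tendsto_mult_left[OF tail, of "?n * b"] by simp
  qed
  then have "(\<lambda>n. Phi (Suc n) i x) \<longlonglongrightarrow> x $ i + (\<Sum>a\<in>UNIV. x $ a * ray_int K 0 (\<lambda>x. N i a (phi x)) x)"
   unfolding PhiS by (intro tendsto_intros)
  from LIMSEQ_unique[OF LIMSEQ_Suc[OF lim[OF x]] this] show ?thesis .
 qed
 \<comment> \<open>Stated for an arbitrary map \<open>v\<close>: with the iterates it is the
   recursion for their derivatives, with the limit it is the derivative formula of the
   conclusion.\<close>
 have pdeq: "pd c (\<lambda>x. x $ i + (\<Sum>a\<in>UNIV. x $ a * ray_int K 0 (\<lambda>x. N i a (v x)) x)) x =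
   ((if i = c then 1 else 0) + ray_int K 0 (\<lambda>x. N i c (v x)) x) +
   ray_op K (ray_wt K c) (\<lambda>i a l x. pd l (N i a) (v x)) (\<lambda>l. pd c (\<lambda>x. v x $ l)) i x"
  if v: "Ck_on 1 ?B v" "!!x. x \<in> ?B ==> v x \<in> ?R" and x: "x \<in> ?B" for v c i x
 proof -
  have vd: "v differentiable at z" if "z \<in> ?B" for z using v(1) that by simp
  have Nv: "Ck_on 1 ?B (\<lambda>x. N i a (v x))" for a
   by (rule Ck_compose[OF open_ball smooth_Ck[OF N] v(1)]) (use v(2) sub in blast)
  then have Nvd: "(\<lambda>x. N i a (v x)) differentiable at z" "continuous_on ?B (pd c (\<lambda>x. N i a (v x)))" if "z \<in> ?B" for a z c
   using that by auto
  have J: "ray_int K 0 (\<lambda>x. N i a (v x)) differentiable at x"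
   "pd c (ray_int K 0 (\<lambda>x. N i a (v x))) x = ray_int K (ray_wt K c) (\<lambda>x. \<Sum>l\<in>UNIV. pd l (N i a) (v x) * pd c (\<lambda>x. v x $ l) x) x" for a
  proof -
   show "ray_int K 0 (\<lambda>x. N i a (v x)) differentiable at x" using Nvd x by (intro pd_ray_int(1)) auto
   have "pd c (ray_int K 0 (\<lambda>x. N i a (v x))) x = ray_int K (0 + ray_wt K c) (pd c (\<lambda>x. N i a (v x))) x"
    using Nvd x by (intro pd_ray_int(2)) auto
   also have "... = ray_int K (0 + ray_wt K c) (\<lambda>x. \<Sum>l\<in>UNIV. pd l (N i a) (v x) * pd c (\<lambda>x. v x $ l) x) x"
    by (rule ray_int_cong[OF _ x]) (simp add: pd_compose(1)[OF N'(1)[OF v(2)] vd] pd_component[OF vd] mult.commute)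
   finally show "pd c (ray_int K 0 (\<lambda>x. N i a (v x))) x = ray_int K (ray_wt K c) (\<lambda>x. \<Sum>l\<in>UNIV. pd l (N i a) (v x) * pd c (\<lambda>x. v x $ l) x) x"
    by simp
  qed
  have d: "(\<lambda>x. x $ a * ray_int K 0 (\<lambda>x. N i a (v x)) x) differentiable at x" for a
   using J(1) by (intro differentiable_mult) auto
  have "pd c (\<lambda>x. x $ i + (\<Sum>a\<in>UNIV. x $ a * ray_int K 0 (\<lambda>x. N i a (v x)) x)) x
   = (if i = c then 1 else 0) + (\<Sum>a\<in>UNIV. x $ a * pd c (ray_int K 0 (\<lambda>x. N i a (v x))) x + (if a = c then 1 else 0) * ray_int K 0 (\<lambda>x. N i a (v x)) x)"
   using J(1) d by (subst pd_add) (auto simp: pd_sum pd_mult intro!: differentiable_sum)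
  also have "... = (if i = c then 1 else 0) + (ray_int K 0 (\<lambda>x. N i c (v x)) x + (\<Sum>a\<in>UNIV. x $ a * pd c (ray_int K 0 (\<lambda>x. N i a (v x))) x))"
   by (simp add: sum.distrib if_distrib[of "\<lambda>z. z * _"] cong: if_cong)
  finally show ?thesis by (simp add: J(2) ray_op_def)
 qed
 have bV: "bdd_family rho k (\<lambda>n x. g (V n x))" if "!!l. bdd_family rho k (\<lambda>n. Phi n l)" "smooth_on (ball 0 R) g" for k g
  by (rule bdd_family_compose[OF that(2) compact_cball sub open_ball smV ran]) (simp_all add: V_def that(1))
 \<comment> \<open>Bounds of order k for the iterates make the coefficients of the derivative
   recursion bounded at order k, hence bound the first derivatives at order k, which is order k +
   1.\<close>
 have bf: "bdd_family rho k (\<lambda>n. Phi n i)" for k i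
 proof (induction k arbitrary: i)
  case 0
  have "\<bar>Phi n i x\<bar> \<le> R'" if "x \<in> ?B" for n x
   using component_le_norm_cart[of "V n x" i] ran[OF that, of n] by (simp add: V_def)
  then show ?case unfolding bdd_family_def using sm R'(1) by (auto intro!: exI[of _ R'])
 next
  case (Suc k)
  have "bdd_family rho k (\<lambda>n. pd c (Phi n i))" for c i
  proof (rule bdd_family_ray_recursion[OF b small, where K = K and j = "ray_wt K c"])
   show "bdd_family rho k (\<lambda>n x. pd l (N i a) (V n x))" for i a l by (rule bV[OF Suc smooth_pd[OF N]])
   show "bdd_family rho k (\<lambda>n x. (if i = c then 1 else 0) + ray_int K 0 (\<lambda>x. N i c (V n x)) x)" for i
    by (intro bdd_family_add bdd_family_const bdd_family_ray_int bV[OF Suc N]) simp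
   show "bdd_family rho k (\<lambda>n. pd c (Phi 0 i))" for i
    unfolding Phi0 by (intro bdd_family_const smooth_pd smooth_nth)
   show "pd c (Phi (Suc n) i) x = ((if i = c then 1 else 0) + ray_int K 0 (\<lambda>x. N i c (V n x)) x) +
    ray_op K (ray_wt K c) (\<lambda>i a l x. pd l (N i a) (V n x)) (\<lambda>l. pd c (Phi n l)) i x" if x: "x \<in> ?B" for n i x
    using pdeq[OF smooth_Ck[OF smV] ran x] unfolding PhiS' by (simp add: V_def)
  qed (use dNb ran smooth_pd[OF sm] in blast)+
  then show ?case using Suc bdd_family_SucI[of rho "\<lambda>n. Phi n i" k] bdd_family_Suc_imp unfolding bdd_family_def
   by (metis derivs_le_norm derivs_le.simps(1))
 qed
 have "smooth_on ?B (\<lambda>x. phi x $ i)" for i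
 proof (rule smooth_limit[of rho "\<lambda>n. Phi n i"])
  show "\<exists>C. \<forall>n. derivs_le k C ?B (Phi n i)" for k using bf[of k i] unfolding bdd_family_def by blast
  show "uniformly_Cauchy_on (cball 0 rho') (\<lambda>n. Phi n i)" if "rho' < rho" for rho'
   using uC[of i] that unfolding uniformly_Cauchy_on_def by fastforce
 qed (use sm lim in blast)+
 then have smphi: "smooth_on ?B phi" using smooth_vec_lambda[of "?B" "\<lambda>i x. phi x $ i"] by simp
 have "pd c phi x $ i = ((if i = c then 1 else 0) + ray_int K 0 (\<lambda>x. N i c (phi x)) x) +
   ray_op K (ray_wt K c) (\<lambda>i a l x. pd l (N i a) (phi x)) (\<lambda>l. pd c (\<lambda>x. phi x $ l)) i x"
  if x: "x \<in> ?B" for c i x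
 proof -
  have "pd c phi x $ i = pd c (\<lambda>x. phi x $ i) x" by (rule pd_component[symmetric, OF smoothD[OF smphi x]])
  also have "... = pd c (\<lambda>x. x $ i + (\<Sum>a\<in>UNIV. x $ a * ray_int K 0 (\<lambda>x. N i a (phi x)) x)) x"
   by (rule pd_cong_open[OF open_ball x]) (rule fix_eq)
  finally show ?thesis using pdeq[OF smooth_Ck[OF smphi] ranphi x, of c i] by simp
 qed
 then show ?thesis using that[of phi] smphi ranphi fix_eq by blast
qed

section \<open>Straightening\<close>

lemmas mm_mult = matrix_matrix_mult_def and mv_mult = matrix_vector_mult_def

lemma matrix_inv_id:
 fixes A :: "'a::field ^ 'n ^ 'n"
 assumes "det A \<noteq> 0"
 shows "A ** matrix_inv A = mat 1" "matrix_inv A ** A = mat 1"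
proof -
 have "\<exists>B. A ** B = mat 1 \<and> B ** A = mat 1" using assms by (simp add: invertible_def flip: invertible_det_nz)
 then have "A ** matrix_inv A = mat 1 \<and> matrix_inv A ** A = mat 1" unfolding matrix_inv_def by (rule someI_ex)
 then show "A ** matrix_inv A = mat 1" "matrix_inv A ** A = mat 1" by auto
qed

text \<open>Cramer's rule writes the entries of the inverse as quotients of polynomials in the
  entries, which makes their smoothness evident.\<close>

lemma matrix_inv_cramer:
 fixes A :: "'a::field ^ 'n ^ 'n"
 assumes "det A \<noteq> 0"
 shows "matrix_inv A $ i $ j = det (\<chi> r c. if c = i then (if r = j then 1 else 0) else A $ r $ c) / det A"
proof -
 have "A *v (matrix_inv A *v axis j 1) = axis j 1"
  by (simp add: matrix_vector_mul_assoc matrix_inv_id[OF assms])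
 then have "matrix_inv A *v axis j 1 = (\<chi> k. det (\<chi> r c. if c = k then axis j 1 $ r else A $ r $ c) / det A)"
  using cramer[OF assms] by blast
 then have "(matrix_inv A *v axis j 1) $ i = det (\<chi> r c. if c = i then axis j 1 $ r else A $ r $ c) / det A" by simp
 moreover have "(\<chi> r c. if c = i then axis j 1 $ r else A $ r $ c) = (\<chi> r c. if c = i then (if r = j then 1 else 0) else A $ r $ c)"
  by (auto simp: vec_eq_iff axis_def)
 moreover have "(matrix_inv A *v axis j 1) $ i = matrix_inv A $ i $ j"
  by (simp add: mv_mult axis_def if_distrib cong: if_cong)
 ultimately show ?thesis by simp
qed

lemma Ck_det:
 fixes A :: "real ^ 'm => 'a::real_normed_field ^ 'n ^ 'n"
 assumes "open S" "!!i j. Ck_on k S (\<lambda>x. A x $ i $ j)"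
 shows "Ck_on k S (\<lambda>x. det (A x))"
 unfolding det_def by (intro Ck_sum Ck_mult Ck_prod Ck_const assms)

lemma Ck_matrix_inv:
 fixes A :: "real ^ 'm => 'a::real_normed_field ^ 'n ^ 'n"
 assumes "open S" "!!i j. Ck_on k S (\<lambda>x. A x $ i $ j)" "!!x. x \<in> S ==> det (A x) \<noteq> 0"
 shows "Ck_on k S (\<lambda>x. matrix_inv (A x) $ i $ j)"
proof (rule Ck_cong[OF assms(1)])
 have "Ck_on k S (\<lambda>x. (\<chi> r c. if c = i then (if r = j then 1 else 0) else A x $ r $ c) $ r $ c)" for r c
  using assms(2) by (cases "c = i"; cases "r = j") simp_all
 then show "Ck_on k S (\<lambda>x. det (\<chi> r c. if c = i then (if r = j then 1 else 0) else A x $ r $ c) / det (A x))"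
  by (intro Ck_divide Ck_det assms)
qed (simp add: matrix_inv_cramer[OF assms(3)])

lemma smooth_det:
 fixes A :: "real ^ 'm => 'a::real_normed_field ^ 'n ^ 'n"
 shows "open S ==> (!!i j. smooth_on S (\<lambda>x. A x $ i $ j)) ==> smooth_on S (\<lambda>x. det (A x))"
 by (simp add: smooth_on_def Ck_det)

lemma smooth_matrix_inv:
 fixes A :: "real ^ 'm => 'a::real_normed_field ^ 'n ^ 'n"
 shows "open S ==> (!!i j. smooth_on S (\<lambda>x. A x $ i $ j)) ==> (!!x. x \<in> S ==> det (A x) \<noteq> 0)
  ==> smooth_on S (\<lambda>x. matrix_inv (A x) $ i $ j)"
 by (simp add: smooth_on_def Ck_matrix_inv)

definition jac :: "(real ^ 'n => real ^ 'n) => real ^ 'n => real ^ 'n ^ 'n"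
 where "jac phi x = (\<chi> i c. pd c phi x $ i)"

lemma has_derivative_jac:
 assumes "phi differentiable at x"
 shows "(phi has_derivative (\<lambda>h. jac phi x *v h)) (at x)"
proof -
 have "(\<Sum>a\<in>UNIV. h $ a *\<^sub>R pd a phi x) = jac phi x *v h" for h
  by (simp add: vec_eq_iff jac_def mv_mult mult.commute)
 then show ?thesis using has_derivative_pd[OF assms] by simp
qed

text \<open>The inverse function theorem gives a differentiable inverse whose derivative is the
  inverse matrix of the Jacobian at \<open>psi\<close>. This formula bootstraps: if
  \<open>psi\<close> is of class C^k, so is its derivative.\<close>

theorem smooth_inverse:
 fixes phi :: "real ^ 'n => real ^ 'n"
 assumes "open U" "smooth_on U phi" "x0 \<in> U" "det (jac phi x0) \<noteq> 0"
 obtains U' V psi where "open U'" "x0 \<in> U'" "U' \<subseteq> U" "open V" "phi x0 \<in> V" "homeomorphism U' V phi psi" "smooth_on V psi"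
proof -
 define e where "e c = Blinfun (\<lambda>h :: real ^ 'n. h $ c)" for c
 have e [simp]: "blinfun_apply (e c) h = h $ c" for c h
  unfolding e_def by (subst bounded_linear_Blinfun_apply) (auto intro: bounded_linear_vec_nth)
 define f' where "f' x = (\<Sum>c\<in>UNIV. blinfun_scaleR_left (pd c phi x) o\<^sub>L e c)" for x
 have f': "blinfun_apply (f' x) = (\<lambda>h. jac phi x *v h)" for x
  by (rule ext) (simp add: f'_def blinfun.sum_left vec_eq_iff jac_def mv_mult mult.commute)
 have der: "(phi has_derivative blinfun_apply (f' x)) (at x)" if "x \<in> U" for x
  unfolding f' by (rule has_derivative_jac[OF smoothD[OF assms(2) that]])
 have cont: "continuous_on U f'"
  unfolding f'_def
  by (intro continuous_intros bounded_linear.continuous_on[OF bounded_linear_blinfun_scaleR_left]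
    smoothC[OF smooth_pd[OF assms(2)]])
 define g0 where "g0 = Blinfun (\<lambda>h. matrix_inv (jac phi x0) *v h)"
 have g0: "blinfun_apply g0 = (\<lambda>h. matrix_inv (jac phi x0) *v h)"
  unfolding g0_def by (rule bounded_linear_Blinfun_apply) (rule matrix_vector_mul_bounded_linear)
 have inv: "g0 o\<^sub>L f' x0 = id_blinfun"
  by (rule blinfun_eqI) (simp add: g0 f' matrix_vector_mul_assoc matrix_inv_id[OF assms(4)])
 obtain U' V psi g' where UV: "open U'" "U' \<subseteq> U" "x0 \<in> U'" "open V" "phi x0 \<in> V" "homeomorphism U' V phi psi"
  and g': "!!y. y \<in> V ==> (psi has_derivative g' y) (at y)" "!!y. y \<in> V ==> g' y = Hilbert_Choice.inv (blinfun_apply (f' (psi y)))"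
  "!!y. y \<in> V ==> bij (blinfun_apply (f' (psi y)))"
  using inverse_function_theorem[OF assms(1) der cont assms(3) inv] by blast
 have psiU: "psi y \<in> U" if "y \<in> V" for y using UV(2,6) that by (auto simp: homeomorphism_def)
 have detnz: "det (jac phi (psi y)) \<noteq> 0" if "y \<in> V" for y
  using g'(3)[OF that] unfolding f' invertible_det_nz[symmetric] invertible_eq_bij .
 have pdpsi: "pd c psi y $ i = matrix_inv (jac phi (psi y)) $ i $ c" if y: "y \<in> V" for c y i
 proof -
  have "jac phi (psi y) *v (matrix_inv (jac phi (psi y)) *v axis c 1) = axis c 1"
   by (simp add: matrix_vector_mul_assoc matrix_inv_id[OF detnz[OF y]])
  then have "Hilbert_Choice.inv (blinfun_apply (f' (psi y))) (axis c 1) = matrix_inv (jac phi (psi y)) *v axis c 1"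
   using bij_is_inj[OF g'(3)[OF y]] unfolding f' by (metis inv_f_f)
  then have "pd c psi y = matrix_inv (jac phi (psi y)) *v axis c 1"
   using pd_eqI[OF g'(1)[OF y]] g'(2)[OF y] by simp
  then show ?thesis by (simp add: mv_mult axis_def if_distrib cong: if_cong)
 qed
 have dif: "psi differentiable at y" if "y \<in> V" for y using g'(1)[OF that] by (auto simp: differentiable_def)
 have jacC: "Ck_on k U (\<lambda>x. jac phi x $ i $ j)" for k i j
  unfolding jac_def using smooth_Ck[OF smooth_component[OF assms(1) smooth_pd[OF assms(2)]]] by simp
 have "Ck_on k V psi" for k
 proof (induction k)
  case 0
  then show ?case using UV(6) by (simp add: homeomorphism_def)
 next
  case (Suc k)
  have jk: "Ck_on k V (\<lambda>y. jac phi (psi y) $ i $ j)" for i j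
   by (rule Ck_compose[OF UV(4) jacC Suc]) (use psiU in blast)
  have "Ck_on k V (pd c psi)" for c
  proof (rule Ck_cong[OF UV(4)])
   show "Ck_on k V (\<lambda>y. \<chi> i. matrix_inv (jac phi (psi y)) $ i $ c)"
    by (intro Ck_vec_lambda UV Ck_matrix_inv jk detnz)
  qed (simp add: vec_eq_iff pdpsi)
  then show ?case using dif by simp
 qed
 then have "smooth_on V psi" by (simp add: smooth_on_def)
 then show ?thesis using that UV by blast
qed

text \<open>The derivative of t f(ray K t x) in t, integrated from 0 to 1.\<close>

lemma ray_int_euler:
 fixes K :: "'n::finite set"
 assumes f: "Ck_on 1 (ball 0 rho) f" and x: "x \<in> ball 0 rho"
 shows "f x = ray_int K 0 f x + (\<Sum>b\<in>-K. x $ b * ray_int K 1 (pd b f) x)"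
proof -
 have fd: "f differentiable at z" "continuous_on (ball 0 rho) (pd b f)" if "z \<in> ball 0 rho" for z b
  using f that by auto
 have fc: "continuous_on (ball 0 rho) f" by (rule Ck_imp_continuous[OF f])
 let ?D = "\<lambda>t. f (ray K t x) + t * (\<Sum>b\<in>UNIV. (if b \<in> K then 0 else x $ b) * pd b f (ray K t x))"
 have "(?D has_integral (1 * f (ray K 1 x) - 0 * f (ray K 0 x))) {0..1}"
 proof (rule fundamental_theorem_of_calculus)
  fix t :: real assume t: "t \<in> {0..1}"
  let ?q = "\<chi> b. if b \<in> K then 0 else x $ b"
  have ray: "ray K t x = (x - ?q) + t *\<^sub>R ?q" for t by (auto simp: vec_eq_iff ray_def)
  have "((\<lambda>t. ray K t x) has_derivative (\<lambda>h. h *\<^sub>R ?q)) (at t within {0..1})"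
   unfolding ray by (auto intro!: derivative_eq_intros)
  from has_derivative_compose[OF this has_derivative_pd[OF fd(1)[OF ray_in_ball[OF t x]]]]
  have "((\<lambda>t. f (ray K t x)) has_vector_derivative (\<Sum>b\<in>UNIV. (if b \<in> K then 0 else x $ b) * pd b f (ray K t x))) (at t within {0..1})"
   by (simp add: has_vector_derivative_def sum_distrib_left mult.assoc)
  from has_vector_derivative_mult[OF has_vector_derivative_id this]
  show "((\<lambda>t. t * f (ray K t x)) has_vector_derivative ?D t) (at t within {0..1})" by (simp add: algebra_simps)
 qed simp
 then have "f x = integral {0..1} ?D" by (simp add: integral_unique)
 also have "... = integral {0..1} (\<lambda>t. t ^ 0 * f (ray K t x) + (\<Sum>b\<in>-K. x $ b * (t ^ 1 * pd b f (ray K t x))))"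
 proof (rule integral_cong)
  fix t :: real
  have "(\<Sum>b\<in>UNIV. (if b \<in> K then 0 else x $ b) * pd b f (ray K t x)) = (\<Sum>b\<in>-K. x $ b * pd b f (ray K t x))"
   by (rule sum.mono_neutral_cong_right) auto
  then show "?D t = t ^ 0 * f (ray K t x) + (\<Sum>b\<in>-K. x $ b * (t ^ 1 * pd b f (ray K t x)))"
   by (simp add: sum_distrib_left mult_ac)
 qed
 also have "... = integral {0..1} (\<lambda>t. t ^ 0 * f (ray K t x)) + (\<Sum>b\<in>-K. x $ b * integral {0..1} (\<lambda>t. t ^ 1 * pd b f (ray K t x)))"
 proof -
  have I: "(\<lambda>t. t ^ 1 * pd b f (ray K t x)) integrable_on {0..1}" "(\<lambda>t. t ^ 0 * f (ray K t x)) integrable_on {0..1}" for b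
   using ray_integrable[OF fd(2)[OF x, of b] x, where j=1 and K=K] ray_integrable[OF fc x, where j=0 and K=K] by auto
  have "integral {0..1} (\<lambda>t. \<Sum>b\<in>-K. x $ b * (t ^ 1 * pd b f (ray K t x))) = (\<Sum>b\<in>-K. integral {0..1} (\<lambda>t. x $ b * (t ^ 1 * pd b f (ray K t x))))"
   by (rule integral_sum) (intro integrable_on_mult_right I finite)+
  moreover have "integral {0..1} (\<lambda>t. t ^ 0 * f (ray K t x) + (\<Sum>b\<in>-K. x $ b * (t ^ 1 * pd b f (ray K t x))))
   = integral {0..1} (\<lambda>t. t ^ 0 * f (ray K t x)) + integral {0..1} (\<lambda>t. \<Sum>b\<in>-K. x $ b * (t ^ 1 * pd b f (ray K t x)))"
   by (rule integral_add) (intro I integrable_sum integrable_on_mult_right finite)+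
  ultimately show ?thesis by simp
 qed
 finally show ?thesis by (simp add: ray_int_def)
qed

text \<open>\<open>int\<close> says that the vector fields E_a = d_a + N_a with a outside
  \<open>K\<close> commute. The solution of the ray equation should map each d_a to E_a; the defect
  satisfies a homogeneous linear ray equation thanks to \<open>int\<close>, so it vanishes.\<close>

theorem frobenius_straightening:
 fixes N :: "'n::finite => 'n => real ^ 'n => real" and K :: "'n set"
 assumes N: "!!i a. smooth_on (ball 0 R) (N i a)" and R: "0 < R"
  and N0: "!!i a. i \<notin> K \<or> a \<in> K ==> N i a = (\<lambda>x. 0)"
  and int: "!!i a b x. x \<in> ball 0 R ==> a \<notin> K ==> b \<notin> K ==>
   pd b (N i a) x + (\<Sum>l\<in>UNIV. N l b x * pd l (N i a) x) = pd a (N i b) x + (\<Sum>l\<in>UNIV. N l a x * pd l (N i b) x)"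
 obtains rho phi where "0 < rho" "smooth_on (ball 0 rho) phi" "!!x. x \<in> ball 0 rho ==> phi x \<in> ball 0 R" "phi 0 = 0"
  "!!a x i. a \<notin> K ==> x \<in> ball 0 rho ==> pd a phi x $ i = (if i = a then 1 else 0) + N i a (phi x)"
  "det (jac phi 0) \<noteq> 0"
proof -
 define R' where "R' = R / 2"
 have R': "0 < R'" "R' < R" using R by (auto simp: R'_def)
 have sub: "cball 0 R' \<subseteq> ball (0 :: real ^ 'n) R" using R' by auto
 define C where "C i a = (SOME C. 0 \<le> C \<and> derivs_le 1 C (cball 0 R') (N i a))" for i a
 have C: "0 \<le> C i a \<and> derivs_le 1 (C i a) (cball 0 R') (N i a)" for i a
  unfolding C_def using derivs_le_compact[OF N compact_cball sub, where k=1]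
  by (rule someI_ex) blast
 define b where "b = (\<Sum>i\<in>UNIV. \<Sum>a\<in>UNIV. C i a)"
 have Cb: "C i a \<le> b" for i a
 proof -
  have "C i a \<le> (\<Sum>a\<in>UNIV. C i a)" by (rule member_le_sum) (use C in auto)
  also have "... \<le> b" unfolding b_def by (rule member_le_sum[of i]) (use C in \<open>auto intro!: sum_nonneg\<close>)
  finally show ?thesis .
 qed
 have b: "0 \<le> b" using Cb C order_trans by blast
 have Nb: "\<bar>N i a u\<bar> \<le> b" if "u \<in> cball 0 R'" for i a u
  using C[of i a] that Cb[of i a] by (auto intro: order_trans)
 have dNb: "\<bar>pd l (N i a) u\<bar> \<le> b" if "u \<in> cball 0 R'" for i a l u
 proof -
  have "derivs_le 0 (C i a) (cball 0 R') (pd l (N i a))" using C[of i a] by simp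
  then show ?thesis using that Cb[of i a] by (auto intro: order_trans)
 qed
 define n where "n = real CARD('n)"
 have n: "n \<ge> 1" unfolding n_def using one_le_card_finite[where 'a='n] by simp
 \<comment> \<open>The two entries are chosen for the contraction condition and for the range
   condition of the ray equation.\<close>
 define rho where "rho = min (1 / (4 * (n\<^sup>2 * b + 1))) (R' / (n * (1 + n * b)))"
 have "1 + n * b > 0" using n b by (intro add_pos_nonneg mult_nonneg_nonneg) auto
 moreover have "n\<^sup>2 * b + 1 > 0" using n b by (intro add_nonneg_pos mult_nonneg_nonneg) auto
 ultimately have pos: "n\<^sup>2 * b + 1 > 0" "n * (1 + n * b) > 0" using n by auto
 have rho: "rho > 0" using pos R' by (simp add: rho_def)
 have small: "n\<^sup>2 * rho * b \<le> 1 / 4"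
 proof -
  have "rho \<le> 1 / (4 * (n\<^sup>2 * b + 1))" by (simp add: rho_def)
  then have "(n\<^sup>2 * b + 1) * rho \<le> (n\<^sup>2 * b + 1) * (1 / (4 * (n\<^sup>2 * b + 1)))" using pos by (intro mult_left_mono) auto
  also have "... = 1 / 4" using pos by (simp add: field_simps)
  finally show ?thesis using rho by (simp add: algebra_simps)
 qed
 have range: "n * (rho * (1 + n * b)) \<le> R'"
 proof -
  have "rho \<le> R' / (n * (1 + n * b))" by (simp add: rho_def)
  then have "(n * (1 + n * b)) * rho \<le> (n * (1 + n * b)) * (R' / (n * (1 + n * b)))" using pos by (intro mult_left_mono) auto
  also have "... = R'" using pos by (simp add: field_simps)
  finally show ?thesis by (simp add: algebra_simps)
 qed
 obtain phi where phi: "smooth_on (ball 0 rho) phi" "!!x. x \<in> ball 0 rho ==> phi x \<in> cball 0 R'"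
  and phieq: "!!i x. x \<in> ball 0 rho ==> phi x $ i = x $ i + (\<Sum>a\<in>UNIV. x $ a * ray_int K 0 (\<lambda>x. N i a (phi x)) x)"
  and pdphi: "!!c i x. x \<in> ball 0 rho ==> pd c phi x $ i = ((if i = c then 1 else 0) + ray_int K 0 (\<lambda>x. N i c (phi x)) x) +
   ray_op K (ray_wt K c) (\<lambda>i a l x. pd l (N i a) (phi x)) (\<lambda>l. pd c (\<lambda>x. phi x $ l)) i x"
  by (rule nonlinear_ray_equation[where N=N and K=K and R=R and R'=R' and b=b and rho=rho])
   (assumption | rule N R' b Nb dNb small[unfolded n_def] rho range[unfolded n_def] that)+
 let ?B = "ball (0 :: real ^ 'n) rho"
 have phiR: "phi x \<in> ball 0 R" if "x \<in> ?B" for x using phi(2)[OF that] sub by blast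
 have phid: "phi differentiable at x" if "x \<in> ?B" for x by (rule smoothD[OF phi(1) that])
 have smN: "smooth_on ?B (\<lambda>x. N i a (phi x))" for i a
  by (rule smooth_compose[OF open_ball N phi(1)]) (use phiR in blast)
 have smdN: "smooth_on ?B (\<lambda>x. pd l (N i a) (phi x))" for i a l
  by (rule smooth_compose[OF open_ball smooth_pd[OF N] phi(1)]) (use phiR in blast)
 have z0: "(0 :: real ^ 'n) \<in> ?B" using rho by simp
 have phi0: "phi 0 = 0" using phieq[OF z0] by (simp add: vec_eq_iff)
 \<comment> \<open>The defect: how far phi is from mapping d_a to E_a.\<close>
 define F where "F a i x = pd a phi x $ i - (if i = a then 1 else 0) - N i a (phi x)" for a i x
 have conF: "continuous_on ?B (F a i)" for a i
  unfolding F_def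
  by (intro continuous_intros smoothC[OF smN] smoothC[OF smooth_component[OF open_ball smooth_pd[OF phi(1)]]])
 \<comment> \<open>What remains of d_a(N_c phi) - d_c(N_a phi) when the derivatives of phi are
   replaced by their expected values plus the defect; the expected values cancel by
   \<open>int\<close>.\<close>
 define G where "G a i c x = (\<Sum>l\<in>UNIV. pd l (N i c) (phi x) * F a l x - pd l (N i a) (phi x) * F c l x)" for a i c x
 have conG: "continuous_on ?B (G a i c)" for a i c
  unfolding G_def by (intro continuous_intros smoothC[OF smdN] conF)
 have Feq: "F a i x = (\<Sum>c\<in>-K. x $ c * ray_int K 1 (G a i c) x)" if a: "a \<notin> K" and x: "x \<in> ?B" for a i x
 proof -
  let ?P = "\<lambda>c y. \<Sum>l\<in>UNIV. pd l (N i c) (phi y) * pd a (\<lambda>x. phi x $ l) y"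
  let ?Q = "\<lambda>c. pd c (\<lambda>x. N i a (phi x))"
  have zero: "?P c = (\<lambda>y. 0)" if "c \<in> K" for c using N0[of i c] that by simp
  have "pd a phi x $ i = ((if i = a then 1 else 0) + ray_int K 0 (\<lambda>x. N i a (phi x)) x) + (\<Sum>c\<in>UNIV. x $ c * ray_int K 1 (?P c) x)"
   using pdphi[OF x, of a i] a by (simp add: ray_op_def ray_wt_def)
  also have "(\<Sum>c\<in>UNIV. x $ c * ray_int K 1 (?P c) x) = (\<Sum>c\<in>-K. x $ c * ray_int K 1 (?P c) x)"
  proof (rule sum.mono_neutral_right)
   show "\<forall>c\<in>UNIV - - K. x $ c * ray_int K 1 (?P c) x = 0"
   proof
    fix c assume "c \<in> UNIV - - K"
    then have "?P c = (\<lambda>y. 0)" by (intro zero) simp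
    then have "ray_int K 1 (?P c) x = ray_int K 1 (\<lambda>y. 0) x" by (rule arg_cong[where f="\<lambda>h. ray_int K 1 h x"])
    then show "x $ c * ray_int K 1 (?P c) x = 0" by (simp add: ray_int_def)
   qed
  qed auto
  finally have 1: "pd a phi x $ i = ((if i = a then 1 else 0) + ray_int K 0 (\<lambda>x. N i a (phi x)) x) + (\<Sum>c\<in>-K. x $ c * ray_int K 1 (?P c) x)" .
  have 2: "N i a (phi x) = ray_int K 0 (\<lambda>x. N i a (phi x)) x + (\<Sum>c\<in>-K. x $ c * ray_int K 1 (?Q c) x)"
   by (rule ray_int_euler[OF smooth_Ck[OF smN] x])
  have G: "ray_int K 1 (?P c) x - ray_int K 1 (?Q c) x = ray_int K 1 (G a i c) x" if c: "c \<notin> K" for c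
  proof -
   have cP: "continuous_on ?B (?P c)"
    by (intro continuous_intros smoothC[OF smdN] smoothC[OF smooth_pd[OF smooth_component[OF open_ball phi(1)]]])
   have cQ: "continuous_on ?B (?Q c)" by (rule smoothC[OF smooth_pd[OF smN]])
   have "?P c y - ?Q c y = G a i c y" if y: "y \<in> ?B" for y
   proof -
    have pc: "pd e (\<lambda>x. phi x $ l) y = F e l y + (if l = e then 1 else 0) + N l e (phi y)" for e l
     using pd_component[OF phid[OF y], of e l] by (simp add: F_def)
    have dN: "N i a differentiable at (phi y)" by (rule smoothD[OF N phiR[OF y]])
    have Q: "?Q c y = (\<Sum>l\<in>UNIV. pd l (N i a) (phi y) * pd c (\<lambda>x. phi x $ l) y)"
     using pd_compose(1)[OF dN phid[OF y], of c] by (simp add: pd_component[OF phid[OF y]] mult.commute)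
    have s: "(\<Sum>l\<in>UNIV. pd l (N i c) (phi y) * (if l = a then 1 else 0)) = pd a (N i c) (phi y)"
     "(\<Sum>l\<in>UNIV. pd l (N i a) (phi y) * (if l = c then 1 else 0)) = pd c (N i a) (phi y)"
     by (simp_all add: if_distrib cong: if_cong)
    show ?thesis
     using int[OF phiR[OF y] a c, of i]
     by (simp add: Q pc G_def distrib_left sum.distrib sum_subtractf s mult.commute[of "N _ _ _"])
   qed
   then have "ray_int K 1 (G a i c) x = ray_int K 1 (\<lambda>y. ?P c y - ?Q c y) x"
    by (intro ray_int_cong[OF _ x]) simp
   then show ?thesis using ray_int_diff[OF cP cQ x, of K 1] by simp
  qed
  have "F a i x = (\<Sum>c\<in>-K. x $ c * (ray_int K 1 (?P c) x - ray_int K 1 (?Q c) x))"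
   using 1 2 by (simp add: F_def right_diff_distrib sum_subtractf)
  also have "... = (\<Sum>c\<in>-K. x $ c * ray_int K 1 (G a i c) x)"
   by (rule sum.cong[OF refl], subst G) auto
  finally show ?thesis .
 qed
 have F0: "F a i x = 0" if a: "a \<notin> K" and x: "x \<in> ?B" for a i x
 proof -
  define rho' where "rho' = norm x"
  have rho': "rho' < rho" "x \<in> cball 0 rho'" using x by (auto simp: rho'_def)
  have sub': "cball 0 rho' \<subseteq> ball (0 :: real ^ 'n) rho" using rho' by auto
  have "\<exists>B. \<forall>x\<in>cball 0 rho'. \<bar>F a i x\<bar> \<le> B" for a i
   using compact_imp_bounded[OF compact_continuous_image[OF continuous_on_subset[OF conF sub'] compact_cball]]
   unfolding bounded_iff by auto
  then obtain B where B: "!!a i x. x \<in> cball 0 rho' ==> \<bar>F a i x\<bar> \<le> B a i" by metis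
  have B0: "0 \<le> B a i" for a i using B[OF rho'(2)] abs_ge_zero order_trans by blast
  define M where "M = (\<Sum>k\<in>UNIV. B (fst k) (snd k))"
  have "B a i \<le> M" for a i unfolding M_def using B0 member_le_sum[of "(a, i)" UNIV "\<lambda>k. B (fst k) (snd k)"] by simp
  then have M: "M \<ge> 0" "!!a i x. x \<in> cball 0 rho' ==> \<bar>F a i x\<bar> \<le> M" using B0 B order_trans by blast+
  \<comment> \<open>Each application of the equation gains the factor 2 n^2 rho b \<le> 1/2, so the
    defect is below every M 2^(-k).\<close>
  have le: "\<bar>F a i x\<bar> \<le> M * (1 / 2) ^ k" if "a \<notin> K" "x \<in> cball 0 rho'" for k a i x
   using that
  proof (induction k arbitrary: a i x)
   case 0
   then show ?case using M(2)[of x a i] by simp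
  next
   case (Suc k)
   let ?S = "M * (1 / 2) ^ k"
   have x': "x \<in> ?B" using Suc.prems sub' by blast
   have "\<bar>\<Sum>c\<in>-K. x $ c * ray_int K 1 (G a i c) x\<bar> \<le> (\<Sum>c\<in>-K. rho * (n * (b * ?S + b * ?S)))"
   proof (intro order_trans[OF sum_abs] sum_mono)
    fix c assume c: "c \<in> -K"
    have "\<bar>x $ c\<bar> \<le> rho" using component_le_norm_cart[of x c] x' by auto
    moreover have "\<bar>ray_int K 1 (G a i c) x\<bar> \<le> n * (b * ?S + b * ?S)"
    proof (rule ray_int_bound[OF conG x'])
     fix t :: real assume t: "t \<in> {0..1}"
     let ?y = "ray K t x"
     have y: "?y \<in> cball 0 rho'" by (rule ray_in_cball[OF t Suc.prems(2)])
     have y': "phi ?y \<in> cball 0 R'" by (rule phi(2)) (use y sub' in blast)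
     have "\<bar>G a i c ?y\<bar> \<le> (\<Sum>l\<in>(UNIV :: 'n set). b * ?S + b * ?S)"
      unfolding G_def
     proof (intro order_trans[OF sum_abs] sum_mono order_trans[OF abs_triangle_ineq4] add_mono)
      show "\<bar>pd l (N i c) (phi ?y) * F a l ?y\<bar> \<le> b * ?S" for l
       unfolding abs_mult by (intro mult_mono dNb[OF y'] Suc.IH y Suc.prems b) auto
      show "\<bar>pd l (N i a) (phi ?y) * F c l ?y\<bar> \<le> b * ?S" for l
       unfolding abs_mult using c by (intro mult_mono dNb[OF y'] Suc.IH y b) auto
     qed
     then show "\<bar>G a i c ?y\<bar> \<le> n * (b * ?S + b * ?S)" by (simp add: n_def)
    qed
    ultimately show "\<bar>x $ c * ray_int K 1 (G a i c) x\<bar> \<le> rho * (n * (b * ?S + b * ?S))"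
     unfolding abs_mult using rho by (intro mult_mono) auto
   qed
   also have "... = real (card (-K)) * (rho * (n * (b * ?S + b * ?S)))" by simp
   also have "... \<le> n * (rho * (n * (b * ?S + b * ?S)))"
    using rho n b M(1) unfolding n_def by (intro mult_right_mono) (auto intro!: card_mono mult_nonneg_nonneg add_nonneg_nonneg)
   also have "... = (n\<^sup>2 * rho * b) * (2 * ?S)" by (simp add: power2_eq_square)
   also have "... \<le> (1 / 4) * (2 * ?S)" using M(1) by (intro mult_right_mono small) auto
   finally show ?case unfolding Feq[OF Suc.prems(1) x'] by simp
  qed
  have "(\<lambda>k. M * (1 / 2 :: real) ^ k) \<longlonglongrightarrow> M * 0" by (intro tendsto_intros LIMSEQ_realpow_zero) auto
  then have "\<bar>F a i x\<bar> \<le> M * 0"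
   by (rule tendsto_lowerbound) (use le[OF a rho'(2)] in auto)
  then show ?thesis by simp
 qed
 have der: "pd a phi x $ i = (if i = a then 1 else 0) + N i a (phi x)" if "a \<notin> K" "x \<in> ?B" for a x i
  using F0[OF that, of i] by (simp add: F_def)
 have jac0: "jac phi 0 $ i $ c = (if i = c then 1 else 0) + N i c 0" for i c
 proof -
  have "ray K t (0 :: real ^ 'n) = 0" for t by (simp add: vec_eq_iff ray_def)
  then show ?thesis using pdphi[OF z0, of c i] phi0 by (simp add: jac_def ray_op_def ray_int_def)
 qed
 \<comment> \<open>At 0 the Jacobian is 1 + N. As \<open>N\<close> maps the directions outside
   \<open>K\<close> into those of \<open>K\<close> and kills the latter, N N = 0 and 1 - N is its
   inverse.\<close>
 define M where "M = ((\<chi> i c. (if i = c then 1 else 0) - N i c 0) :: real ^ 'n ^ 'n)"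
 have "jac phi 0 ** M = mat 1"
 proof -
  have NN: "(\<Sum>k\<in>UNIV. N i k 0 * N k j 0) = 0" for i j
  proof (rule sum.neutral, rule ballI)
   fix k
   show "N i k 0 * N k j 0 = 0" using N0[of i k] N0[of k j] by (cases "k \<in> K") auto
  qed
  have "(\<Sum>k\<in>UNIV. ((if i = k then 1 else 0) + N i k 0) * ((if k = j then 1 else 0) - N k j 0)) = (if i = j then 1 else 0)" for i j
  proof -
   have "(\<Sum>k\<in>UNIV. ((if i = k then 1 else 0) + N i k 0) * ((if k = j then 1 else 0) - N k j 0))
    = (\<Sum>k\<in>UNIV. (if i = k then (if k = j then 1 else 0) - N k j 0 else 0)) + (\<Sum>k\<in>UNIV. (if k = j then N i k 0 else 0)) - (\<Sum>k\<in>UNIV. N i k 0 * N k j 0)"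
    unfolding sum.distrib[symmetric] sum_subtractf[symmetric] by (rule sum.cong) (auto simp: algebra_simps)
   then show ?thesis by (simp add: NN)
  qed
  then show ?thesis by (simp add: vec_eq_iff mm_mult jac0 M_def mat_def)
 qed
 then have "det (jac phi 0) * det M = 1" by (metis det_mul det_I)
 then have "det (jac phi 0) \<noteq> 0" by auto
 with that rho phi(1) phiR phi0 der show ?thesis by blast
qed

section \<open>Covector fields, their pullbacks and their straightening\<close>

text \<open>For a covector field \<open>theta\<close> this says \<open>theta \<and> dtheta = 0\<close>, in a form that is convenient for complex \<open>theta\<close>.\<close>

definition kernel_closed :: "(real ^ 'n) set => ('n => real ^ 'n => complex) => bool"
 where "kernel_closed S theta \<longleftrightarrow> (\<forall>x\<in>S. \<forall>v w. (\<Sum>i\<in>UNIV. theta i x * v i) = 0 --> (\<Sum>i\<in>UNIV. theta i x * w i) = 0 -->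
  (\<Sum>i\<in>UNIV. \<Sum>j\<in>UNIV. (pd i (theta j) x - pd j (theta i) x) * v i * w j) = 0)"

text \<open>The real kernel of the covector meets the coordinate plane of \<open>K\<close> in 0
  only. For K = {a} this means a nonzero component, for two indices that the two components are
  linearly independent over the reals.\<close>

definition real_independent_on :: "'n::finite set => ('n => complex) => bool"
 where "real_independent_on K z \<longleftrightarrow>
  (\<forall>W. (\<forall>i. i \<notin> K --> W i = 0) --> (\<Sum>i\<in>UNIV. of_real (W i) * z i) = 0 --> (\<forall>i. W i = 0))"

definition pullback :: "(real ^ 'n => real ^ 'n) => ('n => real ^ 'n => complex) => 'n => real ^ 'n => complex"
 where "pullback phi theta b x = (\<Sum>i\<in>UNIV. theta i (phi x) * of_real (pd b phi x $ i))"

lemma smooth_pullback: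
 assumes "open S" "!!i. smooth_on T (theta i)" "smooth_on S phi" "phi ` S \<subseteq> T"
 shows "smooth_on S (pullback phi theta b)"
 unfolding pullback_def
 by (intro smooth_sum smooth_mult smooth_of_real smooth_component smooth_pd assms(1,3)
   smooth_compose[OF assms(1,2,3,4)])

text \<open>The exterior derivative commutes with pullback: the terms with second derivatives of phi
  are symmetric in a and b and cancel.\<close>

lemma pullback_exterior_derivative:
 assumes "open S" "open T" "!!i. smooth_on T (theta i)" "smooth_on S phi" "phi ` S \<subseteq> T" and x: "x \<in> S"
 shows "pd a (pullback phi theta b) x - pd b (pullback phi theta a) x =
  (\<Sum>i\<in>UNIV. \<Sum>j\<in>UNIV. (pd i (theta j) (phi x) - pd j (theta i) (phi x)) * of_real (pd a phi x $ i) * of_real (pd b phi x $ j))"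
proof -
 have dtheta: "theta j differentiable at (phi x)" for j using assms smoothD[OF assms(3)] by blast
 have dphi: "phi differentiable at x" by (rule smoothD[OF assms(4) x])
 have dpd: "pd b phi differentiable at x" for b by (rule smoothD[OF smooth_pd[OF assms(4)] x])
 have d1: "(\<lambda>x. theta j (phi x)) differentiable at x" for j by (rule pd_compose(2)[OF dtheta dphi])
 have d2: "(\<lambda>x. pd b phi x $ j) differentiable at x" for b j by (rule differentiable_linear[OF bounded_linear_vec_nth dpd])
 have d3: "(\<lambda>x. of_real (pd b phi x $ j) :: complex) differentiable at x" for b j
  by (rule differentiable_linear[OF bounded_linear_of_real d2])
 have pd3: "pd a (\<lambda>x. of_real (pd b phi x $ j) :: complex) x = of_real (pd a (pd b phi) x $ j)" for a b j
  by (simp add: pd_linear[OF bounded_linear_of_real d2] pd_component[OF dpd])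
 have sym: "pd a (pd b phi) x = pd b (pd a phi) x" by (rule pd_commute[OF smooth_Ck[OF assms(4)] assms(1) x])
 have P: "pd a (pullback phi theta b) x = (\<Sum>j\<in>UNIV. theta j (phi x) * of_real (pd a (pd b phi) x $ j)) +
  (\<Sum>j\<in>UNIV. \<Sum>i\<in>UNIV. pd i (theta j) (phi x) * of_real (pd a phi x $ i) * of_real (pd b phi x $ j))" for a b
 proof -
  have "pd a (pullback phi theta b) x = (\<Sum>j\<in>UNIV. theta j (phi x) * of_real (pd a (pd b phi) x $ j) + pd a (\<lambda>x. theta j (phi x)) x * of_real (pd b phi x $ j))"
   unfolding pullback_def[abs_def] using d1 d3 by (subst pd_sum) (auto simp: pd_mult pd3 intro: differentiable_mult)
  then show ?thesis
   by (simp add: pd_compose(1)[OF dtheta dphi] sum.distrib sum_distrib_left sum_distrib_right scaleR_conv_of_real mult_ac)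
 qed
 have "pd a (pullback phi theta b) x - pd b (pullback phi theta a) x =
  (\<Sum>j\<in>UNIV. \<Sum>i\<in>UNIV. pd i (theta j) (phi x) * of_real (pd a phi x $ i) * of_real (pd b phi x $ j)) -
  (\<Sum>j\<in>UNIV. \<Sum>i\<in>UNIV. pd i (theta j) (phi x) * of_real (pd b phi x $ i) * of_real (pd a phi x $ j))"
  using sym by (simp add: P)
 also have "(\<Sum>j\<in>UNIV. \<Sum>i\<in>UNIV. pd i (theta j) (phi x) * of_real (pd a phi x $ i) * of_real (pd b phi x $ j)) =
  (\<Sum>i\<in>UNIV. \<Sum>j\<in>UNIV. pd i (theta j) (phi x) * of_real (pd a phi x $ i) * of_real (pd b phi x $ j))"
  by (rule sum.swap)
 also have "... - (\<Sum>j\<in>UNIV. \<Sum>i\<in>UNIV. pd i (theta j) (phi x) * of_real (pd b phi x $ i) * of_real (pd a phi x $ j)) =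
  (\<Sum>i\<in>UNIV. \<Sum>j\<in>UNIV. (pd i (theta j) (phi x) - pd j (theta i) (phi x)) * of_real (pd a phi x $ i) * of_real (pd b phi x $ j))"
  unfolding sum_subtractf[symmetric] by (intro sum.cong refl) (simp add: algebra_simps)
 finally show ?thesis .
qed

lemma sum_swap_pairs:
 "(\<Sum>a\<in>A. \<Sum>b\<in>B. \<Sum>i\<in>I. \<Sum>j\<in>J. f a b i j) = (\<Sum>i\<in>I. \<Sum>j\<in>J. \<Sum>a\<in>A. \<Sum>b\<in>B. f a b i j)"
proof -
 have "(\<Sum>a\<in>A. \<Sum>b\<in>B. \<Sum>i\<in>I. \<Sum>j\<in>J. f a b i j) = (\<Sum>a\<in>A. \<Sum>i\<in>I. \<Sum>b\<in>B. \<Sum>j\<in>J. f a b i j)"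
  by (intro sum.cong refl sum.swap)
 also have "... = (\<Sum>i\<in>I. \<Sum>a\<in>A. \<Sum>j\<in>J. \<Sum>b\<in>B. f a b i j)"
  by (subst sum.swap) (intro sum.cong refl sum.swap)
 finally show ?thesis by (simp only: sum.swap[of _ A J])
qed

text \<open>Vectors in the kernel of the pullback are pushed forward, as complex vectors, into the
  kernel of theta, and the exterior derivative is natural.\<close>

lemma kernel_closed_pullback:
 fixes theta :: "'n::finite => real ^ 'n => complex"
 assumes "open S" "open T" "!!i. smooth_on T (theta i)" "smooth_on S phi" "phi ` S \<subseteq> T" "kernel_closed T theta"
 shows "kernel_closed S (pullback phi theta)"
 unfolding kernel_closed_def
proof (intro ballI allI impI)
 fix x and v w :: "'n => complex" assume x: "x \<in> S" and v: "(\<Sum>i\<in>UNIV. pullback phi theta i x * v i) = 0" and w: "(\<Sum>i\<in>UNIV. pullback phi theta i x * w i) = 0"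
 define P where "P v i = (\<Sum>a\<in>UNIV. of_real (pd a phi x $ i) * v a)" for v :: "'n => complex" and i
 have push: "(\<Sum>i\<in>UNIV. pullback phi theta i x * v' i) = (\<Sum>i\<in>UNIV. theta i (phi x) * P v' i)" for v'
  unfolding pullback_def P_def sum_distrib_left sum_distrib_right by (subst sum.swap) (simp add: mult.assoc)
 have "(\<Sum>i\<in>UNIV. \<Sum>j\<in>UNIV. (pd i (theta j) (phi x) - pd j (theta i) (phi x)) * P v i * P w j) = 0"
  using assms(5,6) x v w unfolding push kernel_closed_def by (meson image_subset_iff)
 moreover have "(\<Sum>a\<in>UNIV. \<Sum>b\<in>UNIV. (pd a (pullback phi theta b) x - pd b (pullback phi theta a) x) * v a * w b)
  = (\<Sum>i\<in>UNIV. \<Sum>j\<in>UNIV. (pd i (theta j) (phi x) - pd j (theta i) (phi x)) * P v i * P w j)"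
 proof -
  let ?D = "\<lambda>i j. pd i (theta j) (phi x) - pd j (theta i) (phi x)"
  let ?d = "\<lambda>a i. complex_of_real (pd a phi x $ i)"
  have "(\<Sum>a\<in>UNIV. \<Sum>b\<in>UNIV. (pd a (pullback phi theta b) x - pd b (pullback phi theta a) x) * v a * w b)
   = (\<Sum>a\<in>UNIV. \<Sum>b\<in>UNIV. \<Sum>i\<in>UNIV. \<Sum>j\<in>UNIV. ?D i j * (?d a i * v a) * (?d b j * w b))"
   by (simp only: pullback_exterior_derivative[OF assms(1-5) x] sum_distrib_right) (simp add: mult_ac)
  also have "... = (\<Sum>i\<in>UNIV. \<Sum>j\<in>UNIV. \<Sum>a\<in>UNIV. \<Sum>b\<in>UNIV. ?D i j * (?d a i * v a) * (?d b j * w b))"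
   by (rule sum_swap_pairs)
  also have "... = (\<Sum>i\<in>UNIV. \<Sum>j\<in>UNIV. ?D i j * P v i * P w j)"
   unfolding P_def mult.assoc sum_product by (simp only: sum_distrib_left)
  finally show ?thesis .
 qed
 ultimately show "(\<Sum>i\<in>UNIV. \<Sum>j\<in>UNIV. (pd i (pullback phi theta j) x - pd j (pullback phi theta i) x) * v i * w j) = 0"
  by simp
qed

text \<open>\<open>rel\<close> says that theta annihilates the real fields E_a = d_a + N_a, a
  outside \<open>K\<close>. The bracket of two of them is a real vector supported in
  \<open>K\<close>; theta annihilates it because it is closed on its kernel, so \<open>ind\<close>
  makes it zero and Frobenius applies.\<close>

theorem covector_straightening:
 fixes theta :: "'n::finite => real ^ 'n => complex" and N :: "'n => 'n => real ^ 'n => real" and K :: "'n set"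
 assumes R: "R > 0" and theta: "!!i. smooth_on (ball 0 R) (theta i)" and N: "!!i a. smooth_on (ball 0 R) (N i a)"
  and N0: "!!i a. i \<notin> K \<or> a \<in> K ==> N i a = (\<lambda>x. 0)"
  and rel: "!!a x. x \<in> ball 0 R ==> a \<notin> K ==> theta a x + (\<Sum>k\<in>UNIV. of_real (N k a x) * theta k x) = 0"
  and ind: "!!x. x \<in> ball 0 R ==> real_independent_on K (\<lambda>i. theta i x)"
  and ker: "kernel_closed (ball 0 R) theta"
 obtains r phi psi V where "0 < r" "smooth_on (ball 0 r) phi" "open V" "smooth_on V psi" "homeomorphism (ball 0 r) V phi psi"
  "phi 0 = 0" "V \<subseteq> ball 0 R"
  "!!a x. x \<in> ball 0 r ==> a \<notin> K ==> pullback phi theta a x = 0"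
  "!!x. x \<in> ball 0 r ==> real_independent_on K (\<lambda>i. pullback phi theta i x)"
  "!!i y. y \<in> V ==> theta i y = (\<Sum>b\<in>UNIV. pullback phi theta b (psi y) * of_real (pd i psi y $ b))"
proof -
 have thetad: "theta i differentiable at x" if "x \<in> ball 0 R" for i x by (rule smoothD[OF theta that])
 have Nd: "N i a differentiable at x" if "x \<in> ball 0 R" for i a x by (rule smoothD[OF N that])
 define E where "E a i x = (if i = a then 1 else 0) + N i a x" for a i x
 have E_sum: "(\<Sum>i\<in>UNIV. f i * complex_of_real (E a i x)) = f a + (\<Sum>k\<in>UNIV. of_real (N k a x) * f k)" for f a x
 proof -
  have "(\<Sum>i\<in>UNIV. f i * complex_of_real (E a i x)) = (\<Sum>i\<in>UNIV. (if i = a then f i else 0) + of_real (N i a x) * f i)"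
   by (rule sum.cong) (auto simp: E_def distrib_left mult.commute)
  then show ?thesis by (simp add: sum.distrib)
 qed
 have int: "pd b (N i a) x + (\<Sum>l\<in>UNIV. N l b x * pd l (N i a) x) = pd a (N i b) x + (\<Sum>l\<in>UNIV. N l a x * pd l (N i b) x)"
  if x: "x \<in> ball 0 R" and ab: "a \<notin> K" "b \<notin> K" for i a b x
 proof -
  \<comment> \<open>The components of the bracket of E_b and E_a; they vanish outside
    \<open>K\<close> because \<open>N\<close> does.\<close>
  define W where "W k = (pd b (N k a) x + (\<Sum>l\<in>UNIV. N l b x * pd l (N k a) x)) - (pd a (N k b) x + (\<Sum>l\<in>UNIV. N l a x * pd l (N k b) x))" for k
  have WK: "W k = 0" if "k \<notin> K" for k using N0[of k] that by (simp add: W_def)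
  have dR: "pd j (theta a) x + (\<Sum>k\<in>UNIV. of_real (N k a x) * pd j (theta k) x + of_real (pd j (N k a) x) * theta k x) = 0" if "a \<notin> K" for j a
  proof -
   have d: "(\<lambda>x. complex_of_real (N k a x)) differentiable at x" for k by (rule differentiable_linear[OF bounded_linear_of_real Nd[OF x]])
   have "pd j (\<lambda>x. theta a x + (\<Sum>k\<in>UNIV. of_real (N k a x) * theta k x)) x = pd j (\<lambda>x. 0) x"
    by (rule pd_cong_open[OF open_ball x]) (rule rel[OF _ that])
   moreover have "pd j (\<lambda>x. theta a x + (\<Sum>k\<in>UNIV. of_real (N k a x) * theta k x)) x =
    pd j (theta a) x + (\<Sum>k\<in>UNIV. of_real (N k a x) * pd j (theta k) x + of_real (pd j (N k a) x) * theta k x)"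
    using d thetad[OF x] by (subst pd_add) (auto simp: pd_sum pd_mult pd_linear[OF bounded_linear_of_real Nd[OF x]] intro!: differentiable_sum differentiable_mult)
   ultimately show ?thesis by simp
  qed
  have dR': "(\<Sum>i\<in>UNIV. pd j (theta i) x * of_real (E a i x)) = - (\<Sum>k\<in>UNIV. of_real (pd j (N k a) x) * theta k x)" if "a \<notin> K" for j a
   using dR[OF that, of j] unfolding E_sum by (simp add: sum.distrib add_eq_0_iff2 add.assoc[symmetric])
  have kerE: "(\<Sum>i\<in>UNIV. theta i x * of_real (E a i x)) = 0" if "a \<notin> K" for a
   unfolding E_sum by (rule rel[OF x that])
  have "(\<Sum>j\<in>UNIV. \<Sum>i\<in>UNIV. (pd j (theta i) x - pd i (theta j) x) * of_real (E b j x) * of_real (E a i x)) = 0"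
   using ker[unfolded kernel_closed_def, rule_format, OF x kerE[OF ab(2)] kerE[OF ab(1)]] .
  also have "(\<Sum>j\<in>UNIV. \<Sum>i\<in>UNIV. (pd j (theta i) x - pd i (theta j) x) * of_real (E b j x) * of_real (E a i x))
   = (\<Sum>j\<in>UNIV. \<Sum>i\<in>UNIV. pd j (theta i) x * of_real (E a i x) * of_real (E b j x)) - (\<Sum>j\<in>UNIV. \<Sum>i\<in>UNIV. pd i (theta j) x * of_real (E b j x) * of_real (E a i x))"
   unfolding sum_subtractf[symmetric] by (intro sum.cong refl) (simp add: algebra_simps)
  also have "(\<Sum>j\<in>UNIV. \<Sum>i\<in>UNIV. pd i (theta j) x * of_real (E b j x) * of_real (E a i x)) = (\<Sum>i\<in>UNIV. \<Sum>j\<in>UNIV. pd i (theta j) x * of_real (E b j x) * of_real (E a i x))"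
   by (rule sum.swap)
  finally have "(\<Sum>j\<in>UNIV. (\<Sum>i\<in>UNIV. pd j (theta i) x * of_real (E a i x)) * of_real (E b j x)) - (\<Sum>i\<in>UNIV. (\<Sum>j\<in>UNIV. pd i (theta j) x * of_real (E b j x)) * of_real (E a i x)) = 0"
   by (simp only: sum_distrib_right)
  then have "(\<Sum>j\<in>UNIV. (\<Sum>k\<in>UNIV. of_real (pd j (N k a) x) * theta k x) * of_real (E b j x)) - (\<Sum>i\<in>UNIV. (\<Sum>k\<in>UNIV. of_real (pd i (N k b) x) * theta k x) * of_real (E a i x)) = 0"
   by (simp add: dR'[OF ab(1)] dR'[OF ab(2)] sum_negf)
  moreover have "(\<Sum>j\<in>UNIV. (\<Sum>k\<in>UNIV. of_real (pd j (N k a) x) * theta k x) * of_real (E b j x)) = (\<Sum>k\<in>UNIV. of_real (pd b (N k a) x + (\<Sum>l\<in>UNIV. N l b x * pd l (N k a) x)) * theta k x)" for a b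
   unfolding E_sum by (simp add: distrib_right sum.distrib sum_distrib_left sum_distrib_right mult.assoc) (rule sum.swap)
  ultimately have "(\<Sum>k\<in>UNIV. of_real (W k) * theta k x) = 0"
   by (simp add: W_def left_diff_distrib sum_subtractf)
  then have "\<forall>k. W k = 0" using ind[OF x] WK unfolding real_independent_on_def by blast
  then show ?thesis by (simp add: W_def)
 qed
 obtain rho phi where rho: "0 < rho" and phi: "smooth_on (ball 0 rho) phi" "!!x. x \<in> ball 0 rho ==> phi x \<in> ball 0 R" "phi 0 = 0"
  and dphi: "!!a x i. a \<notin> K ==> x \<in> ball 0 rho ==> pd a phi x $ i = (if i = a then 1 else 0) + N i a (phi x)"
  and det: "det (jac phi 0) \<noteq> 0"
  by (rule frobenius_straightening[where N=N and K=K and R=R]) (assumption | rule N R N0 int that)+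
 have z0: "(0 :: real ^ 'n) \<in> ball 0 rho" using rho by simp
 obtain U' V0 psi where U': "open U'" "0 \<in> U'" "U' \<subseteq> ball 0 rho" "open V0" "phi 0 \<in> V0" "homeomorphism U' V0 phi psi" "smooth_on V0 psi"
  using smooth_inverse[OF open_ball phi(1) z0 det] by blast
 obtain r where r: "r > 0" "ball 0 r \<subseteq> U'" using U'(1,2) openE by blast
 define V where "V = phi ` ball 0 r"
 have hom: "homeomorphism (ball 0 r) V phi psi"
  unfolding V_def by (rule homeomorphism_of_subsets[OF U'(6) r(2)]) (use U'(6) r(2) in \<open>auto simp: homeomorphism_def\<close>)
 have Veq: "V = V0 \<inter> psi -` ball 0 r"
  using U'(6) r(2) unfolding V_def homeomorphism_def by (force simp: image_iff)
 have Vopen: "open V"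
  unfolding Veq using U'(4) U'(6) by (intro continuous_open_preimage) (auto simp: homeomorphism_def)
 have VV0: "V \<subseteq> V0" by (auto simp: Veq)
 have rr: "ball 0 r \<subseteq> (ball 0 rho :: (real ^ 'n) set)" using r(2) U'(3) by blast
 have phiR: "phi x \<in> ball 0 R" if "x \<in> ball 0 r" for x using phi(2) rr that by blast
 have VR: "V \<subseteq> ball 0 R" unfolding V_def using phiR by blast
 have smphi: "smooth_on (ball 0 r) phi" by (rule smooth_subset[OF phi(1) rr])
 have smpsi: "smooth_on V psi" by (rule smooth_subset[OF U'(7) VV0])
 have psiphi: "psi (phi x) = x" if "x \<in> ball 0 r" for x using hom that by (simp add: homeomorphism_def)
 have phipsi: "phi (psi y) = y" "psi y \<in> ball 0 r" if "y \<in> V" for y using hom that by (auto simp: homeomorphism_def)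
 have phiV: "phi x \<in> V" if "x \<in> ball 0 r" for x using that by (simp add: V_def)
 have dphir: "phi differentiable at x" if "x \<in> ball 0 r" for x by (rule smoothD[OF smphi that])
 have dpsir: "psi differentiable at y" if "y \<in> V" for y by (rule smoothD[OF smpsi that])
 have chain1: "(\<Sum>j\<in>UNIV. pd a phi x $ j * pd j psi (phi x) $ i) = (if i = a then 1 else 0)" if x: "x \<in> ball 0 r" for a i x
 proof -
  have "pd a (\<lambda>x. psi (phi x)) x = pd a (\<lambda>x. x) x" by (rule pd_cong_open[OF open_ball x]) (rule psiphi)
  then have "(\<Sum>j\<in>UNIV. pd a phi x $ j *\<^sub>R pd j psi (phi x)) = axis a 1"
   using pd_compose(1)[OF dpsir[OF phiV[OF x]] dphir[OF x], of a] pd_eqI[OF has_derivative_ident, of a x] by simp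
  then have "(\<Sum>j\<in>UNIV. pd a phi x $ j *\<^sub>R pd j psi (phi x)) $ i = axis a 1 $ i" by simp
  then show ?thesis by (auto simp: axis_def)
 qed
 have chain2: "(\<Sum>j\<in>UNIV. pd i psi y $ j * pd j phi (psi y) $ k) = (if k = i then 1 else 0)" if y: "y \<in> V" for i k y
 proof -
  have "pd i (\<lambda>y. phi (psi y)) y = pd i (\<lambda>x. x) y" by (rule pd_cong_open[OF Vopen y]) (rule phipsi(1))
  then have "(\<Sum>j\<in>UNIV. pd i psi y $ j *\<^sub>R pd j phi (psi y)) = axis i 1"
   using pd_compose(1)[OF dphir[OF phipsi(2)[OF y]] dpsir[OF y], of i] pd_eqI[OF has_derivative_ident, of i y] by simp
  then have "(\<Sum>j\<in>UNIV. pd i psi y $ j *\<^sub>R pd j phi (psi y)) $ k = axis i 1 $ k" by simp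
  then show ?thesis by (auto simp: axis_def)
 qed
 have pull0: "pullback phi theta a x = 0" if x: "x \<in> ball 0 r" and a: "a \<notin> K" for a x
 proof -
  have "pullback phi theta a x = (\<Sum>i\<in>UNIV. theta i (phi x) * of_real (E a i (phi x)))"
   unfolding pullback_def using dphi[OF a, of x] subsetD[OF rr x] by (simp add: E_def)
  also have "... = 0" unfolding E_sum by (rule rel[OF phiR[OF x] a])
  finally show ?thesis .
 qed
 have rep: "theta i y = (\<Sum>b\<in>UNIV. pullback phi theta b (psi y) * of_real (pd i psi y $ b))" if y: "y \<in> V" for i y
 proof -
  have "(\<Sum>b\<in>UNIV. pullback phi theta b (psi y) * of_real (pd i psi y $ b))
   = (\<Sum>k\<in>UNIV. theta k y * of_real (\<Sum>b\<in>UNIV. pd i psi y $ b * pd b phi (psi y) $ k))"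
   unfolding pullback_def phipsi(1)[OF y] sum_distrib_right of_real_sum sum_distrib_left
   by (subst sum.swap) (simp add: mult_ac)
  also have "... = theta i y" by (simp add: chain2[OF y] if_distrib[of of_real] if_distrib[of "\<lambda>z. _ * z"] cong: if_cong)
  finally show ?thesis by simp
 qed
 have ind': "real_independent_on K (\<lambda>i. pullback phi theta i x)" if x: "x \<in> ball 0 r" for x
  unfolding real_independent_on_def
 proof (intro allI impI)
  fix W :: "'n => real" and i assume W: "\<forall>i. i \<notin> K --> W i = 0" and eq: "(\<Sum>i\<in>UNIV. of_real (W i) * pullback phi theta i x) = 0"
  define w where "w j = (\<Sum>a\<in>UNIV. W a * pd a phi x $ j)" for j
  have wtheta: "(\<Sum>j\<in>UNIV. of_real (w j) * theta j (phi x)) = 0"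
   using eq unfolding pullback_def w_def of_real_sum sum_distrib_left sum_distrib_right
   by (subst (asm) sum.swap) (simp add: mult_ac)
  \<comment> \<open>The pushed-forward vector minus its leaf part, which is a combination of the
    E_a. It is supported in \<open>K\<close> and annihilated by theta, hence zero; so the original
    vector is tangent to the leaves although supported in \<open>K\<close>, and must vanish.\<close>
  define W' where "W' k = w k - (\<Sum>a\<in>-K. w a * E a k (phi x))" for k
  have W'K: "W' k = 0" if "k \<notin> K" for k
  proof -
   have "(\<Sum>a\<in>-K. w a * E a k (phi x)) = (\<Sum>a\<in>-K. if a = k then w k else 0)"
    by (rule sum.cong) (use N0[of k] that in \<open>auto simp: E_def\<close>)
   also have "... = w k" using that by simp
   finally show ?thesis by (simp add: W'_def)
  qed
  have "(\<Sum>k\<in>UNIV. of_real (\<Sum>a\<in>-K. w a * E a k (phi x)) * theta k (phi x)) = (\<Sum>a\<in>-K. of_real (w a) * (\<Sum>k\<in>UNIV. theta k (phi x) * of_real (E a k (phi x))))"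
   unfolding of_real_sum sum_distrib_left sum_distrib_right by (subst sum.swap) (simp add: mult_ac)
  also have "... = 0" unfolding E_sum using rel[OF phiR[OF x]] by (intro sum.neutral) auto
  finally have "(\<Sum>k\<in>UNIV. of_real (W' k) * theta k (phi x)) = 0"
   using wtheta by (simp add: W'_def left_diff_distrib sum_subtractf)
  then have W'0: "W' k = 0" for k using ind[OF phiR[OF x]] W'K unfolding real_independent_on_def by blast
  have w_eq: "w k = (\<Sum>a\<in>-K. w a * pd a phi x $ k)" for k
  proof -
   have "(\<Sum>a\<in>-K. w a * E a k (phi x)) = (\<Sum>a\<in>-K. w a * pd a phi x $ k)"
    by (rule sum.cong) (use dphi rr x in \<open>auto simp: E_def\<close>)
   then show ?thesis using W'0[of k] by (simp add: W'_def)
  qed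
  have pushW: "(\<Sum>k\<in>UNIV. w k * pd k psi (phi x) $ j) = W j" for j
  proof -
   have "(\<Sum>k\<in>UNIV. w k * pd k psi (phi x) $ j) = (\<Sum>a\<in>UNIV. W a * (\<Sum>k\<in>UNIV. pd a phi x $ k * pd k psi (phi x) $ j))"
    unfolding w_def sum_distrib_left sum_distrib_right by (subst sum.swap) (simp add: mult_ac)
   then show ?thesis by (simp add: chain1[OF x] if_distrib[of "\<lambda>z. _ * z"] cong: if_cong)
  qed
  have "W j = 0" if "j \<in> K" for j
  proof -
   have "W j = (\<Sum>k\<in>UNIV. (\<Sum>a\<in>-K. w a * pd a phi x $ k) * pd k psi (phi x) $ j)"
    unfolding w_eq[symmetric] by (rule pushW[symmetric])
   also have "... = (\<Sum>a\<in>-K. w a * (\<Sum>k\<in>UNIV. pd a phi x $ k * pd k psi (phi x) $ j))"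
    unfolding sum_distrib_left sum_distrib_right by (subst sum.swap) (simp add: mult_ac)
   also have "... = 0" using that by (intro sum.neutral) (auto simp: chain1[OF x])
   finally show ?thesis .
  qed
  then show "W i = 0" using W by blast
 qed
 show ?thesis
  by (rule that[OF r(1) smphi Vopen smpsi hom phi(3) VR pull0 ind' rep])
qed

section \<open>Complex integrating factors\<close>

text \<open>Every function whose differential is a multiple of theta is one holomorphic function of
  u on the whole image. Applied to an eigenvalue this makes it a function of its coordinate. For
  real u the image is real and holomorphy means differentiability within it.\<close>

definition factors_through :: "(real ^ 'n) set => ('n => real ^ 'n => complex) => (real ^ 'n => complex) => bool"
 where "factors_through V theta u \<longleftrightarrow>
  (\<forall>h. (\<forall>x\<in>V. h differentiable at x) \<and> (\<forall>x\<in>V. \<exists>nu. \<forall>i. pd i h x = nu * theta i x) -->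
   (\<exists>F. F holomorphic_on u ` V \<and> (\<forall>x\<in>V. h x = F (u x))))"

text \<open>The domain is shrunk so that the image is a ball: convexity is what later allows
  comparing values along segments in the chart.\<close>

lemma smooth_chart:
 fixes kappa :: "real ^ 'n => real ^ 'n"
 assumes "open U" "smooth_on U kappa" "p \<in> U" "det (jac kappa p) \<noteq> 0"
 obtains V e Xi where "open V" "p \<in> V" "V \<subseteq> U" "e > 0" "smooth_on (ball (kappa p) e) Xi" "homeomorphism V (ball (kappa p) e) kappa Xi"
proof -
 obtain U' V0 Xi where U': "open U'" "p \<in> U'" "U' \<subseteq> U" "open V0" "kappa p \<in> V0" "homeomorphism U' V0 kappa Xi" "smooth_on V0 Xi"
  using smooth_inverse[OF assms] by blast
 obtain e where e: "e > 0" "ball (kappa p) e \<subseteq> V0" using U'(4,5) openE by blast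
 define V where "V = U' \<inter> kappa -` ball (kappa p) e"
 have "open V"
  unfolding V_def using U'(1,6) by (intro continuous_open_preimage) (auto simp: homeomorphism_def)
 moreover have "homeomorphism V (ball (kappa p) e) kappa Xi"
 proof (rule homeomorphism_of_subsets[OF U'(6)])
  show "kappa ` V = ball (kappa p) e"
  proof
   show "kappa ` V \<subseteq> ball (kappa p) e" by (auto simp: V_def)
   show "ball (kappa p) e \<subseteq> kappa ` V"
   proof
    fix z assume z: "z \<in> ball (kappa p) e"
    then have "kappa (Xi z) = z" "Xi z \<in> U'" using U'(6) e(2) by (auto simp: homeomorphism_def)
    then show "z \<in> kappa ` V" using z by (force simp: V_def)
   qed
  qed
 qed (use e in \<open>auto simp: V_def\<close>)
 ultimately show ?thesis
  using that[of V e Xi] smooth_subset[OF U'(7) e(2)] e(1) U'(2,3) by (auto simp: V_def)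
qed

lemma pd_zero_transport:
 fixes h u :: "real ^ 'n => complex"
 assumes Xi: "open B" "smooth_on B Xi" "Xi ` B \<subseteq> V" and h: "!!x. x \<in> V ==> h differentiable at x"
  and u: "!!x. x \<in> V ==> u differentiable at x" and par: "!!x. x \<in> V ==> \<exists>nu. \<forall>i. pd i h x = nu * pd i u x"
  and z: "z \<in> B"
 shows "(\<lambda>z. h (Xi z)) differentiable at z" "\<exists>nu. \<forall>c. pd c (\<lambda>z. h (Xi z)) z = nu * pd c (\<lambda>z. u (Xi z)) z"
proof -
 have zV: "Xi z \<in> V" using assms by auto
 have d: "Xi differentiable at z" by (rule smoothD[OF Xi(2) z])
 show "(\<lambda>z. h (Xi z)) differentiable at z" by (rule pd_compose(2)[OF h[OF zV] d])
 obtain nu where nu: "!!i. pd i h (Xi z) = nu * pd i u (Xi z)" using par[OF zV] by blast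
 have "pd c (\<lambda>z. h (Xi z)) z = nu * pd c (\<lambda>z. u (Xi z)) z" for c
  by (simp add: pd_compose(1)[OF h[OF zV] d] pd_compose(1)[OF u[OF zV] d] nu sum_distrib_left)
 then show "\<exists>nu. \<forall>c. pd c (\<lambda>z. h (Xi z)) z = nu * pd c (\<lambda>z. u (Xi z)) z" by blast
qed

lemma det_nz_if_ker:
 fixes A :: "'a::field ^ 'n ^ 'n"
 assumes "!!h. A *v h = 0 ==> h = 0"
 shows "det A \<noteq> 0"
 unfolding invertible_det_nz[symmetric] invertible_left_inverse matrix_left_invertible_ker using assms by blast

text \<open>Re u and Im u replace the coordinates a and b; the equality a = b marks the case of real
  u, where only Re u is used. In this chart a function with differential parallel to du depends on
  these coordinates alone, and in the complex case it satisfies the Cauchy-Riemann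
  equations.\<close>

lemma function_of_integral:
 fixes u :: "real ^ 'n => complex"
 assumes U: "open U" "p \<in> U" and u: "smooth_on U u"
  and nz: "if a = b then pd a u p \<noteq> 0 \<and> (\<forall>x\<in>U. u x \<in> \<real>) else Im (cnj (pd a u p) * pd b u p) \<noteq> 0"
 obtains V where "open V" "p \<in> V" "V \<subseteq> U" "factors_through V (\<lambda>i. pd i u) u"
proof -
 define kappa where "kappa x = (\<chi> i. if i = a then Re (u x) else if i = b then Im (u x) else x $ i)" for x
 have kappai: "kappa x $ i = (if i = a then Re (u x) else if i = b then Im (u x) else x $ i)" for x i by (simp add: kappa_def)
 have ud: "u differentiable at x" if "x \<in> U" for x by (rule smoothD[OF u that])
 have sm: "smooth_on U (\<lambda>x. if i = a then Re (u x) else if i = b then Im (u x) else x $ i)" for i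
  using smooth_Re[OF U(1) u] smooth_Im[OF U(1) u] by (cases "i = a"; cases "i = b") auto
 have smkappa: "smooth_on U kappa" unfolding kappa_def[abs_def] by (rule smooth_vec_lambda[OF U(1) sm])
 have pdkappa: "pd c kappa p $ i = (if i = a then Re (pd c u p) else if i = b then Im (pd c u p) else if i = c then 1 else 0)" for c i
  using pd_component[OF smoothD[OF smkappa U(2)], of c i]
  by (cases "i = a"; cases "i = b")
   (auto simp: kappai[abs_def] pd_linear[OF bounded_linear_Re ud[OF U(2)]] pd_linear[OF bounded_linear_Im ud[OF U(2)]])
 have det: "det (jac kappa p) \<noteq> 0"
 proof (rule det_nz_if_ker)
  fix h assume h: "jac kappa p *v h = 0"
  have c: "(\<Sum>c\<in>UNIV. pd c kappa p $ i * h $ c) = 0" for i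
   using arg_cong[OF h, of "\<lambda>v. v $ i"] by (simp add: jac_def mv_mult)
  have h0: "h $ i = 0" if "i \<noteq> a" "i \<noteq> b" for i using c[of i] that by (simp add: pdkappa if_distrib[of "\<lambda>z. z * _"] cong: if_cong)
  have split: "(\<Sum>c\<in>UNIV. f c * h $ c) = f a * h $ a + (if a = b then 0 else f b * h $ b)" for f
  proof -
   have "(\<Sum>c\<in>UNIV. f c * h $ c) = (\<Sum>c\<in>{a, b}. f c * h $ c)"
    by (rule sum.mono_neutral_right) (use h0 in auto)
   then show ?thesis by simp
  qed
  have "h $ a = 0 \<and> h $ b = 0"
  proof (cases "a = b")
   case True
   have "Im (pd a u p) = pd a (\<lambda>x. Im (u x)) p" by (simp add: pd_linear[OF bounded_linear_Im ud[OF U(2)]])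
   also have "... = pd a (\<lambda>x. 0) p"
    by (rule pd_cong_open[OF U]) (use nz True in \<open>auto simp: complex_is_Real_iff\<close>)
   finally show ?thesis using c[of a] split[of "\<lambda>c. Re (pd c u p)"] nz True by (auto simp: pdkappa complex_eq_iff)
  next
   case False
   have e1: "Re (pd a u p) * h $ a + Re (pd b u p) * h $ b = 0" using c[of a] False split[of "\<lambda>c. Re (pd c u p)"] by (simp add: pdkappa)
   have e2: "Im (pd a u p) * h $ a + Im (pd b u p) * h $ b = 0" using c[of b] False split[of "\<lambda>c. Im (pd c u p)"] by (simp add: pdkappa)
   have D: "Im (cnj (pd a u p) * pd b u p) = Re (pd a u p) * Im (pd b u p) - Im (pd a u p) * Re (pd b u p)" by simp
   have "Im (cnj (pd a u p) * pd b u p) * h $ a = 0" "Im (cnj (pd a u p) * pd b u p) * h $ b = 0"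
    unfolding D using e1 e2 by algebra+
   then show ?thesis using nz False by auto
  qed
  then show "h = 0" using h0 by (metis vec_eq_iff zero_index)
 qed
 obtain V e Xi where V: "open V" "p \<in> V" "V \<subseteq> U" "e > 0" "smooth_on (ball (kappa p) e) Xi" and hom: "homeomorphism V (ball (kappa p) e) kappa Xi"
  using smooth_chart[OF U(1) smkappa U(2) det] by blast
 let ?B = "ball (kappa p) e"
 have XiV: "Xi ` ?B \<subseteq> V" and kappaXi: "!!z. z \<in> ?B ==> kappa (Xi z) = z" and Xikappa: "!!x. x \<in> V ==> Xi (kappa x) = x" and kappaV: "!!x. x \<in> V ==> kappa x \<in> ?B"
  using hom by (auto simp: homeomorphism_def)
 define J where "J = (if a = b then 0 else \<i>)"
 have uu: "Re (u x) = kappa x $ a" "Im (u x) = (if a = b then 0 else kappa x $ b)" if "x \<in> V" for x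
  using nz V(3) that by (auto simp: kappai complex_is_Real_iff)
 have uXi: "u (Xi z) = of_real (z $ a) + of_real (z $ b) * J" if "z \<in> ?B" for z
  using uu[OF subsetD[OF XiV imageI[OF that]]] kappaXi[OF that] by (simp add: complex_eq_iff J_def)
 \<comment> \<open>A section of u: the chart point with prescribed real and imaginary part of u and
   all other coordinates those of p. It is componentwise no farther from the centre than the given
   point, so it stays in the ball.\<close>
 define base where "base w = kappa p + ((Re w - kappa p $ a) *\<^sub>R axis a 1 + (if a = b then 0 else Im w - kappa p $ b) *\<^sub>R axis b 1)" for w :: complex
 have base_i: "base w $ i = (if i = a then Re w else if i = b then Im w else kappa p $ i)" for w i by (simp add: base_def axis_def)
 have base_B: "base (u x) \<in> ?B" if "x \<in> V" for x
 proof -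
  have "norm (base (u x) - kappa p) \<le> norm (kappa x - kappa p)"
   by (rule norm_le_componentwise_cart) (simp add: base_i uu[OF that])
  then show ?thesis using kappaV[OF that] by (simp add: dist_norm norm_minus_commute)
 qed
 have main: "\<exists>F. F holomorphic_on u ` V \<and> (\<forall>x\<in>V. h x = F (u x))"
  if h: "!!x. x \<in> V ==> h differentiable at x" and par: "!!x. x \<in> V ==> \<exists>nu. \<forall>i. pd i h x = nu * pd i u x" for h :: "real ^ 'n => complex"
 proof -
  define K where "K z = h (Xi z)" for z
  have ud': "u differentiable at x" if "x \<in> V" for x using ud V(3) that by blast
  have Kd: "K differentiable at z" if "z \<in> ?B" for z
   unfolding K_def[abs_def] by (rule pd_zero_transport(1)[OF open_ball V(5) XiV h ud' par that])
  have pdu: "pd c (\<lambda>z. u (Xi z)) z = (if c = a then 1 else if c = b then \<i> else 0)" if "z \<in> ?B" for c z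
  proof -
   have "pd c (\<lambda>z. u (Xi z)) z = pd c (\<lambda>z. complex_of_real (z $ a) + complex_of_real (z $ b) * J) z" by (rule pd_cong_open[OF open_ball that uXi])
   also have "... = of_real (pd c (\<lambda>z. z $ a) z) + of_real (pd c (\<lambda>z. z $ b) z) * J"
    using differentiable_linear[OF bounded_linear_of_real differentiable_nth]
    by (subst pd_add) (auto simp: pd_mult pd_linear[OF bounded_linear_of_real differentiable_nth] intro: differentiable_mult)
   finally show ?thesis by (auto simp: J_def)
  qed
  have pdK: "pd c K z = pd a K z * (if c = a then 1 else if c = b then \<i> else 0)" if z: "z \<in> ?B" for c z
  proof -
   obtain nu where "!!c. pd c K z = nu * pd c (\<lambda>z. u (Xi z)) z"
    using pd_zero_transport(2)[OF open_ball V(5) XiV h ud' par z] unfolding K_def[abs_def] by blast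
   then show ?thesis by (simp add: pdu[OF z])
  qed
  have pdK0: "pd c K z = 0" if "z \<in> ?B" "c \<notin> {a, b}" for c z
   using pdK[OF that(1), of c] that(2) by auto
  define F where "F w = K (base w)" for w
  have "h x = F (u x)" if "x \<in> V" for x
  proof -
   have "K (kappa x) = K (base (u x))"
    by (rule eq_if_pd_zero[where K = "{a, b}", OF convex_ball Kd pdK0 kappaV[OF that] base_B[OF that]]) (auto simp: base_i uu[OF that])
   then show ?thesis using Xikappa[OF that] by (simp add: F_def K_def)
  qed
  moreover have "F field_differentiable (at w within u ` V)" if w: "w \<in> u ` V" for w
  proof -
   have wB: "base w \<in> ?B" using w base_B by auto
   have "(base has_derivative (\<lambda>t. Re t *\<^sub>R axis a 1 + (if a = b then 0 else Im t) *\<^sub>R axis b 1)) (at w within u ` V)"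
    unfolding base_def[abs_def] by (cases "a = b") (auto intro!: derivative_eq_intros)
   from has_derivative_compose[OF this has_derivative_pd[OF Kd[OF wB]]]
   moreover have "(\<Sum>c\<in>UNIV. (Re t *\<^sub>R axis a 1 + (if a = b then 0 else Im t) *\<^sub>R axis b 1) $ c *\<^sub>R pd c K (base w))
    = (of_real (Re t) + of_real (Im t) * J) * pd a K (base w)" for t
   proof -
    have "(\<Sum>c\<in>UNIV. (Re t *\<^sub>R axis a 1 + (if a = b then 0 else Im t) *\<^sub>R axis b 1) $ c *\<^sub>R pd c K (base w))
     = (\<Sum>c\<in>{a, b}. (Re t *\<^sub>R axis a 1 + (if a = b then 0 else Im t) *\<^sub>R axis b 1) $ c *\<^sub>R pd c K (base w))"
     by (rule sum.mono_neutral_right) (auto simp: axis_def)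
    also have "... = Re t *\<^sub>R pd a K (base w) + (if a = b then 0 else Im t) *\<^sub>R pd b K (base w)"
     by (cases "a = b") (simp_all add: axis_def)
    also have "... = (of_real (Re t) + of_real (Im t) * J) * pd a K (base w)"
     using pdK[OF wB, of b] by (cases "a = b") (simp_all add: J_def scaleR_conv_of_real distrib_right)
    finally show ?thesis .
   qed
   ultimately have dF: "(F has_derivative (\<lambda>t. (of_real (Re t) + of_real (Im t) * J) * pd a K (base w))) (at w within u ` V)"
    by (simp add: F_def[abs_def])
   \<comment> \<open>The added term vanishes on the image of u, where real values have zero
     imaginary part; there it changes nothing but makes the derivative complex linear.\<close>
   have "((\<lambda>t. F t + pd a K (base w) * (t - (of_real (Re t) + of_real (Im t) * J))) has_derivative (*) (pd a K (base w))) (at w within u ` V)"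
    by (rule has_derivative_eq_rhs[OF has_derivative_add[OF dF]]) (auto intro!: derivative_eq_intros simp: algebra_simps)
   then have "(F has_derivative (*) (pd a K (base w))) (at w within u ` V)"
    by (rule has_derivative_transform[rotated 2]) (use w uu in \<open>auto simp: J_def complex_eq_iff\<close>)
   then show ?thesis unfolding field_differentiable_def has_field_derivative_def by blast
  qed
  ultimately show ?thesis unfolding holomorphic_on_def by blast
 qed
 have "factors_through V (\<lambda>i. pd i u) u" unfolding factors_through_def using main by blast
 then show ?thesis by (rule that[OF V(1-3)])
qed

lemma nonzero_on_ball:
 fixes f :: "'a::metric_space => 'b::t1_space"
 assumes "continuous_on (ball p R) f" "f p \<noteq> c" "R > 0"
 obtains R' where "0 < R'" "R' \<le> R" "!!x. x \<in> ball p R' ==> f x \<noteq> c"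
proof -
 obtain e where "e > 0" "\<forall>y. dist p y < e --> f y \<noteq> c"
  using continuous_on_open_avoid[OF assms(1) open_ball _ assms(2)] assms(3) by auto
 then show ?thesis using that[of "min e R"] assms(3) by auto
qed

lemma sum_two:
 fixes f :: "'n::finite => 'b::comm_monoid_add"
 assumes "a \<noteq> b" "!!i. i \<noteq> a ==> i \<noteq> b ==> f i = 0"
 shows "(\<Sum>i\<in>UNIV. f i) = f a + f b"
proof -
 have "(\<Sum>i\<in>UNIV. f i) = (\<Sum>i\<in>{a, b}. f i)" by (rule sum.mono_neutral_right) (use assms in auto)
 then show ?thesis using assms(1) by simp
qed

lemma sum_one:
 fixes f :: "'n::finite => 'b::comm_monoid_add"
 assumes "!!i. i \<noteq> a ==> f i = 0"
 shows "(\<Sum>i\<in>UNIV. f i) = f a"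
proof -
 have "(\<Sum>i\<in>UNIV. f i) = (\<Sum>i\<in>{a}. f i)" by (rule sum.mono_neutral_right) (use assms in auto)
 then show ?thesis by simp
qed

text \<open>Here a = b again marks the real case. Straightening leaves only the components a and b
  of theta. In the real case x_a is the integral. Otherwise the quotient m of the two components is
  nonreal by independence, depends on x_a and x_b only, and the planar equation for m provides the
  integral.\<close>

lemma local_integrating_factor:
 fixes theta :: "'n::finite => real ^ 'n => complex"
 assumes R: "R > 0" and theta: "!!i. smooth_on (ball 0 R) (theta i)" and ker: "kernel_closed (ball 0 R) theta"
  and nz: "if a = b then theta a 0 \<noteq> 0 \<and> (\<forall>x\<in>ball 0 R. \<forall>i. theta i x \<in> \<real>) else Im (cnj (theta a 0) * theta b 0) \<noteq> 0"
 obtains V u where "open V" "0 \<in> V" "V \<subseteq> ball 0 R" "smooth_on V u"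
  "!!x. x \<in> V ==> \<exists>mu. mu \<noteq> 0 \<and> (\<forall>i. pd i u x = mu * theta i x)" "!!x. a = b ==> x \<in> V ==> u x \<in> \<real>"
proof -
 obtain R' N where R': "0 < R'" "R' \<le> R" and Nsm: "!!k c. smooth_on (ball 0 R') (N k c)"
  and N0: "!!k c. k \<notin> {a, b} \<or> c \<in> {a, b} ==> N k c = (\<lambda>x. 0)"
  and rel: "!!x c. x \<in> ball 0 R' ==> c \<notin> {a, b} ==> theta c x + (\<Sum>k\<in>UNIV. of_real (N k c x) * theta k x) = 0"
  and ind: "!!x. x \<in> ball 0 R' ==> real_independent_on {a, b} (\<lambda>i. theta i x)"
 proof (cases "a = b")
  case True
  then have re: "theta i x \<in> \<real>" if "x \<in> ball 0 R" for i x using nz that by simp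
  have nz: "theta a 0 \<noteq> 0" using nz True by simp
  obtain R' where R': "0 < R'" "R' \<le> R" "!!x. x \<in> ball 0 R' ==> theta a x \<noteq> 0"
   using nonzero_on_ball[OF smoothC[OF theta] nz R] by blast
  have sub: "ball 0 R' \<subseteq> (ball 0 R :: (real ^ 'n) set)" using R'(2) by auto
  have theta': "smooth_on (ball 0 R') (theta i)" for i by (rule smooth_subset[OF theta sub])
  have eqR: "theta i x = of_real (Re (theta i x))" if "x \<in> ball 0 R'" for i x using re[of x i] sub that by auto
  have Re_nz: "Re (theta a x) \<noteq> 0" if "x \<in> ball 0 R'" for x
   using R'(3)[OF that] eqR[OF that, of a] by (metis of_real_0)
  define N where "N k c = (\<lambda>x. if k = a \<and> c \<noteq> a then - (Re (theta c x) / Re (theta a x)) else 0)" for k c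
  have Nsm: "smooth_on (ball 0 R') (N k c)" for k c
  proof (cases "k = a \<and> c \<noteq> a")
   case True
   have "smooth_on (ball 0 R') (\<lambda>x. - (Re (theta c x) / Re (theta a x)))"
    by (intro smooth_minus smooth_divide smooth_Re open_ball theta' Re_nz)
   then show ?thesis using True by (simp add: N_def)
  qed (auto simp: N_def)
  have rel: "theta c x + (\<Sum>k\<in>UNIV. of_real (N k c x) * theta k x) = 0" if x: "x \<in> ball 0 R'" and c: "c \<notin> {a}" for c x
  proof -
   have "(\<Sum>k\<in>UNIV. of_real (N k c x) * theta k x) = of_real (N a c x) * theta a x" by (rule sum_one) (auto simp: N_def)
   also have "... = of_real (N a c x * Re (theta a x))" by (subst eqR[OF x]) simp
   also have "... = - theta c x" using c Re_nz[OF x] by (subst eqR[OF x, of c]) (simp add: N_def)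
   finally show ?thesis by simp
  qed
  have ind: "real_independent_on {a} (\<lambda>i. theta i x)" if x: "x \<in> ball 0 R'" for x
   unfolding real_independent_on_def
  proof (intro allI impI)
   fix W :: "'n => real" and i assume W: "\<forall>i. i \<notin> {a} --> W i = 0" "(\<Sum>i\<in>UNIV. of_real (W i) * theta i x) = 0"
   have "(\<Sum>i\<in>UNIV. of_real (W i) * theta i x) = of_real (W a) * theta a x" by (rule sum_one) (use W(1) in auto)
   then show "W i = 0" using W R'(3)[OF x] by (cases "i = a") auto
  qed
  show thesis
   by (rule that[OF R'(1,2) Nsm _ rel]) (use ind True in \<open>auto simp: N_def\<close>)
 next
  case False
  then have ab: "a \<noteq> b" and nz: "Im (cnj (theta a 0) * theta b 0) \<noteq> 0" using nz by auto
  define delta where "delta c d x = Im (cnj (theta c x) * theta d x)" for c d x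
  have deltasm: "smooth_on (ball 0 R) (delta c d)" for c d
  proof -
   have "smooth_on (ball 0 R) (\<lambda>x. Re (theta c x) * Im (theta d x) - Im (theta c x) * Re (theta d x))"
    by (intro smooth_diff smooth_mult smooth_Re smooth_Im open_ball theta)
   then show ?thesis by (simp add: delta_def[abs_def])
  qed
  have delta0: "delta a b 0 \<noteq> 0" using nz by (simp add: delta_def)
  obtain R' where R': "0 < R'" "R' \<le> R" "!!x. x \<in> ball 0 R' ==> delta a b x \<noteq> 0"
   using nonzero_on_ball[OF smoothC[OF deltasm] delta0 R] by blast
  have sub: "ball 0 R' \<subseteq> (ball 0 R :: (real ^ 'n) set)" using R'(2) by auto
  have theta': "smooth_on (ball 0 R') (theta i)" and delta': "smooth_on (ball 0 R') (delta i j)" for i j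
   by (rule smooth_subset[OF theta sub] smooth_subset[OF deltasm sub])+
  \<comment> \<open>Cramer's rule in the real plane: \<open>delta c d\<close> is the determinant of
    theta_c and theta_d as real vectors, and any three vectors in the plane satisfy the linear
    relation with these coefficients.\<close>
  define N where "N k c = (if k = a \<and> c \<notin> {a, b} then \<lambda>x. delta b c x / delta a b x
   else if k = b \<and> c \<notin> {a, b} then \<lambda>x. - (delta a c x / delta a b x) else (\<lambda>x. 0))" for k c
  have Nsm: "smooth_on (ball 0 R') (N k c)" for k c
  proof -
   have "smooth_on (ball 0 R') (\<lambda>x. delta b c x / delta a b x)" "smooth_on (ball 0 R') (\<lambda>x. - (delta a c x / delta a b x))"
    by (intro smooth_minus smooth_divide open_ball delta' R'(3); assumption)+
   then show ?thesis by (simp add: N_def)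
  qed
  have rel: "theta c x + (\<Sum>k\<in>UNIV. of_real (N k c x) * theta k x) = 0" if x: "x \<in> ball 0 R'" and c: "c \<notin> {a, b}" for c x
  proof -
   have "(\<Sum>k\<in>UNIV. of_real (N k c x) * theta k x) = of_real (N a c x) * theta a x + of_real (N b c x) * theta b x"
    by (rule sum_two[OF ab]) (auto simp: N_def)
   also have "... = of_real (delta b c x / delta a b x) * theta a x - of_real (delta a c x / delta a b x) * theta b x" using c ab by (auto simp: N_def)
   also have "... = - theta c x"
   proof -
    have "of_real (delta b c x) * theta a x - of_real (delta a c x) * theta b x = - (of_real (delta a b x) * theta c x)"
     by (simp add: complex_eq_iff delta_def algebra_simps)
    then have "(of_real (delta b c x) * theta a x - of_real (delta a c x) * theta b x) / of_real (delta a b x) = - theta c x"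
     using R'(3)[OF x] by simp
    then show ?thesis by (simp add: diff_divide_distrib)
   qed
   finally show ?thesis by simp
  qed
  have ind: "real_independent_on {a, b} (\<lambda>i. theta i x)" if x: "x \<in> ball 0 R'" for x
   unfolding real_independent_on_def
  proof (intro allI impI)
   fix W :: "'n => real" and i assume W: "\<forall>i. i \<notin> {a, b} --> W i = 0" "(\<Sum>i\<in>UNIV. of_real (W i) * theta i x) = 0"
   have "(\<Sum>i\<in>UNIV. of_real (W i) * theta i x) = of_real (W a) * theta a x + of_real (W b) * theta b x"
    by (rule sum_two[OF ab]) (use W(1) in auto)
   then have z: "of_real (W a) * theta a x + of_real (W b) * theta b x = 0" using W(2) by simp
   have "W b * delta a b x = Im (cnj (theta a x) * (of_real (W a) * theta a x + of_real (W b) * theta b x))"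
    by (simp add: delta_def algebra_simps)
   moreover have "W a * delta a b x = - Im (cnj (theta b x) * (of_real (W a) * theta a x + of_real (W b) * theta b x))"
    by (simp add: delta_def algebra_simps)
   ultimately have "W a * delta a b x = 0" "W b * delta a b x = 0" unfolding z by simp_all
   then have "W a = 0" "W b = 0" using R'(3)[OF x] by simp_all
   then show "W i = 0" using W(1) by (cases "i \<in> {a, b}") auto
  qed
  show thesis
   by (rule that[OF R'(1,2) Nsm _ rel]) (use ind ab in \<open>auto simp: N_def\<close>)
 qed
 have sub: "ball 0 R' \<subseteq> (ball 0 R :: (real ^ 'n) set)" using R'(2) by auto
 have theta': "smooth_on (ball 0 R') (theta i)" for i by (rule smooth_subset[OF theta sub])
 have ker': "kernel_closed (ball 0 R') theta" using ker sub unfolding kernel_closed_def by blast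
 obtain r phi psi V where r: "0 < r" "smooth_on (ball 0 r) phi" and V: "open V" "smooth_on V psi" "homeomorphism (ball 0 r) V phi psi"
  "phi 0 = 0" "V \<subseteq> ball 0 R'"
  and p0: "!!c x. x \<in> ball 0 r ==> c \<notin> {a, b} ==> pullback phi theta c x = 0"
  and pind: "!!x. x \<in> ball 0 r ==> real_independent_on {a, b} (\<lambda>i. pullback phi theta i x)"
  and rep: "!!i y. y \<in> V ==> theta i y = (\<Sum>b\<in>UNIV. pullback phi theta b (psi y) * of_real (pd i psi y $ b))"
  by (rule covector_straightening[where N = N and K = "{a, b}" and R = R' and theta = theta])
   (use R'(1) theta' Nsm N0 rel ind ker' in auto)
 have psir: "psi y \<in> ball 0 r" if "y \<in> V" for y using V(3) that by (auto simp: homeomorphism_def)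
 have phiim: "phi ` ball 0 r \<subseteq> ball 0 R'" using V(3,5) by (auto simp: homeomorphism_def)
 define T where "T c = pullback phi theta c" for c
 have Tsm: "smooth_on (ball 0 r) (T c)" for c unfolding T_def by (rule smooth_pullback[OF open_ball theta' r(2) phiim])
 have Td: "T c differentiable at x" if "x \<in> ball 0 r" for c x by (rule smoothD[OF Tsm that])
 have T0: "T c x = 0" if "x \<in> ball 0 r" "c \<notin> {a, b}" for c x unfolding T_def by (rule p0[OF that])
 have Ta: "T a x \<noteq> 0" if x: "x \<in> ball 0 r" for x
 proof
  assume "T a x = 0"
  then have "(\<Sum>i\<in>UNIV. of_real (if i = a then 1 else 0) * T i x) = 0" by (subst sum_one[of a]) auto
  then have "\<forall>i. (if i = a then 1 else 0) = (0::real)"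
   using pind[OF x, unfolded real_independent_on_def, rule_format, of "\<lambda>i. if i = a then 1 else 0"] by (auto simp: T_def)
  from spec[OF this, of a] show False by simp
 qed
 obtain r' Z where r': "0 < r'" "r' \<le> r" "smooth_on (ball 0 r') Z" and Za: "!!x. x \<in> ball 0 r' ==> pd a Z x \<noteq> 0"
  and ZT': "!!x d. x \<in> ball 0 r' ==> T a x * pd d Z x = T d x * pd a Z x" and Zr: "!!x. a = b ==> Z x \<in> \<real>"
 proof (cases "a = b")
  case True
  have p: "pd d (\<lambda>x. complex_of_real (x $ a)) x = (if d = a then 1 else 0)" for d and x :: "real ^ 'n"
   by (simp add: pd_linear[OF bounded_linear_of_real differentiable_nth])
  have "smooth_on (ball 0 r) (\<lambda>x :: real ^ 'n. complex_of_real (x $ a))" by (intro smooth_of_real smooth_nth open_ball)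
  then show thesis by (rule that[OF r(1) order_refl]) (unfold p, use T0 True in auto)
 next
  case ab: False
  have Tind: "s = 0 \<and> t = 0" if x: "x \<in> ball 0 r" and z: "of_real s * T a x + of_real t * T b x = 0" for s t x
  proof -
   let ?W = "\<lambda>i. if i = a then s else if i = b then t else (0::real)"
   have "(\<Sum>i\<in>UNIV. of_real (?W i) * T i x) = of_real (?W a) * T a x + of_real (?W b) * T b x"
    by (rule sum_two[OF ab]) auto
   also have "... = 0" using z ab by simp
   finally have "\<forall>i. ?W i = 0" using pind[OF x, unfolded real_independent_on_def, rule_format, of ?W] by (auto simp: T_def)
   from spec[OF this, of a] spec[OF this, of b] show ?thesis using ab by simp
  qed
  define m where "m x = T b x / T a x" for x
  have msm: "smooth_on (ball 0 r) m" unfolding m_def[abs_def] by (intro smooth_divide open_ball Tsm Ta)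
  have Im_m: "Im (m x) \<noteq> 0" if x: "x \<in> ball 0 r" for x
  proof
   assume "Im (m x) = 0"
   then have "m x = of_real (Re (m x))" by (simp add: complex_eq_iff)
   then have "T b x = of_real (Re (m x)) * T a x" using Ta[OF x] by (simp add: m_def field_simps)
   then show False using Tind[OF x, of "- Re (m x)" 1] by simp
  qed
  have pdm: "pd c m x = 0" if x: "x \<in> ball 0 r" and c: "c \<noteq> a" "c \<noteq> b" for c x
  proof -
   \<comment> \<open>The kernel vector in the (a,b)-plane. Closedness on it and on the c-th axis
     says T_a d_c T_b = T_b d_c T_a, which is d_c m = 0.\<close>
   let ?v = "\<lambda>i. if i = a then T b x else if i = b then - T a x else 0"
   have kc: "kernel_closed (ball 0 r) T"
    unfolding T_def[abs_def] by (rule kernel_closed_pullback[OF open_ball open_ball theta' r(2) phiim ker'])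
   have z: "pd i (T c) x = 0" for i
   proof -
    have "pd i (T c) x = pd i (\<lambda>x. 0) x" by (rule pd_cong_open[OF open_ball x]) (use T0 c in auto)
    then show ?thesis by simp
   qed
   have s: "(\<Sum>i\<in>UNIV. g i * (if i = c then 1 else 0)) = g c" for g :: "'n => complex" by (subst sum_one[of c]) auto
   have v0: "(\<Sum>i\<in>UNIV. T i x * ?v i) = 0" using ab by (subst sum_two[OF ab]) auto
   have w0: "(\<Sum>i\<in>UNIV. T i x * (if i = c then 1 else 0)) = 0" unfolding s using T0[OF x] c by auto
   have "(\<Sum>i\<in>UNIV. \<Sum>j\<in>UNIV. (pd i (T j) x - pd j (T i) x) * ?v i * (if j = c then 1 else 0)) = 0"
    using kc[unfolded kernel_closed_def, rule_format, OF x v0 w0] .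
   then have "(\<Sum>i\<in>UNIV. - pd c (T i) x * ?v i) = 0" unfolding s z by simp
   moreover have "(\<Sum>i\<in>UNIV. - pd c (T i) x * ?v i) = - pd c (T a) x * ?v a + - pd c (T b) x * ?v b"
    by (rule sum_two[OF ab]) auto
   ultimately have e: "T a x * pd c (T b) x = T b x * pd c (T a) x" using ab by (simp add: algebra_simps)
   have "pd c (\<lambda>x. T a x * m x) x = pd c (T b) x"
    by (rule pd_cong_open[OF open_ball x]) (use Ta in \<open>simp add: m_def\<close>)
   then have "T a x * pd c m x + pd c (T a) x * m x = pd c (T b) x"
    using pd_mult[OF Td[OF x] smoothD[OF msm x]] by simp
   then have "T a x * (T a x * pd c m x) = 0"
    using e Ta[OF x] by (simp add: m_def field_simps)
   then show ?thesis using Ta[OF x] by simp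
  qed
  obtain r' Z where r': "0 < r'" "r' \<le> r" "smooth_on (ball 0 r') Z"
   and Z0: "!!x d. x \<in> ball 0 r' ==> d \<noteq> a ==> d \<noteq> b ==> pd d Z x = 0"
   and Zb: "!!x. x \<in> ball 0 r' ==> pd b Z x = m x * pd a Z x" and Za: "!!x. x \<in> ball 0 r' ==> pd a Z x \<noteq> 0"
   using local_beltrami[OF ab msm r(1) _ pdm] Im_m[of 0] r(1) by auto
  have "T a x * pd d Z x = T d x * pd a Z x" if x: "x \<in> ball 0 r'" for x d
   using Zb[OF x] Z0[OF x, of d] T0[of x d] Ta[of x] x r'(2) by (cases "d = a"; cases "d = b") (auto simp: m_def)
  then show thesis using that[OF r' Za] ab by blast
 qed
 define V' where "V' = V \<inter> psi -` ball 0 r'"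
 have V': "open V'" unfolding V'_def by (rule continuous_open_preimage[OF smoothC[OF V(2)] V(1) open_ball])
 define u where "u y = Z (psi y)" for y
 have smu: "smooth_on V' u"
  unfolding u_def[abs_def]
  by (rule smooth_compose[OF V' r'(3) smooth_subset[OF V(2)]]) (auto simp: V'_def)
 have main: "\<exists>mu. mu \<noteq> 0 \<and> (\<forall>i. pd i u y = mu * theta i y)" if y: "y \<in> V'" for y
 proof -
  have yV: "y \<in> V" and yr: "psi y \<in> ball 0 r'" "psi y \<in> ball 0 r" using y psir by (auto simp: V'_def)
  define mu where "mu = pd a Z (psi y) / T a (psi y)"
  have ZT: "pd c Z (psi y) = mu * T c (psi y)" for c
   using ZT'[OF yr(1), of c] Ta[OF yr(2)] by (simp add: mu_def field_simps)
  have "pd i u y = mu * theta i y" for i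
  proof -
   have "pd i u y = (\<Sum>j\<in>UNIV. pd i psi y $ j *\<^sub>R pd j Z (psi y))"
    unfolding u_def[abs_def]
    by (rule pd_compose(1)[OF smoothD[OF r'(3) yr(1)] smoothD[OF V(2) yV]])
   also have "... = mu * theta i y"
    unfolding rep[OF yV] ZT sum_distrib_left by (rule sum.cong) (auto simp: T_def scaleR_conv_of_real)
   finally show ?thesis .
  qed
  moreover have "mu \<noteq> 0" using Za[OF yr(1)] Ta[OF yr(2)] by (simp add: mu_def)
  ultimately show ?thesis by blast
 qed
 have "psi (phi 0) = 0" "phi 0 \<in> V" using V(3) r(1) by (auto simp: homeomorphism_def)
 then have "0 \<in> V'" using V(4) r'(1) by (auto simp: V'_def)
 then show ?thesis using that[of V' u, OF V' _ _ smu main] V(5) sub Zr by (auto simp: V'_def u_def)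
qed

lemma pd_translate:
 assumes "f differentiable at (x + p)"
 shows "pd i (\<lambda>x. f (x + p)) x = pd i f (x + p)"
proof -
 have "(f has_derivative frechet_derivative f (at (x + p))) (at (x + p))" using assms frechet_derivative_works by blast
 moreover have "((\<lambda>x. x + p) has_derivative (\<lambda>h. h)) (at x)" by (auto intro!: derivative_eq_intros)
 ultimately have "((\<lambda>x. f (x + p)) has_derivative (\<lambda>h. frechet_derivative f (at (x + p)) h)) (at x)"
  by (rule has_derivative_compose[rotated])
 then show ?thesis by (simp add: pd_eqI pd_def[symmetric])
qed

lemma smooth_translate:
 assumes "smooth_on U f" "open S" "(\<lambda>x. x + p) ` S \<subseteq> U"
 shows "smooth_on S (\<lambda>x. f (x + p))"
 by (rule smooth_compose[OF assms(2,1) _ assms(3)]) (intro smooth_add assms(2) smooth_ident smooth_const)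

text \<open>The two alternatives are exactly the real and the genuinely complex case at p; the base
  point is moved to 0 and back. Excluded is a complex field that happens to be a multiple of a real
  covector at p alone.\<close>

theorem integrating_factor:
 fixes theta :: "'n::finite => real ^ 'n => complex"
 assumes U: "open U" "p \<in> U" and theta: "!!i. smooth_on U (theta i)" and ker: "kernel_closed U theta"
  and "(\<exists>a. theta a p \<noteq> 0 \<and> (\<forall>x\<in>U. \<forall>i. theta i x \<in> \<real>)) \<or> (\<exists>a b. Im (cnj (theta a p) * theta b p) \<noteq> 0)"
 obtains V u where "open V" "p \<in> V" "V \<subseteq> U" "smooth_on V u" "!!x. x \<in> V ==> \<exists>mu. mu \<noteq> 0 \<and> (\<forall>i. pd i u x = mu * theta i x)" "factors_through V theta u"
proof -
 obtain R where R: "R > 0" "ball p R \<subseteq> U" using U openE by blast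
 have img: "(\<lambda>x. x + p) ` ball 0 R \<subseteq> U" using R(2) by (force simp: dist_norm)
 define T where "T i x = theta i (x + p)" for i x
 have Tsm: "smooth_on (ball 0 R) (T i)" for i
  unfolding T_def by (rule smooth_translate[OF theta open_ball img])
 have pdT: "pd j (T i) x = pd j (theta i) (x + p)" if "x \<in> ball 0 R" for i j x
  unfolding T_def[abs_def] by (rule pd_translate) (use smoothD[OF theta] img that in blast)
 have Tker: "kernel_closed (ball 0 R) T"
  unfolding kernel_closed_def
 proof (intro ballI allI impI)
  fix x and v w :: "'n => complex" assume x: "x \<in> ball 0 R" and v: "(\<Sum>i\<in>UNIV. T i x * v i) = 0" and w: "(\<Sum>i\<in>UNIV. T i x * w i) = 0"
  have xU: "x + p \<in> U" using img x by blast
  show "(\<Sum>i\<in>UNIV. \<Sum>j\<in>UNIV. (pd i (T j) x - pd j (T i) x) * v i * w j) = 0"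
   unfolding pdT[OF x] using ker[unfolded kernel_closed_def, rule_format, OF xU v[unfolded T_def] w[unfolded T_def]] .
 qed
 have translate_back: "\<exists>V u. open V \<and> p \<in> V \<and> V \<subseteq> U \<and> smooth_on V u \<and> (\<forall>x\<in>V. \<exists>mu. mu \<noteq> 0 \<and> (\<forall>i. pd i u x = mu * theta i x))
   \<and> ((\<forall>x\<in>W. w x \<in> \<real>) --> (\<forall>x\<in>V. u x \<in> \<real>))"
  if W: "open W" "0 \<in> W" "W \<subseteq> ball 0 R" "smooth_on W w" "!!x. x \<in> W ==> \<exists>mu. mu \<noteq> 0 \<and> (\<forall>i. pd i w x = mu * T i x)" for W w
 proof -
  define V where "V = (\<lambda>x. x - p) -` W"
  define u where "u x = w (x + - p)" for x
  have V: "open V" unfolding V_def by (intro open_vimage W continuous_intros)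
  have "smooth_on V u" unfolding u_def[abs_def] by (rule smooth_translate[OF W(4) V]) (auto simp: V_def)
  moreover have "\<exists>mu. mu \<noteq> 0 \<and> (\<forall>i. pd i u x = mu * theta i x)" if x: "x \<in> V" for x
  proof -
   have xW: "x + - p \<in> W" using x by (simp add: V_def)
   have "pd i u x = pd i w (x + - p)" for i
    unfolding u_def[abs_def] by (rule pd_translate[OF smoothD[OF W(4) xW]])
   then show ?thesis using W(5)[OF xW] by (simp add: T_def)
  qed
  moreover have "V \<subseteq> U"
  proof
   fix x assume "x \<in> V"
   then have "x - p \<in> ball 0 R" using W(3) by (auto simp: V_def)
   then show "x \<in> U" using img by force
  qed
  ultimately show ?thesis using V W(2) by (intro exI[of _ V] exI[of _ u]) (auto simp: V_def u_def)
 qed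
 note main = that
 have finish: thesis
  if V: "open V" "p \<in> V" "V \<subseteq> U" "smooth_on V u" "!!x. x \<in> V ==> \<exists>mu. mu \<noteq> 0 \<and> (\<forall>i. pd i u x = mu * theta i x)"
   and V': "open V'" "p \<in> V'" "V' \<subseteq> V" and F: "factors_through V' (\<lambda>i. pd i u) u" for V V' u
 proof -
  have par: "\<exists>nu. \<forall>i. pd i h x = nu * pd i u x" if x: "x \<in> V'" and h: "\<exists>nu. \<forall>i. pd i h x = nu * theta i x" for h x
  proof -
   obtain mu nu where "mu \<noteq> 0" "!!i. pd i u x = mu * theta i x" "!!i. pd i h x = nu * theta i x" using V(5) V'(3) h x by blast
   then have "\<forall>i. pd i h x = (nu / mu) * pd i u x" by simp
   then show ?thesis by blast
  qed
  have ft: "factors_through V' theta u"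
   unfolding factors_through_def
  proof (intro allI impI)
   fix h :: "real ^ 'n => complex"
   assume h: "(\<forall>x\<in>V'. h differentiable at x) \<and> (\<forall>x\<in>V'. \<exists>nu. \<forall>i. pd i h x = nu * theta i x)"
   show "\<exists>F. F holomorphic_on u ` V' \<and> (\<forall>x\<in>V'. h x = F (u x))"
    by (rule F[unfolded factors_through_def, rule_format]) (use h par in blast)
  qed
  show thesis
   by (rule main[OF V'(1,2) subset_trans[OF V'(3) V(3)] smooth_subset[OF V(4) V'(3)] V(5)[OF subsetD[OF V'(3)]] ft])
 qed
 obtain a b where nz: "if a = b then theta a p \<noteq> 0 \<and> (\<forall>x\<in>U. \<forall>i. theta i x \<in> \<real>) else Im (cnj (theta a p) * theta b p) \<noteq> 0"
 proof -
  have "a \<noteq> b" if "Im (cnj (theta a p) * theta b p) \<noteq> 0" for a b using that by (auto simp: algebra_simps)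
  then show thesis using assms(5) that by (metis (no_types, lifting))
 qed
 then have nzT: "if a = b then T a 0 \<noteq> 0 \<and> (\<forall>x\<in>ball 0 R. \<forall>i. T i x \<in> \<real>) else Im (cnj (T a 0) * T b 0) \<noteq> 0"
  using img by (auto simp: T_def split: if_splits)
 obtain W w where W: "open W" "0 \<in> W" "W \<subseteq> ball 0 R" "smooth_on W w"
  "!!x. x \<in> W ==> \<exists>mu. mu \<noteq> 0 \<and> (\<forall>i. pd i w x = mu * T i x)" "!!x. a = b ==> x \<in> W ==> w x \<in> \<real>"
  using local_integrating_factor[OF R(1) Tsm Tker nzT] by blast
 obtain V u where V: "open V" "p \<in> V" "V \<subseteq> U" "smooth_on V u" "!!x. x \<in> V ==> \<exists>mu. mu \<noteq> 0 \<and> (\<forall>i. pd i u x = mu * theta i x)"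
  and ur: "(\<forall>x\<in>W. w x \<in> \<real>) --> (\<forall>x\<in>V. u x \<in> \<real>)"
  using translate_back[OF W(1-5)] by blast
 obtain mu :: complex where mu: "mu \<noteq> 0" "!!i. pd i u p = mu * theta i p" using V(5)[OF V(2)] by blast
 \<comment> \<open>Passing from theta to du multiplies the real determinant of the two components by
   |mu|^2, so it stays nonzero.\<close>
 have "cnj (pd a u p) * pd b u p = (cnj mu * mu) * (cnj (theta a p) * theta b p)" by (simp add: mu(2))
 also have "... = of_real ((norm mu)\<^sup>2) * (cnj (theta a p) * theta b p)" by (simp only: complex_norm_square mult.commute[of mu])
 finally have "Im (cnj (pd a u p) * pd b u p) = (norm mu)\<^sup>2 * Im (cnj (theta a p) * theta b p)" by (simp only: Im_complex_of_real Re_complex_of_real times_complex.sel(2) mult_zero_left add_0_right)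
 then have uab: "if a = b then pd a u p \<noteq> 0 \<and> (\<forall>x\<in>V. u x \<in> \<real>) else Im (cnj (pd a u p) * pd b u p) \<noteq> 0"
  using nz mu ur W(6) by auto
 obtain V' where V': "open V'" "p \<in> V'" "V' \<subseteq> V" and F: "factors_through V' (\<lambda>i. pd i u) u"
  using function_of_integral[OF V(1,2,4) uab] by blast
 show ?thesis by (rule finish[OF V V' F])
qed

section \<open>The Levi-Civita connection in Lame coordinates\<close>

lemma matrix_ring:
 fixes A B C :: "'a::comm_ring_1 ^ 'n ^ 'n"
 shows "(A + B) ** C = A ** C + B ** C" "C ** (A + B) = C ** A + C ** B"
  "(A - B) ** C = A ** C - B ** C" "C ** (A - B) = C ** A - C ** B"
  "(- A) ** C = - (A ** C)" "C ** (- A) = - (C ** A)" "0 ** A = 0" "A ** 0 = 0" "A ** (B ** C) = A ** B ** C"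
  "transpose (A + B) = transpose A + transpose B" "transpose (- A) = - transpose A" "transpose (A - B) = transpose A - transpose B"
 by (simp_all add: matrix_mul_assoc) (simp_all add: vec_eq_iff mm_mult transpose_def distrib_left distrib_right
   left_diff_distrib right_diff_distrib sum.distrib sum_subtractf sum_negf)

lemma diff_vec_iff: "f differentiable at x \<longleftrightarrow> (\<forall>i. (\<lambda>x. f x $ i) differentiable at x)"
 for f :: "real ^ 'n => 'b::real_normed_vector ^ 'm"
 using pd_vec_lambda(1)[of "\<lambda>i x. f x $ i"] differentiable_linear[OF bounded_linear_vec_nth] by auto

lemma pd_matrix_mult:
 fixes A B :: "real ^ 'n => complex ^ 'm ^ 'm"
 assumes "A differentiable at x" "B differentiable at x"
 shows "pd k (\<lambda>x. A x ** B x) x = A x ** pd k B x + pd k A x ** B x" "(\<lambda>x. A x ** B x) differentiable at x"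
proof -
 have d: "(\<lambda>x. A x $ i $ j) differentiable at x" "(\<lambda>x. B x $ i $ j) differentiable at x" for i j
  using assms by (simp_all add: diff_vec_iff)
 have c: "pd k (\<lambda>x. A x $ i $ j) x = pd k A x $ i $ j" "pd k (\<lambda>x. B x $ i $ j) x = pd k B x $ i $ j" for i j
  using assms by (simp_all add: pd_component diff_vec_iff)
 show *: "(\<lambda>x. A x ** B x) differentiable at x"
  by (auto simp: diff_vec_iff mm_mult intro!: differentiable_sum differentiable_mult d)
 have "pd k (\<lambda>x. A x ** B x) x $ i $ j = pd k (\<lambda>x. (A x ** B x) $ i $ j) x" for i j
  using * by (simp add: pd_component diff_vec_iff)
 also have "... i j = (A x ** pd k B x + pd k A x ** B x) $ i $ j" for i j
  using d by (simp add: mm_mult pd_sum pd_mult differentiable_mult c sum.distrib)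
 finally show "pd k (\<lambda>x. A x ** B x) x = A x ** pd k B x + pd k A x ** B x" by (simp add: vec_eq_iff)
qed

lemma pd_transpose:
 fixes A :: "real ^ 'n => complex ^ 'm ^ 'm"
 assumes "A differentiable at x"
 shows "pd k (\<lambda>x. transpose (A x)) x = transpose (pd k A x)" "(\<lambda>x. transpose (A x)) differentiable at x"
proof -
 show *: "(\<lambda>x. transpose (A x)) differentiable at x" using assms by (simp add: diff_vec_iff transpose_def)
 have "pd k (\<lambda>x. transpose (A x)) x $ i $ j = pd k (\<lambda>x. transpose (A x) $ i $ j) x" for i j
  using * by (simp add: pd_component diff_vec_iff)
 then show "pd k (\<lambda>x. transpose (A x)) x = transpose (pd k A x)"
  using assms by (simp add: vec_eq_iff transpose_def pd_component diff_vec_iff)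
qed

definition cmat :: "real ^ 'n ^ 'n => complex ^ 'n ^ 'n"
 where "cmat A = map_matrix complex_of_real A"

lemma cmat_nth [simp]: "cmat A $ i $ j = of_real (A $ i $ j)"
 by (simp add: cmat_def map_matrix_def)

lemma cmat_mult: "cmat (A ** B) = cmat A ** cmat B"
 by (simp add: vec_eq_iff mm_mult)

lemma cmat_mat [simp]: "cmat (mat 1) = mat 1"
 by (simp add: vec_eq_iff mat_def)

lemma det_cmat: "det (cmat A) = of_real (det A)"
 by (simp add: det_def of_real_sum of_real_prod)

lemma det_nz_iff_inverse:
 fixes A :: "'a::field ^ 'n ^ 'n"
 assumes "A ** B = mat 1"
 shows "B ** A = mat 1" "det A \<noteq> 0" "matrix_inv A = B"
proof -
 show BA: "B ** A = mat 1" using assms by (simp add: matrix_left_right_inverse)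
 have "det A * det B = 1" using assms by (metis det_mul det_I)
 then show nz: "det A \<noteq> 0" by auto
 have "matrix_inv A = matrix_inv A ** (A ** B)" using assms by simp
 also have "... = B" by (simp only: matrix_ring matrix_inv_id[OF nz] matrix_mul_lid)
 finally show "matrix_inv A = B" .
qed

text \<open>The connection matrix in direction k, complexified because it will be transformed to a
  complex frame.\<close>

definition chr :: "'n::finite tensor2 => 'n => real ^ 'n => complex ^ 'n ^ 'n"
 where "chr g k x = (\<chi> i j. of_real (christoffel g i k j x))"

text \<open>The two characterizing properties of the Levi-Civita connection at one point: the
  contravariant metric is parallel and the torsion vanishes.\<close>

definition metric_connection :: "'n::finite tensor2 => ('n => complex ^ 'n ^ 'n) => real ^ 'n => bool"
 where "metric_connection g A x \<longleftrightarrow> (\<forall>k. pd k (\<lambda>y. cmat (g y)) x + A k ** cmat (g x) + cmat (g x) ** transpose (A k) = 0) \<and>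
   (\<forall>i j k. A k $ i $ j = A j $ i $ k)"

context
 fixes S :: "(real ^ 'n) set" and g :: "'n tensor2"
 assumes S: "open S" and g: "contravariant_metric S g"
begin

lemma metric_smooth: "smooth_on S (\<lambda>y. g y $ i $ j)" and metric_sym: "x \<in> S ==> transpose (g x) = g x"
 and metric_det: "x \<in> S ==> det (g x) \<noteq> 0"
 using g by (auto simp: contravariant_metric_def)

lemma covariant_smooth: "smooth_on S (\<lambda>y. covariant g y $ i $ j)"
 unfolding covariant_def by (rule smooth_matrix_inv[OF S metric_smooth metric_det])

lemma christoffel_smooth: "smooth_on S (christoffel g i j k)"
 unfolding christoffel_def[abs_def]
 by (intro smooth_mult smooth_const smooth_sum smooth_diff smooth_add smooth_pd covariant_smooth metric_smooth S)

lemma cmat_differentiable: "x \<in> S ==> (\<lambda>y. cmat (g y)) differentiable at x"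
 by (simp add: diff_vec_iff differentiable_linear[OF bounded_linear_of_real smoothD[OF metric_smooth]])

lemma covariant_differentiable: "x \<in> S ==> (\<lambda>y. cmat (covariant g y)) differentiable at x"
 by (simp add: diff_vec_iff differentiable_linear[OF bounded_linear_of_real smoothD[OF covariant_smooth]])

lemma cmat_inverse:
 assumes "x \<in> S"
 shows "cmat (g x) ** cmat (covariant g x) = mat 1" "cmat (covariant g x) ** cmat (g x) = mat 1"
 unfolding cmat_mult[symmetric] covariant_def by (simp_all add: matrix_inv_id[OF metric_det[OF assms]])

lemma cmat_sym: "x \<in> S ==> transpose (cmat (g x)) = cmat (g x)"
 using metric_sym[of x] by (simp add: vec_eq_iff transpose_def)

lemma covariant_sym:
 assumes "x \<in> S"
 shows "covariant g x $ i $ j = covariant g x $ j $ i"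
proof -
 have "transpose (covariant g x) ** g x = transpose (g x ** covariant g x)"
  by (simp add: matrix_transpose_mul metric_sym[OF assms])
 then have "transpose (covariant g x) ** g x = mat 1"
  by (simp add: covariant_def matrix_inv_id[OF metric_det[OF assms]] transpose_mat)
 then have "matrix_inv (g x) = transpose (covariant g x)" using det_nz_iff_inverse(1,3) by blast
 then have "covariant g x = transpose (covariant g x)" unfolding covariant_def .
 from arg_cong[OF this, of "\<lambda>M. M $ i $ j"] show ?thesis by (simp add: transpose_def)
qed

lemma pd_covariant:
 assumes x: "x \<in> S"
 shows "pd k (\<lambda>y. cmat (covariant g y)) x = - (cmat (covariant g x) ** pd k (\<lambda>y. cmat (g y)) x ** cmat (covariant g x))"
proof -
 let ?h = "\<lambda>y. cmat (covariant g y)" and ?G = "\<lambda>y. cmat (g y)"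
 have "pd k (\<lambda>y. ?h y ** ?G y) x = pd k (\<lambda>y. mat 1) x" by (rule pd_cong_open[OF S x cmat_inverse(2)])
 then have "?h x ** pd k ?G x + pd k ?h x ** ?G x = 0"
  by (simp add: pd_matrix_mult(1)[OF covariant_differentiable[OF x] cmat_differentiable[OF x]])
 then have "(?h x ** pd k ?G x + pd k ?h x ** ?G x) ** ?h x = 0" by (simp add: matrix_ring)
 moreover have "pd k ?h x ** ?G x ** ?h x = pd k ?h x" using cmat_inverse(1)[OF x] by (simp flip: matrix_ring(9))
 ultimately show ?thesis by (simp add: matrix_ring add_eq_0_iff)
qed

lemma christoffel_koszul:
 assumes "x \<in> S"
 shows "chr g k x $ i $ j = (\<Sum>s\<in>UNIV. cmat (g x) $ i $ s *
   ((pd k (\<lambda>y. cmat (covariant g y)) x $ s $ j + pd j (\<lambda>y. cmat (covariant g y)) x $ k $ s - pd s (\<lambda>y. cmat (covariant g y)) x $ k $ j) / 2))"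
proof -
 have "pd m (\<lambda>y. cmat (covariant g y)) x $ s $ t = of_real (pd m (\<lambda>y. covariant g y $ s $ t) x)" for m s t
 proof -
  have d: "(\<lambda>y. cmat (covariant g y) $ s) differentiable at x"
   using covariant_differentiable[OF assms] by (simp add: diff_vec_iff)
  have "pd m (\<lambda>y. cmat (covariant g y)) x $ s $ t = pd m (\<lambda>y. complex_of_real (covariant g y $ s $ t)) x"
   using pd_component[OF covariant_differentiable[OF assms], of m s] pd_component[OF d, of m t] by simp
  then show ?thesis by (simp add: pd_linear[OF bounded_linear_of_real smoothD[OF covariant_smooth assms]])
 qed
 then show ?thesis by (simp add: chr_def christoffel_def sum_distrib_left mult_ac)
qed

lemma pd_covariant_sym: "x \<in> S ==> pd m (\<lambda>y. cmat (covariant g y)) x $ s $ t = pd m (\<lambda>y. cmat (covariant g y)) x $ t $ s"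
 using pd_cong_open[OF S, of x "\<lambda>y. cmat (covariant g y)" "\<lambda>y. transpose (cmat (covariant g y))" m]
  pd_transpose(1)[OF covariant_differentiable] covariant_sym
 by (simp add: vec_eq_iff transpose_def)

text \<open>With the upper index lowered, metricity gives L_k plus its transpose and vanishing
  torsion gives a symmetry in the other pair of indices; cyclic permutation leaves only Koszul's
  formula.\<close>

lemma christoffel_unique:
 assumes x: "x \<in> S" and A: "metric_connection g A x"
 shows "A k = chr g k x"
proof -
 let ?h = "cmat (covariant g x)" and ?G = "cmat (g x)"
 define L where "L k = ?h ** A k" for k
 have hT: "transpose ?h = ?h" using covariant_sym[OF x] by (simp add: vec_eq_iff transpose_def)
 have dh: "pd k (\<lambda>y. cmat (covariant g y)) x = L k + transpose (L k)" for k
 proof -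
  have "pd k (\<lambda>y. cmat (g y)) x + A k ** ?G + ?G ** transpose (A k) = 0" using A unfolding metric_connection_def by blast
  then have "- pd k (\<lambda>y. cmat (g y)) x = A k ** ?G + ?G ** transpose (A k)" by (intro minus_unique) (simp only: add.assoc)
  moreover have "pd k (\<lambda>y. cmat (covariant g y)) x = ?h ** - pd k (\<lambda>y. cmat (g y)) x ** ?h"
   unfolding pd_covariant[OF x] by (simp only: matrix_ring)
  ultimately have "pd k (\<lambda>y. cmat (covariant g y)) x = ?h ** (A k ** ?G + ?G ** transpose (A k)) ** ?h" by simp
  also have "... = ?h ** A k ** (?G ** ?h) + (?h ** ?G) ** transpose (A k) ** ?h" by (simp add: matrix_ring)
  finally show ?thesis unfolding cmat_inverse[OF x] L_def matrix_transpose_mul hT by simp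
 qed
 have Ls: "(\<Sum>s\<in>UNIV. ?h $ i $ s * A k $ s $ j) = (\<Sum>s\<in>UNIV. ?h $ i $ s * A j $ s $ k)" for i j k
  using A unfolding metric_connection_def by (intro sum.cong refl) metis
 have sym: "L k $ i $ j = L j $ i $ k" for i j k
  using Ls[of i k j] by (simp add: L_def mm_mult)
 have "chr g k x $ i $ j = (\<Sum>s\<in>UNIV. ?G $ i $ s * L k $ s $ j)" for i j
  unfolding christoffel_koszul[OF x] dh
 proof (rule sum.cong[OF refl])
  fix s show "?G $ i $ s * (((L k + transpose (L k)) $ s $ j + (L j + transpose (L j)) $ k $ s - (L s + transpose (L s)) $ k $ j) / 2) = ?G $ i $ s * L k $ s $ j"
   using sym[of k j s] sym[of j s k] sym[of j k s] by (simp add: transpose_def)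
 qed
 then have "chr g k x = ?G ** L k" by (simp add: vec_eq_iff mm_mult)
 also have "... = A k" unfolding L_def matrix_ring(9) cmat_inverse[OF x] by simp
 finally show ?thesis by simp
qed

lemma christoffel_metric_connection:
 assumes x: "x \<in> S"
 shows "metric_connection g (\<lambda>k. chr g k x) x"
proof -
 let ?h = "cmat (covariant g x)" and ?G = "cmat (g x)"
 let ?d = "\<lambda>k. pd k (\<lambda>y. cmat (covariant g y)) x"
 define L where "L k = (\<chi> s j. (?d k $ s $ j + ?d j $ k $ s - ?d s $ k $ j) / 2)" for k
 have chr: "chr g k x = ?G ** L k" for k
  by (simp add: vec_eq_iff christoffel_koszul[OF x] L_def mm_mult)
 have sym: "L k $ s $ j = L j $ s $ k" for k s j
  using pd_covariant_sym[OF x, of k s j] pd_covariant_sym[OF x, of j s k] pd_covariant_sym[OF x, of s k j] by (simp add: L_def)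
 have LT: "L k + transpose (L k) = ?d k" for k
  using pd_covariant_sym[OF x] by (simp add: vec_eq_iff L_def transpose_def field_simps)
 have "pd k (\<lambda>y. cmat (g y)) x + chr g k x ** ?G + ?G ** transpose (chr g k x) = 0" for k
 proof -
  have "?G ** ?d k ** ?G = - ((?G ** ?h) ** pd k (\<lambda>y. cmat (g y)) x ** (?h ** ?G))"
   unfolding pd_covariant[OF x] by (simp add: matrix_ring)
  then have "pd k (\<lambda>y. cmat (g y)) x = - (?G ** ?d k ** ?G)" unfolding cmat_inverse[OF x] by simp
  then show ?thesis unfolding LT[symmetric] chr matrix_transpose_mul cmat_sym[OF x] by (simp add: matrix_ring)
 qed
 moreover have "chr g k x $ i $ j = chr g j x $ i $ k" for i j k
  unfolding chr mm_mult by (simp add: sym[of k _ j])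
 ultimately show ?thesis unfolding metric_connection_def by blast
qed

lemma chr_differentiable: "x \<in> S ==> chr g k differentiable at x"
 by (simp add: diff_vec_iff chr_def[abs_def] differentiable_linear[OF bounded_linear_of_real smoothD[OF christoffel_smooth]])

text \<open>In matrix form the curvature is d_k A_l - d_l A_k + [A_k, A_l], the shape in which a
  change of frame acts by conjugation.\<close>

lemma riemann_matrix:
 assumes x: "x \<in> S"
 shows "of_real (riemann g i j k l x) = (pd k (chr g l) x - pd l (chr g k) x + chr g k x ** chr g l x - chr g l x ** chr g k x) $ i $ j"
proof -
 have "pd k (chr g l) x $ i $ j = of_real (pd k (christoffel g i l j) x)" for k l
 proof -
  have d: "(\<lambda>y. chr g l y $ i) differentiable at x" using chr_differentiable[OF x] by (simp add: diff_vec_iff)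
  have "pd k (chr g l) x $ i $ j = pd k (\<lambda>y. chr g l y $ i $ j) x"
   using pd_component[OF chr_differentiable[OF x], of k l i] pd_component[OF d, of k j] by simp
  then show ?thesis by (simp add: chr_def pd_linear[OF bounded_linear_of_real smoothD[OF christoffel_smooth x]])
 qed
 then show ?thesis by (simp add: riemann_def chr_def mm_mult sum_subtractf)
qed

text \<open>The two lower indices stand in the opposite order in \<open>christoffel_up\<close> and
  in the transposed matrix; vanishing torsion exchanges them.\<close>

lemma christoffel_up_matrix: "of_real (christoffel_up g i j k x) = (cmat (g x) ** transpose (chr g k x)) $ i $ j"
 if "x \<in> S"
 using christoffel_metric_connection[OF that]
 by (simp add: christoffel_up_def mm_mult transpose_def metric_connection_def) (simp add: chr_def)

end

lemma sum_delta_mult: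
 fixes f :: "'n::finite => 'b::comm_ring_1"
 shows "(\<Sum>i\<in>UNIV. (if i = a then c i else 0) * f i) = c a * f a" "(\<Sum>i\<in>UNIV. f i * (if i = a then c i else 0)) = f a * c a"
  "(\<Sum>i\<in>UNIV. (if a = i then c i else 0) * f i) = c a * f a" "(\<Sum>i\<in>UNIV. f i * (if a = i then c i else 0)) = f a * c a"
 by (subst sum_one[of a]; simp)+

section \<open>Calculus in complex coordinates\<close>

locale coords =
 fixes V :: "(real ^ 'n) set" and u :: "real ^ 'n => complex ^ 'n"
 assumes V: "open V" and u_smooth: "smooth_on V (\<lambda>x. u x $ i)" and det_J: "x \<in> V ==> det (jacobian u x) \<noteq> 0"
begin

abbreviation "J i a x \<equiv> pd a (\<lambda>y. u y $ i) x"
abbreviation "X a i x \<equiv> matrix_inv (jacobian u x) $ a $ i"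

lemma J_nth: "jacobian u x $ i $ a = J i a x"
 by (simp add: jacobian_def)

lemma J_smooth: "smooth_on V (J i a)"
 by (rule smooth_pd[OF u_smooth])

lemma X_smooth: "smooth_on V (X a i)"
 by (rule smooth_matrix_inv[OF V _ det_J]) (simp add: J_nth J_smooth)

lemma JX: "x \<in> V ==> (\<Sum>a\<in>UNIV. J i a x * X a j x) = (if i = j then 1 else 0)"
 using arg_cong[OF matrix_inv_id(1)[OF det_J], of x "\<lambda>M. M $ i $ j"] by (simp add: mm_mult mat_def jacobian_def)

lemma XJ: "x \<in> V ==> (\<Sum>i\<in>UNIV. X a i x * J i b x) = (if a = b then 1 else 0)"
 using arg_cong[OF matrix_inv_id(2)[OF det_J], of x "\<lambda>M. M $ a $ b"] by (simp add: mm_mult mat_def jacobian_def)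

lemma cd_smooth: "smooth_on V h ==> smooth_on V (cd u i h)"
 unfolding cd_def[abs_def] by (intro smooth_sum smooth_mult X_smooth smooth_pd V)

lemma pd_cd:
 assumes "x \<in> V"
 shows "pd a h x = (\<Sum>i\<in>UNIV. J i a x * cd u i h x)"
proof -
 have "(\<Sum>i\<in>UNIV. J i a x * cd u i h x) = (\<Sum>b\<in>UNIV. (\<Sum>i\<in>UNIV. X b i x * J i a x) * pd b h x)"
  unfolding cd_def sum_distrib_left sum_distrib_right by (subst sum.swap) (simp add: mult_ac)
 then show ?thesis by (simp add: XJ[OF assms] sum_delta_mult)
qed

lemma cd_coord: "x \<in> V ==> cd u i (\<lambda>y. u y $ j) x = (if i = j then 1 else 0)"
 using JX[of x j i] by (simp add: cd_def mult.commute)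

lemma cd_cong: "x \<in> V ==> (!!y. y \<in> V ==> f y = h y) ==> cd u i f x = cd u i h x"
 unfolding cd_def using pd_cong_open[OF V, of x f h] by simp

lemma cd_const [simp]: "cd u i (\<lambda>x. c) x = 0"
 by (simp add: cd_def)

lemma cd_add:
 "x \<in> V ==> smooth_on V f ==> smooth_on V h ==> cd u i (\<lambda>x. f x + h x) x = cd u i f x + cd u i h x"
 by (simp add: cd_def pd_add smoothD distrib_left sum.distrib)

lemma cd_minus: "x \<in> V ==> smooth_on V f ==> cd u i (\<lambda>x. - f x) x = - cd u i f x"
 by (simp add: cd_def pd_minus smoothD sum_negf)

lemma cd_mult:
 "x \<in> V ==> smooth_on V f ==> smooth_on V h ==> cd u i (\<lambda>x. f x * h x) x = f x * cd u i h x + cd u i f x * h x"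
 by (simp add: cd_def pd_mult smoothD distrib_left sum.distrib sum_distrib_left sum_distrib_right mult_ac)

lemma cd_inverse:
 "x \<in> V ==> smooth_on V f ==> f x \<noteq> 0 ==> cd u i (\<lambda>x. inverse (f x)) x = - (cd u i f x / (f x)\<^sup>2)"
 by (simp add: cd_def pd_inverse smoothD sum_negf sum_distrib_right divide_inverse power_inverse mult.assoc)

text \<open>The hypothesis states that the matrix of \<open>T\<close>, multiplied by the Jacobian on
  both sides, is zero; the Jacobian is invertible.\<close>

lemma contract_zero:
 assumes x: "x \<in> V" and "!!a b. (\<Sum>i\<in>UNIV. \<Sum>j\<in>UNIV. J i a x * J j b x * T i j) = 0"
 shows "T i j = 0"
proof -
 let ?J = "jacobian u x" and ?T = "\<chi> i j. T i j"
 have "(transpose ?J ** ?T ** ?J) $ a $ b = (\<Sum>i\<in>UNIV. \<Sum>j\<in>UNIV. J i a x * J j b x * T i j)" for a b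
  by (simp add: mm_mult transpose_def J_nth sum_distrib_right) (subst sum.swap, simp add: mult_ac)
 then have 0: "transpose ?J ** ?T ** ?J = 0" by (simp add: vec_eq_iff assms(2))
 have "transpose (matrix_inv ?J) ** (transpose ?J ** ?T ** ?J) ** matrix_inv ?J = transpose (?J ** matrix_inv ?J) ** ?T ** (?J ** matrix_inv ?J)"
  by (simp add: matrix_ring matrix_transpose_mul)
 then have "?T = 0" unfolding 0 matrix_inv_id[OF det_J[OF x]] by (simp add: transpose_mat matrix_ring)
 then show ?thesis by (simp add: vec_eq_iff)
qed

lemma pd_J_sym: "x \<in> V ==> pd a (J i b) x = pd b (J i a) x"
 by (rule pd_commute[OF smooth_Ck[OF u_smooth] V])

text \<open>Second derivatives in x are symmetric and so are the derivatives of the Jacobian; what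
  remains is the commutator contracted with two Jacobians, and \<open>contract_zero\<close> removes
  these.\<close>

lemma cd_commute:
 assumes x: "x \<in> V" and h: "smooth_on V h"
 shows "cd u i (cd u j h) x = cd u j (cd u i h) x"
proof -
 have e: "pd a (pd b h) x = (\<Sum>j\<in>UNIV. pd a (J j b) x * cd u j h x) + (\<Sum>i\<in>UNIV. \<Sum>j\<in>UNIV. J i a x * J j b x * cd u i (cd u j h) x)" for a b
 proof -
  have d: "J i b differentiable at x" "cd u i h differentiable at x" for i
   by (rule smoothD[OF J_smooth x] smoothD[OF cd_smooth[OF h] x])+
  have "pd a (pd b h) x = pd a (\<lambda>x. \<Sum>j\<in>UNIV. J j b x * cd u j h x) x"
   by (rule pd_cong_open[OF V x pd_cd])
  also have "... = (\<Sum>j\<in>UNIV. J j b x * pd a (cd u j h) x + pd a (J j b) x * cd u j h x)"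
   using d by (subst pd_sum) (auto simp: pd_mult intro: differentiable_mult)
  also have "... = (\<Sum>j\<in>UNIV. pd a (J j b) x * cd u j h x) + (\<Sum>j\<in>UNIV. \<Sum>i\<in>UNIV. J i a x * J j b x * cd u i (cd u j h) x)"
   by (simp add: sum.distrib pd_cd[OF x, of a "cd u j h" for j] sum_distrib_left mult_ac)
  also have "(\<Sum>j\<in>UNIV. \<Sum>i\<in>UNIV. J i a x * J j b x * cd u i (cd u j h) x) = (\<Sum>i\<in>UNIV. \<Sum>j\<in>UNIV. J i a x * J j b x * cd u i (cd u j h) x)"
   by (rule sum.swap)
  finally show ?thesis .
 qed
 have "(\<Sum>i\<in>UNIV. \<Sum>j\<in>UNIV. J i a x * J j b x * (cd u i (cd u j h) x - cd u j (cd u i h) x)) = 0" for a b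
 proof -
  have "(\<Sum>i\<in>UNIV. \<Sum>j\<in>UNIV. J i a x * J j b x * cd u j (cd u i h) x) = (\<Sum>i\<in>UNIV. \<Sum>j\<in>UNIV. J i b x * J j a x * cd u i (cd u j h) x)"
   by (subst sum.swap) (simp add: mult_ac)
  moreover have "pd a (pd b h) x = pd b (pd a h) x" by (rule pd_commute[OF smooth_Ck[OF h] V x])
  ultimately show ?thesis by (simp add: e pd_J_sym[OF x, of a b] right_diff_distrib sum_subtractf)
 qed
 from contract_zero[OF x this, of i j] show ?thesis by simp
qed

end

section \<open>The orthogonal coframe and its connection\<close>

locale lame = coords +
 fixes H :: "'a => real ^ 'a => complex"
 assumes H_smooth: "smooth_on V (H i)" and H_nz: "x \<in> V ==> H i x \<noteq> 0"
begin

text \<open>Rotation coefficients with the diagonal set to 0, so that they may be summed over all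
  indices.\<close>

definition b :: "'a => 'a => real ^ 'a => complex"
 where "b i j = (if i = j then (\<lambda>x. 0) else rot u H i j)"

text \<open>Row i is the covector H_i du^i.\<close>

definition P :: "real ^ 'a => complex ^ 'a ^ 'a"
 where "P x = (\<chi> i a. H i x * J i a x)"

lemma b_smooth: "smooth_on V (b i j)"
 unfolding b_def rot_def[abs_def] using H_nz
 by (auto intro!: smooth_mult smooth_divide smooth_const cd_smooth H_smooth V)

lemma P_nth_smooth: "smooth_on V (\<lambda>x. P x $ i $ a)"
 unfolding P_def by (auto intro!: smooth_mult H_smooth J_smooth V)

lemma P_inverse: "x \<in> V ==> P x ** (\<chi> a i. X a i x / H i x) = mat 1"
proof -
 assume x: "x \<in> V"
 have "(\<Sum>a\<in>UNIV. H i x * J i a x * (X a j x / H j x)) = (\<Sum>a\<in>UNIV. J i a x * X a j x) * (H i x / H j x)" for i j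
  unfolding sum_distrib_right by (rule sum.cong) auto
 then show ?thesis using H_nz[OF x] by (simp add: vec_eq_iff mm_mult P_def mat_def JX[OF x])
qed

lemma det_P: "x \<in> V ==> det (P x) \<noteq> 0"
 by (rule det_nz_iff_inverse(2)[OF P_inverse])

lemma P_smooth: "smooth_on V P"
proof -
 have "smooth_on V (\<lambda>x. \<chi> i. \<chi> a. P x $ i $ a)" by (intro smooth_vec_lambda V P_nth_smooth)
 then show ?thesis by simp
qed

lemma P_diff: "x \<in> V ==> P differentiable at x" "x \<in> V ==> pd k P differentiable at x"
 by (rule smoothD[OF P_smooth], assumption) (rule smoothD[OF smooth_pd[OF P_smooth]])

lemma pd_matrix_nth: "M differentiable at x ==> pd k (\<lambda>x. M x $ i $ j) x = pd k M x $ i $ j"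
 for M :: "real ^ 'a => complex ^ 'm ^ 'l"
 by (simp add: pd_component diff_vec_iff)

text \<open>The derivative of H_i is expanded in the du^c, with c = i kept apart. That term and the
  one with second derivatives of u are symmetric in k and j, so only the rotation coefficients can
  contribute torsion.\<close>

lemma pd_P:
 assumes x: "x \<in> V"
 shows "pd k P x $ i $ j = H i x * pd k (J i j) x + (\<Sum>c\<in>UNIV. b c i x * H c x * J c k x) * J i j x + cd u i (H i) x * J i k x * J i j x"
proof -
 have "pd k P x $ i $ j = pd k (\<lambda>x. H i x * J i j x) x"
  using pd_matrix_nth[OF P_diff(1)[OF x], of k i j] by (simp add: P_def)
 also have "... = H i x * pd k (J i j) x + pd k (H i) x * J i j x"
  by (rule pd_mult[OF smoothD[OF H_smooth x] smoothD[OF J_smooth x]])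
 also have "pd k (H i) x = (\<Sum>c\<in>UNIV. b c i x * H c x * J c k x + (if c = i then cd u i (H i) x * J i k x else 0))"
  unfolding pd_cd[OF x, of k "H i"] by (rule sum.cong) (use H_nz[OF x] in \<open>auto simp: b_def rot_def\<close>)
 finally show ?thesis by (simp add: sum.distrib algebra_simps)
qed

lemma P_cancel: "x \<in> V ==> P x ** M = P x ** N \<longleftrightarrow> (M :: complex ^ 'a ^ 'a) = N" "x \<in> V ==> M ** P x = N ** P x \<longleftrightarrow> M = N"
 "x \<in> V ==> M ** transpose (P x) = N ** transpose (P x) \<longleftrightarrow> M = N"
proof -
 assume "x \<in> V"
 note inv = matrix_inv_id[OF det_P[OF this]]
 have l: "P x ** M = P x ** N ==> M = N" for M N :: "complex ^ 'a ^ 'a"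
  by (drule arg_cong[where f = "\<lambda>Y. matrix_inv (P x) ** Y"]) (simp add: matrix_ring inv)
 show "P x ** M = P x ** N \<longleftrightarrow> M = N" using l by blast
 show "M ** P x = N ** P x \<longleftrightarrow> M = N"
 proof
  assume "M ** P x = N ** P x"
  from arg_cong[OF this, of "\<lambda>Y. Y ** matrix_inv (P x)"] show "M = N" by (simp add: inv flip: matrix_ring(9))
 qed simp
 show "M ** transpose (P x) = N ** transpose (P x) \<longleftrightarrow> M = N"
 proof
  assume "M ** transpose (P x) = N ** transpose (P x)"
  from arg_cong[OF this, of transpose] have "P x ** transpose M = P x ** transpose N" by (simp add: matrix_transpose_mul)
  then show "M = N" using l by (metis transpose_transpose)
 qed simp
qed

end

text \<open>A general diagonal F, each entry depending on its own coordinate only, covers every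
  member l1 f + l2 of the pencil by a single computation.\<close>

locale lame_metric = lame +
 fixes F :: "'a => real ^ 'a => complex" and g :: "'a tensor2"
 assumes F_smooth: "smooth_on V (F i)" and F_nz: "x \<in> V ==> F i x \<noteq> 0"
  and F_single: "x \<in> V ==> i \<noteq> j ==> cd u j (F i) x = 0"
  and g: "contravariant_metric V g"
  and diag: "x \<in> V ==> coord_components u g x $ i $ j = (if i = j then F i x / (H i x)\<^sup>2 else 0)"
begin

text \<open>In the frame \<open>H\<^sub>i du\<^sup>i\<close> the connection form is \<open>\<Sum>\<^sub>c C\<^sub>c du\<^sup>c\<close>.\<close>

definition C :: "'a => 'a => 'a => real ^ 'a => complex"
 where "C i j c = (if i = j then (if c = i then \<lambda>x. - (cd u i (F i) x / (2 * F i x)) else (\<lambda>x. 0))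
  else if c = i then b j i else if c = j then \<lambda>x. - (F i x / F j x * b i j x) else (\<lambda>x. 0))"

definition W :: "'a => real ^ 'a => complex ^ 'a ^ 'a"
 where "W k x = (\<chi> i j. \<Sum>c\<in>UNIV. J c k x * C i j c x)"

lemma W_nth: "W k x $ i $ j = (if i = j then - (cd u i (F i) x / (2 * F i x)) * J i k x
  else b j i x * J i k x - F i x / F j x * b i j x * J j k x)"
proof (cases "i = j")
 case True
 then show ?thesis unfolding W_def by (simp add: C_def if_distribR if_distrib[of "\<lambda>z. _ * z"] cong: if_cong)
next
 case False
 then show ?thesis unfolding W_def by (simp, subst sum_two[OF False]) (auto simp: C_def)
qed

lemma C_smooth: "smooth_on V (C i j c)"
 unfolding C_def using F_nz
 by (auto intro!: smooth_minus smooth_divide smooth_mult cd_smooth F_smooth b_smooth V)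

lemma W_diff: "x \<in> V ==> W k differentiable at x"
 unfolding W_def[abs_def] diff_vec_iff
 by (auto intro!: differentiable_sum differentiable_mult smoothD[OF J_smooth] smoothD[OF C_smooth])

lemma PGP: "x \<in> V ==> P x ** cmat (g x) ** transpose (P x) = (\<chi> i j. if i = j then F i x else 0)"
proof -
 assume x: "x \<in> V"
 have "(P x ** cmat (g x) ** transpose (P x)) $ i $ j = H i x * H j x * coord_components u g x $ i $ j" for i j
  unfolding coord_components_def cmat_def[symmetric] P_def
  by (simp add: mm_mult transpose_def J_nth sum_distrib_left sum_distrib_right mult_ac)
 then show ?thesis using H_nz[OF x] by (simp add: vec_eq_iff diag[OF x] power2_eq_square)
qed

text \<open>The metric in the coframe is diag F; this is the statement that it is parallel for the
  connection form \<open>W\<close>.\<close>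

lemma W_skew:
 assumes x: "x \<in> V"
 shows "pd k (\<lambda>x. \<chi> i j. if i = j then F i x else 0) x + W k x ** (\<chi> i j. if i = j then F i x else 0)
  + (\<chi> i j. if i = j then F i x else 0) ** transpose (W k x) = 0"
proof -
 have d: "(\<lambda>x. if i = j then F i x else 0) differentiable at x" for i j
  using smoothD[OF F_smooth x] by (cases "i = j") auto
 have "pd k (\<lambda>x. \<chi> i j. if i = j then F i x else 0) x = (\<chi> i j. if i = j then pd k (F i) x else 0)"
  by (simp add: pd_vec_lambda d vec_eq_iff)
 moreover have "pd k (F i) x = J i k x * cd u i (F i) x" for i
  unfolding pd_cd[OF x, of k "F i"] using F_single[OF x] by (intro sum_one) auto
 moreover have "(M ** (\<chi> i j. if i = j then F i x else 0)) $ i $ j = M $ i $ j * F j x"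
  "((\<chi> i j. if i = j then F i x else 0) ** M) $ i $ j = F i x * M $ i $ j" for M i j
  by (simp_all add: mm_mult sum_delta_mult)
 ultimately show ?thesis
  using F_nz[OF x] by (auto simp: vec_eq_iff transpose_def W_nth field_simps)
qed

text \<open>The matrices obtained from \<open>W\<close> by the change of frame \<open>P\<close> are
  shown to be metric and torsion free; uniqueness of the Levi-Civita connection identifies them with
  the Christoffel symbols.\<close>

lemma connection:
 assumes x: "x \<in> V"
 shows "P x ** chr g k x = W k x ** P x + pd k P x"
proof -
 let ?G = "cmat (g x)" and ?D = "\<lambda>x. \<chi> i j. if i = j then F i x else 0"
 define A where "A k = matrix_inv (P x) ** (W k x ** P x + pd k P x)" for k
 have PA: "P x ** A k = W k x ** P x + pd k P x" for k
  unfolding A_def matrix_ring(9) matrix_inv_id[OF det_P[OF x]] by simp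
 have "P x ** (pd k (\<lambda>y. cmat (g y)) x + A k ** ?G + ?G ** transpose (A k)) ** transpose (P x) = 0" for k
 proof -
  note dG = cmat_differentiable[OF V g x] and dP = P_diff(1)[OF x]
  have "pd k ?D x = pd k (\<lambda>x. P x ** cmat (g x) ** transpose (P x)) x" by (rule pd_cong_open[OF V x]) (simp add: PGP)
  also have "... = P x ** ?G ** transpose (pd k P x) + (P x ** pd k (\<lambda>y. cmat (g y)) x + pd k P x ** ?G) ** transpose (P x)"
   by (simp add: pd_matrix_mult[OF dP dG] pd_matrix_mult(1)[OF pd_matrix_mult(2)[OF dP dG] pd_transpose(2)[OF dP]] pd_transpose(1)[OF dP])
  finally have a1: "P x ** pd k (\<lambda>y. cmat (g y)) x ** transpose (P x) =
    pd k ?D x - P x ** ?G ** transpose (pd k P x) - pd k P x ** ?G ** transpose (P x)"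
   by (simp add: matrix_ring algebra_simps)
  have a2: "P x ** A k ** ?G ** transpose (P x) = W k x ** ?D x + pd k P x ** ?G ** transpose (P x)"
   unfolding PA PGP[OF x, symmetric] by (simp add: matrix_ring)
  have "P x ** ?G ** transpose (A k) ** transpose (P x) = P x ** ?G ** transpose (P x ** A k)"
   by (simp add: matrix_transpose_mul matrix_ring)
  also have "... = ?D x ** transpose (W k x) + P x ** ?G ** transpose (pd k P x)"
   unfolding PA PGP[OF x, symmetric] by (simp add: matrix_transpose_mul matrix_ring)
  finally have a3: "P x ** ?G ** transpose (A k) ** transpose (P x) = ?D x ** transpose (W k x) + P x ** ?G ** transpose (pd k P x)" .
  have "P x ** (pd k (\<lambda>y. cmat (g y)) x + A k ** ?G + ?G ** transpose (A k)) ** transpose (P x) =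
   P x ** pd k (\<lambda>y. cmat (g y)) x ** transpose (P x) + P x ** A k ** ?G ** transpose (P x) + P x ** ?G ** transpose (A k) ** transpose (P x)"
   by (simp only: matrix_ring)
  also have "... = pd k ?D x + W k x ** ?D x + ?D x ** transpose (W k x)"
   unfolding a1 a2 a3 by (simp add: algebra_simps)
  finally show ?thesis using W_skew[OF x, of k] by simp
 qed
 then have "pd k (\<lambda>y. cmat (g y)) x + A k ** ?G + ?G ** transpose (A k) = 0" for k
 proof -
  let ?M = "pd k (\<lambda>y. cmat (g y)) x + A k ** ?G + ?G ** transpose (A k)"
  assume "!!k. P x ** (pd k (\<lambda>y. cmat (g y)) x + A k ** ?G + ?G ** transpose (A k)) ** transpose (P x) = 0"
  then have "P x ** ?M ** transpose (P x) = P x ** 0 ** transpose (P x)" by (simp only: matrix_ring(7,8))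
  then show ?thesis unfolding P_cancel(3)[OF x] P_cancel(1)[OF x] .
 qed
 \<comment> \<open>Vanishing torsion: the two expressions with rotation coefficients from W P and
   from the derivative of P exchange their roles when k and j are swapped, and all other terms are
   symmetric.\<close>
 moreover have "A k $ i $ j = A j $ i $ k" for i j k
 proof -
  have s: "(P x ** A k) $ i $ j = (P x ** A j) $ i $ k" for i
  proof -
   let ?E = "\<lambda>k. \<Sum>c\<in>UNIV. b c i x * H c x * J c k x" and ?m = "- (cd u i (F i) x / (2 * F i x))"
   have WP: "(W k x ** P x) $ i $ j = J i k x * ?E j - (\<Sum>c\<in>UNIV. F i x / F c x * b i c x * H c x * J c k x * J c j x) + ?m * H i x * J i k x * J i j x" for k j
   proof -
    have "W k x $ i $ c * (H c x * J c j x) = J i k x * (b c i x * H c x * J c j x) - F i x / F c x * b i c x * H c x * J c k x * J c j x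
     + (if c = i then ?m * H i x * J i k x * J i j x else 0)" for c
     by (simp add: W_nth b_def algebra_simps)
    then show ?thesis by (simp add: mm_mult P_def sum.distrib sum_subtractf sum_distrib_left)
   qed
   show ?thesis unfolding PA by (simp add: WP pd_P[OF x] pd_J_sym[OF x, of k j i] mult_ac)
  qed
  have "(matrix_inv (P x) ** (P x ** A k)) $ i $ j = (matrix_inv (P x) ** (P x ** A j)) $ i $ k"
   unfolding mm_mult[of "matrix_inv (P x)"] by (simp add: s)
  then show ?thesis by (simp add: matrix_ring matrix_inv_id[OF det_P[OF x]])
 qed
 ultimately have "metric_connection g A x" unfolding metric_connection_def by blast
 then show ?thesis using christoffel_unique[OF V g x, of A k] PA[of k] by simp
qed

text \<open>The first summand is linear in F and its derivative, the second linear in the metric,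
  while \<open>b\<close> and \<open>P\<close> do not involve them. This is the linearity of the
  raised Christoffel symbols along the pencil.\<close>

lemma christoffel_up_frame:
 assumes x: "x \<in> V"
 shows "(P x ** (cmat (g x) ** transpose (chr g k x)) ** transpose (P x)) $ i $ j =
  (if i = j then - (cd u i (F i) x / 2) * J i k x else F i x * b i j x * J j k x - F j x * b j i x * J i k x)
  + (P x ** cmat (g x) ** transpose (pd k P x)) $ i $ j"
proof -
 have "P x ** (cmat (g x) ** transpose (chr g k x)) ** transpose (P x) = P x ** cmat (g x) ** transpose (P x ** chr g k x)"
  by (simp add: matrix_transpose_mul matrix_ring)
 also have "... = (\<chi> i j. if i = j then F i x else 0) ** transpose (W k x) + P x ** cmat (g x) ** transpose (pd k P x)"
  unfolding connection[OF x] PGP[OF x, symmetric] by (simp add: matrix_transpose_mul matrix_ring)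
 finally show ?thesis
  using F_nz[OF x] by (simp add: mm_mult[of "\<chi> i j. if i = j then F i x else 0"] transpose_def W_nth sum_delta_mult algebra_simps)
qed

text \<open>Components of the curvature form dC + C C along du^d and du^c.\<close>

definition S :: "'a => 'a => 'a => 'a => real ^ 'a => complex"
 where "S i j d c x = cd u d (C i j c) x - cd u c (C i j d) x + (\<Sum>s\<in>UNIV. C i s d x * C s j c x - C i s c x * C s j d x)"

text \<open>Curvature transforms by conjugation: on substituting \<open>connection\<close>, the
  second derivatives of P cancel by symmetry.\<close>

lemma curvature_frame:
 assumes x: "x \<in> V"
 shows "P x ** (pd k (chr g l) x - pd l (chr g k) x + chr g k x ** chr g l x - chr g l x ** chr g k x) =
  (pd k (W l) x - pd l (W k) x + W k x ** W l x - W l x ** W k x) ** P x"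
proof -
 note dP = P_diff(1)[OF x] and dW = W_diff[OF x] and dc = chr_differentiable[OF V g x]
 have e: "P x ** pd k (chr g l) x = W l x ** pd k P x + pd k (W l) x ** P x + pd k (pd l P) x - pd k P x ** chr g l x" for k l
 proof -
  have "pd k (\<lambda>x. P x ** chr g l x) x = pd k (\<lambda>x. W l x ** P x + pd l P x) x" by (rule pd_cong_open[OF V x]) (rule connection)
  then have "P x ** pd k (chr g l) x + pd k P x ** chr g l x = W l x ** pd k P x + pd k (W l) x ** P x + pd k (pd l P) x"
   by (simp only: pd_matrix_mult(1)[OF dP dc] pd_add[OF pd_matrix_mult(2)[OF dW dP] P_diff(2)[OF x]] pd_matrix_mult(1)[OF dW dP])
  then show ?thesis by (simp add: algebra_simps)
 qed
 have dPk: "pd k P x = P x ** chr g k x - W k x ** P x" for k using connection[OF x, of k] by simp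
 have "pd k (pd l P) x = pd l (pd k P) x" by (rule pd_commute[OF smooth_Ck[OF P_smooth] V x])
 then show ?thesis by (simp add: matrix_ring e) (simp add: matrix_ring dPk algebra_simps)
qed

lemma curvature_S:
 assumes x: "x \<in> V"
 shows "(pd k (W l) x - pd l (W k) x + W k x ** W l x - W l x ** W k x) $ i $ j = (\<Sum>d\<in>UNIV. \<Sum>c\<in>UNIV. J d k x * J c l x * S i j d c x)"
proof -
 have pdW: "pd k (W l) x $ i $ j = (\<Sum>c\<in>UNIV. pd k (J c l) x * C i j c x) + (\<Sum>d\<in>UNIV. \<Sum>c\<in>UNIV. J d k x * J c l x * cd u d (C i j c) x)" for k l
 proof -
  have "pd k (W l) x $ i $ j = pd k (\<lambda>x. \<Sum>c\<in>UNIV. J c l x * C i j c x) x"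
   using pd_matrix_nth[OF W_diff[OF x], of k l i j] by (simp add: W_def)
  also have "... = (\<Sum>c\<in>UNIV. J c l x * pd k (C i j c) x + pd k (J c l) x * C i j c x)"
   using smoothD[OF J_smooth x] smoothD[OF C_smooth x]
   by (subst pd_sum) (auto simp: pd_mult intro: differentiable_mult)
  also have "... = (\<Sum>c\<in>UNIV. pd k (J c l) x * C i j c x) + (\<Sum>c\<in>UNIV. \<Sum>d\<in>UNIV. J d k x * J c l x * cd u d (C i j c) x)"
   by (simp add: sum.distrib pd_cd[OF x, of k "C i j c" for c] sum_distrib_left mult_ac)
  also have "(\<Sum>c\<in>UNIV. \<Sum>d\<in>UNIV. J d k x * J c l x * cd u d (C i j c) x) = (\<Sum>d\<in>UNIV. \<Sum>c\<in>UNIV. J d k x * J c l x * cd u d (C i j c) x)"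
   by (rule sum.swap)
  finally show ?thesis .
 qed
 have sw: "(\<Sum>d\<in>UNIV. \<Sum>c\<in>UNIV. J d l x * J c k x * T d c) = (\<Sum>d\<in>UNIV. \<Sum>c\<in>UNIV. J d k x * J c l x * T c d)" for T
  by (subst sum.swap) (simp add: mult_ac)
 have WW: "(W k x ** W l x) $ i $ j = (\<Sum>d\<in>UNIV. \<Sum>c\<in>UNIV. J d k x * J c l x * (\<Sum>s\<in>UNIV. C i s d x * C s j c x))" for k l
 proof -
  have "(W k x ** W l x) $ i $ j = (\<Sum>s\<in>UNIV. \<Sum>d\<in>UNIV. \<Sum>c\<in>UNIV. J d k x * J c l x * (C i s d x * C s j c x))"
   by (simp add: mm_mult W_def sum_product mult_ac)
  also have "... = (\<Sum>d\<in>UNIV. \<Sum>s\<in>UNIV. \<Sum>c\<in>UNIV. J d k x * J c l x * (C i s d x * C s j c x))" by (rule sum.swap)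
  also have "... = (\<Sum>d\<in>UNIV. \<Sum>c\<in>UNIV. \<Sum>s\<in>UNIV. J d k x * J c l x * (C i s d x * C s j c x))" by (intro sum.cong refl sum.swap)
  finally show ?thesis by (simp add: sum_distrib_left)
 qed
 show ?thesis
  by (simp add: pdW WW sw pd_J_sym[OF x, of k l] S_def distrib_left right_diff_distrib sum.distrib sum_subtractf)
qed

end

section \<open>Curvature components in the orthogonal coframe\<close>

context lame_metric
begin

lemma cd_ratio:
 assumes x: "x \<in> V" and h: "smooth_on V h"
 shows "cd u k (\<lambda>x. - (F i x / F j x * h x)) x =
  - (F i x / F j x * cd u k h x + (cd u k (F i) x / F j x - F i x * cd u k (F j) x / (F j x)\<^sup>2) * h x)"
proof -
 have inv: "smooth_on V (\<lambda>x. inverse (F j x))" by (intro smooth_on_inverse V F_smooth F_nz)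
 note q = smooth_mult[OF V F_smooth inv]
 show ?thesis
  unfolding divide_inverse cd_minus[OF x smooth_mult[OF V q h]] cd_mult[OF x q h] cd_mult[OF x F_smooth inv] cd_inverse[OF x F_smooth F_nz[OF x]]
  by (simp add: algebra_simps)
qed

text \<open>The diagonal connection coefficient involves only the coordinate of its own index, and
  in the quadratic terms the ratios F_i / F_s and F_s / F_i cancel each other.\<close>

lemma S_diag:
 assumes x: "x \<in> V" and dc: "d \<noteq> c"
 shows "S i i d c x = 0"
proof -
 have 1: "cd u m (C i i i) x = 0" if m: "m \<noteq> i" for m
 proof -
  have s: "smooth_on V (\<lambda>x. inverse (2 * F i x))" "smooth_on V (\<lambda>x. 2 * F i x)"
   by (intro smooth_on_inverse smooth_mult smooth_const V F_smooth; simp add: F_nz)+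
  have 0: "cd u m (cd u i (F i)) x = 0"
  proof -
   have "cd u i (cd u m (F i)) x = cd u i (\<lambda>_. 0) x" by (rule cd_cong[OF x]) (rule F_single[OF _ m[symmetric]])
   then show ?thesis by (subst cd_commute[OF x F_smooth]) simp
  qed
  have "cd u m (\<lambda>x. 2 * F i x) x = 0" using cd_mult[OF x smooth_const F_smooth, of m 2 i] F_single[OF x m[symmetric]] by simp
  then have "cd u m (\<lambda>x. inverse (2 * F i x)) x = 0" using cd_inverse[OF x s(2), of m] F_nz[OF x] by simp
  then have "cd u m (\<lambda>x. - (cd u i (F i) x * inverse (2 * F i x))) x = 0"
   unfolding cd_minus[OF x smooth_mult[OF V cd_smooth[OF F_smooth] s(1)]] cd_mult[OF x cd_smooth[OF F_smooth] s(1)] 0 by simp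
  then show ?thesis by (simp only: C_def divide_inverse if_True simp_thms)
 qed
 have 2: "cd u d (C i i c) x = 0" if "d \<noteq> c" for d c
  by (cases "c = i") (use that 1 in \<open>auto simp: C_def[of i i c]\<close>)
 have "C i s d x * C s i c x - C i s c x * C s i d x = 0" for s
  using dc F_nz[OF x] by (auto simp: C_def)
 then show ?thesis using 2[OF dc] 2[OF dc[symmetric]] by (simp add: S_def)
qed

text \<open>The only intermediate index that contributes is k. Up to a nonzero factor both
  components are the first Lame equation, once for (j,i) and once for (i,j); F drops out.\<close>

lemma S_three:
 assumes x: "x \<in> V" and d: "i \<noteq> j" "i \<noteq> k" "j \<noteq> k"
 shows "S i j k i x = cd u k (b j i) x - b j k x * b k i x"
  and "S i j k j x = - (F i x / F j x) * (cd u k (b i j) x - b i k x * b k j x)"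
proof -
 have "(\<Sum>s\<in>UNIV. C i s k x * C s j i x - C i s i x * C s j k x) = - b k i x * b j k x"
  by (subst sum_one[of k]) (use d in \<open>auto simp: C_def\<close>)
 then show "S i j k i x = cd u k (b j i) x - b j k x * b k i x" using d by (simp add: S_def C_def)
 have "(\<Sum>s\<in>UNIV. C i s k x * C s j j x - C i s j x * C s j k x) = F i x / F j x * (b i k x * b k j x)"
  by (subst sum_one[of k]) (use d F_nz[OF x] in \<open>auto simp: C_def\<close>)
 moreover have "cd u k (C i j j) x = - (F i x / F j x * cd u k (b i j) x)"
  using d cd_ratio[OF x b_smooth, of k i j i j] F_single[OF x, of i k] F_single[OF x, of j k] by (simp add: C_def)
 ultimately show "S i j k j x = - (F i x / F j x) * (cd u k (b i j) x - b i k x * b k j x)"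
  using d by (simp add: S_def C_def[of i j k] right_diff_distrib)
qed

lemma S_four:
 assumes "i \<noteq> j" "k \<notin> {i, j}" "l \<notin> {i, j}" "k \<noteq> l"
 shows "S i j k l x = 0"
proof -
 have "C i s k x * C s j l x - C i s l x * C s j k x = 0" for s using assms by (auto simp: C_def)
 then show ?thesis using assms by (simp add: S_def C_def[of i j])
qed

text \<open>The half derivatives of F combine the derivative of the ratio F_i / F_j with the
  products involving the diagonal connection coefficients.\<close>

lemma S_two:
 assumes x: "x \<in> V" and d: "i \<noteq> j"
 shows "F j x * S i j j i x = F j x * cd u j (b j i) x + cd u j (F j) x / 2 * b j i x + F i x * cd u i (b i j) x
  + cd u i (F i) x / 2 * b i j x + (\<Sum>s\<in>UNIV - {i, j}. F s x * b s i x * b s j x)"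
proof -
 let ?f = "\<lambda>s. C i s j x * C s j i x - C i s i x * C s j j x"
 have "(\<Sum>s\<in>UNIV. ?f s) = (\<Sum>s\<in>UNIV - {i, j}. ?f s) + (\<Sum>s\<in>{i, j}. ?f s)" by (rule sum.subset_diff) auto
 also have "(\<Sum>s\<in>{i, j}. ?f s) = - (cd u i (F i) x / (2 * F j x) * b i j x) + cd u j (F j) x / (2 * F j x) * b j i x"
  using d F_nz[OF x] by (simp add: C_def)
 also have "(\<Sum>s\<in>UNIV - {i, j}. ?f s) = (\<Sum>s\<in>UNIV - {i, j}. F s x * b s i x * b s j x / F j x)"
  by (rule sum.cong) (use d in \<open>auto simp: C_def\<close>)
 finally have f: "(\<Sum>s\<in>UNIV. ?f s) = (\<Sum>s\<in>UNIV - {i, j}. F s x * b s i x * b s j x) / F j x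
  + (- (cd u i (F i) x / (2 * F j x) * b i j x) + cd u j (F j) x / (2 * F j x) * b j i x)"
  by (simp add: sum_divide_distrib)
 have c: "cd u i (C i j j) x = - (F i x / F j x * cd u i (b i j) x + cd u i (F i) x / F j x * b i j x)"
  using d cd_ratio[OF x b_smooth, of i i j i j] F_single[OF x, of j i] by (simp add: C_def)
 have eq: "S i j j i x = cd u j (b j i) x - cd u i (C i j j) x + (\<Sum>s\<in>UNIV. ?f s)"
  using d by (simp add: S_def C_def[of i j i])
 show ?thesis
  by (rule iffD1[OF mult_left_cancel[OF F_nz[OF x, of j]]], unfold eq f c) (use F_nz[OF x, of j] in \<open>simp add: field_simps\<close>)
qed

text \<open>Stripping \<open>P\<close> and the Jacobians reduces flatness to the components
  \<open>S\<close>, which are sorted by how many of d and c lie in {i, j}: both, one, or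
  none.\<close>

theorem flat_iff:
 assumes x: "x \<in> V"
 shows "(\<forall>i j k l. riemann g i j k l x = 0) \<longleftrightarrow>
  (\<forall>i j k. i \<noteq> j \<and> i \<noteq> k \<and> j \<noteq> k --> cd u k (rot u H i j) x = rot u H i k x * rot u H k j x) \<and>
  (\<forall>i j. i \<noteq> j --> F j x * cd u j (rot u H j i) x + cd u j (F j) x / 2 * rot u H j i x + F i x * cd u i (rot u H i j) x
   + cd u i (F i) x / 2 * rot u H i j x + (\<Sum>s\<in>UNIV - {i, j}. F s x * rot u H s i x * rot u H s j x) = 0)"
  (is "?R \<longleftrightarrow> ?E")
proof -
 let ?M = "\<lambda>k l. pd k (chr g l) x - pd l (chr g k) x + chr g k x ** chr g l x - chr g l x ** chr g k x"
 let ?N = "\<lambda>k l. pd k (W l) x - pd l (W k) x + W k x ** W l x - W l x ** W k x"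
 have "?R \<longleftrightarrow> (\<forall>i j k l. ?M k l $ i $ j = 0)"
  unfolding riemann_matrix[OF V g x, symmetric] by simp
 also have "... \<longleftrightarrow> (\<forall>k l. ?M k l = 0)" unfolding vec_eq_iff zero_index by blast
 also have "... \<longleftrightarrow> (\<forall>k l. ?N k l = 0)"
 proof -
  have "?M k l = 0 \<longleftrightarrow> ?N k l = 0" for k l
   using P_cancel(1)[OF x, of "?M k l" 0] P_cancel(2)[OF x, of "?N k l" 0] unfolding curvature_frame[OF x] by (simp add: matrix_ring(7,8))
  then show ?thesis by simp
 qed
 also have "... \<longleftrightarrow> (\<forall>i j d c. S i j d c x = 0)"
 proof
  assume N: "\<forall>k l. ?N k l = 0"
  show "\<forall>i j d c. S i j d c x = 0"
  proof (intro allI)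
   fix i j d c
   show "S i j d c x = 0" by (rule contract_zero[OF x]) (simp add: curvature_S[OF x, symmetric] N)
  qed
 next
  assume "\<forall>i j d c. S i j d c x = 0"
  then have "?N k l $ i $ j = 0" for k l i j unfolding curvature_S[OF x] by simp
  then show "\<forall>k l. ?N k l = 0" unfolding vec_eq_iff zero_index by blast
 qed
 also have "... \<longleftrightarrow> (\<forall>i j k. i \<noteq> j \<and> i \<noteq> k \<and> j \<noteq> k --> cd u k (b i j) x = b i k x * b k j x) \<and> (\<forall>i j. i \<noteq> j --> S i j j i x = 0)"
  (is "?S \<longleftrightarrow> ?T")
 proof
  assume S: ?S
  have "cd u k (b i j) x = b i k x * b k j x" if "i \<noteq> j" "i \<noteq> k" "j \<noteq> k" for i j k
   using S_three(1)[OF x, of j i k] that S by simp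
  then show ?T using S by blast
 next
  assume T: ?T
  have anti: "S i j d c x = - S i j c d x" for i j d c
  proof -
   have "(\<Sum>s\<in>UNIV. C i s d x * C s j c x - C i s c x * C s j d x) = - (\<Sum>s\<in>UNIV. C i s c x * C s j d x - C i s d x * C s j c x)"
    by (simp add: sum_subtractf)
   then show ?thesis by (simp add: S_def)
  qed
  have three: "S i j k c x = 0" if "i \<noteq> j" "k \<noteq> i" "k \<noteq> j" "c = i \<or> c = j" for i j k c
   using that S_three[OF x, of i j k] T by auto
  have two: "S i j j i x = 0" "S i j i j x = 0" if "i \<noteq> j" for i j
   using T that anti[of i j i j] by auto
  have "S i j d c x = 0" for i j d c
  proof (cases "d = c")
   case True
   then show ?thesis using anti[of i j d d] by simp
  next
   case dc: False
   show ?thesis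
   proof (cases "i = j")
    case True
    then show ?thesis using S_diag[OF x dc] by simp
   next
    case ij: False
    consider "d \<in> {i, j}" "c \<in> {i, j}" | "d \<notin> {i, j}" "c \<in> {i, j}" | "d \<in> {i, j}" "c \<notin> {i, j}" | "d \<notin> {i, j}" "c \<notin> {i, j}" by blast
    then show ?thesis
    proof cases
     case 1
     then show ?thesis using two[OF ij] dc by auto
    next
     case 2
     then show ?thesis using three[OF ij, of d c] by auto
    next
     case 3
     then show ?thesis using three[OF ij, of c d] anti[of i j d c] by auto
    next
     case 4
     then show ?thesis using S_four[OF ij _ _ dc] by blast
    qed
   qed
  qed
  then show ?S by blast
 qed
 also have "... \<longleftrightarrow> ?E"
 proof -
  have 1: "(\<forall>i j. i \<noteq> j --> S i j j i x = 0) \<longleftrightarrow> (\<forall>i j. i \<noteq> j --> F j x * cd u j (b j i) x + cd u j (F j) x / 2 * b j i x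
   + F i x * cd u i (b i j) x + cd u i (F i) x / 2 * b i j x + (\<Sum>s\<in>UNIV - {i, j}. F s x * b s i x * b s j x) = 0)"
  proof (intro iff_allI imp_cong refl)
   fix i j :: 'a assume ij: "i \<noteq> j"
   show "S i j j i x = 0 \<longleftrightarrow> F j x * cd u j (b j i) x + cd u j (F j) x / 2 * b j i x
   + F i x * cd u i (b i j) x + cd u i (F i) x / 2 * b i j x + (\<Sum>s\<in>UNIV - {i, j}. F s x * b s i x * b s j x) = 0"
    unfolding S_two[OF x ij, symmetric] using F_nz[OF x, of j] by simp
  qed
  have b: "b i j = rot u H i j" if "i \<noteq> j" for i j using that by (simp add: b_def)
  have 2: "(\<Sum>s\<in>UNIV - {i, j}. F s x * b s i x * b s j x) = (\<Sum>s\<in>UNIV - {i, j}. F s x * rot u H s i x * rot u H s j x)" for i j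
   by (rule sum.cong) (auto simp: b)
  show ?thesis unfolding 1 2 by (intro conj_cong iff_allI imp_cong refl) (auto simp: b)
 qed
 finally show ?thesis .
qed

end

section \<open>The whole pencil in Lame coordinates\<close>

lemma open_det_nonzero:
 assumes "open U" "contravariant_metric U g1" "contravariant_metric U g2"
 shows "open {x \<in> U. det (pencil l1 l2 g1 g2 x) \<noteq> 0}"
proof -
 have "smooth_on U (\<lambda>x. det (pencil l1 l2 g1 g2 x))"
  using assms unfolding pencil_def contravariant_metric_def
  by (intro smooth_det) (auto intro!: smooth_add smooth_mult smooth_const)
 then have "open (U \<inter> (\<lambda>x. det (pencil l1 l2 g1 g2 x)) -` (- {0}))"
  by (intro continuous_open_preimage smoothC assms) auto
 moreover have "U \<inter> (\<lambda>x. det (pencil l1 l2 g1 g2 x)) -` (- {0}) = {x \<in> U. det (pencil l1 l2 g1 g2 x) \<noteq> 0}" by auto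
 ultimately show ?thesis by simp
qed

lemma contravariant_pencil:
 assumes "open U" "contravariant_metric U g1" "contravariant_metric U g2"
 shows "contravariant_metric {x \<in> U. det (pencil l1 l2 g1 g2 x) \<noteq> 0} (pencil l1 l2 g1 g2)"
proof -
 have "smooth_on U (\<lambda>x. pencil l1 l2 g1 g2 x $ i $ j)" for i j
  using assms unfolding pencil_def contravariant_metric_def by (auto intro!: smooth_add smooth_mult smooth_const)
 moreover have "x \<in> U ==> transpose (pencil l1 l2 g1 g2 x) = pencil l1 l2 g1 g2 x" for x
  using assms unfolding pencil_def contravariant_metric_def by (auto simp: transpose_def vec_eq_iff)
 ultimately show ?thesis unfolding contravariant_metric_def by (auto intro: smooth_subset)
qed

locale lame_pair = lame +
 fixes f r :: "'a => complex => complex" and g1 g2 :: "'a tensor2"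
 assumes single_f: "single_variable_fun V u i (f i)" and single_r: "single_variable_fun V u i (r i)"
  and f_nz: "x \<in> V ==> f i (u x $ i) \<noteq> 0" and r_square: "x \<in> V ==> (r i (u x $ i))\<^sup>2 = f i (u x $ i)"
  and g1: "contravariant_metric V g1" and g2: "contravariant_metric V g2"
  and diag2: "x \<in> V ==> coord_components u g2 x $ i $ j = (if i = j then 1 / (H i x)\<^sup>2 else 0)"
  and diag1: "x \<in> V ==> coord_components u g1 x $ i $ j = (if i = j then f i (u x $ i) / (H i x)\<^sup>2 else 0)"
begin

lemma f_smooth: "smooth_on V (\<lambda>x. f i (u x $ i))" and r_smooth: "smooth_on V (\<lambda>x. r i (u x $ i))"
 using single_f single_r by (auto simp: single_variable_fun_def)

text \<open>The derivative of \<open>h\<close> exists only within the set of values of u^i, which is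
  exactly what the chain rule along u^i consumes; the outcome is a multiple of du^i.\<close>

lemma cd_single_variable:
 assumes x: "x \<in> V" and h: "single_variable_fun V u i h" and ij: "i \<noteq> j"
 shows "cd u j (\<lambda>y. h (u y $ i)) x = 0"
proof -
 let ?w = "\<lambda>y. u y $ i"
 obtain D where D: "(h has_derivative (*) D) (at (?w x) within ?w ` V)"
  using h x unfolding single_variable_fun_def holomorphic_on_def field_differentiable_def has_field_derivative_def by blast
 have "(?w has_derivative frechet_derivative ?w (at x)) (at x within V)"
  using smoothD[OF u_smooth x] frechet_derivative_works has_derivative_at_withinI by blast
 from has_derivative_in_compose[OF this D]
 have "((\<lambda>y. h (?w y)) has_derivative (\<lambda>t. D * frechet_derivative ?w (at x) t)) (at x)"
  using at_within_open[OF x V] by simp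
 then have "pd a (\<lambda>y. h (?w y)) x = D * J i a x" for a
  unfolding pd_def[of a ?w] by (rule pd_eqI)
 then have "cd u j (\<lambda>y. h (?w y)) x = D * cd u j ?w x" by (simp add: cd_def sum_distrib_left mult_ac)
 then show ?thesis using cd_coord[OF x] ij by simp
qed

abbreviation "F l1 l2 i x \<equiv> of_real l1 * f i (u x $ i) + of_real l2"
abbreviation "V' l1 l2 \<equiv> {x \<in> V. det (pencil l1 l2 g1 g2 x) \<noteq> 0}"

lemma pencil_diag: "x \<in> V ==> coord_components u (pencil l1 l2 g1 g2) x $ i $ j = (if i = j then F l1 l2 i x / (H i x)\<^sup>2 else 0)"
proof -
 have "coord_components u (pencil l1 l2 g1 g2) x $ i $ j = of_real l1 * coord_components u g1 x $ i $ j + of_real l2 * coord_components u g2 x $ i $ j"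
  by (simp add: coord_components_def pencil_def mm_mult map_matrix_def sum_distrib_left sum_distrib_right
    distrib_left distrib_right sum.distrib mult_ac)
 then show "x \<in> V ==> ?thesis" by (simp add: diag1 diag2 add_divide_distrib)
qed

lemmas pencil_open = open_det_nonzero[OF V g1 g2] and pencil_metric = contravariant_pencil[OF V g1 g2]

text \<open>All members of the pencil are diagonal in one coframe. That F has no zero is read off
  from the determinant, which is a product over the diagonal.\<close>

lemma pencil_lame: "lame_metric (V' l1 l2) u H (F l1 l2) (pencil l1 l2 g1 g2)"
proof
 fix x i j
 show "open (V' l1 l2)" by (rule pencil_open)
 show "contravariant_metric (V' l1 l2) (pencil l1 l2 g1 g2)" by (rule pencil_metric)
 show "smooth_on (V' l1 l2) (\<lambda>x. u x $ i)" "smooth_on (V' l1 l2) (H i)"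
  by (auto intro: smooth_subset[OF u_smooth] smooth_subset[OF H_smooth])
 have "smooth_on V (F l1 l2 i)" by (intro smooth_add smooth_mult smooth_const f_smooth V)
 then show "smooth_on (V' l1 l2) (F l1 l2 i)" by (rule smooth_subset) auto
 assume x: "x \<in> V' l1 l2"
 then have xV: "x \<in> V" by simp
 show "det (jacobian u x) \<noteq> 0" "H i x \<noteq> 0" by (auto simp: det_J H_nz xV)
 show *: "coord_components u (pencil l1 l2 g1 g2) x $ i $ j = (if i = j then F l1 l2 i x / (H i x)\<^sup>2 else 0)" for i j
  by (rule pencil_diag[OF xV])
 have "det (coord_components u (pencil l1 l2 g1 g2) x) \<noteq> 0"
  using x det_J[OF xV] by (simp add: coord_components_def det_mul det_transpose det_cmat[unfolded cmat_def])
 moreover have "det (coord_components u (pencil l1 l2 g1 g2) x) = (\<Prod>i\<in>UNIV. F l1 l2 i x / (H i x)\<^sup>2)"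
  by (subst det_diagonal) (auto simp: *)
 ultimately show "F l1 l2 i x \<noteq> 0" by auto
 show "i \<noteq> j ==> cd u j (F l1 l2 i) x = 0"
  using cd_add[OF xV smooth_mult[OF V smooth_const f_smooth] smooth_const] cd_mult[OF xV smooth_const f_smooth]
   cd_single_variable[OF xV single_f] by simp
qed

lemma cd_F: "x \<in> V ==> cd u j (F l1 l2 i) x = of_real l1 * cd u j (\<lambda>y. f i (u y $ i)) x"
 by (simp add: cd_add[OF _ smooth_mult[OF V smooth_const f_smooth] smooth_const] cd_mult[OF _ smooth_const f_smooth])

lemma b_rot: "i \<noteq> j ==> smooth_on V (rot u H i j)"
 using b_smooth[of i j] by (simp add: b_def)

text \<open>Because the derivative of f is 2 r r', the square roots only produce the half derivative
  of f, in the form met in the curvature.\<close>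

lemma sqrt_eq:
 assumes x: "x \<in> V" and ij: "i \<noteq> j"
 shows "r i (u x $ i) * cd u i (\<lambda>y. r i (u y $ i) * rot u H i j y) x =
  f i (u x $ i) * cd u i (rot u H i j) x + cd u i (\<lambda>y. f i (u y $ i)) x / 2 * rot u H i j x"
proof -
 have "cd u i (\<lambda>y. f i (u y $ i)) x = cd u i (\<lambda>y. r i (u y $ i) * r i (u y $ i)) x"
  by (rule cd_cong[OF x]) (simp add: r_square[symmetric] power2_eq_square)
 then have "cd u i (\<lambda>y. f i (u y $ i)) x = 2 * r i (u x $ i) * cd u i (\<lambda>y. r i (u y $ i)) x"
  by (simp add: cd_mult[OF x r_smooth r_smooth])
 then show ?thesis
  unfolding cd_mult[OF x r_smooth b_rot[OF ij]] r_square[OF x, symmetric] by (simp add: power2_eq_square algebra_simps)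
qed

definition E2 :: "'a => 'a => real ^ 'a => complex"
 where "E2 i j x = cd u i (rot u H i j) x + cd u j (rot u H j i) x + (\<Sum>s\<in>UNIV - {i, j}. rot u H s i x * rot u H s j x)"

definition E3 :: "'a => 'a => real ^ 'a => complex"
 where "E3 i j x = r i (u x $ i) * cd u i (\<lambda>y. r i (u y $ i) * rot u H i j y) x +
   r j (u x $ j) * cd u j (\<lambda>y. r j (u y $ j) * rot u H j i y) x +
   (\<Sum>s\<in>UNIV - {i, j}. f s (u x $ s) * rot u H s i x * rot u H s j x)"

text \<open>The two-index curvature condition is linear in F = l1 f + l2: the part with f is the
  left side \<open>E3\<close> of the pencil equation, the constant part is the left side
  \<open>E2\<close> of the second Lame equation.\<close>

lemma pencil_flat_iff:
 assumes x: "x \<in> V' l1 l2"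
 shows "(\<forall>i j k l. riemann (pencil l1 l2 g1 g2) i j k l x = 0) \<longleftrightarrow>
  (\<forall>i j k. i \<noteq> j \<and> i \<noteq> k \<and> j \<noteq> k --> cd u k (rot u H i j) x = rot u H i k x * rot u H k j x) \<and>
  (\<forall>i j. i \<noteq> j --> of_real l1 * E3 i j x + of_real l2 * E2 i j x = 0)"
proof -
 have xV: "x \<in> V" using x by simp
 have "F l1 l2 j x * cd u j (rot u H j i) x + cd u j (F l1 l2 j) x / 2 * rot u H j i x + F l1 l2 i x * cd u i (rot u H i j) x
   + cd u i (F l1 l2 i) x / 2 * rot u H i j x + (\<Sum>s\<in>UNIV - {i, j}. F l1 l2 s x * rot u H s i x * rot u H s j x)
  = of_real l1 * E3 i j x + of_real l2 * E2 i j x" if "i \<noteq> j" for i j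
  unfolding E2_def E3_def sqrt_eq[OF xV that] sqrt_eq[OF xV that[symmetric]] cd_F[OF xV]
  by (simp add: sum_distrib_left sum.distrib algebra_simps)
 then show ?thesis
  unfolding lame_metric.flat_iff[OF pencil_lame x] by (intro conj_cong iff_allI imp_cong refl) simp
qed

lemma pencil_simps: "pencil 1 0 g1 g2 = g1" "pencil 0 1 g1 g2 = g2" "V' 1 0 = V" "V' 0 1 = V"
 using g1 g2 by (auto simp: pencil_def contravariant_metric_def)

lemma in_V': "x \<in> V ==> x \<in> V' 1 0" "x \<in> V ==> x \<in> V' 0 1"
 unfolding pencil_simps(3,4) .

lemma equations_if_flat:
 assumes "!!i j k l x. x \<in> V ==> riemann g1 i j k l x = 0" "!!i j k l x. x \<in> V ==> riemann g2 i j k l x = 0"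
 shows "lame_equations V u H" "pencil_equation V u H f r"
proof -
 have "(\<forall>i j k. i \<noteq> j \<and> i \<noteq> k \<and> j \<noteq> k --> cd u k (rot u H i j) x = rot u H i k x * rot u H k j x) \<and> (\<forall>i j. i \<noteq> j --> E3 i j x = 0)"
  "\<forall>i j. i \<noteq> j --> E2 i j x = 0" if "x \<in> V" for x
  using pencil_flat_iff[OF in_V'(1)[OF that]] pencil_flat_iff[OF in_V'(2)[OF that]] assms[OF that] by (simp_all add: pencil_simps(1,2))
 then show "lame_equations V u H" "pencil_equation V u H f r"
  unfolding lame_equations_def pencil_equation_def E2_def E3_def by blast+
qed

lemma flat_if_equations:
 assumes "lame_equations V u H" "pencil_equation V u H f r" and x: "x \<in> V' l1 l2"
 shows "riemann (pencil l1 l2 g1 g2) i j k l x = 0"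
proof -
 have "E2 i j x = 0" "E3 i j x = 0" if "i \<noteq> j" for i j
  using assms that unfolding lame_equations_def pencil_equation_def E2_def E3_def by auto
 moreover have "cd u k (rot u H i j) x = rot u H i k x * rot u H k j x" if "i \<noteq> j" "i \<noteq> k" "j \<noteq> k" for i j k
  using assms that unfolding lame_equations_def by auto
 ultimately show ?thesis using pencil_flat_iff[OF x] by auto
qed

text \<open>The three metrics share \<open>P\<close>, so their frame expressions add up linearly;
  cancelling the invertible \<open>P\<close> on both sides returns to the coordinates x.\<close>

lemma christoffel_up_pencil:
 assumes x: "x \<in> V' l1 l2"
 shows "christoffel_up (pencil l1 l2 g1 g2) i j k x = l1 * christoffel_up g1 i j k x + l2 * christoffel_up g2 i j k x"
proof -
 let ?A = "\<lambda>g. cmat (g x) ** transpose (chr g k x)"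
 have xV: "x \<in> V" using x by simp
 have smul: "(c *\<^sub>R M) ** N = c *\<^sub>R (M ** N)" "N ** (c *\<^sub>R M) = c *\<^sub>R (N ** M)" for c and M N :: "complex ^ 'a ^ 'a"
  by (simp_all add: vec_eq_iff mm_mult scaleR_sum_right)
 have cp: "cmat (pencil l1 l2 g1 g2 x) = l1 *\<^sub>R cmat (g1 x) + l2 *\<^sub>R cmat (g2 x)"
  by (simp add: vec_eq_iff pencil_def scaleR_conv_of_real[where 'a = complex])
 have lin: "(P x ** cmat (pencil l1 l2 g1 g2 x) ** M) $ i $ j = of_real l1 * (P x ** cmat (g1 x) ** M) $ i $ j + of_real l2 * (P x ** cmat (g2 x) ** M) $ i $ j" for M :: "complex ^ 'a ^ 'a" and i j
  by (simp add: cp matrix_ring(1,2) smul scaleR_conv_of_real[where 'a = complex])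
 note up = lame_metric.christoffel_up_frame[OF pencil_lame in_V'(1)[OF xV], of k, unfolded pencil_simps(1)]
  lame_metric.christoffel_up_frame[OF pencil_lame in_V'(2)[OF xV], of k, unfolded pencil_simps(2)]
  lame_metric.christoffel_up_frame[OF pencil_lame x, of k]
 have "(P x ** ?A (pencil l1 l2 g1 g2) ** transpose (P x)) $ i $ j
  = of_real l1 * (P x ** ?A g1 ** transpose (P x)) $ i $ j + of_real l2 * (P x ** ?A g2 ** transpose (P x)) $ i $ j" for i j
  unfolding up lin cd_F[OF xV] by (simp add: algebra_simps)
 then have "P x ** ?A (pencil l1 l2 g1 g2) ** transpose (P x) = P x ** (l1 *\<^sub>R ?A g1 + l2 *\<^sub>R ?A g2) ** transpose (P x)"
  unfolding matrix_ring(1,2) smul vec_eq_iff by (simp add: scaleR_conv_of_real[where 'a = complex])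
 then have "?A (pencil l1 l2 g1 g2) = l1 *\<^sub>R ?A g1 + l2 *\<^sub>R ?A g2"
  by (simp only: P_cancel[OF xV])
 from arg_cong[OF this, of "\<lambda>M. M $ i $ j"]
 have "complex_of_real (christoffel_up (pencil l1 l2 g1 g2) i j k x) = of_real (l1 * christoffel_up g1 i j k x + l2 * christoffel_up g2 i j k x)"
  by (simp add: christoffel_up_matrix[OF pencil_open pencil_metric x] christoffel_up_matrix[OF V g1 xV] christoffel_up_matrix[OF V g2 xV] scaleR_conv_of_real[where 'a = complex])
 then show ?thesis by (simp only: of_real_eq_iff)
qed

end

section \<open>Eigenframes\<close>

text \<open>A point x together with a complex number, stored as a real vector with two extra
  components, so that the calculus of \<open>real ^ 'n\<close> applies to equations with a complex
  unknown.\<close>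

definition emb :: "real ^ 'n => complex => real ^ ('n + bool)"
 where "emb x z = (\<chi> k. case k of Inl i => x $ i | Inr t => if t then Re z else Im z)"

definition base :: "real ^ ('n::finite + bool) => real ^ 'n"
 where "base X = (\<chi> i. X $ Inl i)"

definition fibre :: "real ^ ('n::finite + bool) => complex"
 where "fibre X = of_real (X $ Inr True) + of_real (X $ Inr False) * \<i>"

lemma emb_simps [simp]: "base (emb x z) = x" "fibre (emb x z) = z" "emb (base X) (fibre X) = X"
 by (auto simp: emb_def base_def fibre_def vec_eq_iff complex_eq_iff split: sum.split)

lemma emb_nth [simp]: "emb x z $ Inl i = x $ i" "emb x z $ Inr t = (if t then Re z else Im z)"
 by (simp_all add: emb_def)

lemma smooth_emb: "open S ==> smooth_on S (\<lambda>x. emb x c)"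
 unfolding emb_def
proof (intro smooth_vec_lambda)
 fix k :: "'a + bool"
 show "smooth_on S (\<lambda>x :: real ^ 'a. case k of Inl i => x $ i | Inr t => if t then Re c else Im c)" by (cases k) auto
qed

lemma smooth_base: "open S ==> smooth_on S base" and smooth_on_fibre: "open S ==> smooth_on S fibre"
 unfolding base_def[abs_def] fibre_def[abs_def]
 by (intro smooth_vec_lambda smooth_nth smooth_add smooth_mult smooth_of_real smooth_const; assumption)+

lemma continuous_on_emb: "continuous_on S (\<lambda>(x, z). emb x z)"
proof -
 have "continuous_on S (\<lambda>w. \<chi> k. case k of Inl i => fst w $ i | Inr t => if t then Re (snd w) else Im (snd w))"
 proof (rule continuous_on_vec_lambda)
  fix k :: "'a + bool"
  show "continuous_on S (\<lambda>w :: (real ^ 'a) \<times> complex. case k of Inl i => fst w $ i | Inr t => if t then Re (snd w) else Im (snd w))"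
   by (cases k; (cases "projr k")?) (auto intro!: continuous_intros)
 qed
 then show ?thesis by (simp add: emb_def case_prod_beta)
qed

text \<open>The two conditions on D are the Cauchy-Riemann equations at the point: the real 2 by 2
  block is multiplication by D, hence invertible. The local uniqueness of the root is exported
  because it decides reality of eigenvalues.\<close>

lemma implicit_complex:
 fixes Q :: "real ^ ('n::finite + bool) => complex"
 assumes U: "open U" "p \<in> U" and Q: "smooth_on {X. base X \<in> U} Q" "Q (emb p l) = 0"
  and D: "pd (Inr True) Q (emb p l) = D" "pd (Inr False) Q (emb p l) = \<i> * D" "D \<noteq> 0"
 obtains V h e where "open V" "p \<in> V" "V \<subseteq> U" "smooth_on V h" "h p = l" "!!x. x \<in> V ==> Q (emb x (h x)) = 0"
  "!!x. x \<in> V ==> dist (h x) l < e" "!!x z. x \<in> V ==> dist z l < e ==> Q (emb x z) = 0 ==> z = h x"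
proof -
 let ?U = "{X. base X \<in> U} :: (real ^ ('n + bool)) set" and ?X0 = "emb p l"
 have U': "open ?U" using open_vimage[OF U(1) smoothC[OF smooth_base[OF open_UNIV]]]
  by (simp add: vimage_def)
 define K where "K X = (\<chi> k. case k of Inl i => X $ Inl i | Inr t => if t then Re (Q X) else Im (Q X))" for X
 have K_nth: "K X $ Inl i = X $ Inl i" "K X $ Inr t = (if t then Re (Q X) else Im (Q X))" for X i t by (simp_all add: K_def)
 have smK: "smooth_on ?U K"
  unfolding K_def[abs_def]
 proof (rule smooth_vec_lambda[OF U'])
  fix k :: "'n + bool"
  show "smooth_on ?U (\<lambda>X. case k of Inl i => X $ Inl i | Inr t => if t then Re (Q X) else Im (Q X))"
   using smooth_Re[OF U' Q(1)] smooth_Im[OF U' Q(1)] by (cases k; cases "projr k") simp_all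
 qed
 have X0: "?X0 \<in> ?U" using U(2) by simp
 have Kemb: "K X = emb (base X) (Q X)" for X by (auto simp: vec_eq_iff K_def emb_def base_def split: sum.split)
 have dQ: "Q differentiable at ?X0" by (rule smoothD[OF Q(1) X0])
 have dK: "K differentiable at ?X0" by (rule smoothD[OF smK X0])
 have pdK: "pd c K ?X0 $ Inl i = (if Inl i = c then 1 else 0)" "pd c K ?X0 $ Inr t = (if t then Re (pd c Q ?X0) else Im (pd c Q ?X0))" for c i t
  using pd_component[OF dK, of c "Inl i"] pd_component[OF dK, of c "Inr t"]
  by (auto simp: K_nth pd_linear[OF bounded_linear_Re dQ] pd_linear[OF bounded_linear_Im dQ])
 have det: "det (jac K ?X0) \<noteq> 0"
 proof (rule det_nz_if_ker)
  fix h assume h: "jac K ?X0 *v h = 0"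
  have c: "(\<Sum>c\<in>UNIV. pd c K ?X0 $ k * h $ c) = 0" for k
   using arg_cong[OF h, of "\<lambda>v. v $ k"] by (simp add: jac_def mv_mult)
  have h0: "h $ Inl i = 0" for i using c[of "Inl i"] by (simp add: pdK sum_delta_mult)
  have two: "(\<Sum>c\<in>UNIV. f c * h $ c) = f (Inr True) * h $ Inr True + f (Inr False) * h $ Inr False" for f
  proof (rule sum_two)
   fix c :: "'n + bool" assume "c \<noteq> Inr True" "c \<noteq> Inr False"
   then show "f c * h $ c = 0" using h0 by (cases c) auto
  qed simp
  \<comment> \<open>The two real equations are the real and imaginary part of D times a complex
    number being 0.\<close>
  have "Re D * h $ Inr True - Im D * h $ Inr False = 0" "Im D * h $ Inr True + Re D * h $ Inr False = 0"
   using c[of "Inr True"] c[of "Inr False"] unfolding pdK if_True if_False refl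
    two[of "\<lambda>c. Re (pd c Q ?X0)"] two[of "\<lambda>c. Im (pd c Q ?X0)"] by (simp_all add: D)
  then have "D * Complex (h $ Inr True) (h $ Inr False) = 0" by (simp add: complex_eq_iff)
  then have "Complex (h $ Inr True) (h $ Inr False) = 0" using D(3) by (simp only: mult_eq_0_iff) simp
  then have "h $ Inr True = 0" "h $ Inr False = 0" by (simp_all add: complex_eq_iff)
  then have "h $ k = 0" for k using h0 by (cases k; cases "projr k") simp_all
  then show "h = 0" by (simp add: vec_eq_iff)
 qed
 obtain T e1 Xi where T: "open T" "?X0 \<in> T" "T \<subseteq> ?U" "e1 > 0" "smooth_on (ball (K ?X0) e1) Xi" and hom: "homeomorphism T (ball (K ?X0) e1) K Xi"
  using smooth_chart[OF U' smK X0 det] by blast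
 have K0: "K ?X0 = emb p 0" by (simp add: Kemb Q(2))
 have "open ((\<lambda>(x, z). emb x z) -` T)" "(p, l) \<in> (\<lambda>(x, z). emb x z) -` T"
  using open_vimage[OF T(1) continuous_on_emb[of UNIV]] T(2) by simp_all
 then obtain A B where A: "open A" "open B" "p \<in> A" "l \<in> B" "A \<times> B \<subseteq> (\<lambda>(x, z). emb x z) -` T"
  by (elim open_prod_elim) auto
 obtain e where e: "e > 0" "ball l e \<subseteq> B" using A(2,4) openE by blast
 define V1 where "V1 = A \<inter> (\<lambda>x. emb x 0) -` ball (emb p 0) e1"
 have V1: "open V1" unfolding V1_def
  by (intro open_Int A(1) open_vimage open_ball smoothC smooth_emb open_UNIV)
 define h where "h x = fibre (Xi (emb x 0))" for x
 have smh: "smooth_on V1 h" unfolding h_def[abs_def]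
  by (rule smooth_compose[OF V1 smooth_on_fibre[OF open_UNIV] smooth_compose[OF V1 T(5) smooth_emb[OF V1]]])
   (auto simp: K0 V1_def)
 have Xi: "Xi (emb x 0) \<in> T" "K (Xi (emb x 0)) = emb x 0" if "x \<in> V1" for x
  using hom that unfolding homeomorphism_def V1_def K0 by auto
 have em: "Xi (emb x 0) = emb x (h x)" "Q (emb x (h x)) = 0" if "x \<in> V1" for x
 proof -
  have "base (Xi (emb x 0)) = x" "Q (Xi (emb x 0)) = 0"
   using arg_cong[OF Xi(2)[OF that], of base] arg_cong[OF Xi(2)[OF that], of fibre] by (simp_all add: Kemb)
  then show "Xi (emb x 0) = emb x (h x)" "Q (emb x (h x)) = 0" using emb_simps(3)[of "Xi (emb x 0)"] by (simp_all add: h_def)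
 qed
 have uniq: "z = h x" if x: "x \<in> V1" and z: "dist z l < e" "Q (emb x z) = 0" for x z
 proof -
  have "(x, z) \<in> A \<times> B" using e(2) x z(1) by (auto simp: V1_def dist_commute)
  from subsetD[OF A(5) this] have "emb x z \<in> T" by simp
  moreover have "K (emb x z) = emb x 0" by (simp add: Kemb z(2))
  ultimately have "emb x z = Xi (emb x 0)" using hom unfolding homeomorphism_def by metis
  from arg_cong[OF this, of fibre] show ?thesis by (simp add: h_def)
 qed
 have p1: "p \<in> V1" using A(3) T(4) by (simp add: V1_def)
 have hp: "h p = l" using uniq[OF p1, of l] Q(2) e(1) by simp
 define V where "V = V1 \<inter> h -` ball l e"
 have "open V" unfolding V_def by (rule continuous_open_preimage[OF smoothC[OF smh] V1 open_ball])
 moreover have "V \<subseteq> U"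
 proof
  fix x assume "x \<in> V"
  then show "x \<in> U" using Xi(1)[of x] em(1)[of x] T(3) by (auto simp: V_def)
 qed
 ultimately show ?thesis
  using that[of V h e] smooth_subset[OF smh, of V] uniq em(2) hp p1 e(1) by (auto simp: V_def dist_commute)
qed

section \<open>Eigenvalues and eigencovectors of a pair of symmetric matrices\<close>

definition pm :: "complex ^ 'n ^ 'n => complex ^ 'n ^ 'n => complex => complex ^ 'n ^ 'n"
 where "pm A B z = (\<chi> i j. A $ i $ j - z * B $ i $ j)"

lemma eigenvalues_pair_pm: "eigenvalues_pair g1 g2 x = {l. det (pm (cmat (g1 x)) (cmat (g2 x)) l) = 0}"
 by (simp add: eigenvalues_pair_def pm_def)

lemma pm_mult: "pm A B z *v w = A *v w - z *s (B *v w)"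
 by (simp add: vec_eq_iff pm_def mv_mult left_diff_distrib sum_subtractf sum_distrib_left mult.assoc)

text \<open>Bilinear, without conjugation: complexified real symmetric matrices are symmetric for
  this pairing even at nonreal eigenvalues.\<close>

definition dot :: "complex ^ 'n => complex ^ 'n => complex"
 where "dot v w = (\<Sum>i\<in>UNIV. v $ i * w $ i)"

lemma dot_simps: "dot v (w - w') = dot v w - dot v w'" "dot v (c *s w) = c * dot v w" "dot v 0 = 0"
 "dot (c *s v) w = c * dot v w" "dot (v - v') w = dot v w - dot v' w"
 by (simp_all add: dot_def right_diff_distrib left_diff_distrib sum_subtractf sum_distrib_left mult_ac)

lemma dot_sym:
 assumes "transpose B = B"
 shows "dot v (B *v w) = dot w (B *v v)"
proof -
 have "B $ i $ j = B $ j $ i" for i j using arg_cong[OF assms, of "\<lambda>M. M $ i $ j"] by (simp add: transpose_def)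
 then have e: "v $ i * (B $ i $ j * w $ j) = w $ j * (B $ j $ i * v $ i)" for i j by simp
 show ?thesis
  unfolding dot_def mv_mult vec_lambda_beta sum_distrib_left e by (rule sum.swap)
qed

lemma kernel_trivial: "det M \<noteq> 0 ==> M *v w = 0 ==> w = 0" for M :: "'a::field ^ 'n ^ 'n"
proof -
 assume M: "det M \<noteq> 0" "M *v w = 0"
 have "w = matrix_inv M *v (M *v w)" by (simp add: matrix_vector_mul_assoc matrix_inv_id(2)[OF M(1)])
 then show "w = 0" using M(2) by (simp add: matrix_vector_mult_0_right)
qed

lemma eigencovectors_orthogonal:
 assumes "transpose A = A" "transpose B = B" "A *v v = l *s (B *v v)" "A *v w = m *s (B *v w)" "l \<noteq> m"
 shows "dot w (B *v v) = 0"
proof -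
 have "l * dot w (B *v v) = dot w (A *v v)" by (simp add: assms dot_simps)
 also have "... = dot v (A *v w)" by (rule dot_sym[OF assms(1)])
 also have "... = m * dot w (B *v v)" by (simp add: assms dot_simps dot_sym[OF assms(2), of v])
 finally show ?thesis using assms(5) by simp
qed

text \<open>From a linear relation, A - l_b B removes the b-th term and multiplies the others by l_a
  - l_b, which is nonzero; this is the induction over the index set.\<close>

lemma eigencovectors_independent:
 fixes v :: "'n::finite => complex ^ 'n"
 assumes B: "det B \<noteq> 0" and l: "inj l" and eig: "!!a. A *v v a = l a *s (B *v v a)" and nz: "!!a. v a \<noteq> 0"
 shows "det (vec_lambda v) \<noteq> 0"
proof -
 have "(\<Sum>a\<in>S. c a *s v a) = 0 ==> a \<in> S ==> c a = 0" for S c a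
 proof (induction S arbitrary: c a rule: infinite_finite_induct)
  case (insert b S)
  have mul: "M *v (\<Sum>a\<in>T. c a *s v a) = (\<Sum>a\<in>T. c a *s (M *v v a))" for M c and T :: "'n set"
   by (simp add: vec_eq_iff mv_mult sum_distrib_left mult_ac) (subst sum.swap, simp)
  let ?s = "\<Sum>a\<in>insert b S. c a *s v a"
  have "0 = A *v ?s - l b *s (B *v ?s)" by (simp add: insert.prems matrix_vector_mult_0_right)
  also have "... = (\<Sum>a\<in>insert b S. (c a * (l a - l b)) *s (B *v v a))"
   unfolding mul eig by (simp add: vec_eq_iff sum_distrib_left sum_subtractf[symmetric] algebra_simps)
  also have "... = B *v (\<Sum>a\<in>S. (c a * (l a - l b)) *s v a)"
   using insert.hyps by (simp add: mul)
  finally have "matrix_inv B *v (B *v (\<Sum>a\<in>S. (c a * (l a - l b)) *s v a)) = 0" by (simp add: matrix_vector_mult_0_right)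
  then have "(\<Sum>a\<in>S. (c a * (l a - l b)) *s v a) = 0"
   by (simp add: matrix_vector_mul_assoc matrix_inv_id[OF B])
  then have c0: "c a = 0" if "a \<in> S" for a
   using insert.IH[of "\<lambda>a. c a * (l a - l b)" a] that insert.hyps(2) injD[OF l, of a b] by auto
  then have "c b *s v b = 0" using insert.prems(1) insert.hyps by simp
  then have "c b = 0" using nz[of b] by (auto simp: vec_eq_iff)
  then show ?case using c0 insert.prems(2) by blast
 qed auto
 note ind = this
 have "det (transpose (vec_lambda v)) \<noteq> 0"
 proof (rule det_nz_if_ker)
  fix c assume c: "transpose (vec_lambda v) *v c = 0"
  have e: "(\<Sum>a\<in>UNIV. c $ a *s v a) = transpose (vec_lambda v) *v c"
   by (simp add: vec_eq_iff mv_mult transpose_def mult.commute)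
  have "c $ a = 0" for a by (rule ind[of "\<lambda>a. c $ a" UNIV, OF e[unfolded c]]) simp
  then show "c = 0" by (simp add: vec_eq_iff)
 qed
 then show ?thesis by (simp add: det_transpose)
qed

text \<open>The eigencovectors diagonalize the whole pencil by congruence, so the characteristic
  determinant is a nonzero multiple of the product of the l_a - z; in particular every root is
  simple.\<close>

lemma det_pm:
 fixes v :: "'n::finite => complex ^ 'n"
 assumes sym: "transpose A = A" "transpose B = B" and B: "det B \<noteq> 0" and l: "inj l"
  and eig: "!!a. A *v v a = l a *s (B *v v a)" and nz: "!!a. v a \<noteq> 0"
 obtains c where "c \<noteq> 0" "!!z. det (pm A B z) = c * (\<Prod>a\<in>UNIV. l a - z)"
proof -
 let ?T = "vec_lambda v"
 have T: "det ?T \<noteq> 0" by (rule eigencovectors_independent[OF B l eig nz])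
 have ent: "(?T ** M ** transpose ?T) $ a $ b = dot (v a) (M *v v b)" for M a b
  by (simp add: mm_mult transpose_def dot_def mv_mult sum_distrib_left sum_distrib_right)
   (subst sum.swap, simp add: mult.assoc)
 have orth: "dot (v a) (B *v v b) = 0" if "a \<noteq> b" for a b
  by (rule eigencovectors_orthogonal[OF sym eig eig]) (use that injD[OF l] in blast)
 have gen: "x = q / a\<^sup>2 * p" if "a * x * a = p * q" "a \<noteq> 0" for a x p q :: complex
  using that by (simp add: field_simps power2_eq_square)
 have "det (?T ** pm A B z ** transpose ?T) = (\<Prod>a\<in>UNIV. (l a - z) * dot (v a) (B *v v a))" for z
 proof -
  have e: "(?T ** pm A B z ** transpose ?T) $ a $ b = (l b - z) * dot (v a) (B *v v b)" for a b
   unfolding ent pm_mult eig by (simp add: dot_simps left_diff_distrib)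
  show ?thesis by (subst det_diagonal) (simp_all add: e orth)
 qed
 then have d: "det (pm A B z) = (\<Prod>a\<in>UNIV. dot (v a) (B *v v a)) / (det ?T)\<^sup>2 * (\<Prod>a\<in>UNIV. l a - z)" for z
  by (intro gen T) (simp only: det_mul det_transpose prod.distrib)
 have "det (?T ** B ** transpose ?T) = (\<Prod>a\<in>UNIV. dot (v a) (B *v v a))"
  by (subst det_diagonal) (simp_all add: ent orth)
 then have "(\<Prod>a\<in>UNIV. dot (v a) (B *v v a)) = det ?T * det B * det ?T" by (simp only: det_mul det_transpose)
 then have "(\<Prod>a\<in>UNIV. dot (v a) (B *v v a)) / (det ?T)\<^sup>2 \<noteq> 0" using T B by (simp only:) simp
 then show ?thesis using that d by blast
qed

lemma det_expand_row:
 fixes M :: "complex ^ 'n ^ 'n"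
 shows "(\<Sum>j\<in>UNIV. w $ j * det (\<chi> s. if s = r then axis j 1 else M $ s)) = det (\<chi> s. if s = r then w else M $ s)"
proof -
 have "det (\<chi> s. if s = r then w else M $ s) = det (\<chi> s. if s = r then (\<Sum>j\<in>UNIV. w $ j *s axis j 1) else M $ s)"
  by (simp only: basis_expansion)
 also have "... = (\<Sum>j\<in>UNIV. det (\<chi> s. if s = r then w $ j *s axis j 1 else M $ s))" by (rule det_linear_row_sum) simp
 finally show ?thesis by (simp add: det_row_mul)
qed

text \<open>Row i of M times the cofactor vector of row r is the determinant with row r replaced by
  row i: two equal rows, or M itself. This yields eigencovectors that are polynomial in the
  entries.\<close>

lemma cofactors_in_kernel:
 fixes M :: "complex ^ 'n ^ 'n"
 assumes "det M = 0"
 shows "M *v (\<chi> j. det (\<chi> s. if s = r then axis j 1 else M $ s)) = 0"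
proof -
 have "det (\<chi> s. if s = r then M $ i else M $ s) = 0" for i
 proof (cases "i = r")
  case True
  then have "(\<chi> s. if s = r then M $ i else M $ s) = M" by (simp add: vec_eq_iff)
  then show ?thesis using assms by simp
 next
  case False
  then show ?thesis by (intro det_identical_rows[of r i]) (auto simp: row_def)
 qed
 then show ?thesis by (simp add: vec_eq_iff mv_mult det_expand_row)
qed

text \<open>A vector h in the kernel of the modified matrix has h_r = 0, and M h can be nonzero only
  at r; pairing with v_a excludes that too. So h is an eigencovector, hence a multiple of v_a by
  simplicity of the root, and h_r = 0 forces it to be 0.\<close>

lemma cofactor_nonzero:
 fixes v :: "'n::finite => complex ^ 'n"
 assumes sym: "transpose A = A" "transpose B = B" and B: "det B \<noteq> 0" and l: "inj l"
  and eig: "!!a. A *v v a = l a *s (B *v v a)" and r: "v a $ r \<noteq> 0" and nz: "!!a. v a \<noteq> 0"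
 shows "det (\<chi> s. if s = r then axis r 1 else pm A B (l a) $ s) \<noteq> 0"
proof (rule det_nz_if_ker)
 let ?M = "pm A B (l a)"
 have symM: "transpose ?M = ?M"
  using sym by (simp add: pm_def transpose_def vec_eq_iff)
 fix h assume h: "(\<chi> s. if s = r then axis r 1 else ?M $ s) *v h = 0"
 have Mh: "(?M *v h) $ s = 0" if "s \<noteq> r" for s using arg_cong[OF h, of "\<lambda>w. w $ s"] that by (simp add: mv_mult)
 have hr: "h $ r = 0" using arg_cong[OF h, of "\<lambda>w. w $ r"] by (simp add: mv_mult axis_def if_distrib[of "\<lambda>z. z * _"] cong: if_cong)
 have "dot (v a) (?M *v h) = dot h (?M *v v a)" by (rule dot_sym[OF symM])
 moreover have "dot (v a) (?M *v h) = v a $ r * (?M *v h) $ r" unfolding dot_def by (rule sum_one) (use Mh in auto)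
 ultimately have "(?M *v h) $ r = 0" using r by (simp add: pm_mult eig dot_simps)
 then have "?M *v h = 0" using Mh by (metis vec_eq_iff zero_index)
 then have eh: "A *v h = l a *s (B *v h)" by (simp add: pm_mult)
 have inj: "w = 0" if "!!b. dot (v b) (B *v w) = 0" for w
 proof -
  have "(vec_lambda v) *v (B *v w) = 0" using that by (simp add: vec_eq_iff dot_def mv_mult)
  then show "w = 0" using kernel_trivial[OF eigencovectors_independent[OF B l eig nz]] kernel_trivial[OF B] by blast
 qed
 have orth: "dot (v b) (B *v w) = 0" if "b \<noteq> a" "A *v w = l a *s (B *v w)" for b w
  by (rule eigencovectors_orthogonal[OF sym that(2) eig]) (use that(1) injD[OF l] in blast)
 define delta where "delta = (dot (v a) (B *v v a) :: complex)"
 have delta: "delta \<noteq> 0" using inj[of "v a"] nz[of a] orth[OF _ eig] unfolding delta_def by (metis (full_types))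
 have "delta *s h - dot (v a) (B *v h) *s v a = 0"
 proof (rule inj)
  fix b
  show "dot (v b) (B *v (delta *s h - dot (v a) (B *v h) *s v a)) = 0"
   using orth[OF _ eig, of b] orth[OF _ eh, of b]
   by (cases "b = a") (simp_all add: delta_def matrix_vector_mult_diff_distrib vector_scalar_commute dot_simps)
 qed
 then have e: "delta *s h = dot (v a) (B *v h) *s v a" by simp
 from arg_cong[OF this, of "\<lambda>w. w $ r"] have "dot (v a) (B *v h) = 0" using hr r by simp
 then have "delta *s h = 0" using e by simp
 then show "h = 0" using delta by (simp add: vec_eq_iff)
qed

lemma cnj_det: "cnj (det M) = det (\<chi> i j. cnj (M $ i $ j))"
 by (simp add: det_def)

lemma smooth_cmat_base:
 assumes "open U" "contravariant_metric U g"
 shows "smooth_on {X. base X \<in> U} (\<lambda>X. complex_of_real (g (base X) $ i $ j))"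
proof -
 have o: "open {X. base X \<in> U}"
  using open_vimage[OF assms(1) smoothC[OF smooth_base[OF open_UNIV]]] by (simp add: vimage_def)
 show ?thesis
  by (rule smooth_of_real[OF o smooth_compose[OF o metric_smooth[OF assms] smooth_base[OF o]]]) auto
qed

text \<open>A simple root continues smoothly by the implicit function theorem. If it is real at p,
  its conjugate is a root equally close to it nearby, so uniqueness keeps it real.\<close>

lemma eigenvalue_function:
 assumes U: "open U" "p \<in> U" and g: "contravariant_metric U g1" "contravariant_metric U g2"
  and root: "det (pm (cmat (g1 p)) (cmat (g2 p)) l) = 0"
  and simple: "((\<lambda>z. det (pm (cmat (g1 p)) (cmat (g2 p)) z)) has_field_derivative D) (at l)" "D \<noteq> 0"
 obtains V h where "open V" "p \<in> V" "V \<subseteq> U" "smooth_on V h" "h p = l"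
  "!!x. x \<in> V ==> det (pm (cmat (g1 x)) (cmat (g2 x)) (h x)) = 0" "l \<in> \<real> ==> (!!x. x \<in> V ==> h x \<in> \<real>)"
proof -
 define Q where "Q X = det (pm (cmat (g1 (base X))) (cmat (g2 (base X))) (fibre X))" for X
 have o: "open {X. base X \<in> U}"
  using open_vimage[OF U(1) smoothC[OF smooth_base[OF open_UNIV]]] by (simp add: vimage_def)
 have smQ: "smooth_on {X. base X \<in> U} Q"
  unfolding Q_def[abs_def] pm_def using smooth_cmat_base[OF U(1) g(1)] smooth_cmat_base[OF U(1) g(2)] smooth_on_fibre[OF o]
  by (intro smooth_det[OF o]) (auto intro!: smooth_diff smooth_mult o)
 \<comment> \<open>The determinant is holomorphic in z, so its derivatives in the two fibre
   directions are D times 1 and D times the imaginary unit.\<close>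
 have pdQ: "pd (Inr t) Q (emb p l) = w * D" if w: "w = (if t then 1 else \<i>)" for t w
 proof -
  have "Q differentiable at (emb p l)" by (rule smoothD[OF smQ]) (simp add: U)
  then have "((\<lambda>s. Q (emb p l + s *\<^sub>R axis (Inr t) 1)) has_vector_derivative pd (Inr t) Q (emb p l)) (at 0)"
   using pd_along_axis[of Q "emb p l" 0 "Inr t"] by simp
  moreover have "emb p l + s *\<^sub>R axis (Inr t) 1 = emb p (l + of_real s * w)" for s
   by (auto simp: vec_eq_iff emb_def axis_def w split: sum.split)
  ultimately have 1: "((\<lambda>s. det (pm (cmat (g1 p)) (cmat (g2 p)) (l + of_real s * w))) has_vector_derivative pd (Inr t) Q (emb p l)) (at 0)"
   by (simp add: Q_def)
  have "((\<lambda>s. l + of_real s * w) has_vector_derivative w) (at (0::real))"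
   by (auto intro!: derivative_eq_intros simp: has_vector_derivative_def scaleR_conv_of_real)
  from field_vector_diff_chain_at[OF this, of "\<lambda>z. det (pm (cmat (g1 p)) (cmat (g2 p)) z)" D] simple(1)
  have "((\<lambda>s. det (pm (cmat (g1 p)) (cmat (g2 p)) (l + of_real s * w))) has_vector_derivative w * D) (at 0)"
   by (simp add: o_def)
  then show ?thesis using 1 vector_derivative_unique_at by blast
 qed
 have Q0: "Q (emb p l) = 0" by (simp add: Q_def root)
 have t: "pd (Inr True) Q (emb p l) = D" "pd (Inr False) Q (emb p l) = \<i> * D" using pdQ[of 1 True] pdQ[of \<i> False] by simp_all
 obtain V h e where V: "open V" "p \<in> V" "V \<subseteq> U" "smooth_on V h" "h p = l" "!!x. x \<in> V ==> Q (emb x (h x)) = 0"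
  "!!x. x \<in> V ==> dist (h x) l < e" "!!x z. x \<in> V ==> dist z l < e ==> Q (emb x z) = 0 ==> z = h x"
  using implicit_complex[OF U smQ Q0 t simple(2)] by blast
 have root_h: "det (pm (cmat (g1 x)) (cmat (g2 x)) (h x)) = 0" if "x \<in> V" for x using V(6)[OF that] by (simp add: Q_def)
 have "h x \<in> \<real>" if l: "l \<in> \<real>" and x: "x \<in> V" for x
 proof -
  have "det (pm (cmat (g1 x)) (cmat (g2 x)) (cnj (h x))) = cnj (det (pm (cmat (g1 x)) (cmat (g2 x)) (h x)))"
   by (simp add: cnj_det pm_def)
  then have "Q (emb x (cnj (h x))) = 0" using root_h[OF x] by (simp add: Q_def)
  moreover have "dist (cnj (h x)) l < e"
  proof -
   have "dist (cnj (h x)) l = cmod (cnj (h x - l))" using l by (simp add: dist_norm Reals_cnj_iff)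
   then show ?thesis using V(7)[OF x] by (simp only: complex_mod_cnj dist_norm)
  qed
  ultimately have "cnj (h x) = h x" using V(8)[OF x] by blast
  then show ?thesis by (simp add: Reals_cnj_iff)
 qed
 then show ?thesis using that[OF V(1-5)] root_h by blast
qed

text \<open>Cofactor vectors make the eigencovectors smooth functions of the metrics and the
  eigenvalue. The last conclusion is the dichotomy for integrating factors: a real eigenvalue has
  real cofactors, while a nonreal one cannot have an eigencovector proportional to a real
  one.\<close>

theorem smooth_eigenframe:
 fixes U :: "(real ^ 'n) set"
 assumes U: "open U" "p \<in> U" and g: "contravariant_metric U g1" "contravariant_metric U g2" and ns: "nonsingular_pair U g1 g2"
 obtains V f theta where "open V" "p \<in> V" "V \<subseteq> U" "!!a :: 'n. smooth_on V (f a)" "!!a j :: 'n. smooth_on V (theta a j)"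
  "!!x. x \<in> V ==> inj (\<lambda>a. f a x)" "!!x. x \<in> V ==> eigenvalues_pair g1 g2 x = range (\<lambda>a. f a x)" "!!x a. x \<in> V ==> f a x \<noteq> 0"
  "!!x a. x \<in> V ==> cmat (g1 x) *v (\<chi> j. theta a j x) = f a x *s (cmat (g2 x) *v (\<chi> j. theta a j x))"
  "!!x a. x \<in> V ==> (\<chi> j. theta a j x) \<noteq> 0"
  "!!a. (\<exists>j. theta a j p \<noteq> 0 \<and> (\<forall>x\<in>V. \<forall>j. theta a j x \<in> \<real>)) \<or> (\<exists>j k. Im (cnj (theta a j p) * theta a k p) \<noteq> 0)"
proof -
 let ?q = "\<lambda>x z. pm (cmat (g1 x)) (cmat (g2 x)) z"
 have detg: "det (cmat (g1 x)) \<noteq> 0" "det (cmat (g2 x)) \<noteq> 0" if "x \<in> U" for x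
  using metric_det[OF U(1) g(1) that] metric_det[OF U(1) g(2) that] by (simp_all add: det_cmat)
 have sym: "transpose (cmat (g1 x)) = cmat (g1 x)" "transpose (cmat (g2 x)) = cmat (g2 x)" if "x \<in> U" for x
  by (rule cmat_sym[OF U(1) g(1) that] cmat_sym[OF U(1) g(2) that])+
 have card: "card (eigenvalues_pair g1 g2 x) = CARD('n)" if "x \<in> U" for x using ns that by (simp add: nonsingular_pair_def)
 have fin: "finite (eigenvalues_pair g1 g2 x)" if "x \<in> U" for x by (rule card_ge_0_finite) (simp add: card[OF that])
 obtain l :: "'n => complex" where "bij_betw l UNIV (eigenvalues_pair g1 g2 p)"
  using finite_same_card_bij[OF finite_class.finite_UNIV fin[OF U(2)]] card[OF U(2)] by auto
 then have l: "inj l" "det (?q p (l a)) = 0" for a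
  by (auto simp: bij_betw_def eigenvalues_pair_pm)
 have "\<exists>v. v \<noteq> 0 \<and> ?q p (l a) *v v = 0" for a using det_nz_if_ker l(2) by blast
 then obtain v where v: "!!a. v a \<noteq> 0" "!!a. ?q p (l a) *v v a = 0" by metis
 have eig: "cmat (g1 p) *v v a = l a *s (cmat (g2 p) *v v a)" for a using v(2)[of a] by (simp add: pm_mult)
 have "\<exists>r. v a $ r \<noteq> 0" for a using v(1)[of a] by (auto simp: vec_eq_iff)
 then obtain r where r: "!!a. v a $ r a \<noteq> 0" by metis
 obtain c where c: "c \<noteq> 0" "!!z. det (?q p z) = c * (\<Prod>a\<in>UNIV. l a - z)"
  using det_pm[OF sym[OF U(2)] detg(2)[OF U(2)] l(1) eig v(1)] by blast
 \<comment> \<open>By the product formula the derivative at l_a is, up to sign, the remaining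
   product of differences of distinct roots.\<close>
 have simple: "\<exists>D. D \<noteq> 0 \<and> ((\<lambda>z. det (?q p z)) has_field_derivative D) (at (l a))" for a
 proof -
  let ?s = "\<lambda>z. c * (\<Prod>b\<in>UNIV - {a}. l b - z)"
  have e: "(\<lambda>z. det (?q p z)) = (\<lambda>z. (l a - z) * ?s z)"
   by (rule ext) (simp add: c(2) prod.remove[of UNIV a])
  have "?s holomorphic_on UNIV" by (intro holomorphic_intros)
  then have "?s field_differentiable at (l a)" by (rule holomorphic_on_imp_differentiable_at) auto
  then obtain s' where "(?s has_field_derivative s') (at (l a))" unfolding field_differentiable_def by blast
  then have "((\<lambda>z. (l a - z) * ?s z) has_field_derivative - ?s (l a)) (at (l a))"
   by (rule DERIV_cong[OF DERIV_mult[OF DERIV_diff[OF DERIV_const DERIV_ident]]]) simp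
  moreover have "?s (l a) \<noteq> 0" using c(1) injD[OF l(1)] by auto
  ultimately show ?thesis unfolding e by (intro exI[of _ "- ?s (l a)"]) simp
 qed
 define Pr where "Pr a V h \<longleftrightarrow> open V \<and> p \<in> V \<and> V \<subseteq> U \<and> smooth_on V h \<and> h p = l a \<and> (\<forall>x\<in>V. det (?q x (h x)) = 0)
   \<and> (l a \<in> \<real> --> (\<forall>x\<in>V. h x \<in> \<real>))" for a V h
 have "\<exists>V h. Pr a V h" for a
 proof -
  obtain D where "D \<noteq> 0" "((\<lambda>z. det (?q p z)) has_field_derivative D) (at (l a))" using simple by blast
  then show ?thesis unfolding Pr_def using eigenvalue_function[OF U g l(2)] by metis
 qed
 then obtain V0 f where Pr: "!!a. Pr a (V0 a) (f a)" by metis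
 define V1 where "V1 = (\<Inter>a. V0 a)"
 have V1: "open V1" "p \<in> V1" using Pr by (auto simp: V1_def Pr_def)
 have V1U: "V1 \<subseteq> U" using Pr[of undefined] by (auto simp: V1_def Pr_def)
 have sub: "V1 \<subseteq> V0 a" for a by (auto simp: V1_def)
 have fsm: "smooth_on V1 (f a)" for a using Pr[of a] smooth_subset[OF _ sub] by (auto simp: Pr_def)
 have root: "det (?q x (f a x)) = 0" if "x \<in> V1" for a x using Pr[of a] sub[of a] that unfolding Pr_def by blast
 have fp: "f a p = l a" for a using Pr by (auto simp: Pr_def)
 have fR: "f a x \<in> \<real>" if "l a \<in> \<real>" "x \<in> V1" for a x using Pr[of a] sub[of a] that unfolding Pr_def by blast
 define theta where "theta a j x = det (\<chi> s. if s = r a then axis j 1 else ?q x (f a x) $ s)" for a j x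
 have thetasm: "smooth_on V1 (theta a j)" for a j
  unfolding theta_def[abs_def]
 proof (rule smooth_det[OF V1(1)])
  fix s k
  have "smooth_on V1 (\<lambda>x. of_real (g1 x $ s $ k) - f a x * of_real (g2 x $ s $ k))"
   by (intro smooth_diff smooth_mult smooth_of_real V1(1) fsm smooth_subset[OF metric_smooth[OF U(1) g(1)] V1U]
     smooth_subset[OF metric_smooth[OF U(1) g(2)] V1U])
  then show "smooth_on V1 (\<lambda>x. (\<chi> s. if s = r a then axis j 1 else ?q x (f a x) $ s) $ s $ k)"
   by (cases "s = r a") (simp_all add: pm_def)
 qed
 have thetap: "theta a (r a) p \<noteq> 0" for a
  unfolding theta_def fp by (rule cofactor_nonzero[OF sym[OF U(2)] detg(2)[OF U(2)] l(1) eig r v(1)])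
 \<comment> \<open>Nonvanishing of this one smooth function keeps the eigenvalues distinct and the
   cofactor vectors nonzero near p.\<close>
 define disc where "disc x = (\<Prod>a\<in>UNIV. \<Prod>b\<in>UNIV. if a = b then 1 else f a x - f b x) * (\<Prod>a\<in>UNIV. theta a (r a) x)" for x
 have dsm: "smooth_on V1 disc"
 proof -
  have "smooth_on V1 (\<lambda>x. if a = b then 1 else f a x - f b x)" for a b
   using smooth_diff[OF V1(1) fsm fsm] by (cases "a = b") auto
  then show ?thesis unfolding disc_def[abs_def] by (intro smooth_mult smooth_prod V1(1) thetasm)
 qed
 define V where "V = V1 \<inter> disc -` (- {0})"
 have V: "open V" "V \<subseteq> V1"
  unfolding V_def by (intro continuous_open_preimage smoothC dsm V1(1)) auto
 have dp: "disc p \<noteq> 0" using thetap injD[OF l(1)] by (auto simp: disc_def fp)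
 then have pV: "p \<in> V" using V1(2) by (simp add: V_def)
 have inj: "inj (\<lambda>a. f a x)" if "x \<in> V" for x
 proof (rule injI, rule ccontr)
  fix a b assume ab: "f a x = f b x" "a \<noteq> b"
  then have "(\<Prod>b\<in>UNIV. if a = b then 1 else f a x - f b x) = 0" by (intro prod_zero) auto
  then have "(\<Prod>a\<in>UNIV. \<Prod>b\<in>UNIV. if a = b then 1 else f a x - f b x) = 0" by (intro prod_zero finite_class.finite_UNIV) blast
  then have "disc x = 0" by (simp add: disc_def)
  then show False using that by (simp add: V_def)
 qed
 have U': "x \<in> U" "x \<in> V1" if "x \<in> V" for x using that V(2) V1U by auto
 have ev: "eigenvalues_pair g1 g2 x = range (\<lambda>a. f a x)" if x: "x \<in> V" for x
 proof -
  have "range (\<lambda>a. f a x) \<subseteq> eigenvalues_pair g1 g2 x" using root[OF U'(2)[OF x]] by (auto simp: eigenvalues_pair_pm)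
  moreover have "card (range (\<lambda>a. f a x)) = card (eigenvalues_pair g1 g2 x)"
   using card_image[OF inj[OF x]] card[OF U'(1)[OF x]] by simp
  ultimately show ?thesis using card_subset_eq[OF fin[OF U'(1)[OF x]]] by blast
 qed
 have f0: "f a x \<noteq> 0" if x: "x \<in> V" for a x
 proof
  assume "f a x = 0"
  moreover have "pm A B 0 = A" for A B :: "complex ^ 'n ^ 'n" by (simp add: pm_def vec_eq_iff)
  ultimately show False using root[OF U'(2)[OF x], of a] detg(1)[OF U'(1)[OF x]] by simp
 qed
 have eigV: "cmat (g1 x) *v (\<chi> j. theta a j x) = f a x *s (cmat (g2 x) *v (\<chi> j. theta a j x))" if "x \<in> V" for x a
  using cofactors_in_kernel[OF root[OF U'(2)[OF that]], of a "r a"] by (simp add: pm_mult theta_def)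
 have nzV: "(\<chi> j. theta a j x) \<noteq> 0" if "x \<in> V" for x a
 proof
  assume "(\<chi> j. theta a j x) = 0"
  then have "theta a (r a) x = 0" by (metis vec_lambda_beta zero_index)
  then have "disc x = 0" by (auto simp: disc_def prod_zero_iff)
  then show False using that by (simp add: V_def)
 qed
 have nd: "(\<exists>j. theta a j p \<noteq> 0 \<and> (\<forall>x\<in>V. \<forall>j. theta a j x \<in> \<real>)) \<or> (\<exists>j k. Im (cnj (theta a j p) * theta a k p) \<noteq> 0)" for a
 proof (cases "l a \<in> \<real>")
  case True
  have "theta a j x \<in> \<real>" if "x \<in> V" for x j
  proof -
   have "cnj (f a x) = f a x" using fR[OF True U'(2)[OF that]] by (simp add: Reals_cnj_iff)
   then have "(\<chi> s t. cnj ((\<chi> s. if s = r a then axis j 1 else ?q x (f a x) $ s) $ s $ t)) = (\<chi> s. if s = r a then axis j 1 else ?q x (f a x) $ s)"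
    by (simp add: vec_eq_iff pm_def axis_def)
   then have "cnj (theta a j x) = theta a j x" unfolding theta_def cnj_det by simp
   then show ?thesis by (simp add: Reals_cnj_iff)
  qed
  then show ?thesis using thetap by blast
 next
  case False
  have "\<exists>j k. Im (cnj (theta a j p) * theta a k p) \<noteq> 0"
  proof (rule ccontr)
   assume "\<nexists>j k. Im (cnj (theta a j p) * theta a k p) \<noteq> 0"
   then have im: "cnj (theta a j p) * theta a k p = of_real (Re (cnj (theta a j p) * theta a k p))" for j k by (simp add: complex_eq_iff)
   let ?t = "theta a (r a) p"
   \<comment> \<open>If all these imaginary parts vanish, multiplication by the conjugate of one
     nonzero component turns the eigencovector into a real one.\<close>
   define rho where "rho = (\<chi> k. Re (cnj ?t * theta a k p))"
   have tr: "cnj ?t *s (\<chi> j. theta a j p) = (\<chi> k. complex_of_real (rho $ k))" using im by (simp add: vec_eq_iff rho_def)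
   have ep: "cmat (g1 p) *v (\<chi> k. complex_of_real (rho $ k)) = l a *s (cmat (g2 p) *v (\<chi> k. complex_of_real (rho $ k)))"
    using arg_cong[OF eigV[OF pV, of a], of "\<lambda>w. cnj ?t *s w"] unfolding tr[symmetric] vector_scalar_commute fp
    by (simp add: mult.commute)
   have rc: "cmat M *v (\<chi> k. complex_of_real (rho $ k)) = (\<chi> k. complex_of_real ((M *v rho) $ k))" for M
    by (simp add: vec_eq_iff mv_mult)
   \<comment> \<open>The imaginary part of the eigenvalue equation for a real covector is Im (l a)
     times g2 rho, and Im (l a) is nonzero.\<close>
   have "g2 p *v rho = 0"
   proof -
    have "Im (l a) * (g2 p *v rho) $ k = 0" for k
     using arg_cong[OF ep, of "\<lambda>w. Im (w $ k)"] by (simp add: rc)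
    then show ?thesis using False by (auto simp: vec_eq_iff complex_is_Real_iff)
   qed
   then have "cmat (g2 p) *v (\<chi> k. complex_of_real (rho $ k)) = 0" by (simp add: rc vec_eq_iff)
   then have "(\<chi> k. complex_of_real (rho $ k)) = 0" by (rule kernel_trivial[OF detg(2)[OF U(2)]])
   then have "cnj ?t * ?t = 0" unfolding tr[symmetric] by (metis vec_lambda_beta vector_smult_component zero_index)
   then show False using thetap by simp
  qed
  then show ?thesis by blast
 qed
 show ?thesis
  by (rule that[of V f theta]) (use V pV V1U smooth_subset[OF fsm V(2)] smooth_subset[OF thetasm V(2)] inj ev f0 eigV nzV nd in blast)+
qed

text \<open>The contraction of the Christoffel symbols with two vectors in the lower slots and a
  covector in the upper one; vanishing torsion makes it symmetric in y and z.\<close>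

definition tri :: "('n::finite => complex ^ 'n ^ 'n) => complex ^ 'n => complex ^ 'n => complex ^ 'n => complex"
 where "tri A y z c = (\<Sum>k\<in>UNIV. y $ k * dot z (transpose (A k) *v c))"

lemma tri_sym:
 assumes "!!i j k. A k $ i $ j = A j $ i $ k"
 shows "tri A y z c = tri A z y c"
proof -
 have e: "tri A y z c = (\<Sum>k\<in>UNIV. \<Sum>t\<in>UNIV. \<Sum>i\<in>UNIV. y $ k * z $ t * (A k $ i $ t * c $ i))" for y z
  by (simp add: tri_def dot_def mv_mult transpose_def sum_distrib_left mult_ac)
 show ?thesis unfolding e[of y z] e[of z y] by (subst sum.swap) (simp add: assms[of _ _ _] mult_ac)
qed

lemma tri_scale: "tri A y (c *s z) w = c * tri A y z w" "tri A (c *s y) z w = c * tri A y z w"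
 by (simp_all add: tri_def dot_simps sum_distrib_left mult_ac)

lemma dot_transpose: "dot v (A *v w) = dot w (transpose A *v v)"
 unfolding dot_def mv_mult transpose_def vec_lambda_beta sum_distrib_left by (subst sum.swap) (simp add: mult_ac)

lemma dot_commute: "dot v w = dot w v"
 by (simp add: dot_def mult.commute)

text \<open>A raised Christoffel symbol contracted with a covector \<open>w\<close> is
  \<open>tri\<close> at the vector G w. This translates the linearity of the pencil, a statement on
  raised symbols, into one on \<open>tri\<close>.\<close>

lemma tri_up:
 assumes "transpose G = G"
 shows "(\<Sum>k\<in>UNIV. y $ k * dot w ((G ** transpose (A k)) *v c)) = tri A y (G *v w) c"
proof -
 have "dot w ((G ** transpose (A k)) *v c) = dot (G *v w) (transpose (A k) *v c)" for k
  unfolding matrix_vector_mul_assoc[symmetric] using dot_sym[OF assms, of w "transpose (A k) *v c"] by (simp only: dot_commute)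
 then show ?thesis by (simp add: tri_def)
qed

lemma pd_matrix_vector:
 fixes A :: "real ^ 'n => complex ^ 'n ^ 'n"
 assumes "A differentiable at x" "w differentiable at x"
 shows "pd k (\<lambda>x. A x *v w x) x = pd k A x *v w x + A x *v pd k w x"
proof -
 have d: "(\<lambda>x. A x $ i $ j) differentiable at x" "(\<lambda>x. w x $ j) differentiable at x" for i j
  using assms by (simp_all add: diff_vec_iff)
 have c: "pd k (\<lambda>x. A x $ i $ j) x = pd k A x $ i $ j" "pd k (\<lambda>x. w x $ j) x = pd k w x $ j" for i j
  using assms by (simp_all add: pd_component diff_vec_iff)
 have "pd k (\<lambda>x. \<chi> i. \<Sum>j\<in>UNIV. A x $ i $ j * w x $ j) x = (\<chi> i. \<Sum>j\<in>UNIV. A x $ i $ j * pd k w x $ j + pd k A x $ i $ j * w x $ j)"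
  using d by (subst pd_vec_lambda(2)) (auto simp: pd_sum pd_mult differentiable_mult differentiable_sum c)
 then show ?thesis by (simp add: mv_mult vec_eq_iff sum.distrib)
qed

lemma pd_smult_vec:
 fixes w :: "real ^ 'n => complex ^ 'm"
 assumes "f differentiable at x" "w differentiable at x"
 shows "pd k (\<lambda>x. f x *s w x) x = pd k f x *s w x + f x *s pd k w x"
proof -
 have d: "(\<lambda>x. w x $ j) differentiable at x" for j using assms by (simp add: diff_vec_iff)
 have "pd k (\<lambda>x. \<chi> i. f x * w x $ i) x = (\<chi> i. f x * pd k w x $ i + pd k f x * w x $ i)"
  using assms d by (subst pd_vec_lambda(2)) (auto simp: pd_mult differentiable_mult pd_component)
 then show ?thesis by (simp add: vector_scalar_mult_def vec_eq_iff add.commute)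
qed

section \<open>Derivatives of eigenvalues and eigencovectors along the eigenframe\<close>

locale eigenframe =
 fixes V :: "(real ^ 'n) set" and g1 g2 :: "'n tensor2" and f :: "'n => real ^ 'n => complex"
  and theta :: "'n => 'n => real ^ 'n => complex"
 assumes V: "open V" and g1: "contravariant_metric V g1" and g2: "contravariant_metric V g2"
  and f_smooth: "smooth_on V (f a)" and theta_smooth: "smooth_on V (theta a j)"
  and f_inj: "x \<in> V ==> inj (\<lambda>a. f a x)" and f_nz: "x \<in> V ==> f a x \<noteq> 0"
  and eig: "x \<in> V ==> cmat (g1 x) *v (\<chi> j. theta a j x) = f a x *s (cmat (g2 x) *v (\<chi> j. theta a j x))"
  and theta_nz: "x \<in> V ==> (\<chi> j. theta a j x) \<noteq> 0"
begin

definition th :: "'n => real ^ 'n => complex ^ 'n" where "th a x = (\<chi> j. theta a j x)"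

text \<open>The eigencovectors raised with g2: up to factors, the vector frame dual to them.\<close>

definition Y :: "'n => real ^ 'n => complex ^ 'n" where "Y a x = cmat (g2 x) *v th a x"

lemma sym: "x \<in> V ==> transpose (cmat (g1 x)) = cmat (g1 x)" "x \<in> V ==> transpose (cmat (g2 x)) = cmat (g2 x)"
 by (rule cmat_sym[OF V g1], assumption) (rule cmat_sym[OF V g2])

lemma det_g2: "x \<in> V ==> det (cmat (g2 x)) \<noteq> 0"
 using metric_det[OF V g2] by (simp add: det_cmat)

lemma g1_th: "x \<in> V ==> cmat (g1 x) *v th a x = f a x *s Y a x"
 by (simp add: th_def Y_def eig)

lemma f_distinct: "x \<in> V ==> a \<noteq> b ==> f a x \<noteq> f b x"
 using injD[OF f_inj] by blast

lemma orth: "x \<in> V ==> a \<noteq> b ==> dot (th a x) (Y b x) = 0"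
 unfolding Y_def by (rule eigencovectors_orthogonal[OF sym g1_th[unfolded Y_def] g1_th[unfolded Y_def] f_distinct]) auto

lemma det_th: "x \<in> V ==> det (vec_lambda (\<lambda>a. th a x)) \<noteq> 0"
 by (rule eigencovectors_independent[OF det_g2 f_inj g1_th[unfolded Y_def]]) (auto simp: th_def theta_nz)

lemma diag_nz:
 assumes x: "x \<in> V"
 shows "dot (th a x) (Y a x) \<noteq> 0"
proof
 assume "dot (th a x) (Y a x) = 0"
 then have "dot (th b x) (Y a x) = 0" for b using orth[OF x, of b a] by (cases "b = a") auto
 then have "vec_lambda (\<lambda>a. th a x) *v Y a x = 0" by (simp add: vec_eq_iff mv_mult dot_def)
 then have "Y a x = 0" by (rule kernel_trivial[OF det_th[OF x]])
 then have "th a x = 0" unfolding Y_def by (rule kernel_trivial[OF det_g2[OF x]])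
 then show False using theta_nz[OF x] by (simp add: th_def)
qed

lemma completeness:
 assumes x: "x \<in> V"
 shows "(\<Sum>a\<in>UNIV. Y a x $ i * (theta a j x / dot (th a x) (Y a x))) = (if i = j then 1 else 0)"
proof -
 let ?T = "\<chi> a j. theta a j x / dot (th a x) (Y a x)" and ?Y = "\<chi> i a. Y a x $ i"
 have "(?T ** ?Y) $ a $ b = dot (th a x) (Y b x) / dot (th a x) (Y a x)" for a b
  by (simp add: mm_mult dot_def th_def sum_divide_distrib)
 then have "?T ** ?Y = mat 1" using orth[OF x] diag_nz[OF x] by (simp add: vec_eq_iff mat_def)
 then have "?Y ** ?T = mat 1" by (rule det_nz_iff_inverse(1))
 from arg_cong[OF this, of "\<lambda>M. M $ i $ j"] show ?thesis by (simp add: mm_mult mat_def)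
qed

lemma th_diff: "x \<in> V ==> th a differentiable at x"
 using smoothD[OF theta_smooth] by (simp add: diff_vec_iff th_def[abs_def])

lemma pd_th: "x \<in> V ==> pd k (th a) x $ j = pd k (theta a j) x"
 using pd_component[OF th_diff, of x k a j] by (simp add: th_def)

text \<open>Both metrics are parallel for their own connections, so their derivatives can be traded
  for Christoffel contractions.\<close>

lemma pd_metric:
 assumes S: "open S" "contravariant_metric S g" and x: "x \<in> S"
 shows "(\<Sum>k\<in>UNIV. y $ k * dot w (pd k (\<lambda>x. cmat (g x)) x *v v))
  = - (tri (\<lambda>k. chr g k x) y (cmat (g x) *v w) v + tri (\<lambda>k. chr g k x) y (cmat (g x) *v v) w)"
proof -
 let ?G = "cmat (g x)" and ?A = "\<lambda>k. chr g k x"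
 have "pd k (\<lambda>x. cmat (g x)) x = - (?A k ** ?G + ?G ** transpose (?A k))" for k
  using christoffel_metric_connection[OF S x] unfolding metric_connection_def eq_neg_iff_add_eq_0 add.assoc by blast
 moreover have "dot w ((- (?A k ** ?G + ?G ** transpose (?A k))) *v v)
  = - dot (?G *v v) (transpose (?A k) *v w) - dot w ((?G ** transpose (?A k)) *v v)" for k
 proof -
  have "dot w ((- (M + N)) *v v) = - dot w (M *v v) - dot w (N *v v)" for M N
   by (simp add: dot_def mv_mult right_diff_distrib left_diff_distrib sum_subtractf sum_negf)
  then show ?thesis unfolding matrix_vector_mul_assoc[symmetric] dot_transpose[of w "?A k"] by (simp only: matrix_vector_mul_assoc dot_transpose[symmetric])
 qed
 ultimately have "(\<Sum>k\<in>UNIV. y $ k * dot w (pd k (\<lambda>x. cmat (g x)) x *v v)) =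
  - (\<Sum>k\<in>UNIV. y $ k * dot w ((?G ** transpose (?A k)) *v v)) - tri ?A y (?G *v v) w"
  by (simp add: tri_def right_diff_distrib sum_subtractf sum_negf)
 then show ?thesis unfolding tri_up[OF cmat_sym[OF S x]] by simp
qed

definition t1 :: "'n => 'n => 'n => real ^ 'n => complex" where "t1 a b c x = tri (\<lambda>k. chr g1 k x) (Y a x) (Y b x) (th c x)"

definition t2 :: "'n => 'n => 'n => real ^ 'n => complex" where "t2 a b c x = tri (\<lambda>k. chr g2 k x) (Y a x) (Y b x) (th c x)"

lemma t_sym: "x \<in> V ==> t1 a b c x = t1 b a c x" "x \<in> V ==> t2 a b c x = t2 b a c x"
 unfolding t1_def t2_def
 using christoffel_metric_connection[OF V g1] christoffel_metric_connection[OF V g2]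
 by (auto intro!: tri_sym simp: metric_connection_def)

text \<open>The equation g1 theta_b = f_b g2 theta_b is differentiated along Y_a and paired with
  theta_c; symmetry of the metrics moves them onto theta_c, and parallelism removes their
  derivatives.\<close>

lemma derivative_relation:
 assumes x: "x \<in> V"
 shows "- (f c x * t1 a c b x + f b x * t1 a b c x) + f c x * (\<Sum>k\<in>UNIV. Y a x $ k * dot (Y c x) (pd k (th b) x))
  = (\<Sum>k\<in>UNIV. Y a x $ k * pd k (f b) x) * dot (th c x) (Y b x) - f b x * (t2 a c b x + t2 a b c x)
   + f b x * (\<Sum>k\<in>UNIV. Y a x $ k * dot (Y c x) (pd k (th b) x))"
proof -
 let ?G1 = "\<lambda>x. cmat (g1 x)" and ?G2 = "\<lambda>x. cmat (g2 x)"
 note d = cmat_differentiable[OF V g1 x] cmat_differentiable[OF V g2 x] th_diff[OF x, of b] smoothD[OF f_smooth x, of b]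
 have dY: "Y b differentiable at x"
  unfolding Y_def[abs_def] mv_mult using d(2,3)
  by (auto simp: diff_vec_iff intro!: differentiable_sum differentiable_mult)
 have "pd k (\<lambda>x. ?G1 x *v th b x) x = pd k (\<lambda>x. f b x *s Y b x) x" for k
  by (rule pd_cong_open[OF V x g1_th])
 then have e: "pd k ?G1 x *v th b x + ?G1 x *v pd k (th b) x = pd k (f b) x *s Y b x + f b x *s (pd k ?G2 x *v th b x + ?G2 x *v pd k (th b) x)" for k
  by (simp only: pd_matrix_vector[OF d(1,3)] pd_smult_vec[OF d(4) dY]) (simp only: Y_def[abs_def] pd_matrix_vector[OF d(2,3)])
 have m: "dot (th c x) (?G1 x *v w) = f c x * dot (Y c x) w" "dot (th c x) (?G2 x *v w) = dot (Y c x) w" for w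
  using dot_sym[OF sym(1)[OF x], of "th c x" w] dot_sym[OF sym(2)[OF x], of "th c x" w]
  by (simp_all add: g1_th[OF x] Y_def[symmetric] dot_simps) (simp_all add: dot_def mult.commute)
 have add: "dot v (w + w') = dot v w + dot v w'" for v w w' :: "complex ^ 'n" by (simp add: dot_def distrib_left sum.distrib)
 have "dot (th c x) (pd k ?G1 x *v th b x) + f c x * dot (Y c x) (pd k (th b) x)
  = pd k (f b) x * dot (th c x) (Y b x) + f b x * dot (th c x) (pd k ?G2 x *v th b x) + f b x * dot (Y c x) (pd k (th b) x)" for k
  using arg_cong[OF e[of k], of "dot (th c x)"] by (simp add: add dot_simps m algebra_simps)
 then have "(\<Sum>k\<in>UNIV. Y a x $ k * (dot (th c x) (pd k ?G1 x *v th b x) + f c x * dot (Y c x) (pd k (th b) x)))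
  = (\<Sum>k\<in>UNIV. Y a x $ k * (pd k (f b) x * dot (th c x) (Y b x) + f b x * dot (th c x) (pd k ?G2 x *v th b x) + f b x * dot (Y c x) (pd k (th b) x)))"
  by simp
 then have "(\<Sum>k\<in>UNIV. Y a x $ k * dot (th c x) (pd k ?G1 x *v th b x)) + f c x * (\<Sum>k\<in>UNIV. Y a x $ k * dot (Y c x) (pd k (th b) x))
  = (\<Sum>k\<in>UNIV. Y a x $ k * pd k (f b) x) * dot (th c x) (Y b x) + f b x * (\<Sum>k\<in>UNIV. Y a x $ k * dot (th c x) (pd k ?G2 x *v th b x))
   + f b x * (\<Sum>k\<in>UNIV. Y a x $ k * dot (Y c x) (pd k (th b) x))"
  by (simp add: distrib_left sum.distrib sum_distrib_left sum_distrib_right mult_ac)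
 then show ?thesis
  unfolding pd_metric[OF V g1 x] pd_metric[OF V g2 x] g1_th[OF x] tri_scale Y_def[symmetric] t1_def t2_def by (simp add: algebra_simps)
qed

text \<open>For one regular member of the pencil, linearity expresses (f_b + t) times its
  contraction on Y_a, Y_b through \<open>t1\<close> and \<open>t2\<close>. Exchanging a and b and
  comparing leaves (f_a - f_b) t (t2 - t1) = 0.\<close>

lemma pencil_relation:
 assumes x: "x \<in> V" and t: "t \<noteq> 0" "det (pencil 1 t g1 g2 x) \<noteq> 0"
  and S: "open S" "x \<in> S" "contravariant_metric S (pencil 1 t g1 g2)"
  and lin: "!!i j k. christoffel_up (pencil 1 t g1 g2) i j k x = 1 * christoffel_up g1 i j k x + t * christoffel_up g2 i j k x"
  and ab: "a \<noteq> b"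
 shows "t1 a b c x = t2 a b c x"
proof -
 let ?g = "pencil 1 t g1 g2" and ?t = "complex_of_real t"
 have up: "(cmat (?g x) ** transpose (chr ?g k x)) $ i $ j
  = (cmat (g1 x) ** transpose (chr g1 k x)) $ i $ j + ?t * (cmat (g2 x) ** transpose (chr g2 k x)) $ i $ j" for i j k
  unfolding christoffel_up_matrix[OF S(1,3,2), symmetric] christoffel_up_matrix[OF V g1 x, symmetric] christoffel_up_matrix[OF V g2 x, symmetric]
  using lin[of i j k] by simp
 have gth: "cmat (?g x) *v th a x = (f a x + ?t) *s Y a x" for a
 proof -
  have "cmat (?g x) *v th a x = cmat (g1 x) *v th a x + ?t *s (cmat (g2 x) *v th a x)"
   by (simp add: vec_eq_iff pencil_def mv_mult distrib_right distrib_left sum.distrib sum_distrib_left mult_ac)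
  then show ?thesis by (simp add: g1_th[OF x] Y_def[symmetric] vector_sadd_rdistrib)
 qed
 have upth: "dot w ((cmat (?g x) ** transpose (chr ?g k x)) *v v) = dot w ((cmat (g1 x) ** transpose (chr g1 k x)) *v v)
  + ?t * dot w ((cmat (g2 x) ** transpose (chr g2 k x)) *v v)" for k w v
  by (simp add: dot_def mv_mult up distrib_left distrib_right sum.distrib sum_distrib_left mult_ac)
 have e: "(f b x + ?t) * tri (\<lambda>k. chr ?g k x) (Y a x) (Y b x) (th c x) = f b x * t1 a b c x + ?t * t2 a b c x" for a b
 proof -
  have "tri (\<lambda>k. chr ?g k x) (Y a x) (cmat (?g x) *v th b x) (th c x)
   = tri (\<lambda>k. chr g1 k x) (Y a x) (cmat (g1 x) *v th b x) (th c x) + ?t * tri (\<lambda>k. chr g2 k x) (Y a x) (cmat (g2 x) *v th b x) (th c x)"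
   unfolding tri_up[OF cmat_sym[OF S(1,3,2)], symmetric] tri_up[OF sym(1)[OF x], symmetric] tri_up[OF sym(2)[OF x], symmetric] upth
   by (simp add: distrib_left sum.distrib sum_distrib_left mult_ac)
  then show ?thesis unfolding gth g1_th[OF x] tri_scale t1_def t2_def Y_def[symmetric] .
 qed
 let ?T = "\<lambda>a b. tri (\<lambda>k. chr ?g k x) (Y a x) (Y b x) (th c x)"
 have Ts: "?T a b = ?T b a"
  using christoffel_metric_connection[OF S(1,3,2)] by (intro tri_sym) (auto simp: metric_connection_def)
 have "(f a x + ?t) * (f b x * t1 a b c x + ?t * t2 a b c x) = (f b x + ?t) * (f a x * t1 b a c x + ?t * t2 b a c x)"
  unfolding e[symmetric] Ts by (simp add: mult_ac)
 then have "(f a x - f b x) * ?t * (t2 a b c x - t1 a b c x) = 0"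
  unfolding t_sym(1)[OF x, of b a] t_sym(2)[OF x, of b a] by (simp add: algebra_simps)
 then show ?thesis using t(1) f_distinct[OF x ab] by simp
qed

end

context eigenframe
begin

lemma frame_expansion:
 assumes x: "x \<in> V"
 shows "v i = (\<Sum>a\<in>UNIV. Y a x $ i * ((\<Sum>j\<in>UNIV. theta a j x * v j) / dot (th a x) (Y a x)))"
proof -
 have "(\<Sum>a\<in>UNIV. Y a x $ i * ((\<Sum>j\<in>UNIV. theta a j x * v j) / dot (th a x) (Y a x)))
  = (\<Sum>j\<in>UNIV. (\<Sum>a\<in>UNIV. Y a x $ i * (theta a j x / dot (th a x) (Y a x))) * v j)"
  by (simp add: sum_distrib_left sum_distrib_right sum_divide_distrib mult.assoc) (rule sum.swap)
 then show ?thesis unfolding completeness[OF x] sum_delta_mult by simp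
qed

context
 assumes rel: "!!x a b c. x \<in> V ==> a \<noteq> b ==> t1 a b c x = t2 a b c x"
begin

text \<open>In the relation with c = b the Christoffel terms agree and the derivatives of theta_b
  enter both sides with the same factor; only the derivative of f_b is left.\<close>

lemma derivative_f_zero:
 assumes x: "x \<in> V" and ab: "a \<noteq> b"
 shows "(\<Sum>k\<in>UNIV. Y a x $ k * pd k (f b) x) = 0"
proof -
 have "(\<Sum>k\<in>UNIV. Y a x $ k * pd k (f b) x) * dot (th b x) (Y b x) = 0"
  using derivative_relation[OF x, of b a b] rel[OF x ab, of b] by (simp add: algebra_simps)
 then show ?thesis using diag_nz[OF x] by simp
qed

text \<open>With c different from b the eigenvalue derivative drops out by orthogonality, and all
  remaining terms carry the common factor f_c - f_b.\<close>

lemma derivative_th: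
 assumes x: "x \<in> V" and d: "a \<noteq> b" "c \<noteq> b" "a \<noteq> c"
 shows "(\<Sum>k\<in>UNIV. Y a x $ k * dot (Y c x) (pd k (th b) x)) = t2 a c b x"
proof -
 have "(f c x - f b x) * ((\<Sum>k\<in>UNIV. Y a x $ k * dot (Y c x) (pd k (th b) x)) - t2 a c b x) = 0"
  using derivative_relation[OF x, of c a b] rel[OF x d(1), of c] rel[OF x d(3), of b] orth[OF x d(2)]
  by (simp add: algebra_simps)
 then show ?thesis using f_distinct[OF x d(2)] by simp
qed

text \<open>Kernel vectors of theta_b have no Y_b component. On the other frame vectors the
  derivatives of theta_b are the values \<open>t2 a c b\<close>, symmetric in a and c, so their
  antisymmetric part vanishes.\<close>

lemma theta_kernel_closed: "kernel_closed V (theta b)"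
 unfolding kernel_closed_def
proof (intro ballI allI impI)
 fix x and v w :: "'n => complex" assume x: "x \<in> V" and v: "(\<Sum>i\<in>UNIV. theta b i x * v i) = 0" and w: "(\<Sum>i\<in>UNIV. theta b i x * w i) = 0"
 define coeff where "coeff v a = (\<Sum>j\<in>UNIV. theta a j x * v j) / dot (th a x) (Y a x)" for v :: "'n => complex" and a
 define D where "D a c = (\<Sum>k\<in>UNIV. Y a x $ k * dot (Y c x) (pd k (th b) x))" for a c
 have ex: "v i = (\<Sum>a\<in>UNIV. Y a x $ i * coeff v a)" for v :: "'n => complex" and i
  unfolding coeff_def by (rule frame_expansion[OF x])
 have bil: "(\<Sum>i\<in>UNIV. \<Sum>j\<in>UNIV. pd i (theta b j) x * v i * w j) = (\<Sum>a\<in>UNIV. \<Sum>c\<in>UNIV. coeff v a * coeff w c * D a c)" for v w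
 proof -
  have "(\<Sum>i\<in>UNIV. \<Sum>j\<in>UNIV. pd i (theta b j) x * v i * w j)
   = (\<Sum>i\<in>UNIV. \<Sum>j\<in>UNIV. pd i (theta b j) x * (\<Sum>a\<in>UNIV. Y a x $ i * coeff v a) * (\<Sum>c\<in>UNIV. Y c x $ j * coeff w c))"
   by (simp only: ex[symmetric])
  also have "... = (\<Sum>i\<in>UNIV. \<Sum>j\<in>UNIV. \<Sum>a\<in>UNIV. \<Sum>c\<in>UNIV. coeff v a * coeff w c * (Y a x $ i * (Y c x $ j * pd i (theta b j) x)))"
   by (simp only: mult.assoc sum_product) (simp only: sum_distrib_left mult_ac)
  also have "... = (\<Sum>a\<in>UNIV. \<Sum>c\<in>UNIV. \<Sum>i\<in>UNIV. \<Sum>j\<in>UNIV. coeff v a * coeff w c * (Y a x $ i * (Y c x $ j * pd i (theta b j) x)))"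
   by (rule sum_swap_pairs)
  also have "... = (\<Sum>a\<in>UNIV. \<Sum>c\<in>UNIV. coeff v a * coeff w c * D a c)"
   by (simp only: D_def dot_def pd_th[OF x] sum_distrib_left)
  finally show ?thesis .
 qed
 have "coeff v a * coeff w c * D a c = coeff w c * coeff v a * D c a" for a c
 proof (cases "a = b \<or> c = b \<or> a = c")
  case True
  then show ?thesis using v w by (auto simp: coeff_def)
 next
  case False
  then have "D a c = D c a"
   unfolding D_def using t_sym(2)[OF x, of a c b] derivative_th[OF x, of a b c] derivative_th[OF x, of c b a] by auto
  then show ?thesis by simp
 qed
 then have "(\<Sum>a\<in>UNIV. \<Sum>c\<in>UNIV. coeff v a * coeff w c * D a c) = (\<Sum>a\<in>UNIV. \<Sum>c\<in>UNIV. coeff w a * coeff v c * D a c)"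
  by (simp only:) (rule sum.swap)
 then have "(\<Sum>i\<in>UNIV. \<Sum>j\<in>UNIV. pd i (theta b j) x * v i * w j) - (\<Sum>i\<in>UNIV. \<Sum>j\<in>UNIV. pd i (theta b j) x * w i * v j) = 0"
  unfolding bil by simp
 moreover have "(\<Sum>i\<in>UNIV. \<Sum>j\<in>UNIV. pd i (theta b j) x * w i * v j) = (\<Sum>i\<in>UNIV. \<Sum>j\<in>UNIV. pd j (theta b i) x * v i * w j)"
  by (subst sum.swap) (simp add: mult_ac)
 ultimately show "(\<Sum>i\<in>UNIV. \<Sum>j\<in>UNIV. (pd i (theta b j) x - pd j (theta b i) x) * v i * w j) = 0"
  by (simp add: left_diff_distrib sum_subtractf)
qed

text \<open>The differential of f_b vanishes on all Y_a with a different from b, so its expansion in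
  the dual coframe reduces to theta_b.\<close>

lemma pd_f:
 assumes x: "x \<in> V"
 shows "\<exists>nu. \<forall>i. pd i (f b) x = nu * theta b i x"
proof -
 have "pd i (f b) x = (\<Sum>k\<in>UNIV. pd k (f b) x * Y b x $ k) / dot (th b x) (Y b x) * theta b i x" for i
 proof -
  have "pd i (f b) x = (\<Sum>k\<in>UNIV. pd k (f b) x * (\<Sum>a\<in>UNIV. Y a x $ k * (theta a i x / dot (th a x) (Y a x))))"
   unfolding completeness[OF x] sum_delta_mult by simp
  also have "... = (\<Sum>a\<in>UNIV. (\<Sum>k\<in>UNIV. Y a x $ k * pd k (f b) x) * (theta a i x / dot (th a x) (Y a x)))"
   unfolding sum_distrib_left sum_distrib_right by (subst sum.swap) (simp add: mult_ac)
  also have "... = (\<Sum>k\<in>UNIV. Y b x $ k * pd k (f b) x) * (theta b i x / dot (th b x) (Y b x))"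
   by (rule sum_one) (simp add: derivative_f_zero[OF x])
  finally show ?thesis by (simp add: mult.commute)
 qed
 then show ?thesis by blast
qed

end

end

section \<open>Branches of square roots and injectivity of complex coordinates\<close>

lemma smooth_sqrt_branch:
 fixes h :: "real ^ 'n => complex"
 assumes U: "open U" "p \<in> U" and h: "smooth_on U h" "h p \<noteq> 0"
 obtains V where "open V" "p \<in> V" "V \<subseteq> U" "!!x. x \<in> V ==> h x / h p \<notin> \<real>\<^sub>\<le>\<^sub>0"
proof
 let ?V = "U \<inter> (\<lambda>x. h x / h p) -` (- \<real>\<^sub>\<le>\<^sub>0)"
 show "open ?V"
  by (intro continuous_open_preimage continuous_on_divide smoothC[OF h(1)] continuous_on_const U open_Compl closed_nonpos_Reals_complex)
   (simp add: h)
qed (use U h in auto)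

text \<open>Dividing by a reference value moves the function off the cut of the principal root; the
  factor \<open>csqrt c\<close> restores a root of h itself.\<close>

lemma smooth_csqrt:
 assumes "open V" "smooth_on V h" "!!x. x \<in> V ==> h x / c \<notin> \<real>\<^sub>\<le>\<^sub>0"
 shows "smooth_on V (\<lambda>x. csqrt (h x / c) * csqrt c)"
proof -
 have "csqrt holomorphic_on (- \<real>\<^sub>\<le>\<^sub>0)" by (rule holomorphic_on_csqrt)
 moreover have "smooth_on V (\<lambda>x. h x / c)"
  unfolding divide_inverse by (intro smooth_mult smooth_const assms)
 ultimately have "smooth_on V (\<lambda>x. csqrt (h x / c))"
  using smooth_holomorphic[OF assms(1) _ , of "- \<real>\<^sub>\<le>\<^sub>0" csqrt "\<lambda>x. h x / c"] assms(3)
  by (auto simp: open_Compl closed_nonpos_Reals_complex)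
 then show ?thesis by (intro smooth_mult smooth_const assms(1))
qed

text \<open>u maps a real n-dimensional domain into complex n-space, so it is not itself a map
  between spaces of equal dimension. The real part of the inverse Jacobian at p applied to u is such
  a map, with the identity as its Jacobian at p.\<close>

lemma locally_injective:
 fixes u :: "real ^ 'n => complex ^ 'n"
 assumes U: "open U" "p \<in> U" and u: "!!i. smooth_on U (\<lambda>x. u x $ i)" and det: "det (jacobian u p) \<noteq> 0"
 obtains V where "open V" "p \<in> V" "V \<subseteq> U" "inj_on u V"
proof -
 define M where "M = matrix_inv (jacobian u p)"
 define k where "k x = (\<chi> i. Re (\<Sum>j\<in>UNIV. M $ i $ j * u x $ j))" for x
 have sms: "smooth_on U (\<lambda>x. \<Sum>j\<in>UNIV. M $ i $ j * u x $ j)" for i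
  by (intro smooth_sum smooth_mult smooth_const u U)
 have smk: "smooth_on U k" unfolding k_def[abs_def] by (intro smooth_vec_lambda smooth_Re sms U)
 have "pd c k p $ i = (if i = c then 1 else 0)" for c i
 proof -
  have "pd c k p $ i = pd c (\<lambda>x. Re (\<Sum>j\<in>UNIV. M $ i $ j * u x $ j)) p"
   using pd_component[OF smoothD[OF smk U(2)], of c i] by (simp add: k_def)
  also have "... = Re (\<Sum>j\<in>UNIV. M $ i $ j * pd c (\<lambda>x. u x $ j) p)"
   unfolding pd_linear[OF bounded_linear_Re smoothD[OF sms U(2)]] using smoothD[OF u U(2)]
   by (subst pd_sum) (auto simp del: Re_sum simp: pd_mult differentiable_mult)
  also have "(\<Sum>j\<in>UNIV. M $ i $ j * pd c (\<lambda>x. u x $ j) p) = (if i = c then 1 else 0)"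
   using arg_cong[OF matrix_inv_id(2)[OF det], of "\<lambda>N. N $ i $ c"]
   by (simp add: M_def mm_mult jacobian_def mat_def)
  finally show ?thesis by simp
 qed
 then have "jac k p = mat 1" by (simp add: jac_def mat_def vec_eq_iff)
 then have dk: "det (jac k p) \<noteq> 0" by simp
 obtain V e Xi where V: "open V" "p \<in> V" "V \<subseteq> U" "e > 0" "smooth_on (ball (k p) e) Xi" "homeomorphism V (ball (k p) e) k Xi"
  by (rule smooth_chart[OF U(1) smk U(2) dk])
 have "inj_on u V"
 proof
  fix x y assume xy: "x \<in> V" "y \<in> V" "u x = u y"
  then have "k x = k y" by (simp add: k_def)
  then show "x = y" using V(6) xy(1,2) unfolding homeomorphism_def by metis
 qed
 then show ?thesis by (rule that[OF V(1-3)])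
qed

section \<open>The normal form\<close>

lemma contravariant_metric_subset: "contravariant_metric S g ==> T \<subseteq> S ==> contravariant_metric T g"
 unfolding contravariant_metric_def using smooth_subset by blast

text \<open>The pair has finitely many eigenvalues, so some real t differs from 0 and from every -
  Re l; then - t is no eigenvalue and g1 + t g2 is regular.\<close>

lemma regular_pencil_member:
 fixes g1 g2 :: "'n::finite tensor2"
 assumes "finite (eigenvalues_pair g1 g2 x)"
 obtains t where "t \<noteq> 0" "det (pencil 1 t g1 g2 x) \<noteq> 0"
proof -
 have "finite (insert 0 ((\<lambda>l. - Re l) ` eigenvalues_pair g1 g2 x))" using assms by simp
 then obtain t :: real where t: "t \<notin> insert 0 ((\<lambda>l. - Re l) ` eigenvalues_pair g1 g2 x)"
  using ex_new_if_finite[OF infinite_UNIV_char_0] by blast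
 have "- complex_of_real t \<notin> eigenvalues_pair g1 g2 x" using t by force
 moreover have "pm (cmat (g1 x)) (cmat (g2 x)) (- complex_of_real t) = cmat (pencil 1 t g1 g2 x)"
  by (simp add: pm_def pencil_def vec_eq_iff)
 ultimately have "det (pencil 1 t g1 g2 x) \<noteq> 0" by (simp add: eigenvalues_pair_pm det_cmat)
 then show ?thesis using t that by auto
qed

lemma (in eigenframe) rel_if_compatible:
 assumes U: "open U" "V \<subseteq> U" and g: "contravariant_metric U g1" "contravariant_metric U g2"
  and comp: "compatible_flat_metrics U g1 g2" and fin: "!!x. x \<in> V ==> finite (eigenvalues_pair g1 g2 x)"
  and x: "x \<in> V" and ab: "a \<noteq> b"
 shows "t1 a b c x = t2 a b c x"
proof -
 obtain t where t: "t \<noteq> 0" "det (pencil 1 t g1 g2 x) \<noteq> 0" by (rule regular_pencil_member[OF fin[OF x]])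
 have xS: "x \<in> {x \<in> U. det (pencil 1 t g1 g2 x) \<noteq> 0}" using x U(2) t(2) by auto
 show ?thesis
 proof (rule pencil_relation[OF x t open_det_nonzero[OF U(1) g] xS _ _ ab])
  show "contravariant_metric {x \<in> U. det (pencil 1 t g1 g2 x) \<noteq> 0} (pencil 1 t g1 g2)"
   using comp unfolding compatible_flat_metrics_def flat_metric_def by blast
  show "christoffel_up (pencil 1 t g1 g2) i j k x = 1 * christoffel_up g1 i j k x + t * christoffel_up g2 i j k x" for i j k
   using comp xS unfolding compatible_flat_metrics_def by blast
 qed
qed

lemma sqrt_square: "c \<noteq> 0 ==> (csqrt (z / c) * csqrt c)\<^sup>2 = z"
 by (simp add: power_mult_distrib)

text \<open>Each eigencovector has a local integral with differential a nonzero multiple of it, so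
  these integrals have an invertible Jacobian; eigencovectors are orthogonal for both metrics, so
  both become diagonal. Factoring through the integral makes each eigenvalue a function of its own
  coordinate.\<close>

lemma local_normal_form:
 fixes U :: "(real ^ 'n) set"
 assumes U: "open U" "p \<in> U" and g: "contravariant_metric U g1" "contravariant_metric U g2" and ns: "nonsingular_pair U g1 g2"
  and comp: "compatible_flat_metrics U g1 g2"
 obtains V and u :: "real ^ 'n => complex ^ 'n" and H F r where "p \<in> V" "V \<subseteq> U" "inj_on u V" "lame_pair V u H F r g1 g2"
  "!!x. x \<in> V ==> eigenvalues_pair g1 g2 x = range (\<lambda>i. F i (u x $ i))"
proof (rule smooth_eigenframe[OF U g ns])
 fix V0 f theta
 assume V0: "open V0" "p \<in> V0" "V0 \<subseteq> U" and f: "!!a :: 'n. smooth_on V0 (f a)" and theta: "!!a j :: 'n. smooth_on V0 (theta a j)"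
  and inj: "!!x. x \<in> V0 ==> inj (\<lambda>a. f a x)" and ev: "!!x. x \<in> V0 ==> eigenvalues_pair g1 g2 x = range (\<lambda>a. f a x)"
  and f0: "!!x a. x \<in> V0 ==> f a x \<noteq> 0"
  and eig: "!!x a. x \<in> V0 ==> cmat (g1 x) *v (\<chi> j. theta a j x) = f a x *s (cmat (g2 x) *v (\<chi> j. theta a j x))"
  and theta0: "!!x a. x \<in> V0 ==> (\<chi> j. theta a j x) \<noteq> 0"
  and nd: "!!a. (\<exists>j. theta a j p \<noteq> 0 \<and> (\<forall>x\<in>V0. \<forall>j. theta a j x \<in> \<real>)) \<or> (\<exists>j k. Im (cnj (theta a j p) * theta a k p) \<noteq> 0)"
 interpret E: eigenframe V0 g1 g2 f theta
  by unfold_locales (use V0 contravariant_metric_subset[OF g(1) V0(3)] contravariant_metric_subset[OF g(2) V0(3)] f theta inj f0 eig theta0 in auto)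
 have rel: "E.t1 a b c x = E.t2 a b c x" if "x \<in> V0" "a \<noteq> b" for x a b c
  by (rule E.rel_if_compatible[OF U(1) V0(3) g comp _ that]) (simp add: ev)
 define Pr where "Pr b V w \<longleftrightarrow> open V \<and> p \<in> V \<and> V \<subseteq> V0 \<and> smooth_on V w \<and> (\<forall>x\<in>V. \<exists>mu. mu \<noteq> 0 \<and> (\<forall>i. pd i w x = mu * theta b i x))
  \<and> factors_through V (theta b) w" for b V w
 have "\<exists>V w. Pr b V w" for b
 proof (rule integrating_factor[OF V0(1,2) theta E.theta_kernel_closed[OF rel] nd])
  fix V w assume "open V" "p \<in> V" "V \<subseteq> V0" "smooth_on V w" "!!x. x \<in> V ==> \<exists>mu. mu \<noteq> 0 \<and> (\<forall>i. pd i w x = mu * theta b i x)" "factors_through V (theta b) w"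
  then show ?thesis unfolding Pr_def by blast
 qed
 then obtain Vb w where Pr: "!!b. Pr b (Vb b) (w b)" by metis
 have Vb: "open (Vb b)" "p \<in> Vb b" "Vb b \<subseteq> V0" "smooth_on (Vb b) (w b)" "factors_through (Vb b) (theta b) (w b)" for b
  using Pr[of b] by (auto simp: Pr_def)
 have "\<exists>F. F holomorphic_on w b ` Vb b \<and> (\<forall>x\<in>Vb b. f b x = F (w b x))" for b
  using Vb(5)[of b, unfolded factors_through_def, rule_format, of "f b"] E.pd_f[OF rel] smoothD[OF f] Vb(3)[of b] by blast
 then obtain F where F: "!!b. F b holomorphic_on w b ` Vb b" "!!b x. x \<in> Vb b ==> f b x = F b (w b x)" by metis
 define V1 where "V1 = (\<Inter>b. Vb b)"
 have V1: "open V1" "p \<in> V1" and V1b: "V1 \<subseteq> Vb b" for b using Vb by (auto simp: V1_def)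
 have V10: "x \<in> V0" if "x \<in> V1" for x using that V1b Vb(3) by blast
 define u where "u x = (\<chi> b. w b x)" for x
 have ub: "(\<lambda>x. u x $ b) = w b" for b by (simp add: u_def)
 have usm: "smooth_on V1 (\<lambda>x. u x $ b)" for b unfolding ub by (rule smooth_subset[OF Vb(4) V1b])
 have "\<exists>mu. \<forall>b. mu b \<noteq> 0 \<and> (\<forall>i. jacobian u x $ b $ i = mu b * theta b i x)" if "x \<in> V1" for x
 proof -
  have "\<exists>mu. mu \<noteq> 0 \<and> (\<forall>i. pd i (w b) x = mu * theta b i x)" for b using Pr[of b] V1b[of b] that unfolding Pr_def by blast
  then show ?thesis unfolding jacobian_def ub vec_lambda_beta by metis
 qed
 then obtain mu where mu: "!!x b. x \<in> V1 ==> mu x b \<noteq> 0" "!!x b i. x \<in> V1 ==> jacobian u x $ b $ i = mu x b * theta b i x" by metis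
 have row: "jacobian u x $ b = mu x b *s E.th b x" if "x \<in> V1" for x b
  using mu(2)[OF that] by (simp add: vec_eq_iff E.th_def)
 have det: "det (jacobian u x) \<noteq> 0" if x: "x \<in> V1" for x
 proof (rule det_nz_if_ker)
  fix h assume h: "jacobian u x *v h = 0"
  have "(jacobian u x *v h) $ b = mu x b * (vec_lambda (\<lambda>a. E.th a x) *v h) $ b" for b
   by (simp add: mv_mult row[OF x] sum_distrib_left mult_ac)
  then have "vec_lambda (\<lambda>a. E.th a x) *v h = 0" using h mu(1)[OF x] by (simp add: vec_eq_iff)
  then show "h = 0" by (rule kernel_trivial[OF E.det_th[OF V10[OF x]]])
 qed
 define m where "m i x = coord_components u g2 x $ i $ i" for i x
 have cc: "coord_components u g' x $ i $ j = dot (jacobian u x $ i) (cmat (g' x) *v jacobian u x $ j)" for g' x i j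
  by (simp add: coord_components_def cmat_def[symmetric] mm_mult transpose_def dot_def mv_mult
    sum_distrib_left sum_distrib_right) (subst sum.swap, simp add: mult_ac)
 have cc2: "coord_components u g2 x $ i $ j = mu x i * mu x j * dot (E.th i x) (E.Y j x)" if "x \<in> V1" for x i j
  unfolding cc row[OF that] vector_scalar_commute dot_simps E.Y_def by simp
 have cc1: "coord_components u g1 x $ i $ j = f j x * coord_components u g2 x $ i $ j" if "x \<in> V1" for x i j
  unfolding cc2[OF that] unfolding cc row[OF that] vector_scalar_commute dot_simps E.g1_th[OF V10[OF that]] by simp
 have m0: "m i x \<noteq> 0" if "x \<in> V1" for i x
  unfolding m_def cc2[OF that] using mu(1)[OF that] E.diag_nz[OF V10[OF that]] by simp
 have d2: "coord_components u g2 x $ i $ j = (if i = j then m i x else 0)" if "x \<in> V1" for x i j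
  using cc2[OF that] E.orth[OF V10[OF that], of i j] by (simp add: m_def)
 have msm: "smooth_on V1 (m i)" for i
 proof -
  have J: "smooth_on V1 (\<lambda>x. jacobian u x $ i $ j)" for i j
   using smooth_pd[OF usm] by (simp add: jacobian_def)
  have "smooth_on V1 (\<lambda>x. complex_of_real (g2 x $ j $ k))" for j k
   by (intro smooth_of_real V1 smooth_subset[OF metric_smooth[OF U(1) g(2)]]) (use V10 V0(3) in blast)
  then show ?thesis
   unfolding m_def[abs_def] cc dot_def mv_mult by (auto intro!: smooth_sum smooth_mult J V1)
 qed
 \<comment> \<open>In the normal form the diagonal entry of g2 is 1 / H^2, so this is the square of
   the H to be chosen.\<close>
 define h where "h i x = 1 / m i x" for i x
 have hsm: "smooth_on V1 (h i)" for i
  unfolding h_def[abs_def] by (intro smooth_divide smooth_const msm V1 m0)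
 have h0: "h i p \<noteq> 0" for i using m0[OF V1(2), of i] by (simp add: h_def)
 have fsm: "smooth_on V1 (f i)" for i by (rule smooth_subset[OF f]) (use V10 in blast)
 have "\<exists>W. open W \<and> p \<in> W \<and> W \<subseteq> V1 \<and> (\<forall>x\<in>W. h i x / h i p \<notin> \<real>\<^sub>\<le>\<^sub>0 \<and> f i x / f i p \<notin> \<real>\<^sub>\<le>\<^sub>0)" for i
 proof -
  obtain A where "open A" "p \<in> A" "A \<subseteq> V1" "!!x. x \<in> A ==> h i x / h i p \<notin> \<real>\<^sub>\<le>\<^sub>0"
   using smooth_sqrt_branch[OF V1 hsm[of i] h0] by blast
  moreover obtain B where "open B" "p \<in> B" "B \<subseteq> V1" "!!x. x \<in> B ==> f i x / f i p \<notin> \<real>\<^sub>\<le>\<^sub>0"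
   using smooth_sqrt_branch[OF V1 fsm[of i] f0[OF V0(2)]] by blast
  ultimately show ?thesis by (intro exI[of _ "A \<inter> B"]) auto
 qed
 then obtain W where W: "!!i. open (W i)" "!!i. p \<in> W i" "!!i. W i \<subseteq> V1" "!!i x. x \<in> W i ==> h i x / h i p \<notin> \<real>\<^sub>\<le>\<^sub>0"
  "!!i x. x \<in> W i ==> f i x / f i p \<notin> \<real>\<^sub>\<le>\<^sub>0" by metis
 obtain C where C: "open C" "p \<in> C" "C \<subseteq> V1" "inj_on u C" by (rule locally_injective[OF V1 usm det[OF V1(2)]])
 define V where "V = C \<inter> (\<Inter>i. W i)"
 have V: "open V" "p \<in> V" "V \<subseteq> V1" and VW: "V \<subseteq> W i" for i
  unfolding V_def using C W(1-3) by (auto intro!: open_Int open_INT)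
 have VU: "V \<subseteq> U" using V(3) V10 V0(3) by blast
 define H where "H i x = csqrt (h i x / h i p) * csqrt (h i p)" for i x
 \<comment> \<open>The branch is normalized by the constant f i p and depends on z alone, which
   makes it a holomorphic function of the single coordinate.\<close>
 define r where "r i z = csqrt (F i z / f i p) * csqrt (f i p)" for i z
 have Hsm: "smooth_on V (H i)" for i
  unfolding H_def[abs_def] by (rule smooth_csqrt[OF V(1) smooth_subset[OF hsm V(3)]]) (use VW W(4) in blast)
 have "(H i x)\<^sup>2 = h i x" for i x unfolding H_def by (rule sqrt_square[OF h0])
 then have Hsq: "(H i x)\<^sup>2 = 1 / m i x" for i x by (simp add: h_def)
 have fF: "F i (u x $ i) = f i x" if "x \<in> V" for i x using F(2)[of x i] V1b[of i] V(3) that by (auto simp: u_def)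
 have rsm: "smooth_on V (\<lambda>x. r i (u x $ i))" for i
  by (rule smooth_cong[OF V(1) _ smooth_csqrt[OF V(1) smooth_subset[OF fsm V(3)], of i "f i p"]])
   (use VW[of i] W(5) in \<open>auto simp: r_def fF\<close>)
 have im: "(\<lambda>x. u x $ i) ` V \<subseteq> w i ` Vb i" for i unfolding ub using V1b V(3) by blast
 have Fh: "F i holomorphic_on (\<lambda>x. u x $ i) ` V" for i by (rule holomorphic_on_subset[OF F(1) im])
 have rh: "r i holomorphic_on (\<lambda>x. u x $ i) ` V" for i
 proof -
  have "(\<lambda>z. csqrt (F i z / f i p)) holomorphic_on (\<lambda>x. u x $ i) ` V"
   by (rule holomorphic_on_csqrt'[OF holomorphic_on_divide[OF Fh holomorphic_on_const]])
    (use f0[OF V0(2)] VW[of i] W(5)[of _ i] fF in auto)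
  then show ?thesis unfolding r_def[abs_def] by (rule holomorphic_on_mult[OF _ holomorphic_on_const])
 qed
 have "lame_pair V u H F r g1 g2"
 proof unfold_locales
  fix i j x
  show "open V" by fact
  show "smooth_on V (\<lambda>x. u x $ i)" by (rule smooth_subset[OF usm V(3)])
  show "smooth_on V (H i)" by (rule Hsm)
  show "contravariant_metric V g1" "contravariant_metric V g2" using contravariant_metric_subset VU g by blast+
  show "single_variable_fun V u i (F i)"
   unfolding single_variable_fun_def
   by (rule conjI[OF Fh smooth_cong[OF V(1) _ smooth_subset[OF fsm V(3)]]]) (simp add: fF)
  show "single_variable_fun V u i (r i)" unfolding single_variable_fun_def using rh rsm by blast
  assume x: "x \<in> V"
  then have x1: "x \<in> V1" using V(3) by blast
  show "det (jacobian u x) \<noteq> 0" by (rule det[OF x1])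
  show "H i x \<noteq> 0" using Hsq[of i x] m0[OF x1, of i] by auto
  show "F i (u x $ i) \<noteq> 0" unfolding fF[OF x] by (rule f0[OF V10[OF x1]])
  show "(r i (u x $ i))\<^sup>2 = F i (u x $ i)" unfolding r_def by (rule sqrt_square[OF f0[OF V0(2)]])
  show d: "coord_components u g2 x $ i $ j = (if i = j then 1 / (H i x)\<^sup>2 else 0)" unfolding Hsq by (simp add: d2[OF x1])
  show "coord_components u g1 x $ i $ j = (if i = j then F i (u x $ i) / (H i x)\<^sup>2 else 0)"
   unfolding cc1[OF x1] d fF[OF x] by simp
 qed
 moreover have "eigenvalues_pair g1 g2 x = range (\<lambda>i. F i (u x $ i))" if "x \<in> V" for x
  using ev[OF V10] V(3) that fF[OF that] by auto
 moreover have "inj_on u V" using C(4) by (rule inj_on_subset) (auto simp: V_def)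
 ultimately show ?thesis using that V(2) VU by blast
qed

theorem theorem5p1:
 fixes U :: "(real ^ 'n) set" and g1 g2 :: "real ^ 'n \<Rightarrow> real ^ 'n ^ 'n"
 assumes "open U"
  and "contravariant_metric U g1" and "contravariant_metric U g2"
  and "nonsingular_pair U g1 g2"
 shows "compatible_flat_metrics U g1 g2 \<longleftrightarrow>
  (\<forall>p\<in>U. \<exists>V (u :: real ^ 'n \<Rightarrow> complex ^ 'n) (H :: 'n \<Rightarrow> real ^ 'n \<Rightarrow> complex)
    (f :: 'n \<Rightarrow> complex \<Rightarrow> complex) (r :: 'n \<Rightarrow> complex \<Rightarrow> complex).
   open V \<and> p \<in> V \<and> V \<subseteq> U \<and> local_coordinates V u \<and>
   (\<forall>i. smooth_on V (H i) \<and> single_variable_fun V u i (f i) \<and> single_variable_fun V u i (r i)) \<and>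
   (\<forall>x\<in>V. \<forall>i. H i x \<noteq> 0 \<and> f i (u x $ i) \<noteq> 0 \<and> (r i (u x $ i))\<^sup>2 = f i (u x $ i)) \<and>
   (\<forall>x\<in>V. eigenvalues_pair g1 g2 x = range (\<lambda>i. f i (u x $ i))) \<and>
   (\<forall>x\<in>V. \<forall>i j.
     coord_components u g2 x $ i $ j = (if i = j then 1 / (H i x)\<^sup>2 else 0) \<and>
     coord_components u g1 x $ i $ j = (if i = j then f i (u x $ i) / (H i x)\<^sup>2 else 0)) \<and>
   lame_equations V u H \<and> pencil_equation V u H f r)"
  (is "?C \<longleftrightarrow> (\<forall>p\<in>U. \<exists>V u H f r. ?L p V u H f r)")
proof
 assume C: ?C
 show "\<forall>p\<in>U. \<exists>V u H f r. ?L p V u H f r"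
 proof
  fix p assume p: "p \<in> U"
  obtain V u H F r where loc: "p \<in> V" "V \<subseteq> U" "inj_on u V" and lp: "lame_pair V u H F r g1 g2"
   and ev: "\<And>x. x \<in> V \<Longrightarrow> eigenvalues_pair g1 g2 x = range (\<lambda>i. F i (u x $ i))"
   using local_normal_form[OF assms(1) p assms(2-4) C] by blast
  interpret lame_pair V u H F r g1 g2 by (rule lp)
  have "riemann g1 i j k l x = 0" "riemann g2 i j k l x = 0" if "x \<in> V" for i j k l x
   using C subsetD[OF loc(2) that] unfolding compatible_flat_metrics_def flat_metric_def by auto
  note eq = equations_if_flat[OF this]
  have "local_coordinates V u" unfolding local_coordinates_def using u_smooth loc(3) det_J by blast
  then have "?L p V u H F r"
   using V loc(1,2) H_smooth single_f single_r H_nz f_nz r_square ev diag1 diag2 eq by auto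
  then show "\<exists>V u H f r. ?L p V u H f r" by blast
 qed
next
 assume R: "\<forall>p\<in>U. \<exists>V u H f r. ?L p V u H f r"
 \<comment> \<open>Flatness and linearity at a point depend on germs, so the coordinates around that
   point suffice; the values (1,0) and (0,1) will recover the two metrics themselves.\<close>
 have loc: "riemann (pencil l1 l2 g1 g2) i j k l x = 0 \<and>
   christoffel_up (pencil l1 l2 g1 g2) i j k x = l1 * christoffel_up g1 i j k x + l2 * christoffel_up g2 i j k x"
  if x: "x \<in> U" "det (pencil l1 l2 g1 g2 x) \<noteq> 0" for x l1 l2 i j k l
 proof -
  obtain V u H f r where L: "?L x V u H f r" using bspec[OF R x(1)] by (elim exE) (rule that)
  then have V: "open V" "x \<in> V" "V \<subseteq> U" "local_coordinates V u" and eq: "lame_equations V u H" "pencil_equation V u H f r"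
   and sm: "\<And>i. smooth_on V (H i)" "\<And>i. single_variable_fun V u i (f i)" "\<And>i. single_variable_fun V u i (r i)"
   and nz: "\<And>y i. y \<in> V \<Longrightarrow> H i y \<noteq> 0" "\<And>y i. y \<in> V \<Longrightarrow> f i (u y $ i) \<noteq> 0" "\<And>y i. y \<in> V \<Longrightarrow> (r i (u y $ i))\<^sup>2 = f i (u y $ i)"
   and cc: "\<And>y i j. y \<in> V \<Longrightarrow> coord_components u g2 y $ i $ j = (if i = j then 1 / (H i y)\<^sup>2 else 0)"
    "\<And>y i j. y \<in> V \<Longrightarrow> coord_components u g1 y $ i $ j = (if i = j then f i (u y $ i) / (H i y)\<^sup>2 else 0)"
   by (simp_all del: split_paired_All)
  have u: "\<And>i. smooth_on V (\<lambda>x. u x $ i)" "\<And>y. y \<in> V \<Longrightarrow> det (jacobian u y) \<noteq> 0"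
   using V(4) by (auto simp: local_coordinates_def)
  have g: "contravariant_metric V g1" "contravariant_metric V g2" by (rule contravariant_metric_subset[OF _ V(3)], rule assms)+
  interpret lame_pair V u H f r g1 g2
   by (unfold_locales; (rule V(1) u sm nz cc g; assumption?))
  have "x \<in> V' l1 l2" using L x(2) by blast
  then show ?thesis using flat_if_equations[OF eq] christoffel_up_pencil by blast
 qed
 have e: "pencil 1 0 g1 g2 = g1" "pencil 0 1 g1 g2 = g2" by (auto simp: pencil_def)
 have flat: "flat_metric U g1" "flat_metric U g2"
  using loc[of _ 1 0] loc[of _ 0 1] assms(2,3) unfolding e flat_metric_def contravariant_metric_def by auto
 show ?C unfolding compatible_flat_metrics_def flat_metric_def
  using flat loc contravariant_pencil[OF assms(1-3)] by (auto simp: flat_metric_def)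
qed

end
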